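(* Let $E$ be a Banach space having an unconditional finite dimensional expansion of the identity, let $F$ be a Banach space, and let $k\in\mathbb{N}$ with $k>1$. Then the following assertions are equivalent: (a) $\mathcal{P}({}^kE,F)=\mathcal{P}_{\mathrm{wb}}({}^kE,F)$; (b) $\mathcal{P}_{\mathrm{wb}}({}^kE,F)$ contains no copy of $c_0$; (c) $\mathcal{P}({}^kE,F)$ contains no copy of $\ell_\infty$; (d) $\mathcal{P}_{\mathrm{wb}}({}^kE,F)$ is complemented in $\mathcal{P}({}^kE,F)$.
   Context: Banach spaces are over $\mathbb{K}=\mathbb{R}$ or $\mathbb{C}$. $\mathcal{P}({}^kE,F)$ is the Banach space of all continuous $k$-homogeneous polynomials $P:E\to F$ (i.e. $P(x)=A(x,\ldots,x)$ for a continuous $k$-linear map $A:E^k\to F$), with norm $\|P\|=\sup_{\|x\|\le 1}\|P(x)\|$. $\mathcal{P}_{\mathrm{wb}}({}^kE,F)$ is the (closed) subspace of those polynomials whose restriction to every bounded subset of $E$ is continuous from the weak topology of $E$ to the norm topology of $F$. An unconditional finite dimensional expansion of the identity for $E$ is a sequence of bounded finite-rank linear operators $A_n:E\to E$ such that, for each $x\in E$, $x=\sum_{n=1}^\infty A_n(x)$ with the series unconditionally convergent. A Banach space contains a copy of $X$ if it has a closed subspace linearly homeomorphic to $X$. A closed subspace is complemented if it is the range of a bounded linear projection.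
   Formalization: E is additionally assumed infinite-dimensional; for finite-dimensional E the equivalence fails, e.g. E = K, F = c_0, k = 2, where (a) and (d) hold but P_wb(^2E,F) is isometric to c_0, so (b) fails. *)

theory Defs
  imports "HOL-Analysis.Analysis" "HOL-Library.Function_Algebras"
begin

section \<open>Scalars and Banach spaces\<close>

text \<open>The class of scalar fields: up to isometric isomorphism, only the reals and the
  complex numbers belong to it.\<close>

class real_or_complex = real_normed_field +
  assumes real_or_complex:
    "(\<exists>f :: 'a \<Rightarrow> real. bij f \<and> (\<forall>x y. f (x + y) = f x + f y) \<and> (\<forall>x y. f (x * y) = f x * f y) \<and>
        (\<forall>r x. f (r *\<^sub>R x) = r *\<^sub>R f x) \<and> (\<forall>x. norm (f x) = norm x)) \<or>
     (\<exists>f :: 'a \<Rightarrow> complex. bij f \<and> (\<forall>x y. f (x + y) = f x + f y) \<and> (\<forall>x y. f (x * y) = f x * f y) \<and>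
        (\<forall>r x. f (r *\<^sub>R x) = r *\<^sub>R f x) \<and> (\<forall>x. norm (f x) = norm x))"

instance real :: real_or_complex
proof
  show "(\<exists>f :: real \<Rightarrow> real. bij f \<and> (\<forall>x y. f (x + y) = f x + f y) \<and> (\<forall>x y. f (x * y) = f x * f y) \<and>
        (\<forall>r x. f (r *\<^sub>R x) = r *\<^sub>R f x) \<and> (\<forall>x. norm (f x) = norm x)) \<or>
     (\<exists>f :: real \<Rightarrow> complex. bij f \<and> (\<forall>x y. f (x + y) = f x + f y) \<and> (\<forall>x y. f (x * y) = f x * f y) \<and>
        (\<forall>r x. f (r *\<^sub>R x) = r *\<^sub>R f x) \<and> (\<forall>x. norm (f x) = norm x))"
    by (intro disjI1 exI[of _ id]) auto
qed

instance complex :: real_or_complex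
proof
  show "(\<exists>f :: complex \<Rightarrow> real. bij f \<and> (\<forall>x y. f (x + y) = f x + f y) \<and> (\<forall>x y. f (x * y) = f x * f y) \<and>
        (\<forall>r x. f (r *\<^sub>R x) = r *\<^sub>R f x) \<and> (\<forall>x. norm (f x) = norm x)) \<or>
     (\<exists>f :: complex \<Rightarrow> complex. bij f \<and> (\<forall>x y. f (x + y) = f x + f y) \<and> (\<forall>x y. f (x * y) = f x * f y) \<and>
        (\<forall>r x. f (r *\<^sub>R x) = r *\<^sub>R f x) \<and> (\<forall>x. norm (f x) = norm x))"
    by (intro disjI2 exI[of _ id]) auto
qed

text \<open>Norm and completeness come from the class \<^class>\<open>banach\<close>; the locale adds the
  multiplication by scalars from \<open>'k\<close>, which extends the given real one.\<close>

locale banach_space_over = vector_space scale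
  for scale :: "'k::real_or_complex \<Rightarrow> 'a::banach \<Rightarrow> 'a" +
  assumes norm_scale: "norm (scale c x) = norm c * norm x"
    and scale_of_real: "scale (of_real r) x = r *\<^sub>R x"

lemma banach_space_over_scaleR: "banach_space_over (scaleR :: real \<Rightarrow> 'a::banach \<Rightarrow> 'a)"
  by unfold_locales (auto simp: algebra_simps)

lemma banach_space_over_complex: "banach_space_over ((*) :: complex \<Rightarrow> complex \<Rightarrow> complex)"
  by unfold_locales (auto simp: algebra_simps norm_mult scaleR_conv_of_real)

definition bounded_operator ::
    "('k::real_or_complex \<Rightarrow> 'a::real_normed_vector \<Rightarrow> 'a) \<Rightarrow>
     ('k \<Rightarrow> 'b::real_normed_vector \<Rightarrow> 'b) \<Rightarrow> ('a \<Rightarrow> 'b) \<Rightarrow> bool" where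
  "bounded_operator s1 s2 T \<longleftrightarrow>
     Vector_Spaces.linear s1 s2 T \<and> (\<exists>C. \<forall>x. norm (T x) \<le> C * norm x)"

definition weak_topology ::
    "('k::real_or_complex \<Rightarrow> 'a::real_normed_vector \<Rightarrow> 'a) \<Rightarrow> 'a topology" where
  "weak_topology s =
     topology_generated_by {\<phi> -` U | \<phi> U. bounded_operator s (*) \<phi> \<and> open U}"

definition unconditionally_sums :: "(nat \<Rightarrow> 'a::real_normed_vector) \<Rightarrow> 'a \<Rightarrow> bool" where
  "unconditionally_sums f x \<longleftrightarrow> f sums x \<and> (\<forall>\<pi>. bij \<pi> \<longrightarrow> summable (\<lambda>n. f (\<pi> n)))"

definition unconditional_fd_expansion ::
    "('k::real_or_complex \<Rightarrow> 'a::real_normed_vector \<Rightarrow> 'a) \<Rightarrow> (nat \<Rightarrow> 'a \<Rightarrow> 'a) \<Rightarrow> bool" where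
  "unconditional_fd_expansion s A \<longleftrightarrow>
     (\<forall>n. bounded_operator s s (A n) \<and> (\<exists>B. finite B \<and> range (A n) = module.span s B)) \<and>
     (\<forall>x. unconditionally_sums (\<lambda>n. A n x) x)"

section \<open>Normed spaces given by a carrier\<close>

text \<open>The spaces of \<open>k\<close>-homogeneous polynomials depend on the number \<open>k\<close>, so they are sets
  of functions rather than types. The addition is that of the ambient type \<open>'v\<close>.\<close>

record ('k, 'v) normed_sp =
  pts :: "'v set"
  scl :: "'k \<Rightarrow> 'v \<Rightarrow> 'v"
  nrm :: "'v \<Rightarrow> real"

text \<open>The norm is meaningful only on the carrier, whereas \<^locale>\<open>Metric_space\<close> wants a
  function that is nonnegative everywhere; hence the value 0 outside.\<close>

definition norm_topology :: "('k, 'v::ab_group_add) normed_sp \<Rightarrow> 'v topology" where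
  "norm_topology X =
     Metric_space.mtopology (pts X)
       (\<lambda>x y. if x \<in> pts X \<and> y \<in> pts X then nrm X (x - y) else 0)"

definition closed_subspace ::
    "'v set \<Rightarrow> ('k::comm_ring_1, 'v::ab_group_add) normed_sp \<Rightarrow> bool" where
  "closed_subspace Z Y \<longleftrightarrow>
     Z \<subseteq> pts Y \<and> module.subspace (scl Y) Z \<and> closedin (norm_topology Y) Z"

definition linear_between ::
    "('k, 'v::ab_group_add) normed_sp \<Rightarrow> ('k, 'w::ab_group_add) normed_sp \<Rightarrow> ('v \<Rightarrow> 'w) \<Rightarrow> bool"
  where
  "linear_between X Y T \<longleftrightarrow>
     T \<in> pts X \<rightarrow> pts Y \<and>
     (\<forall>x\<in>pts X. \<forall>y\<in>pts X. T (x + y) = T x + T y) \<and>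
     (\<forall>c. \<forall>x\<in>pts X. T (scl X c x) = scl Y c (T x))"

definition contains_copy_of ::
    "('k::comm_ring_1, 'v::ab_group_add) normed_sp \<Rightarrow> ('k, 'w::ab_group_add) normed_sp \<Rightarrow> bool"
  where
  "contains_copy_of Y X \<longleftrightarrow>
     (\<exists>Z T. closed_subspace Z Y \<and> linear_between X Y T \<and>
            homeomorphic_map (norm_topology X) (subtopology (norm_topology Y) Z) T)"

definition complemented_in ::
    "'v set \<Rightarrow> ('k::comm_ring_1, 'v::ab_group_add) normed_sp \<Rightarrow> bool" where
  "complemented_in Z Y \<longleftrightarrow>
     closed_subspace Z Y \<and>
     (\<exists>\<pi>. linear_between Y Y \<pi> \<and> (\<exists>C. \<forall>y\<in>pts Y. nrm Y (\<pi> y) \<le> C * nrm Y y) \<and>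
          (\<forall>y\<in>pts Y. \<pi> (\<pi> y) = \<pi> y) \<and> \<pi> ` pts Y = Z)"

definition ell_infinity :: "('k::real_or_complex, nat \<Rightarrow> 'k) normed_sp" where
  "ell_infinity = \<lparr>pts = {x. bounded (range x)}, scl = (\<lambda>c x n. c * x n),
                   nrm = (\<lambda>x. SUP n. norm (x n))\<rparr>"

definition c_zero :: "('k::real_or_complex, nat \<Rightarrow> 'k) normed_sp" where
  "c_zero = \<lparr>pts = {x. x \<longlonglongrightarrow> 0}, scl = (\<lambda>c x n. c * x n),
             nrm = (\<lambda>x. SUP n. norm (x n))\<rparr>"

section \<open>Homogeneous polynomials\<close>

text \<open>Elements of \<open>E\<^sup>k\<close> are functions on \<open>nat\<close> that are undefined outside \<open>{..<k}\<close>.\<close>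

definition continuous_multilinear ::
    "('k::field \<Rightarrow> 'a::real_normed_vector \<Rightarrow> 'a) \<Rightarrow> ('k \<Rightarrow> 'b::real_normed_vector \<Rightarrow> 'b) \<Rightarrow>
     nat \<Rightarrow> ((nat \<Rightarrow> 'a) \<Rightarrow> 'b) \<Rightarrow> bool" where
  "continuous_multilinear s1 s2 k A \<longleftrightarrow>
     (\<forall>x \<in> {..<k} \<rightarrow>\<^sub>E UNIV. \<forall>i<k. Vector_Spaces.linear s1 s2 (\<lambda>t. A (x(i := t)))) \<and>
     continuous_map (product_topology (\<lambda>_. euclidean) {..<k}) euclidean A"

definition hom_polys ::
    "('k::field \<Rightarrow> 'a::real_normed_vector \<Rightarrow> 'a) \<Rightarrow> ('k \<Rightarrow> 'b::real_normed_vector \<Rightarrow> 'b) \<Rightarrow>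
     nat \<Rightarrow> ('a \<Rightarrow> 'b) set" where
  "hom_polys s1 s2 k =
     {P. \<exists>A. continuous_multilinear s1 s2 k A \<and> (\<forall>x. P x = A (\<lambda>i\<in>{..<k}. x))}"

definition wb_polys ::
    "('k::real_or_complex \<Rightarrow> 'a::real_normed_vector \<Rightarrow> 'a) \<Rightarrow>
     ('k \<Rightarrow> 'b::real_normed_vector \<Rightarrow> 'b) \<Rightarrow> nat \<Rightarrow> ('a \<Rightarrow> 'b) set" where
  "wb_polys s1 s2 k =
     {P \<in> hom_polys s1 s2 k.
        \<forall>B. bounded B \<longrightarrow> continuous_map (subtopology (weak_topology s1) B) euclidean P}"

definition poly_space ::
    "('k::field \<Rightarrow> 'a::real_normed_vector \<Rightarrow> 'a) \<Rightarrow> ('k \<Rightarrow> 'b::real_normed_vector \<Rightarrow> 'b) \<Rightarrow>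
     nat \<Rightarrow> ('k, 'a \<Rightarrow> 'b) normed_sp" where
  "poly_space s1 s2 k = \<lparr>pts = hom_polys s1 s2 k, scl = (\<lambda>c P x. s2 c (P x)),
                         nrm = (\<lambda>P. SUP x\<in>{x. norm x \<le> 1}. norm (P x))\<rparr>"

definition wb_poly_space ::
    "('k::real_or_complex \<Rightarrow> 'a::real_normed_vector \<Rightarrow> 'a) \<Rightarrow>
     ('k \<Rightarrow> 'b::real_normed_vector \<Rightarrow> 'b) \<Rightarrow> nat \<Rightarrow> ('k, 'a \<Rightarrow> 'b) normed_sp" where
  "wb_poly_space s1 s2 k = (poly_space s1 s2 k)\<lparr>pts := wb_polys s1 s2 k\<rparr>"

end

theory Submission
  imports Defs
begin

text \<open>
  If some polynomial is not weakly continuous on bounded sets, write it as a multilinear map, choose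
  a slot in which finite rank operators make it weakly continuous, and insert there the multipliers
  \<open>\<Sum>\<^sub>p \<xi>\<^sub>p B\<^sub>p\<close>, where the \<open>B\<^sub>p\<close> are disjoint blocks of the expansion. By a gliding hump this
  is an isomorphic embedding \<open>\<Phi>\<close> of \<open>\<ell>\<^sub>\<infinity>\<close> into the polynomials that sends \<open>c\<^sub>0\<close> to
  weakly continuous ones. A projection \<open>\<pi>\<close> onto the weakly continuous polynomials is excluded as in
  Phillips' theorem: \<open>\<pi> \<circ> \<Phi> - \<Phi>\<close> vanishes on finitely supported sequences, so for some infinite \<open>M\<close> countably
  many evaluations do not distinguish \<open>\<Phi> 1\<^sub>M\<close> from \<open>\<pi> (\<Phi> 1\<^sub>M)\<close>, although only the latter is
  weakly continuous. These evaluations detect the discontinuity if the expansion is shrinking; otherwise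
  there are almost biorthogonal \<open>\<pi>\<^sub>i\<close> and \<open>y\<^sub>i\<close> similar to the \<open>\<ell>\<^sub>1\<close> basis, and one uses
  \<open>\<Phi> \<xi> = \<Sum>\<^sub>i \<xi>\<^sub>i \<pi>\<^sub>i\<^sup>k f\<close> instead.

  If all polynomials are weakly continuous on bounded sets, the expansion is shrinking, and a sequence of
  polynomials with bounded finite sums tends to zero in norm, by induction on the number of free slots of the
  associated multilinear maps. The images of the unit vectors under an embedding of \<open>c\<^sub>0\<close> or \<open>\<ell>\<^sub>\<infinity>\<close>
  would violate this.
\<close>

subsection \<open>The scalar field\<close>

text \<open>A multiplier in every slot would make the family depend on \<open>\<xi>\<close> with
  degree \<open>k\<close> instead of linearly, so one slot has to carry it; finite truncations in
  that slot must then already be weakly continuous, which is what \<open>exists_slot\<close>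
  secures. The hump points \<open>x p\<close> are only known to satisfy that
  \<open>S m (x p)\<close> tends to \<open>S m x0\<close> for each \<open>m\<close>. This amounts to
  weak convergence exactly when functionals are uniformly approximated through the
  \<open>S m\<close>, whence the shrinking dichotomy. Without shrinking, weakly small vectors have
  to be built from the \<open>y i\<close>; there \<open>k > 1\<close> matters, because a linear
  functional is always small at them. In the converse direction \<open>c_0\<close> inside the range
  space is an obstacle of its own: with infinite dimensional domain it yields an operator through
  \<open>c_0\<close> that is not weak-to-norm continuous on bounded sets. So it is excluded first;
  afterwards series with bounded finite sums converge and can be summed to one multilinear map. For
  a finite dimensional domain every polynomial is weakly continuous whatever the range is, so
  infinite dimension is essential.\<close>

lemma real_or_complex_coordinates:
  obtains re im :: "'k::real_or_complex \<Rightarrow> real" and i :: 'k where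
    "\<And>c. c = of_real (re c) + of_real (im c) * i"
    "\<And>c d. re (c + d) = re c + re d" "\<And>c d. im (c + d) = im c + im d"
    "\<And>c. \<bar>re c\<bar> \<le> norm c" "\<And>c. \<bar>im c\<bar> \<le> norm c"
    "\<And>a b. re (of_real a + of_real b * i) = a"
    "i = 0 \<or> i * i = -1" "norm i \<le> 1"
proof -
  from real_or_complex[where 'a = 'k] show ?thesis
  proof (elim disjE exE conjE)
    fix f :: "'k \<Rightarrow> real"
    assume f: "bij f" "\<forall>x y. f (x + y) = f x + f y" "\<forall>x y. f (x * y) = f x * f y"
      "\<forall>r x. f (r *\<^sub>R x) = r *\<^sub>R f x" "\<forall>x. norm (f x) = norm x"
    have "f 1 \<noteq> 0" using f(5)[rule_format, of 1] by auto
    moreover have "f 1 * f 1 = f 1" using f(3)[rule_format, of 1 1] by simp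
    ultimately have f1: "f 1 = 1" by simp
    have fr: "f (of_real r) = r" for r using f(4)[rule_format, of r 1] f1 by (simp add: of_real_def)
    have inj: "f x = f y \<Longrightarrow> x = y" for x y using f(1) by (simp add: bij_def inj_def)
    show ?thesis
    \<comment> \<open>The real field is treated as a degenerate complex one with imaginary unit 0,
      which lets later proofs handle both fields at once.\<close>
    proof (rule that[of f "\<lambda>_. 0" 0])
      show "c = of_real (f c) + of_real 0 * 0" for c
        by (rule inj) (simp add: fr)
      show "\<bar>f c\<bar> \<le> norm c" for c using f(5)[rule_format, of c] by simp
    qed (use f fr in auto)
  next
    fix f :: "'k \<Rightarrow> complex"
    assume f: "bij f" "\<forall>x y. f (x + y) = f x + f y" "\<forall>x y. f (x * y) = f x * f y"
      "\<forall>r x. f (r *\<^sub>R x) = r *\<^sub>R f x" "\<forall>x. norm (f x) = norm x"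
    have "f 1 \<noteq> 0" using f(5)[rule_format, of 1] by auto
    moreover have "f 1 * f 1 = f 1" using f(3)[rule_format, of 1 1] by simp
    ultimately have f1: "f 1 = 1" by simp
    have fr: "f (of_real r) = of_real r" for r
      using f(4)[rule_format, of r 1] f1 by (simp add: of_real_def)
    have inj: "f x = f y \<Longrightarrow> x = y" for x y using f(1) by (simp add: bij_def inj_def)
    obtain j where j: "f j = \<i>" using f(1) by (metis bij_pointE)
    show ?thesis
    proof (rule that[of "\<lambda>c. Re (f c)" "\<lambda>c. Im (f c)" j])
      show "c = of_real (Re (f c)) + of_real (Im (f c)) * j" for c
        by (rule inj) (simp add: fr f j complex_eq mult.commute)
      show "\<bar>Re (f c)\<bar> \<le> norm c" for c using f(5)[rule_format, of c] abs_Re_le_cmod[of "f c"] by simp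
      show "\<bar>Im (f c)\<bar> \<le> norm c" for c using f(5)[rule_format, of c] abs_Im_le_cmod[of "f c"] by simp
      show "Re (f (of_real a + of_real b * j)) = a" for a b by (simp add: f fr j)
      show "norm j \<le> 1" using f(5)[rule_format, of j] by (simp add: j)
      have "f (-1) = -1" using fr[of "-1"] by simp
      then show "j = 0 \<or> j * j = -1" by (intro disjI2 inj) (simp add: f j)
    qed (use f in auto)
  qed
qed

text \<open>Bolzano-Weierstrass for the pair of real coordinates. Completeness of the scalars
  follows, so that they can serve as a target Banach space.\<close>

instance real_or_complex \<subseteq> heine_borel
proof
  fix s :: "nat \<Rightarrow> 'a::real_or_complex"
  assume "bounded (range s)"
  then obtain B where B: "\<And>n. norm (s n) \<le> B" by (auto simp: bounded_iff)
  obtain re im :: "'a \<Rightarrow> real" and i :: 'a where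
    c: "\<And>c. c = of_real (re c) + of_real (im c) * i"
    "\<And>c. \<bar>re c\<bar> \<le> norm c" "\<And>c. \<bar>im c\<bar> \<le> norm c"
    by (rule real_or_complex_coordinates[where 'k = 'a]) (rule that)
  have "bounded (range (\<lambda>n. (re (s n), im (s n))))"
  proof (rule boundedI)
    fix x assume "x \<in> range (\<lambda>n. (re (s n), im (s n)))"
    then obtain n where n: "x = (re (s n), im (s n))" by auto
    have "norm x \<le> norm (re (s n)) + norm (im (s n))"
      unfolding n by (rule norm_Pair_le)
    also have "\<dots> \<le> B + B" using c(2)[of "s n"] c(3)[of "s n"] B[of n] by simp
    finally show "norm x \<le> B + B" .
  qed
  then obtain l r where r: "strict_mono (r::nat\<Rightarrow>nat)"
    and l: "((\<lambda>n. (re (s n), im (s n))) \<circ> r) \<longlonglongrightarrow> l"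
    using bounded_imp_convergent_subsequence by blast
  have "(\<lambda>n. re (s (r n))) \<longlonglongrightarrow> fst l" "(\<lambda>n. im (s (r n))) \<longlonglongrightarrow> snd l"
    using tendsto_fst[OF l] tendsto_snd[OF l] by (simp_all add: o_def)
  then have "(\<lambda>n. of_real (re (s (r n))) + of_real (im (s (r n))) * i)
      \<longlonglongrightarrow> of_real (fst l) + of_real (snd l) * i"
    by (intro tendsto_intros)
  then have "(s \<circ> r) \<longlonglongrightarrow> of_real (fst l) + of_real (snd l) * i"
    by (simp add: c(1)[symmetric] o_def)
  with r show "\<exists>l r. strict_mono (r::nat\<Rightarrow>nat) \<and> (s \<circ> r) \<longlonglongrightarrow> l" by blast
qed

instance real_or_complex \<subseteq> banach ..

lemma banach_space_over_mult: "banach_space_over ((*) :: 'k::real_or_complex \<Rightarrow> 'k \<Rightarrow> 'k)"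
  by unfold_locales (auto simp: algebra_simps norm_mult scaleR_conv_of_real)

subsection \<open>Bounded operators\<close>

lemma bounded_operatorI:
  assumes "banach_space_over s1" "banach_space_over s2"
    and "\<And>x y. T (x + y) = T x + T y" "\<And>c x. T (s1 c x) = s2 c (T x)"
    and "\<And>x. norm (T x) \<le> C * norm x"
  shows "bounded_operator s1 s2 T"
  using assms
  by (auto simp: bounded_operator_def Vector_Spaces.linear_iff banach_space_over_def)

lemma bounded_operatorD:
  assumes "bounded_operator s1 s2 T"
  shows bounded_operator_add: "T (x + y) = T x + T y"
    and bounded_operator_scale: "T (s1 c x) = s2 c (T x)"
    and bounded_operator_zero: "T 0 = 0"
    and bounded_operator_diff: "T (x - y) = T x - T y"
    and bounded_operator_sum: "T (sum f N) = (\<Sum>n\<in>N. T (f n))"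
proof -
  show add: "T (x + y) = T x + T y" for x y
    using assms by (auto simp: bounded_operator_def Vector_Spaces.linear_iff)
  show "T (s1 c x) = s2 c (T x)"
    using assms by (auto simp: bounded_operator_def Vector_Spaces.linear_iff)
  have "Modules.additive T" by standard (rule add)
  then show "T 0 = 0" "T (x - y) = T x - T y"
    "T (sum f N) = (\<Sum>n\<in>N. T (f n))"
    by (simp_all add: Modules.additive.zero Modules.additive.diff Modules.additive.sum)
qed

lemma bounded_operator_bound:
  assumes "bounded_operator s1 s2 T"
  obtains C where "C > 0" "\<And>x. norm (T x) \<le> C * norm x"
proof -
  obtain C where C: "\<And>x. norm (T x) \<le> C * norm x" using assms by (auto simp: bounded_operator_def)
  have "norm (T x) \<le> max C 1 * norm x" for x
    by (rule order_trans[OF C]) (simp add: mult_right_mono)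
  then show ?thesis using that[of "max C 1"] by simp
qed

lemma bounded_operator_tendsto:
  assumes "bounded_operator s1 s2 T" "(f \<longlongrightarrow> l) F"
  shows "((\<lambda>x. T (f x)) \<longlongrightarrow> T l) F"
proof -
  obtain C where C: "C > 0" "\<And>x. norm (T x) \<le> C * norm x"
    using bounded_operator_bound[OF assms(1)] by blast
  have "((\<lambda>x. C * norm (f x - l)) \<longlongrightarrow> C * norm (l - l)) F"
    by (intro tendsto_intros assms)
  then have "((\<lambda>x. C * norm (f x - l)) \<longlongrightarrow> 0) F" by simp
  then have "((\<lambda>x. T (f x) - T l) \<longlongrightarrow> 0) F"
    by (rule Lim_null_comparison[rotated])
       (simp add: C(2) bounded_operator_diff[OF assms(1), symmetric])
  then show ?thesis by (simp add: Lim_null[symmetric])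
qed

lemma bounded_operator_compose:
  assumes "bounded_operator s1 s2 T" "bounded_operator s2 s3 U"
  shows "bounded_operator s1 s3 (\<lambda>x. U (T x))"
proof -
  obtain C where C: "C > 0" "\<And>x. norm (T x) \<le> C * norm x"
    using bounded_operator_bound[OF assms(1)] by blast
  obtain D where D: "D > 0" "\<And>x. norm (U x) \<le> D * norm x"
    using bounded_operator_bound[OF assms(2)] by blast
  have "norm (U (T x)) \<le> (D * C) * norm x" for x
    using order_trans[OF D(2) mult_left_mono[OF C(2)]] D(1) by (simp add: mult.assoc)
  moreover have "Vector_Spaces.linear s1 s3 (U \<circ> T)"
    using assms Vector_Spaces.linear_compose by (auto simp: bounded_operator_def)
  ultimately show ?thesis by (auto simp: bounded_operator_def o_def)
qed

context banach_space_over
begin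

lemma bounded_operator_add_fun:
  assumes "bounded_operator s1 scale T" "bounded_operator s1 scale U"
  shows "bounded_operator s1 scale (\<lambda>x. T x + U x)"
proof -
  obtain C where C: "C > 0" "\<And>x. norm (T x) \<le> C * norm x"
    using bounded_operator_bound[OF assms(1)] by blast
  obtain D where D: "D > 0" "\<And>x. norm (U x) \<le> D * norm x"
    using bounded_operator_bound[OF assms(2)] by blast
  have "norm (T x + U x) \<le> (C + D) * norm x" for x
    using norm_triangle_mono[OF C(2)[of x] D(2)[of x]] by (simp add: distrib_right)
  moreover have "Vector_Spaces.linear s1 scale (\<lambda>x. T x + U x)"
    using assms by (simp add: bounded_operator_def Vector_Spaces.linear_iff scale_right_distrib)
  ultimately show ?thesis by (auto simp: bounded_operator_def)
qed

lemma bounded_operator_scale_fun: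
  assumes "bounded_operator s1 scale T"
  shows "bounded_operator s1 scale (\<lambda>x. scale c (T x))"
proof -
  obtain C where C: "C > 0" "\<And>x. norm (T x) \<le> C * norm x"
    using bounded_operator_bound[OF assms(1)] by blast
  have "norm (scale c (T x)) \<le> (norm c * C) * norm x" for x
    using mult_left_mono[OF C(2)[of x], of "norm c"] by (simp add: norm_scale mult.assoc)
  moreover have "Vector_Spaces.linear s1 scale (\<lambda>x. scale c (T x))"
    using assms by (simp add: bounded_operator_def Vector_Spaces.linear_iff scale_right_distrib mult.commute)
  ultimately show ?thesis by (auto simp: bounded_operator_def)
qed

lemma bounded_operator_id: "bounded_operator scale scale (\<lambda>x. x)"
  by (auto simp: bounded_operator_def Vector_Spaces.linear_iff vector_space_axioms intro: exI[of _ 1])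

lemma bounded_operator_const_zero:
  "vector_space s1 \<Longrightarrow> bounded_operator s1 scale (\<lambda>x. 0)"
  by (auto simp: bounded_operator_def Vector_Spaces.linear_iff vector_space_axioms intro: exI[of _ 1])

lemma bounded_operator_diff_fun:
  assumes "bounded_operator s1 scale T" "bounded_operator s1 scale U"
  shows "bounded_operator s1 scale (\<lambda>x. T x - U x)"
  using bounded_operator_add_fun[OF assms(1) bounded_operator_scale_fun[OF assms(2), of "-1"]]
  by simp

lemma bounded_operator_sum_fun:
  assumes "vector_space s1" "\<And>n. n \<in> N \<Longrightarrow> bounded_operator s1 scale (T n)"
  shows "bounded_operator s1 scale (\<lambda>x. \<Sum>n\<in>N. T n x)"
  using assms(2)
  by (induction N rule: infinite_finite_induct)
     (simp_all add: bounded_operator_const_zero[OF assms(1)] bounded_operator_add_fun)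

lemma tendsto_scale:
  assumes "(f \<longlongrightarrow> a) F" "(g \<longlongrightarrow> b) F"
  shows "((\<lambda>x. scale (f x) (g x)) \<longlongrightarrow> scale a b) F"
proof -
  have "((\<lambda>x. norm (f x - a) * norm (g x) + norm a * norm (g x - b))
      \<longlongrightarrow> norm (a - a) * norm b + norm a * norm (b - b)) F"
    by (intro tendsto_intros assms)
  then have "((\<lambda>x. norm (f x - a) * norm (g x) + norm a * norm (g x - b)) \<longlongrightarrow> 0) F" by simp
  moreover have "norm (scale (f x) (g x) - scale a b)
      \<le> norm (f x - a) * norm (g x) + norm a * norm (g x - b)" for x
    using norm_triangle_ineq[of "scale (f x - a) (g x)" "scale a (g x - b)"]
    by (simp add: norm_scale[symmetric] scale_left_diff_distrib scale_right_diff_distrib)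
  ultimately have "((\<lambda>x. scale (f x) (g x) - scale a b) \<longlongrightarrow> 0) F"
    by (intro Lim_null_comparison[of "\<lambda>x. scale (f x) (g x) - scale a b"]) auto
  then show ?thesis by (simp add: Lim_null[symmetric])
qed

end

subsection \<open>The Hahn-Banach theorem\<close>

definition sublinear :: "('a::real_vector \<Rightarrow> real) \<Rightarrow> bool" where
  "sublinear p \<longleftrightarrow> (\<forall>x y. p (x + y) \<le> p x + p y) \<and> (\<forall>r\<ge>0. \<forall>x. p (r *\<^sub>R x) = r * p x)"

lemma sublinear_neg: 
  assumes "sublinear p" shows "- p (- x) \<le> p x"
proof -
  have "p (0 *\<^sub>R x) = 0 * p x" using assms unfolding sublinear_def by blast
  then have "p 0 = 0" by simp
  moreover have "p (x + - x) \<le> p x + p (- x)" using assms unfolding sublinear_def by blast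
  ultimately show ?thesis by simp
qed

text \<open>A linear functional below \<open>q\<close> takes at \<open>v\<close> the value
  \<open>p v\<close> at least, hence exactly. So tilting prescribes a value in the Hahn-Banach
  theorem, and it also shows that a minimal sublinear functional is odd.\<close>

lemma sublinear_tilt:
  fixes p :: "'a::real_vector \<Rightarrow> real"
  assumes p: "sublinear p"
  obtains q where "sublinear q" "\<And>x. q x \<le> p x" "q (- v) \<le> - p v"
proof -
  define q where "q x = (INF t\<in>{0..}. p (x + t *\<^sub>R v) - t * p v)" for x
  have sub: "p (x + y) \<le> p x + p y" and hom: "r \<ge> 0 \<Longrightarrow> p (r *\<^sub>R x) = r * p x" for x y r
    using p unfolding sublinear_def by blast+
  \<comment> \<open>The family over the unbounded ray is bounded below independently of
    \<open>t\<close>, so the infimum is a real number.\<close>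
  have lower: "- p (- x) \<le> p (x + t *\<^sub>R v) - t * p v" if "t \<ge> 0" for x t
    using sub[of "x + t *\<^sub>R v" "- x"] hom[OF that, of v] by simp
  then have bdd: "bdd_below ((\<lambda>t. p (x + t *\<^sub>R v) - t * p v) ` {0..})" for x
    by (intro bdd_belowI[of _ "- p (- x)"]) auto
  have le: "q x \<le> p (x + t *\<^sub>R v) - t * p v" if "t \<ge> 0" for x t
    unfolding q_def using that by (intro cINF_lower[OF bdd]) auto
  have ge: "a \<le> q x" if "\<And>t. t \<ge> 0 \<Longrightarrow> a \<le> p (x + t *\<^sub>R v) - t * p v" for a x
    unfolding q_def by (rule cINF_greatest) (use that in auto)
  have "q (x + y) \<le> q x + q y" for x y
  proof -
    have "q (x + y) - (p (x + s *\<^sub>R v) - s * p v) \<le> q y" if "s \<ge> 0" for s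
    proof (rule ge)
      fix t :: real assume "t \<ge> 0"
      have "q (x + y) \<le> p (x + y + (s + t) *\<^sub>R v) - (s + t) * p v"
        using \<open>s \<ge> 0\<close> \<open>t \<ge> 0\<close> by (intro le) auto
      also have "\<dots> \<le> p (x + s *\<^sub>R v) + p (y + t *\<^sub>R v) - (s + t) * p v"
        using sub[of "x + s *\<^sub>R v" "y + t *\<^sub>R v"] by (simp add: algebra_simps)
      finally show "q (x + y) - (p (x + s *\<^sub>R v) - s * p v) \<le> p (y + t *\<^sub>R v) - t * p v"
        by (simp add: algebra_simps)
    qed
    then have "q (x + y) - q y \<le> q x" by (intro ge) (smt (verit))
    then show ?thesis by simp
  qed
  moreover have "q (r *\<^sub>R x) = r * q x" if "r \<ge> 0" for r x
  proof (cases "r = 0")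
    case True
    have p0: "p 0 = 0" using hom[of 0 0] by simp
    have "q 0 \<le> 0" using le[of 0 0] p0 by simp
    moreover have "0 \<le> q 0" by (rule ge) (simp add: hom)
    ultimately show ?thesis using True by simp
  next
    case False
    with that have r: "r > 0" by simp
    have *: "r * q x \<le> q (r *\<^sub>R x)" if "r > 0" for r x
    proof (rule ge)
      fix t :: real assume "t \<ge> 0"
      then have "q x \<le> p (x + (t / r) *\<^sub>R v) - (t / r) * p v" using that by (intro le) auto
      then have "r * q x \<le> r * (p (x + (t / r) *\<^sub>R v) - (t / r) * p v)"
        using that by (intro mult_left_mono) auto
      also have "\<dots> = p (r *\<^sub>R (x + (t / r) *\<^sub>R v)) - t * p v"
        using that hom[of r "x + (t / r) *\<^sub>R v"] by (simp add: right_diff_distrib)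
      also have "r *\<^sub>R (x + (t / r) *\<^sub>R v) = r *\<^sub>R x + t *\<^sub>R v"
        using that by (simp add: scaleR_add_right)
      finally show "r * q x \<le> p (r *\<^sub>R x + t *\<^sub>R v) - t * p v" .
    qed
    have "(1 / r) * q (r *\<^sub>R x) \<le> q ((1 / r) *\<^sub>R r *\<^sub>R x)" using r by (intro *) auto
    then have "q (r *\<^sub>R x) \<le> r * q x" using r by (simp add: field_simps)
    with *[OF r] show ?thesis by (simp add: antisym)
  qed
  ultimately have "sublinear q" by (auto simp: sublinear_def)
  moreover have "q x \<le> p x" for x using le[of 0 x] by simp
  moreover have "q (- v) \<le> - p v" using le[of 1 "- v"] hom[of 0 0] by simp
  ultimately show ?thesis using that by blast
qed

text \<open>A pointwise minimal sublinear functional is linear: otherwise it could be tilted.\<close>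

lemma linear_below_sublinear:
  fixes p :: "'a::real_vector \<Rightarrow> real"
  assumes "sublinear p"
  obtains f where "linear f" "\<And>x. f x \<le> p x"
proof -
  define S where "S = {q. sublinear q \<and> q \<le> p}"
  \<comment> \<open>The order is reversed: a maximal element in the sense of Zorn's lemma is a
    pointwise minimal sublinear functional.\<close>
  define r where "r = {(q', q). q' \<in> S \<and> q \<in> S \<and> q \<le> q'}"
  have Fr: "Field r = S" by (auto simp: r_def Field_def)
  have po: "Partial_order r"
    unfolding order_on_defs Fr
    by (auto simp: r_def refl_on_def trans_def antisym_def)
  have "\<exists>u\<in>Field r. \<forall>a\<in>C. (a, u) \<in> r" if C: "C \<in> Chains r" for C
  proof (cases "C = {}")
    case True
    then show ?thesis using assms by (auto simp: Fr S_def)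
  next
    case False
    have CS: "C \<subseteq> S" using C by (auto simp: Chains_def r_def)
    have chain: "a \<le> b \<or> b \<le> a" if "a \<in> C" "b \<in> C" for a b
      using C that by (auto simp: Chains_def r_def)
    define u where "u x = (INF q\<in>C. q x)" for x
    have lower: "- p (- x) \<le> q x" if "q \<in> C" for q x
    proof -
      have "sublinear q" "q \<le> p" using that CS by (auto simp: S_def)
      then show ?thesis using sublinear_neg[of q x] by (smt (verit) le_funD)
    qed
    then have bdd: "bdd_below ((\<lambda>q. q x) ` C)" for x
      by (intro bdd_belowI[of _ "- p (- x)"]) auto
    have le: "u x \<le> q x" if "q \<in> C" for q x
      unfolding u_def using that by (intro cINF_lower[OF bdd])
    have ge: "a \<le> u x" if "\<And>q. q \<in> C \<Longrightarrow> a \<le> q x" for a x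
      unfolding u_def using False that by (intro cINF_greatest) auto
    have "u (x + y) \<le> u x + u y" for x y
    proof -
      have "u (x + y) - q x \<le> u y" if q: "q \<in> C" for q
      proof (rule ge)
        fix q' assume q': "q' \<in> C"
        \<comment> \<open>Subadditivity mixes two members of the chain; the smaller of them serves
          for both.\<close>
        obtain m where m: "m \<in> C" "m \<le> q" "m \<le> q'" using chain[OF q q'] q q' by blast
        then have "sublinear m" using CS by (auto simp: S_def)
        then have "m (x + y) \<le> m x + m y" by (simp add: sublinear_def)
        then show "u (x + y) - q x \<le> q' y"
          using le[OF m(1), of "x + y"] m(2,3) le_funD[of m q x] le_funD[of m q' y] by linarith
      qed
      then have "u (x + y) - u y \<le> u x" by (intro ge) (smt (verit))
      then show ?thesis by simp
    qed
    moreover have "u (t *\<^sub>R x) = t * u x" if "t \<ge> 0" for t x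
    proof -
      have hom: "q (t *\<^sub>R x) = t * q x" if "q \<in> C" for q x
        using that CS \<open>t \<ge> 0\<close> by (auto simp: S_def sublinear_def)
      have "t * u x \<le> u (t *\<^sub>R x)"
        by (rule ge) (simp add: hom le mult_left_mono \<open>t \<ge> 0\<close>)
      moreover have "u (t *\<^sub>R x) \<le> t * u x"
      proof (cases "t = 0")
        case True
        obtain q where "q \<in> C" using False by blast
        then show ?thesis using le[of q "t *\<^sub>R x"] hom[of q x] True by simp
      next
        case False
        then have "t > 0" using that by simp
        have "u (t *\<^sub>R x) / t \<le> u x"
          by (rule ge) (use le[of _ "t *\<^sub>R x"] hom \<open>t > 0\<close> in \<open>force simp: divide_simps mult.commute\<close>)
        then show ?thesis using \<open>t > 0\<close> by (simp add: field_simps)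
      qed
      ultimately show ?thesis by simp
    qed
    ultimately have "sublinear u" by (simp add: sublinear_def)
    moreover have "u \<le> p"
    proof -
      obtain q where "q \<in> C" using False by blast
      moreover have "q \<le> p" using \<open>q \<in> C\<close> CS by (auto simp: S_def)
      ultimately show ?thesis by (meson le le_fun_def order_trans)
    qed
    ultimately have "u \<in> S" by (simp add: S_def)
    then show ?thesis
      using le CS by (intro bexI[of _ u]) (auto simp: Fr, auto simp: r_def le_fun_def)
  qed
  from Zorns_po_lemma[OF po this] obtain f where f: "f \<in> S" "\<And>g. g \<in> S \<Longrightarrow> g \<le> f \<Longrightarrow> g = f"
    unfolding Fr by (auto simp: r_def)
  have fs: "sublinear f" "f \<le> p" using f(1) by (auto simp: S_def)
  have neg: "f (- v) = - f v" for v
  proof -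
    obtain q where q: "sublinear q" "\<And>x. q x \<le> f x" "q (- v) \<le> - f v"
      using sublinear_tilt[OF fs(1)] by blast
    have "q \<le> f" using q(2) by (auto simp: le_fun_def)
    then have "q \<in> S" using q(1) fs(2) by (auto simp: S_def)
    then have "q = f" using f(2) \<open>q \<le> f\<close> by blast
    then show ?thesis using q(3) sublinear_neg[OF fs(1), of v] by simp
  qed
  have sub: "f (x + y) \<le> f x + f y" and hom: "t \<ge> 0 \<Longrightarrow> f (t *\<^sub>R x) = t * f x" for x y t
    using fs(1) unfolding sublinear_def by blast+
  have add: "f (x + y) = f x + f y" for x y
    using sub[of x y] sub[of "- x" "- y"] neg[of "x + y"] neg[of x] neg[of y] by simp
  have "f (t *\<^sub>R x) = t * f x" for t x
    using hom[of t x] hom[of "- t" x] neg[of "t *\<^sub>R x"] by (cases "t \<ge> 0") auto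
  then have "linear f" using add by (intro linearI) auto
  then show ?thesis using that fs(2) by (auto simp: le_fun_def)
qed

lemma real_norming_functional:
  fixes v :: "'a::real_normed_vector"
  obtains f where "linear f" "\<And>x. \<bar>f x\<bar> \<le> norm x" "f v = norm v"
proof -
  have "sublinear (norm :: 'a \<Rightarrow> real)" by (auto simp: sublinear_def norm_triangle_ineq)
  then obtain q where q: "sublinear q" "\<And>x. q x \<le> norm x" "q (- v) \<le> - norm v"
    using sublinear_tilt by blast
  obtain f where f: "linear f" "\<And>x. f x \<le> q x" using linear_below_sublinear[OF q(1)] by blast
  have le: "f x \<le> norm x" for x using f(2) q(2) order_trans by blast
  have neg: "f (- x) = - f x" for x by (rule linear_neg[OF f(1)])
  have "\<bar>f x\<bar> \<le> norm x" for x using le[of x] le[of "- x"] neg[of x] by simp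
  moreover have "f v = norm v" using le[of v] f(2)[of "- v"] q(3) neg[of v] by simp
  ultimately show ?thesis using that f(1) by blast
qed

text \<open>Complexification \<open>f x - i f (i x)\<close> of a real norming functional, written so
  that it also makes sense for \<open>i = 0\<close>. The crude triangle inequality gives the norm
  bound 2, which is good enough everywhere below.\<close>

lemma (in banach_space_over) norming_functional:
  obtains \<psi> where "bounded_operator scale (*) \<psi>" "\<And>x. norm (\<psi> x) \<le> 2 * norm x"
    "norm (\<psi> v) \<ge> norm v"
proof -
  obtain re im :: "'k \<Rightarrow> real" and i :: 'k where
    c: "\<And>c. c = of_real (re c) + of_real (im c) * i"
    "\<And>c. \<bar>re c\<bar> \<le> norm c" "\<And>a b. re (of_real a + of_real b * i) = a" "i = 0 \<or> i * i = -1"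
    and norm_i: "norm i \<le> 1"
    by (rule real_or_complex_coordinates[where 'k = 'k]) (rule that)
  obtain f where f: "Real_Vector_Spaces.linear f" "\<And>x. \<bar>f x\<bar> \<le> norm x" "f v = norm v"
    by (rule real_norming_functional[of v]) (rule that)
  define \<psi> where "\<psi> x = of_real (f x) - of_real (f (scale i x)) * i" for x
  have add: "\<psi> (x + y) = \<psi> x + \<psi> y" for x y
    by (simp add: \<psi>_def scale_right_distrib linear_add[OF f(1)] algebra_simps)
  have real: "\<psi> (scale (of_real r) x) = of_real r * \<psi> x" for r x
  proof -
    have "scale i (scale (of_real r) x) = r *\<^sub>R scale i x"
      unfolding scale_of_real[symmetric] scale_scale by (simp add: mult.commute)
    then show ?thesis
      by (simp add: \<psi>_def scale_of_real linear_scale[OF f(1)] algebra_simps)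
  qed
  have imag: "\<psi> (scale i x) = i * \<psi> x" for x
    using c(4)
  proof
    assume "i * i = -1"
    then show ?thesis
      by (simp add: \<psi>_def linear_neg[OF f(1)] right_diff_distrib mult.left_commute[of i])
  qed (simp add: \<psi>_def linear_0[OF f(1)])
  have scale: "\<psi> (scale c x) = c * \<psi> x" for c x
  proof -
    have "\<psi> (scale c x) = \<psi> (scale (of_real (re c)) x + scale (of_real (im c)) (scale i x))"
      by (simp add: scale_left_distrib[symmetric] c(1)[symmetric])
    also have "\<dots> = (of_real (re c) + of_real (im c) * i) * \<psi> x"
      by (simp only: add real imag) (simp add: algebra_simps)
    finally show ?thesis by (simp add: c(1)[symmetric])
  qed
  have bound: "norm (\<psi> x) \<le> 2 * norm x" for x
  proof -
    have "norm (\<psi> x) \<le> \<bar>f x\<bar> + \<bar>f (scale i x)\<bar> * norm i"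
      unfolding \<psi>_def by (rule order_trans[OF norm_triangle_ineq4]) (simp add: norm_mult)
    also have "\<dots> \<le> \<bar>f x\<bar> + \<bar>f (scale i x)\<bar> * 1"
      using norm_i by (intro add_left_mono mult_left_mono) auto
    also have "\<dots> \<le> norm x + norm (scale i x)" using f(2) by (simp add: add_mono)
    also have "\<dots> \<le> norm x + 1 * norm x"
      unfolding norm_scale using norm_i by (intro add_left_mono mult_right_mono) auto
    finally show ?thesis by simp
  qed
  have "re (\<psi> v) = norm v"
    using c(3)[of "f v" "- f (scale i v)"] f(3) by (simp add: \<psi>_def)
  then have "norm v \<le> norm (\<psi> v)" using c(2)[of "\<psi> v"] by simp
  moreover have "bounded_operator scale (*) \<psi>"
    by (rule bounded_operatorI[OF banach_space_over_axioms banach_space_over_mult add scale bound])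
  ultimately show ?thesis using that bound by blast
qed

subsection \<open>Unconditional convergence\<close>

text \<open>The finite-set form of unconditional convergence; unlike the form with permutations it
  passes directly to blocks, subseries and bounded multipliers.\<close>

definition unconditionally_Cauchy :: "(nat \<Rightarrow> 'a::real_normed_vector) \<Rightarrow> bool" where
  "unconditionally_Cauchy f \<longleftrightarrow>
     (\<forall>e>0. \<exists>L. \<forall>N. finite N \<longrightarrow> N \<subseteq> {L..} \<longrightarrow> norm (sum f N) < e)"

text \<open>Otherwise there are disjoint finite sets with large sums; a permutation that moves each of
  them to an initial segment of an interval of indices destroys convergence.\<close>

lemma unconditionally_CauchyI:
  fixes f :: "nat \<Rightarrow> 'a::banach"
  assumes "\<And>\<pi>. bij \<pi> \<Longrightarrow> summable (\<lambda>n. f (\<pi> n))"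
  shows "unconditionally_Cauchy f"
proof (rule ccontr)
  assume "\<not> unconditionally_Cauchy f"
  then obtain e where e: "e > 0" and "\<And>L. \<exists>N. finite N \<and> N \<subseteq> {L..} \<and> e \<le> norm (sum f N)"
    by (auto simp: unconditionally_Cauchy_def not_less)
  then obtain g where g: "\<And>L. finite (g L)" "\<And>L. g L \<subseteq> {L..}" "\<And>L. e \<le> norm (sum f (g L))"
    by metis
  define h where "h L = Suc (Max (insert L (g L)))" for L
  have gh: "g L \<subseteq> {L..<h L}" for L
    using g(1,2)[of L] by (auto simp: h_def less_Suc_eq_le)
  have hL: "L < h L" for L using g(1)[of L] by (simp add: h_def less_Suc_eq_le)
  define a where "a n = (h ^^ n) 0" for n
  have aS: "a (Suc n) = h (a n)" for n by (simp add: a_def)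
  have mono: "strict_mono a" by (rule strict_mono_Suc_iff[THEN iffD2]) (simp add: aS hL)
  define I where "I n = {a n..<a (Suc n)}" for n
  define G where "G n = g (a n)" for n
  have GI: "G n \<subseteq> I n" and finG: "finite (G n)" for n using gh g(1) by (auto simp: G_def I_def aS)
  have cardI: "a n + card (G n) \<le> a (Suc n)" for n
    using card_mono[OF _ GI[of n]] strict_monoD[OF mono, of n "Suc n"] by (auto simp: I_def)
  \<comment> \<open>A bijection from an initial segment onto \<open>G n\<close> extends to a
    permutation of the interval because the two complements have equal size.\<close>
  have "\<exists>p. bij_betw p (I n) (I n) \<and> p ` {a n..<a n + card (G n)} = G n" for n
  proof -
    let ?J = "{a n..<a n + card (G n)}"
    have J: "?J \<subseteq> I n" using cardI[of n] by (auto simp: I_def)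
    obtain p where p: "bij_betw p ?J (G n)"
      using finite_same_card_bij[of ?J "G n"] finG by auto
    have "card (I n - ?J) = card (I n - G n)"
      using J GI[of n] finG by (subst (1 2) card_Diff_subset) auto
    then obtain q where q: "bij_betw q (I n - ?J) (I n - G n)"
      using finite_same_card_bij[of "I n - ?J" "I n - G n"] by (auto simp: I_def)
    define r where "r x = (if x \<in> ?J then p x else q x)" for x
    have r1: "bij_betw r ?J (G n)" 
      by (rule iffD1[OF bij_betw_cong p]) (auto simp: r_def)
    have r2: "bij_betw r (I n - ?J) (I n - G n)"
      by (rule iffD1[OF bij_betw_cong q]) (auto simp: r_def)
    have "bij_betw r (?J \<union> (I n - ?J)) (G n \<union> (I n - G n))"
      by (rule bij_betw_combine[OF r1 r2]) auto
    moreover have "?J \<union> (I n - ?J) = I n" "G n \<union> (I n - G n) = I n" using J GI by auto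
    ultimately show ?thesis using r1 by (auto simp: bij_betw_def)
  qed
  then obtain p where p: "\<And>n. bij_betw (p n) (I n) (I n)"
      "\<And>n. p n ` {a n..<a n + card (G n)} = G n" by metis
  have I_ex: "\<exists>n. x \<in> I n" for x
  proof -
    have a0: "a 0 = 0" by (simp add: a_def)
    have "x \<le> a x" by (rule strict_mono_imp_increasing[OF mono])
    also have "a x < a (Suc x)" using mono by (simp add: strict_mono_Suc_iff)
    finally have "\<exists>n. x < a n" by blast
    define n where "n = (LEAST n. x < a n)"
    have n: "x < a n" "\<And>m. m < n \<Longrightarrow> \<not> x < a m"
      unfolding n_def using LeastI_ex[OF \<open>\<exists>n. x < a n\<close>] not_less_Least by blast+
    then obtain m where "n = Suc m" using a0 by (cases n) auto
    then have "x \<in> I m" using n(1) n(2)[of m] by (simp add: I_def)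
    then show ?thesis ..
  qed
  have I_disj: "x \<in> I n \<Longrightarrow> x \<in> I m \<Longrightarrow> n = m" for x n m
  proof (rule ccontr)
    assume x: "x \<in> I n" "x \<in> I m" and "n \<noteq> m"
    then have "a (Suc n) \<le> a m \<or> a (Suc m) \<le> a n"
      unfolding strict_mono_less_eq[OF mono] by linarith
    with x show False unfolding I_def by (meson atLeastLessThan_iff leD order_trans)
  qed
  define ix where "ix x = (SOME n. x \<in> I n)" for x
  have ix: "x \<in> I (ix x)" for x unfolding ix_def using I_ex by (rule someI_ex)
  have ix_eq: "x \<in> I n \<Longrightarrow> ix x = n" for x n using I_disj ix by blast
  define \<pi> where "\<pi> x = p (ix x) x" for x
  have \<pi>I: "\<pi> x \<in> I (ix x)" for x using p(1)[of "ix x"] ix[of x] by (auto simp: \<pi>_def bij_betw_def)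
  have "inj \<pi>"
  proof (rule injI)
    fix x y assume eq: "\<pi> x = \<pi> y"
    then have "ix x = ix y" using \<pi>I[of x] \<pi>I[of y] I_disj by metis
    then show "x = y" using eq p(1)[of "ix x"] ix[of x] ix[of y]
      by (auto simp: \<pi>_def bij_betw_def inj_on_def)
  qed
  moreover have "surj \<pi>"
  proof (rule surjI[of \<pi> "\<lambda>y. inv_into (I (ix y)) (p (ix y)) y"])
    fix y
    let ?x = "inv_into (I (ix y)) (p (ix y)) y"
    have "p (ix y) ` I (ix y) = I (ix y)" using p(1) by (simp add: bij_betw_def)
    then have y: "y \<in> p (ix y) ` I (ix y)" using ix[of y] by simp
    have "ix ?x = ix y" by (rule ix_eq) (rule inv_into_into[OF y])
    then show "\<pi> ?x = y" using f_inv_into_f[OF y] by (simp add: \<pi>_def)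
  qed
  ultimately have "summable (\<lambda>n. f (\<pi> n))" by (intro assms) (simp add: bij_def)
  then obtain N where N: "\<And>m n. m \<ge> N \<Longrightarrow> norm (\<Sum>i=m..<n. f (\<pi> i)) < e"
    using e unfolding summable_Cauchy by blast
  let ?J = "{a N..<a N + card (G N)}"
  have JI: "?J \<subseteq> I N" using cardI[of N] by (auto simp: I_def)
  have "(\<Sum>i\<in>?J. f (\<pi> i)) = (\<Sum>i\<in>?J. f (p N i))"
    using JI by (intro sum.cong) (auto simp: \<pi>_def dest!: ix_eq subsetD)
  also have "\<dots> = sum f (p N ` ?J)"
    by (rule sum.reindex[symmetric, unfolded o_def])
       (use p(1)[of N] JI in \<open>auto simp: bij_betw_def intro: inj_on_subset\<close>)
  also have "\<dots> = sum f (G N)" by (simp add: p(2))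
  finally have "norm (\<Sum>i\<in>?J. f (\<pi> i)) \<ge> e" using g(3)[of "a N"] by (simp add: G_def)
  moreover have "N \<le> a N" by (rule strict_mono_imp_increasing[OF mono])
  ultimately show False using N[of "a N" "a N + card (G N)"] by simp
qed

text \<open>By convexity: with the last coefficient \<open>t n\<close>, the vector is a convex
  combination of the cases \<open>t n = 0\<close> and \<open>t n = 1\<close>. The offset
  \<open>w\<close> absorbs the terms already decided.\<close>

lemma convex_multiplier_bound:
  fixes v :: "'i \<Rightarrow> 'a::real_normed_vector"
  assumes "finite N" "\<And>N'. N' \<subseteq> N \<Longrightarrow> norm (w + sum v N') \<le> K"
    and "\<And>n. n \<in> N \<Longrightarrow> 0 \<le> t n \<and> t n \<le> 1"
  shows "norm (w + (\<Sum>n\<in>N. t n *\<^sub>R v n)) \<le> K"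
  using assms
proof (induction N arbitrary: w rule: finite_induct)
  case (insert n N)
  let ?s = "\<Sum>i\<in>N. t i *\<^sub>R v i"
  have t: "0 \<le> t n" "t n \<le> 1" using insert.prems(2)[of n] by auto
  have 1: "norm (w + ?s) \<le> K"
    by (rule insert.IH) (use insert.prems in auto)
  have 2: "norm (w + v n + ?s) \<le> K"
  proof (rule insert.IH)
    fix N' assume N': "N' \<subseteq> N"
    then have "finite N'" "n \<notin> N'" using insert.hyps finite_subset by auto
    then show "norm (w + v n + sum v N') \<le> K"
      using insert.prems(1)[of "insert n N'"] N' by (auto simp: add.assoc)
  qed (use insert.prems in auto)
  have "w + (\<Sum>i\<in>insert n N. t i *\<^sub>R v i) = (1 - t n) *\<^sub>R (w + ?s) + t n *\<^sub>R (w + v n + ?s)"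
    using insert.hyps by (simp add: algebra_simps)
  also have "norm \<dots> \<le> (1 - t n) * norm (w + ?s) + t n * norm (w + v n + ?s)"
    by (rule norm_triangle_mono) (use t in auto)
  also have "\<dots> \<le> (1 - t n) * K + t n * K"
    using t 1 2 by (intro add_mono mult_left_mono) auto
  finally show ?case by (simp add: algebra_simps)
qed auto

lemma real_multiplier_bound:
  fixes v :: "'i \<Rightarrow> 'a::real_normed_vector"
  assumes "finite N" "\<And>N'. N' \<subseteq> N \<Longrightarrow> norm (sum v N') \<le> K"
    and "\<And>n. n \<in> N \<Longrightarrow> \<bar>t n\<bar> \<le> 1"
  shows "norm (\<Sum>n\<in>N. t n *\<^sub>R v n) \<le> 2 * K"
proof -
  have "norm (0 + (\<Sum>n\<in>N. max 0 (t n) *\<^sub>R v n)) \<le> K"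
    using assms by (intro convex_multiplier_bound) (auto simp: abs_le_iff)
  moreover have "norm (0 + (\<Sum>n\<in>N. max 0 (- t n) *\<^sub>R v n)) \<le> K"
    using assms by (intro convex_multiplier_bound) (auto simp: abs_le_iff)
  moreover have "(\<Sum>n\<in>N. t n *\<^sub>R v n)
      = (\<Sum>n\<in>N. max 0 (t n) *\<^sub>R v n) - (\<Sum>n\<in>N. max 0 (- t n) *\<^sub>R v n)"
    by (auto simp: sum_subtractf[symmetric] scaleR_left_diff_distrib[symmetric] max_def
             intro!: sum.cong)
  ultimately show ?thesis
    using norm_triangle_ineq4[of "\<Sum>n\<in>N. max 0 (t n) *\<^sub>R v n" "\<Sum>n\<in>N. max 0 (- t n) *\<^sub>R v n"]
    by simp
qed

context banach_space_over
begin

text \<open>The factor 4 is 2 for positive and negative parts times 2 for the two real coordinates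
  of the scalars.\<close>

lemma multiplier_bound:
  assumes "finite N" "\<And>N'. N' \<subseteq> N \<Longrightarrow> norm (sum v N') \<le> K"
    and "\<And>n. n \<in> N \<Longrightarrow> norm (a n) \<le> 1"
  shows "norm (\<Sum>n\<in>N. scale (a n) (v n)) \<le> 4 * K"
proof -
  obtain re im :: "'k \<Rightarrow> real" and i :: 'k where
    c: "\<And>c. c = of_real (re c) + of_real (im c) * i"
    "\<And>c. \<bar>re c\<bar> \<le> norm c" "\<And>c. \<bar>im c\<bar> \<le> norm c" and norm_i: "norm i \<le> 1"
    by (rule real_or_complex_coordinates[where 'k = 'k]) (rule that)
  have "scale (a n) (v n) = re (a n) *\<^sub>R v n + scale i (im (a n) *\<^sub>R v n)" for n
  proof -
    have "scale (a n) (v n) = scale (of_real (re (a n)) + i * of_real (im (a n))) (v n)"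
      by (simp add: mult.commute[of i] c(1)[symmetric])
    then show ?thesis by (simp add: scale_left_distrib scale_of_real[symmetric])
  qed
  then have "(\<Sum>n\<in>N. scale (a n) (v n))
      = (\<Sum>n\<in>N. re (a n) *\<^sub>R v n) + scale i (\<Sum>n\<in>N. im (a n) *\<^sub>R v n)"
    by (simp add: sum.distrib scale_sum_right)
  also have "norm \<dots> \<le> norm (\<Sum>n\<in>N. re (a n) *\<^sub>R v n) + norm i * norm (\<Sum>n\<in>N. im (a n) *\<^sub>R v n)"
    by (rule norm_triangle_mono) (auto simp: norm_scale)
  also have "\<dots> \<le> norm (\<Sum>n\<in>N. re (a n) *\<^sub>R v n) + 1 * norm (\<Sum>n\<in>N. im (a n) *\<^sub>R v n)"
    using norm_i by (intro add_left_mono mult_right_mono) auto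
  also have "\<dots> \<le> 2 * K + 1 * (2 * K)"
  proof (intro add_mono mult_left_mono real_multiplier_bound assms(1,2))
    fix n assume "n \<in> N"
    then show "\<bar>re (a n)\<bar> \<le> 1" "\<bar>im (a n)\<bar> \<le> 1"
      using assms(3) c(2,3)[of "a n"] by (meson order_trans)+
  qed auto
  finally show ?thesis by simp
qed

lemma unconditionally_Cauchy_multiplier:
  assumes "unconditionally_Cauchy v" "e > 0"
  obtains L where "\<And>N a. finite N \<Longrightarrow> N \<subseteq> {L..} \<Longrightarrow> (\<And>n. n \<in> N \<Longrightarrow> norm (a n) \<le> 1) \<Longrightarrow>
    norm (\<Sum>n\<in>N. scale (a n) (v n)) < e"
proof -
  \<comment> \<open>Dividing by 5 beats the factor 4 of \<open>multiplier_bound\<close>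
    strictly.\<close>
  obtain L where L: "\<And>N. finite N \<Longrightarrow> N \<subseteq> {L..} \<Longrightarrow> norm (sum v N) < e / 5"
    using assms unfolding unconditionally_Cauchy_def by (metis divide_pos_pos zero_less_numeral)
  show ?thesis
  proof (rule that)
    fix N and a :: "nat \<Rightarrow> 'k"
    assume N: "finite N" "N \<subseteq> {L..}" "\<And>n. n \<in> N \<Longrightarrow> norm (a n) \<le> 1"
    have "norm (\<Sum>n\<in>N. scale (a n) (v n)) \<le> 4 * (e / 5)"
      using N by (intro multiplier_bound less_imp_le[OF L]) (auto intro: finite_subset)
    also have "\<dots> < e" using assms(2) by simp
    finally show "norm (\<Sum>n\<in>N. scale (a n) (v n)) < e" .
  qed
qed

lemma unconditionally_Cauchy_scale:
  assumes "unconditionally_Cauchy v" "\<And>n. norm (a n) \<le> B"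
  shows "unconditionally_Cauchy (\<lambda>n. scale (a n) (v n))"
  unfolding unconditionally_Cauchy_def
proof (intro allI impI)
  fix e :: real assume "e > 0"
  define D where "D = max B 1"
  have D: "D > 0" "\<And>n. norm (a n) \<le> D" using assms(2) by (auto simp: D_def max.coboundedI1)
  obtain L where L: "\<And>N b. finite N \<Longrightarrow> N \<subseteq> {L..} \<Longrightarrow> (\<And>n. n \<in> N \<Longrightarrow> norm (b n) \<le> 1) \<Longrightarrow>
      norm (\<Sum>n\<in>N. scale (b n) (v n)) < e / D"
    using unconditionally_Cauchy_multiplier[OF assms(1), of "e / D"] \<open>e > 0\<close> D(1)
    by (metis divide_pos_pos)
  have "norm (\<Sum>n\<in>N. scale (a n) (v n)) < e" if N: "finite N" "N \<subseteq> {L..}" for N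
  proof -
    have "(\<Sum>n\<in>N. scale (a n) (v n)) = scale (of_real D) (\<Sum>n\<in>N. scale (a n / of_real D) (v n))"
      using D(1) by (simp add: scale_sum_right)
    also have "norm \<dots> = D * norm (\<Sum>n\<in>N. scale (a n / of_real D) (v n))"
      using D(1) by (simp add: norm_scale)
    also have "\<dots> < D * (e / D)"
      by (intro mult_strict_left_mono L N) (use D in \<open>auto simp: norm_divide divide_le_eq\<close>)
    finally show ?thesis using D(1) by simp
  qed
  then show "\<exists>L. \<forall>N. finite N \<longrightarrow> N \<subseteq> {L..} \<longrightarrow> norm (\<Sum>n\<in>N. scale (a n) (v n)) < e" by blast
qed

end

lemma unconditionally_Cauchy_summable:
  fixes f :: "nat \<Rightarrow> 'a::banach"
  assumes "unconditionally_Cauchy f"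
  shows "summable f"
  unfolding summable_Cauchy
proof (intro allI impI)
  fix e :: real assume "e > 0"
  then obtain L where L: "\<And>N. finite N \<Longrightarrow> N \<subseteq> {L..} \<Longrightarrow> norm (sum f N) < e"
    using assms unfolding unconditionally_Cauchy_def by blast
  show "\<exists>N. \<forall>m\<ge>N. \<forall>n. norm (sum f {m..<n}) < e"
    by (intro exI[of _ L] allI impI L) auto
qed

lemma unconditionally_Cauchy_norm_summable:
  fixes f :: "nat \<Rightarrow> 'a::real_normed_vector"
  assumes "summable (\<lambda>n. norm (f n))"
  shows "unconditionally_Cauchy f"
  unfolding unconditionally_Cauchy_def
proof (intro allI impI)
  fix e :: real assume "e > 0"
  then obtain L where L: "\<And>m n. m \<ge> L \<Longrightarrow> norm (\<Sum>i=m..<n. norm (f i)) < e"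
    using assms unfolding summable_Cauchy by blast
  have "norm (sum f N) < e" if N: "finite N" "N \<subseteq> {L..}" for N
  proof -
    have "norm (sum f N) \<le> (\<Sum>i\<in>N. norm (f i))" by (rule norm_sum)
    also have "\<dots> \<le> (\<Sum>i=L..<Suc (Max (insert L N)). norm (f i))"
      using N by (intro sum_mono2) (auto simp: less_Suc_eq_le)
    also have "\<dots> < e" using L[of L "Suc (Max (insert L N))"] by (simp add: sum_nonneg)
    finally show ?thesis .
  qed
  then show "\<exists>L. \<forall>N. finite N \<longrightarrow> N \<subseteq> {L..} \<longrightarrow> norm (sum f N) < e" by blast
qed

lemma unconditionally_Cauchy_bounded:
  fixes f :: "nat \<Rightarrow> 'a::real_normed_vector"
  assumes "unconditionally_Cauchy f"
  obtains K where "\<And>N. finite N \<Longrightarrow> norm (sum f N) \<le> K"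
proof -
  obtain L where L: "\<And>N. finite N \<Longrightarrow> N \<subseteq> {L..} \<Longrightarrow> norm (sum f N) < 1"
    using assms unfolding unconditionally_Cauchy_def by (metis zero_less_one)
  have "norm (sum f N) \<le> (\<Sum>n<L. norm (f n)) + 1" if N: "finite N" for N
  proof -
    have "sum f N = sum f (N \<inter> {..<L}) + sum f (N \<inter> {L..})"
      using N by (subst sum.union_disjoint[symmetric]) (auto intro!: sum.cong)
    also have "norm \<dots> \<le> (\<Sum>n\<in>N \<inter> {..<L}. norm (f n)) + 1"
      using N by (intro norm_triangle_mono norm_sum less_imp_le[OF L]) auto
    also have "\<dots> \<le> (\<Sum>n<L. norm (f n)) + 1" by (intro add_right_mono sum_mono2) auto
    finally show ?thesis .
  qed
  then show ?thesis using that by blast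
qed

text \<open>Banach-Steinhaus by Baire category: one of the closed sets \<open>S n\<close> contains a
  ball, and differences move this ball to the origin.\<close>

lemma uniform_boundedness:
  fixes \<T> :: "('a::banach \<Rightarrow> 'b::real_normed_vector) set"
  assumes lin: "\<And>T. T \<in> \<T> \<Longrightarrow> bounded_linear T"
    and pw: "\<And>x. \<exists>B. \<forall>T\<in>\<T>. norm (T x) \<le> B"
  obtains C where "C > 0" "\<And>T x. T \<in> \<T> \<Longrightarrow> norm (T x) \<le> C * norm x"
proof -
  define S where "S n = {x. \<forall>T\<in>\<T>. norm (T x) \<le> real n}" for n
  have closed: "closed (S n)" for n
  proof -
    have "S n = (\<Inter>T\<in>\<T>. {x. norm (T x) \<le> real n})" by (auto simp: S_def)
    moreover have "closed {x. norm (T x) \<le> real n}" if "T \<in> \<T>" for T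
      using lin[OF that] by (intro closed_Collect_le continuous_intros linear_continuous_on)
    ultimately show ?thesis by auto
  qed
  have "\<Union>(range S) = UNIV"
  proof (intro equalityI subsetI)
    fix x
    obtain B where "\<forall>T\<in>\<T>. norm (T x) \<le> B" using pw by blast
    moreover obtain n where "B \<le> real n" using real_arch_simple by blast
    ultimately have "x \<in> S n" unfolding S_def by force
    then show "x \<in> \<Union>(range S)" by blast
  qed auto
  moreover have "interior (\<Union>(range S)) = {}" if "\<And>n. interior (S n) = {}"
    using Met_TC.metric_Baire_category_alt[where 'a = 'a, of "range S"] closed that
    by (auto simp: complete_UNIV)
  ultimately obtain n where "interior (S n) \<noteq> {}" by (metis UNIV_not_empty interior_UNIV)
  then obtain x0 where "x0 \<in> interior (S n)" by auto
  then obtain r where r: "r > 0" "cball x0 r \<subseteq> S n" by (auto simp: mem_interior_cball)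
  have "norm (T x) \<le> (2 * real n / r + 1) * norm x" if T: "T \<in> \<T>" for T x
  proof (cases "x = 0")
    case True
    then show ?thesis using lin[OF T] by (simp add: linear_simps)
  next
    case False
    define y where "y = (r / norm x) *\<^sub>R x"
    have "x0 + y \<in> S n" "x0 \<in> S n" using r False by (auto simp: y_def dist_norm intro!: subsetD[OF r(2)])
    then have "norm (T (x0 + y)) \<le> real n" "norm (T x0) \<le> real n" using T by (auto simp: S_def)
    then have "norm (T (x0 + y) - T x0) \<le> 2 * real n"
      using norm_triangle_ineq4[of "T (x0 + y)" "T x0"] by simp
    then have "(r / norm x) * norm (T x) \<le> 2 * real n"
      using lin[OF T] r by (simp add: y_def linear_simps)
    then have "norm (T x) \<le> (2 * real n / r) * norm x"
      using False r by (simp add: field_simps)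
    also have "\<dots> \<le> (2 * real n / r + 1) * norm x" by (intro mult_right_mono) auto
    finally show ?thesis .
  qed
  moreover have "2 * real n / r + 1 > 0" using r by (simp add: add_nonneg_pos)
  ultimately show ?thesis using that by blast
qed

lemma bounded_operator_bounded_linear:
  assumes "banach_space_over s1" "banach_space_over s2" "bounded_operator s1 s2 T"
  shows "bounded_linear T"
proof -
  interpret E: banach_space_over s1 by fact
  interpret F: banach_space_over s2 by fact
  obtain C where C: "\<And>x. norm (T x) \<le> C * norm x"
    using bounded_operator_bound[OF assms(3)] by metis
  show ?thesis
  proof (rule bounded_linear_intro)
    show "T (r *\<^sub>R x) = r *\<^sub>R T x" for r x
      using bounded_operator_scale[OF assms(3), of "of_real r" x]
      by (simp add: E.scale_of_real F.scale_of_real)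
    show "norm (T x) \<le> norm x * C" for x using C by (simp add: mult.commute)
  qed (rule bounded_operator_add[OF assms(3)])
qed

subsection \<open>Operators of finite rank\<close>

context banach_space_over
begin

text \<open>The constant is the distance from \<open>b\<close> to the closed span, rescaled. It
  makes the coordinate along \<open>b\<close> bounded, which is the core of both closedness of
  finite spans and boundedness of the coordinates of finite rank operators.\<close>

lemma closed_span_dist:
  assumes "closed (span B)" "b \<notin> span B"
  obtains d where "d > 0" "\<And>c y. y \<in> span B \<Longrightarrow> d * norm c \<le> norm (scale c b + y)"
proof -
  have "b \<in> - span B" "open (- span B)" using assms by auto
  then obtain d where d: "d > 0" "ball b d \<subseteq> - span B" using open_contains_ball by blast
  have "d * norm c \<le> norm (scale c b + y)" if y: "y \<in> span B" for c y
  proof (cases "c = 0")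
    case False
    let ?z = "scale (- inverse c) y"
    have "?z \<in> span B" using y by (rule span_scale)
    then have "?z \<notin> ball b d" using d(2) by auto
    then have "d \<le> norm (b - ?z)" by (simp add: dist_norm)
    then have "norm c * d \<le> norm c * norm (b - ?z)" by (intro mult_left_mono) auto
    also have "\<dots> = norm (scale c (b - ?z))" by (simp add: norm_scale)
    also have "scale c (b - ?z) = scale c b + y" using False by (simp add: scale_right_distrib)
    finally show ?thesis by (simp add: mult.commute)
  qed auto
  then show ?thesis using that d(1) by blast
qed

lemma closed_span_finite:
  assumes "finite B" shows "closed (span B)"
  using assms
proof (induction B rule: finite_induct)
  case (insert b B)
  show ?case
  proof (cases "b \<in> span B")
    case True
    then show ?thesis using insert.IH by (simp add: span_redundant)
  next
    case False
    obtain d where d: "d > 0" "\<And>c y. y \<in> span B \<Longrightarrow> d * norm c \<le> norm (scale c b + y)"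
      by (rule closed_span_dist[OF insert.IH False]) (rule that)
    show ?thesis
      unfolding closed_sequential_limits
    proof (intro allI impI, elim conjE)
      fix z l assume z: "\<forall>n. z n \<in> span (insert b B)" "z \<longlonglongrightarrow> l"
      then have "\<forall>n. \<exists>c. z n - scale c b \<in> span B" by (simp add: span_breakdown_eq)
      then obtain c where c: "\<And>n. z n - scale (c n) b \<in> span B" by metis
      have "d * norm (c n - c m) \<le> norm (z n - z m)" for n m
        using d(2)[OF span_diff[OF c[of n] c[of m]], of "c n - c m"]
        by (simp add: scale_left_diff_distrib)
      then have cd: "norm (c n - c m) \<le> norm (z n - z m) / d" for n m
        using d(1) by (simp add: field_simps)
      have "Cauchy c"
      proof (rule metric_CauchyI)
        fix e :: real assume "e > 0"
        then obtain M where "\<forall>m\<ge>M. \<forall>n\<ge>M. dist (z m) (z n) < e * d"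
          using metric_CauchyD[OF LIMSEQ_imp_Cauchy[OF z(2)], of "e * d"] d(1) by auto
        then have "\<forall>m\<ge>M. \<forall>n\<ge>M. dist (c m) (c n) < e"
          using cd d(1) by (simp add: dist_norm) (smt (verit) divide_less_eq)
        then show "\<exists>M. \<forall>m\<ge>M. \<forall>n\<ge>M. dist (c m) (c n) < e" by blast
      qed
      then obtain c0 where "c \<longlonglongrightarrow> c0" using Cauchy_convergent convergent_def by blast
      then have "(\<lambda>n. z n - scale (c n) b) \<longlonglongrightarrow> l - scale c0 b"
        by (intro tendsto_intros tendsto_scale z(2))
      then have "l - scale c0 b \<in> span B"
        using insert.IH c unfolding closed_sequential_limits
        by (elim allE[of _ "\<lambda>n. z n - scale (c n) b"] allE[of _ "l - scale c0 b"]) auto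
      then show "l \<in> span (insert b B)" by (auto simp: span_breakdown_eq)
    qed
  qed
qed simp

text \<open>Spanning vectors are split off one at a time. A redundant vector gets the zero
  functional; otherwise its coordinate is unique and bounded by \<open>closed_span_dist\<close>, and
  the remainder ranges in the smaller span.\<close>

lemma finite_rank_expansion:
  assumes "banach_space_over s1" "finite B" "bounded_operator s1 scale T" "range T \<subseteq> span B"
  shows "\<exists>\<phi>. (\<forall>b\<in>B. bounded_operator s1 (*) (\<phi> b)) \<and> (\<forall>x. T x = (\<Sum>b\<in>B. scale (\<phi> b x) b))"
  using assms(2-)
proof (induction B arbitrary: T rule: finite_induct)
  case (insert b B)
  show ?case
  proof (cases "b \<in> span B")
    case True
    then have "range T \<subseteq> span B" using insert.prems by (simp add: span_redundant)
    from insert.IH[OF insert.prems(1) this] obtain \<phi> where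
      \<phi>: "\<forall>b\<in>B. bounded_operator s1 (*) (\<phi> b)" "\<forall>x. T x = (\<Sum>b\<in>B. scale (\<phi> b x) b)" by blast
    let ?\<phi> = "\<phi>(b := \<lambda>_. 0)"
    interpret K: banach_space_over "(*) :: 'k \<Rightarrow> 'k \<Rightarrow> 'k" by (rule banach_space_over_mult)
    have "\<forall>b\<in>insert b B. bounded_operator s1 (*) (?\<phi> b)"
      using \<phi>(1) K.bounded_operator_const_zero[OF banach_space_over.axioms(1)[OF assms(1)]] by auto
    moreover have "(\<Sum>b'\<in>B. scale (?\<phi> b' x) b') = (\<Sum>b'\<in>B. scale (\<phi> b' x) b')" for x
      using insert.hyps by (intro sum.cong) auto
    then have "\<forall>x. T x = (\<Sum>b'\<in>insert b B. scale (?\<phi> b' x) b')"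
      using \<phi>(2) insert.hyps by simp
    ultimately show ?thesis by blast
  next
    case False
    obtain d where d: "d > 0" "\<And>c y. y \<in> span B \<Longrightarrow> d * norm c \<le> norm (scale c b + y)"
      by (rule closed_span_dist[OF closed_span_finite[OF insert.hyps(1)] False]) (rule that)
    have "\<exists>c. T x - scale c b \<in> span B" for x
      using insert.prems(2) by (simp add: span_breakdown_eq[symmetric] image_subset_iff)
    then obtain \<psi> where \<psi>: "\<And>x. T x - scale (\<psi> x) b \<in> span B" by metis
    have uniq: "c = c'" if "y - scale c b \<in> span B" "y - scale c' b \<in> span B" for y c c'
    proof -
      have "(y - scale c b) - (y - scale c' b) \<in> span B" by (rule span_diff[OF that])
      then have "d * norm (c - c') \<le> norm (scale (c - c') b + ((y - scale c b) - (y - scale c' b)))"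
        by (rule d(2))
      then show ?thesis using d(1) by (simp add: scale_left_diff_distrib mult_le_0_iff)
    qed
    obtain C where C: "C > 0" "\<And>x. norm (T x) \<le> C * norm x"
      using bounded_operator_bound[OF insert.prems(1)] by blast
    have \<psi>_op: "bounded_operator s1 (*) \<psi>"
    proof (rule bounded_operatorI[OF assms(1) banach_space_over_mult])
      show "\<psi> (x + y) = \<psi> x + \<psi> y" for x y
      proof (rule uniq[OF \<psi>])
        have "T (x + y) - scale (\<psi> x + \<psi> y) b
            = (T x - scale (\<psi> x) b) + (T y - scale (\<psi> y) b)"
          by (simp add: bounded_operator_add[OF insert.prems(1)] scale_left_distrib)
        then show "T (x + y) - scale (\<psi> x + \<psi> y) b \<in> span B" using span_add \<psi> by metis
      qed
      show "\<psi> (s1 c x) = c * \<psi> x" for c x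
      proof (rule uniq[OF \<psi>])
        have "T (s1 c x) - scale (c * \<psi> x) b = scale c (T x - scale (\<psi> x) b)"
          by (simp add: bounded_operator_scale[OF insert.prems(1)] scale_right_diff_distrib)
        then show "T (s1 c x) - scale (c * \<psi> x) b \<in> span B" using span_scale \<psi> by metis
      qed
      show "norm (\<psi> x) \<le> (C / d) * norm x" for x
      proof -
        have "d * norm (\<psi> x) \<le> norm (T x)" using d(2)[OF \<psi>[of x], of "\<psi> x"] by simp
        also have "\<dots> \<le> C * norm x" by (rule C)
        finally show ?thesis using d(1) by (simp add: field_simps)
      qed
    qed
    interpret E: banach_space_over s1 by (rule assms)
    obtain D where D: "D > 0" "\<And>x. norm (\<psi> x) \<le> D * norm x"
      using bounded_operator_bound[OF \<psi>_op] by blast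
    have "bounded_operator s1 scale (\<lambda>x. scale (\<psi> x) b)"
    proof (rule bounded_operatorI[OF assms(1) banach_space_over_axioms])
      show "norm (scale (\<psi> x) b) \<le> (D * norm b) * norm x" for x
        using mult_right_mono[OF D(2)[of x], of "norm b"] by (simp add: norm_scale mult_ac)
    qed (simp_all add: bounded_operatorD(1)[OF \<psi>_op] bounded_operator_scale[OF \<psi>_op] scale_left_distrib)
    then have "bounded_operator s1 scale (\<lambda>x. T x - scale (\<psi> x) b)"
      by (rule bounded_operator_diff_fun[OF insert.prems(1)])
    moreover have "range (\<lambda>x. T x - scale (\<psi> x) b) \<subseteq> span B" using \<psi> by auto
    ultimately obtain \<phi> where
      \<phi>: "\<forall>b\<in>B. bounded_operator s1 (*) (\<phi> b)"
         "\<forall>x. T x - scale (\<psi> x) b = (\<Sum>b\<in>B. scale (\<phi> b x) b)"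
      using insert.IH by meson
    let ?\<phi> = "\<phi>(b := \<psi>)"
    have "(\<Sum>b'\<in>B. scale (?\<phi> b' x) b') = (\<Sum>b'\<in>B. scale (\<phi> b' x) b')" for x
      using insert.hyps by (intro sum.cong) auto
    then have "T x = (\<Sum>b'\<in>insert b B. scale (?\<phi> b' x) b')" for x
      using \<phi>(2)[rule_format, of x] insert.hyps by (simp add: algebra_simps)
    moreover have "\<forall>b\<in>insert b B. bounded_operator s1 (*) (?\<phi> b)" using \<phi>(1) \<psi>_op by auto
    ultimately show ?thesis by blast
  qed
next
  case empty
  then show ?case by (auto simp: image_subset_iff)
qed

end

subsection \<open>Weak convergence on balls\<close>

text \<open>The weak neighbourhood filter of \<open>x0\<close> inside the ball of radius
  \<open>r\<close>; it turns weak continuity on bounded sets into a limit statement, open to the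
  usual limit calculus.\<close>

definition weak_at ::
    "('k::real_or_complex \<Rightarrow> 'a::real_normed_vector \<Rightarrow> 'a) \<Rightarrow> real \<Rightarrow> 'a \<Rightarrow> 'a filter" where
  "weak_at s r x0 =
     (INF p\<in>{(\<Phi>, \<eta>). finite \<Phi> \<and> (\<forall>\<phi>\<in>\<Phi>. bounded_operator s (*) \<phi>) \<and> \<eta> > 0}.
        principal {x. norm x \<le> r \<and> (\<forall>\<phi>\<in>fst p. norm (\<phi> x - \<phi> x0) < snd p)})"

lemma eventually_weak_at:
  "eventually Q (weak_at s r x0) \<longleftrightarrow>
     (\<exists>\<Phi> \<eta>. finite \<Phi> \<and> (\<forall>\<phi>\<in>\<Phi>. bounded_operator s (*) \<phi>) \<and> \<eta> > 0 \<and>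
        (\<forall>x. norm x \<le> r \<longrightarrow> (\<forall>\<phi>\<in>\<Phi>. norm (\<phi> x - \<phi> x0) < \<eta>) \<longrightarrow> Q x))"
  unfolding weak_at_def
proof (subst eventually_INF_base, goal_cases)
  case 1
  then show ?case by (auto intro!: exI[of _ "{}"] exI[of _ "1::real"])
next
  case (2 a b)
  have "principal {x. norm x \<le> r \<and> (\<forall>\<phi>\<in>fst a \<union> fst b. norm (\<phi> x - \<phi> x0) < min (snd a) (snd b))}
      \<le> inf (principal {x. norm x \<le> r \<and> (\<forall>\<phi>\<in>fst a. norm (\<phi> x - \<phi> x0) < snd a)})
          (principal {x. norm x \<le> r \<and> (\<forall>\<phi>\<in>fst b. norm (\<phi> x - \<phi> x0) < snd b)})"
    by auto
  moreover have "(fst a \<union> fst b, min (snd a) (snd b))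
      \<in> {(\<Phi>, \<eta>). finite \<Phi> \<and> (\<forall>\<phi>\<in>\<Phi>. bounded_operator s (*) \<phi>) \<and> \<eta> > 0}"
    using 2 by (auto simp: case_prod_beta)
  ultimately show ?case by (intro bexI[of _ "(fst a \<union> fst b, min (snd a) (snd b))"]) simp_all
next
  case 3
  show ?case by (simp add: eventually_principal Bex_def conj_assoc imp_conjL)
qed

lemma weak_at_norm_le: "eventually (\<lambda>x. norm x \<le> r) (weak_at s r x0)"
  unfolding eventually_weak_at by (intro exI[of _ "{}"] exI[of _ 1]) auto

lemma tendsto_weak_at:
  assumes "bounded_operator s (*) \<phi>"
  shows "(\<phi> \<longlongrightarrow> \<phi> x0) (weak_at s r x0)"
proof (rule tendstoI)
  fix e :: real assume "e > 0"
  then show "\<forall>\<^sub>F x in weak_at s r x0. dist (\<phi> x) (\<phi> x0) < e"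
    unfolding eventually_weak_at using assms
    by (intro exI[of _ "{\<phi>}"] exI[of _ e]) (auto simp: dist_norm)
qed

lemma openin_weak_topology_eventually:
  assumes "openin (weak_topology s) V" "x0 \<in> V"
  shows "eventually (\<lambda>x. x \<in> V) (weak_at s r x0)"
proof -
  have "generate_topology_on {\<phi> -` U | \<phi> U. bounded_operator s (*) \<phi> \<and> open U} V"
    using assms(1) unfolding weak_topology_def by (rule openin_topology_generated_by)
  then show ?thesis
    using assms(2)
  proof (induction rule: generate_topology_on.induct)
    case (Int a b)
    then show ?case using eventually_conj by auto
  next
    case (UN K)
    then obtain k where "k \<in> K" "x0 \<in> k" by blast
    then show ?case using UN.IH[of k] by (auto elim: eventually_mono)
  next
    case (Basis V)
    then obtain \<phi> U where "V = \<phi> -` U" "bounded_operator s (*) \<phi>" "open U" by blast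
    then show ?case
      using topological_tendstoD[OF tendsto_weak_at, of s \<phi> U x0 r] Basis.prems by simp
  qed auto
qed

context banach_space_over
begin

lemma topspace_weak_topology: "topspace (weak_topology scale) = UNIV"
proof -
  interpret K: banach_space_over "(*) :: 'k \<Rightarrow> 'k \<Rightarrow> 'k" by (rule banach_space_over_mult)
  have "(UNIV :: 'a set) \<in> {\<phi> -` U | \<phi> U. bounded_operator scale (*) \<phi> \<and> open (U :: 'k set)}"
    using K.bounded_operator_const_zero[OF vector_space_axioms]
    by (intro CollectI exI[of _ "\<lambda>_. 0"] exI[of _ UNIV]) auto
  then show ?thesis unfolding weak_topology_def topology_generated_by_topspace by blast
qed

text \<open>Balls are bounded and every bounded set lies in a ball, so it is enough to test
  continuity at the points of balls, with basic weak neighbourhoods given by finitely many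
  functionals.\<close>

lemma weakly_continuous_on_bounded_iff:
  fixes P :: "'a \<Rightarrow> 'b::real_normed_vector"
  shows "(\<forall>B. bounded B \<longrightarrow> continuous_map (subtopology (weak_topology scale) B) euclidean P) \<longleftrightarrow>
    (\<forall>r x0. norm x0 \<le> r \<longrightarrow> (P \<longlongrightarrow> P x0) (weak_at scale r x0))" (is "?L \<longleftrightarrow> ?R")
proof
  assume L: ?L
  show ?R
  proof (intro allI impI topological_tendstoI)
    fix r :: real and x0 :: 'a and U assume x0: "norm x0 \<le> r" and U: "open U" "P x0 \<in> U"
    have "continuous_map (subtopology (weak_topology scale) (cball 0 r)) euclidean P"
      using L by simp
    then have "openin (subtopology (weak_topology scale) (cball 0 r))
        {x \<in> topspace (subtopology (weak_topology scale) (cball 0 r)). P x \<in> U}"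
      using U(1) unfolding continuous_map_def by simp
    then obtain V where V: "openin (weak_topology scale) V"
      "{x \<in> cball 0 r. P x \<in> U} = V \<inter> cball 0 r"
      by (auto simp: openin_subtopology topspace_weak_topology)
    then have "x0 \<in> V" using x0 U(2) by auto
    then have "eventually (\<lambda>x. x \<in> V) (weak_at scale r x0)"
      by (rule openin_weak_topology_eventually[OF V(1)])
    with weak_at_norm_le show "eventually (\<lambda>x. P x \<in> U) (weak_at scale r x0)"
    proof eventually_elim
      case (elim x)
      then have "x \<in> V \<inter> cball 0 r" by simp
      then show ?case unfolding V(2)[symmetric] by simp
    qed
  qed
next
  assume R: ?R
  show ?L
  proof (intro allI impI)
    fix B :: "'a set" assume "bounded B"
    then obtain r where r: "\<And>x. x \<in> B \<Longrightarrow> norm x \<le> r" by (auto simp: bounded_iff)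
    show "continuous_map (subtopology (weak_topology scale) B) euclidean P"
      unfolding continuous_map_def
    proof (intro conjI allI impI)
      fix U :: "'b set" assume U: "openin euclidean U"
      show "openin (subtopology (weak_topology scale) B)
          {x \<in> topspace (subtopology (weak_topology scale) B). P x \<in> U}"
      proof (subst openin_subopen, intro ballI)
        fix x0 assume "x0 \<in> {x \<in> topspace (subtopology (weak_topology scale) B). P x \<in> U}"
        then have x0: "x0 \<in> B" "P x0 \<in> U" by auto
        have "eventually (\<lambda>x. P x \<in> U) (weak_at scale r x0)"
          using R r[OF x0(1)] U x0(2) by (auto intro: topological_tendstoD)
        then obtain \<Phi> \<eta> where \<Phi>: "finite \<Phi>" "\<And>\<phi>. \<phi> \<in> \<Phi> \<Longrightarrow> bounded_operator scale (*) \<phi>" "\<eta> > 0"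
          "\<And>x. norm x \<le> r \<Longrightarrow> (\<forall>\<phi>\<in>\<Phi>. norm (\<phi> x - \<phi> x0) < \<eta>) \<Longrightarrow> P x \<in> U"
          unfolding eventually_weak_at by blast
        define W where "W = (\<Inter>\<phi>\<in>\<Phi>. \<phi> -` ball (\<phi> x0) \<eta>)"
        have "openin (weak_topology scale) (\<phi> -` ball (\<phi> x0) \<eta>)" if "\<phi> \<in> \<Phi>" for \<phi>
          unfolding weak_topology_def using \<Phi>(2)[OF that]
          by (intro topology_generated_by_Basis) auto
        then have "openin (weak_topology scale) W"
          using \<Phi>(1) openin_topspace[of "weak_topology scale"] unfolding W_def
          by (cases "\<Phi> = {}") (auto simp: topspace_weak_topology)
        then have "openin (subtopology (weak_topology scale) B) (W \<inter> B)"
          by (auto simp: openin_subtopology)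
        moreover have "x0 \<in> W \<inter> B" using x0 \<Phi>(3) by (auto simp: W_def)
        moreover have "W \<inter> B \<subseteq> {x \<in> topspace (subtopology (weak_topology scale) B). P x \<in> U}"
          using \<Phi>(4) r by (auto simp: W_def topspace_weak_topology dist_norm norm_minus_commute)
        ultimately show "\<exists>T. openin (subtopology (weak_topology scale) B) T \<and> x0 \<in> T \<and>
            T \<subseteq> {x \<in> topspace (subtopology (weak_topology scale) B). P x \<in> U}" by blast
      qed
    qed auto
  qed
qed

definition finite_rank :: "('a \<Rightarrow> 'a) \<Rightarrow> bool" where
  "finite_rank T \<longleftrightarrow> bounded_operator scale scale T \<and> (\<exists>B. finite B \<and> range T \<subseteq> span B)"

lemma finite_rank_coordinates:
  assumes "finite_rank T"
  obtains B \<phi> where "finite B" "\<And>b. b \<in> B \<Longrightarrow> bounded_operator scale (*) (\<phi> b)"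
    "\<And>x. T x = (\<Sum>b\<in>B. scale (\<phi> b x) b)"
proof -
  obtain B where B: "finite B" "range T \<subseteq> span B" and T: "bounded_operator scale scale T"
    using assms by (auto simp: finite_rank_def)
  from finite_rank_expansion[OF banach_space_over_axioms B(1) T B(2)] B(1) show ?thesis
    using that by blast
qed

text \<open>Finitely many functionals determine the value of a finite rank operator, so weak
  convergence becomes norm convergence.\<close>

lemma finite_rank_weak_tendsto:
  assumes "finite_rank T"
  shows "(T \<longlongrightarrow> T x0) (weak_at scale r x0)"
proof -
  obtain B \<phi> where "finite B" "\<And>b. b \<in> B \<Longrightarrow> bounded_operator scale (*) (\<phi> b)"
    and T: "\<And>x. T x = (\<Sum>b\<in>B. scale (\<phi> b x) b)"
    using finite_rank_coordinates[OF assms] by metis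
  then show ?thesis
    unfolding T by (intro tendsto_sum tendsto_scale tendsto_weak_at tendsto_const) auto
qed

lemma finite_rank_sum:
  assumes "finite N" "\<And>n. n \<in> N \<Longrightarrow> finite_rank (T n)"
  shows "finite_rank (\<lambda>x. \<Sum>n\<in>N. T n x)"
proof -
  from assms(2) have "\<forall>n\<in>N. \<exists>B. finite B \<and> range (T n) \<subseteq> span B" by (auto simp: finite_rank_def)
  then obtain B where B: "\<And>n. n \<in> N \<Longrightarrow> finite (B n)" "\<And>n. n \<in> N \<Longrightarrow> range (T n) \<subseteq> span (B n)"
    by metis
  have "(\<Sum>n\<in>N. T n x) \<in> span (\<Union>n\<in>N. B n)" for x
    using B(2) by (intro span_sum) (meson SUP_upper range_subsetD span_mono subsetD)
  moreover have "bounded_operator scale scale (\<lambda>x. \<Sum>n\<in>N. T n x)"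
    using assms(2) by (intro bounded_operator_sum_fun vector_space_axioms) (auto simp: finite_rank_def)
  ultimately show ?thesis
    unfolding finite_rank_def using assms(1) B(1) by (intro conjI exI[of _ "\<Union>n\<in>N. B n"]) auto
qed

text \<open>Functionals are totally bounded on bounded sequences, so finitely many of them are almost
  constant along an infinite set of indices.\<close>

lemma almost_constant_functionals:
  fixes x :: "nat \<Rightarrow> 'a"
  assumes "\<And>n. norm (x n) \<le> r" "infinite J" "finite \<Phi>"
    and "\<And>\<phi>. \<phi> \<in> \<Phi> \<Longrightarrow> bounded_operator scale (*) \<phi>" "\<eta> > 0"
  obtains J' where "J' \<subseteq> J" "infinite J'"
    "\<And>\<phi> i j. \<phi> \<in> \<Phi> \<Longrightarrow> i \<in> J' \<Longrightarrow> j \<in> J' \<Longrightarrow> norm (\<phi> (x i) - \<phi> (x j)) < \<eta>"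
proof -
  from assms(3,4)
  have "\<exists>J'\<subseteq>J. infinite J' \<and> (\<forall>\<phi>\<in>\<Phi>. \<forall>i\<in>J'. \<forall>j\<in>J'. norm (\<phi> (x i) - \<phi> (x j)) < \<eta>)"
  proof (induction \<Phi> rule: finite_induct)
    case (insert \<phi> \<Phi>)
    then obtain J' where J': "J' \<subseteq> J" "infinite J'"
      "\<forall>\<phi>\<in>\<Phi>. \<forall>i\<in>J'. \<forall>j\<in>J'. norm (\<phi> (x i) - \<phi> (x j)) < \<eta>" by auto
    obtain C where C: "C > 0" "\<And>y. norm (\<phi> y) \<le> C * norm y"
      using bounded_operator_bound[OF insert.prems[of \<phi>]] by auto
    have "norm (\<phi> (x n)) \<le> C * r" for n
      using C assms(1)[of n] by (meson less_imp_le mult_left_mono order_trans)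
    then have "bounded (range (\<lambda>n. \<phi> (x (enumerate J' n))))" by (auto intro!: boundedI)
    then obtain l s where s: "strict_mono (s :: nat \<Rightarrow> nat)"
        "((\<lambda>n. \<phi> (x (enumerate J' n))) \<circ> s) \<longlonglongrightarrow> l"
      using bounded_imp_convergent_subsequence by blast
    then obtain N where N: "\<And>n. n \<ge> N \<Longrightarrow> norm (\<phi> (x (enumerate J' (s n))) - l) < \<eta> / 2"
      using LIMSEQ_D[OF s(2), of "\<eta> / 2"] assms(5) by auto
    define J'' where "J'' = (\<lambda>n. enumerate J' (s n)) ` {N..}"
    have "inj (\<lambda>n. enumerate J' (s n))"
      using strict_mono_enumerate[OF J'(2)] s(1) by (intro strict_mono_imp_inj_on) (simp add: strict_mono_def)
    then have "infinite J''"
      unfolding J''_def by (meson finite_imageD infinite_Ici inj_on_subset subset_UNIV)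
    moreover have sub: "J'' \<subseteq> J'" using enumerate_in_set[OF J'(2)] by (auto simp: J''_def)
    moreover have "norm (\<phi> (x i) - \<phi> (x j)) < \<eta>" if "i \<in> J''" "j \<in> J''" for i j
    proof -
      have "norm (\<phi> (x i) - l) < \<eta> / 2" "norm (\<phi> (x j) - l) < \<eta> / 2"
        using that N by (auto simp: J''_def)
      then show ?thesis using norm_triangle_lt[of "\<phi> (x i) - l" "l - \<phi> (x j)" \<eta>]
        by (simp add: norm_minus_commute)
    qed
    ultimately show ?case using J'(1,3) by (intro exI[of _ J'']) (simp, blast)
  qed (use assms(2) in auto)
  then show ?thesis using that by blast
qed

end

subsection \<open>Two subsequence principles\<close>

text \<open>View \<open>u c i l\<close> as a matrix that tends to zero in \<open>l\<close> for fixed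
  \<open>i\<close> and has small tails of sums over \<open>i\<close> for fixed \<open>l\<close>. If
  the indices grow fast enough, the terms before the diagonal are individually tiny and those after
  it form a tail; each group contributes at most \<open>\<eta> / 2\<close>. The parameter
  \<open>c\<close> carries coefficient sequences, over which everything is uniform.\<close>

lemma gliding_hump:
  fixes u :: "'c \<Rightarrow> nat \<Rightarrow> nat \<Rightarrow> 'f::real_normed_vector"
  assumes col: "\<And>i e. e > 0 \<Longrightarrow> \<exists>L. \<forall>l\<ge>L. \<forall>c\<in>S. norm (u c i l) < e"
    and tail: "\<And>l e. e > 0 \<Longrightarrow>
      \<exists>L. \<forall>N. finite N \<longrightarrow> N \<subseteq> {L..} \<longrightarrow> (\<forall>c\<in>S. norm (\<Sum>i\<in>N. u c i l) < e)"
    and \<eta>: "\<eta> > 0"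
  obtains r :: "nat \<Rightarrow> nat" where "strict_mono r"
    "\<And>p N c. finite N \<Longrightarrow> p \<notin> N \<Longrightarrow> c \<in> S \<Longrightarrow> norm (\<Sum>i\<in>N. u c (r i) (r p)) \<le> \<eta>"
proof -
  have "\<exists>n>m. (\<forall>i\<le>m. \<forall>l\<ge>n. \<forall>c\<in>S. norm (u c i l) < \<eta> / (2 * (real m + 1))) \<and>
      (\<forall>l\<le>m. \<forall>N. finite N \<longrightarrow> N \<subseteq> {n..} \<longrightarrow> (\<forall>c\<in>S. norm (\<Sum>i\<in>N. u c i l) < \<eta> / 2))" for m
  proof -
    have pos: "\<eta> / (2 * (real m + 1)) > 0" "\<eta> / 2 > 0" using \<eta> by auto
    obtain L1 where L1: "\<And>i l c. l \<ge> L1 i \<Longrightarrow> c \<in> S \<Longrightarrow> norm (u c i l) < \<eta> / (2 * (real m + 1))"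
      using col[OF pos(1)] by metis
    have "\<forall>l. \<exists>L. \<forall>N. finite N \<longrightarrow> N \<subseteq> {L..} \<longrightarrow> (\<forall>c\<in>S. norm (\<Sum>i\<in>N. u c i l) < \<eta> / 2)"
      using tail[OF pos(2)] by blast
    then obtain L2 where L2: "\<And>l N c. finite N \<Longrightarrow> N \<subseteq> {L2 l..} \<Longrightarrow> c \<in> S \<Longrightarrow>
        norm (\<Sum>i\<in>N. u c i l) < \<eta> / 2" by metis
    \<comment> \<open>The sums of thresholds are merely a convenient common upper bound for all
      \<open>i \<le> m\<close>.\<close>
    define n where "n = Suc m + (\<Sum>i\<le>m. L1 i) + (\<Sum>i\<le>m. L2 i)"
    have "L1 i \<le> n" "L2 i \<le> n" if "i \<le> m" for i
      using that member_le_sum[of i "{..m}" L1] member_le_sum[of i "{..m}" L2] by (auto simp: n_def)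
    then have *: "l \<ge> L1 i \<and> N \<subseteq> {L2 i..}" if "i \<le> m" "l \<ge> n" "N \<subseteq> {n..}" for i l N
      using that by (meson atLeast_subset_iff order_trans)
    show ?thesis
    proof (intro exI[of _ n] conjI allI impI ballI)
      show "m < n" by (simp add: n_def)
    next
      fix i l c assume "i \<le> m" "n \<le> l" "c \<in> S"
      then show "norm (u c i l) < \<eta> / (2 * (real m + 1))" using *[of i l "{}"] by (intro L1) auto
    next
      fix l N c assume "l \<le> m" "finite N" "N \<subseteq> {n..}" "c \<in> S"
      then show "norm (\<Sum>i\<in>N. u c i l) < \<eta> / 2" using *[of l n N] by (intro L2) auto
    qed
  qed
  then obtain h where h: "\<And>m. m < h m"
    "\<And>m i l c. i \<le> m \<Longrightarrow> l \<ge> h m \<Longrightarrow> c \<in> S \<Longrightarrow> norm (u c i l) < \<eta> / (2 * (real m + 1))"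
    "\<And>m l N c. l \<le> m \<Longrightarrow> finite N \<Longrightarrow> N \<subseteq> {h m..} \<Longrightarrow> c \<in> S \<Longrightarrow> norm (\<Sum>i\<in>N. u c i l) < \<eta> / 2"
    by metis
  define r where "r n = (h ^^ n) 0" for n
  have rS: "r (Suc n) = h (r n)" for n by (simp add: r_def)
  have mono: "strict_mono r" by (rule strict_mono_Suc_iff[THEN iffD2]) (simp add: rS h)
  have "norm (\<Sum>i\<in>N. u c (r i) (r p)) \<le> \<eta>" if N: "finite N" "p \<notin> N" "c \<in> S" for p N c
  proof -
    have split: "(N \<inter> {..<p}) \<union> (N \<inter> {p<..}) = N" using N(2) by (auto simp: not_less_iff_gr_or_eq)
    have "(\<Sum>i\<in>N. u c (r i) (r p))
        = (\<Sum>i\<in>N \<inter> {..<p}. u c (r i) (r p)) + (\<Sum>i\<in>N \<inter> {p<..}. u c (r i) (r p))"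
      using N(1) by (subst sum.union_disjoint[symmetric]) (auto simp: split)
    moreover have "norm (\<Sum>i\<in>N \<inter> {..<p}. u c (r i) (r p)) \<le> \<eta> / 2"
    proof (cases p)
      case (Suc q)
      have "norm (\<Sum>i\<in>N \<inter> {..<p}. u c (r i) (r p)) \<le> (\<Sum>i\<in>N \<inter> {..<p}. norm (u c (r i) (r p)))"
        by (rule norm_sum)
      also have "\<dots> \<le> (\<Sum>i<p. norm (u c (r i) (r p)))" by (intro sum_mono2) auto
      also have "\<dots> \<le> (\<Sum>i<p. \<eta> / (2 * (real (r q) + 1)))"
      proof (rule sum_mono)
        fix i assume "i \<in> {..<p}"
        then have "r i \<le> r q" using strict_mono_less_eq[OF mono] Suc by auto
        moreover have "h (r q) \<le> r p" by (simp add: Suc rS)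
        ultimately show "norm (u c (r i) (r p)) \<le> \<eta> / (2 * (real (r q) + 1))"
          using h(2)[of "r i" "r q" "r p" c] N(3) by simp
      qed
      also have "\<dots> = real p * (\<eta> / (2 * (real (r q) + 1)))" by simp
      \<comment> \<open>There are \<open>p = Suc q\<close> earlier terms and
        \<open>q \<le> r q\<close>, so the denominator chosen at stage \<open>r q\<close> outweighs
        their number.\<close>
      also have "\<dots> \<le> (real (r q) + 1) * (\<eta> / (2 * (real (r q) + 1)))"
        using strict_mono_imp_increasing[OF mono, of q] Suc \<eta> by (intro mult_right_mono) auto
      also have "\<dots> = \<eta> / 2" by (simp add: field_simps)
      finally show ?thesis .
    qed (use \<eta> in simp)
    moreover have "norm (\<Sum>i\<in>N \<inter> {p<..}. u c (r i) (r p)) \<le> \<eta> / 2"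
    proof -
      have "(\<Sum>i\<in>N \<inter> {p<..}. u c (r i) (r p)) = (\<Sum>i\<in>r ` (N \<inter> {p<..}). u c i (r p))"
        using strict_mono_imp_inj_on[OF mono] by (subst sum.reindex) (auto intro: inj_on_subset)
      moreover have "norm (\<Sum>i\<in>r ` (N \<inter> {p<..}). u c i (r p)) < \<eta> / 2"
        by (rule h(3)[of _ "r p"])
           (use N strict_mono_less_eq[OF mono] in \<open>auto simp: rS[symmetric] Suc_le_eq\<close>)
      ultimately show ?thesis by simp
    qed
    ultimately show ?thesis using norm_triangle_mono[of _ "\<eta> / 2" _ "\<eta> / 2"] by auto
  qed
  then show ?thesis using that mono by blast
qed

text \<open>The branches of the binary tree: \<open>D A\<close> consists of codes of the initial
  segments of \<open>A\<close>, and two different sets share only the segments before their first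
  disagreement. Storing the length \<open>n\<close> keeps the codes distinct.\<close>

lemma almost_disjoint_family:
  obtains D :: "nat set \<Rightarrow> nat set" where "\<And>A. infinite (D A)"
    "\<And>A B. A \<noteq> B \<Longrightarrow> finite (D A \<inter> D B)"
proof (rule that)
  define e where "e A n = prod_encode (n, set_encode (A \<inter> {..<n}))" for A n
  define D where "D A = range (e A)" for A
  have "inj (e A)" for A by (auto simp: e_def inj_on_def)
  then show "infinite (D A)" for A by (simp add: D_def range_inj_infinite)
  fix A B :: "nat set" assume "A \<noteq> B"
  then obtain a where a: "(a \<in> A) \<noteq> (a \<in> B)" by blast
  have "D A \<inter> D B \<subseteq> e A ` {..a}"
  proof
    fix y assume "y \<in> D A \<inter> D B"
    then obtain n where "y = e A n" by (auto simp: D_def)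
    moreover from \<open>y \<in> D A \<inter> D B\<close> obtain m where "y = e B m" by (auto simp: D_def)
    ultimately have y: "y = e A n" "y = e B m" by auto
    then have "n = m" "set_encode (A \<inter> {..<n}) = set_encode (B \<inter> {..<n})" by (auto simp: e_def)
    then have "A \<inter> {..<n} = B \<inter> {..<n}" by (subst (asm) set_encode_eq) auto
    then have "n \<le> a" using a by (auto simp: not_less[symmetric])
    then show "y \<in> e A ` {..a}" using y by auto
  qed
  then show "finite (D A \<inter> D B)" by (rule finite_subset) auto
qed

text \<open>Otherwise each member of an uncountable almost disjoint family is detected by some
  \<open>f m\<close>. Countably many pairs of functional and size cannot share them out finitely, so
  one functional is large on infinitely many members; a suitable combination of many of them still
  has sup norm at most 1, against boundedness.\<close>

lemma functionals_vanish_on_indicator: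
  fixes f :: "nat \<Rightarrow> (nat \<Rightarrow> 'k::real_normed_field) \<Rightarrow> 'k"
  assumes add: "\<And>m x y. bounded (range x) \<Longrightarrow> bounded (range y) \<Longrightarrow>
      f m (\<lambda>n. x n + y n) = f m x + f m y"
    and scale: "\<And>m c x. bounded (range x) \<Longrightarrow> f m (\<lambda>n. c * x n) = c * f m x"
    and bound: "\<And>m. \<exists>C. \<forall>x. (\<forall>n. norm (x n) \<le> 1) \<longrightarrow> norm (f m x) \<le> C"
    and fin: "\<And>m x. finite {n. x n \<noteq> 0} \<Longrightarrow> f m x = 0"
  obtains M where "infinite M" "\<And>m. f m (indicator M) = 0"
proof (rule ccontr)
  assume "\<not> thesis"
  then have neg: "\<exists>m. f m (indicator M) \<noteq> 0" if "infinite M" for M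
    using \<open>infinite M\<close> \<open>\<And>M. infinite M \<Longrightarrow> (\<And>m. f m (indicator M) = 0) \<Longrightarrow> thesis\<close> by blast
  obtain D :: "nat set \<Rightarrow> nat set" where D: "\<And>A. infinite (D A)"
    "\<And>A B. A \<noteq> B \<Longrightarrow> finite (D A \<inter> D B)" by (rule almost_disjoint_family) (rule that)
  \<comment> \<open>The pigeonholes: which functional detects the set, and by how much.\<close>
  define X where "X m k = {A. norm (f m (indicator (D A))) > inverse (real (Suc k))}" for m k
  have "(\<Union>m. \<Union>k. X m k) = UNIV"
  proof (intro equalityI subsetI UNIV_I)
    fix A
    obtain m where "f m (indicator (D A)) \<noteq> 0" using neg[OF D(1)] by blast
    then obtain k where "inverse (real (Suc k)) < norm (f m (indicator (D A)))"
      using reals_Archimedean[of "norm (f m (indicator (D A)))"] by auto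
    then show "A \<in> (\<Union>m. \<Union>k. X m k)" by (auto simp: X_def)
  qed
  moreover have "uncountable (UNIV :: nat set set)"
  proof
    assume "countable (UNIV :: nat set set)"
    then obtain g :: "nat \<Rightarrow> nat set" where "range g = UNIV"
      using uncountable_def[of "UNIV :: nat set set"] by blast
    then show False using Cantors_theorem[of "UNIV :: nat set"] by (metis Pow_UNIV)
  qed
  moreover have "countable (\<Union>m. \<Union>k. X m k)" if "\<And>m k. finite (X m k)"
    using that by (intro countable_UN countableI_type countable_finite)
  ultimately obtain m k where inf: "infinite (X m k)" by metis
  obtain C where C: "\<And>x. (\<And>n. norm (x n) \<le> 1) \<Longrightarrow> norm (f m x) \<le> C" using bound by blast
  obtain K :: nat where K: "C * real (Suc k) < real K" using reals_Archimedean2 by blast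
  obtain F where F: "F \<subseteq> X m k" "finite F" "card F = K"
    using infinite_arbitrarily_large[OF inf, of K] by blast
  \<comment> \<open>Deleting the finite overlaps makes the chosen sets disjoint, and changes no
    value since the functionals vanish on finitely supported sequences.\<close>
  define M' where "M' A = D A - (\<Union>B\<in>F - {A}. D B)" for A
  \<comment> \<open>A scalar of modulus 1 that rotates the value at \<open>D A\<close> to a positive
    number, so that the values add up without cancellation.\<close>
  define c where "c A = of_real (norm (f m (indicator (D A)))) / f m (indicator (D A))" for A
  have bind: "bounded (range (indicator M :: nat \<Rightarrow> 'k))" for M
    by (rule boundedI[of _ 1]) (auto simp: indicator_def)
  have fM': "f m (indicator (M' A)) = f m (indicator (D A))" for A
  proof -
    have "(indicator (D A) :: nat \<Rightarrow> 'k) = (\<lambda>n. indicator (M' A) n + indicator (D A - M' A) n)"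
      by (auto simp: indicator_def M'_def fun_eq_iff)
    moreover have "D A - M' A \<subseteq> (\<Union>B\<in>F - {A}. D A \<inter> D B)" by (auto simp: M'_def)
    then have "finite (D A - M' A)" 
      by (rule finite_subset) (rule finite_UN_I, use F(2) D(2) in auto)
    then have "f m (indicator (D A - M' A)) = 0" 
      by (intro fin) (simp add: indicator_def set_diff_eq)
    ultimately show ?thesis using add[OF bind bind] by simp
  qed
  have fsum: "f m (\<lambda>n. \<Sum>A\<in>G. c A * indicator (M' A) n) = (\<Sum>A\<in>G. c A * f m (indicator (M' A)))
      \<and> bounded (range (\<lambda>n. \<Sum>A\<in>G. c A * indicator (M' A) n))" if "finite G" for G
    using that
  proof (induction G rule: finite_induct)
    case (insert A G)
    have b: "bounded (range (\<lambda>n. c A * indicator (M' A) n))"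
      by (rule boundedI[of _ "norm (c A)"]) (auto simp: indicator_def)
    show ?case
      unfolding sum.insert[OF insert.hyps]
    proof
      show "bounded (range (\<lambda>n. c A * indicator (M' A) n + (\<Sum>A\<in>G. c A * indicator (M' A) n)))"
        by (rule bounded_plus_comp[OF b insert.IH[THEN conjunct2]])
      show "f m (\<lambda>n. c A * indicator (M' A) n + (\<Sum>A\<in>G. c A * indicator (M' A) n))
          = c A * f m (indicator (M' A)) + (\<Sum>A\<in>G. c A * f m (indicator (M' A)))"
        by (simp only: add[OF b insert.IH[THEN conjunct2]] scale[OF bind] insert.IH[THEN conjunct1])
    qed
  qed (auto simp: fin)
  have "norm (\<Sum>A\<in>F. c A * indicator (M' A) n) \<le> 1" for n
  proof (cases "\<exists>A\<in>F. n \<in> M' A")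
    case True
    then obtain A where A: "A \<in> F" "n \<in> M' A" by blast
    then have "(\<Sum>B\<in>F. c B * indicator (M' B) n) = (\<Sum>B\<in>{A}. c B * indicator (M' B) n)"
      using F(2) by (intro sum.mono_neutral_right) (auto simp: M'_def indicator_def)
    then show ?thesis using A(2) by (simp add: c_def norm_divide)
  next
    case False
    then have "(\<Sum>B\<in>F. c B * indicator (M' B) n) = 0" by (intro sum.neutral) auto
    then show ?thesis by simp
  qed
  then have "norm (f m (\<lambda>n. \<Sum>A\<in>F. c A * indicator (M' A) n)) \<le> C" by (rule C)
  moreover have "f m (\<lambda>n. \<Sum>A\<in>F. c A * indicator (M' A) n)
      = of_real (\<Sum>A\<in>F. norm (f m (indicator (D A))))"
    unfolding fsum[OF F(2), THEN conjunct1] fM' of_real_sum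
    by (intro sum.cong refl) (auto simp: c_def)
  moreover have "real K * inverse (real (Suc k)) \<le> (\<Sum>A\<in>F. norm (f m (indicator (D A))))"
    using F(1) unfolding F(3)[symmetric] by (intro sum_bounded_below) (auto simp: X_def)
  moreover have "(\<Sum>A\<in>F. norm (f m (indicator (D A)))) \<ge> 0" by (simp add: sum_nonneg)
  ultimately have "real K * inverse (real (Suc k)) \<le> C" by (simp del: of_real_sum)
  then show False using K by (simp add: field_simps)
qed

subsection \<open>Unconditional finite dimensional expansions\<close>

text \<open>An abstraction of block sequences of the expansion. They need not sum to the identity;
  pointwise unconditional convergence is what makes multipliers possible.\<close>

locale multiplier_sequence = banach_space_over scale
  for scale :: "'k::real_or_complex \<Rightarrow> 'a::banach \<Rightarrow> 'a" +
  fixes B :: "nat \<Rightarrow> 'a \<Rightarrow> 'a"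
  assumes bounded_operator_B: "bounded_operator scale scale (B n)"
    and unconditionally_Cauchy_B: "unconditionally_Cauchy (\<lambda>n. B n x)"
begin

text \<open>Banach-Steinhaus applies to the countable set of finite sums without coefficients; the
  coefficients then cost only the factor 4.\<close>

lemma multiplier_uniform_bound:
  obtains C where "C > 0" "\<And>N a x. finite N \<Longrightarrow> (\<And>n. n \<in> N \<Longrightarrow> norm (a n) \<le> 1) \<Longrightarrow>
    norm (\<Sum>n\<in>N. scale (a n) (B n x)) \<le> C * norm x"
proof -
  define \<T> where "\<T> = (\<lambda>N x. \<Sum>n\<in>N. B n x) ` {N. finite N}"
  have "bounded_linear T" if "T \<in> \<T>" for T
    using that by (auto simp: \<T>_def intro!: bounded_linear_sum
        bounded_operator_bounded_linear[OF banach_space_over_axioms banach_space_over_axioms bounded_operator_B])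
  moreover have "\<exists>K. \<forall>T\<in>\<T>. norm (T x) \<le> K" for x
    using unconditionally_Cauchy_bounded[OF unconditionally_Cauchy_B[of x]]
    unfolding \<T>_def by (metis (no_types, lifting) imageE mem_Collect_eq)
  ultimately obtain C where C: "C > 0" "\<And>T x. T \<in> \<T> \<Longrightarrow> norm (T x) \<le> C * norm x"
    using uniform_boundedness[of \<T>] by metis
  show ?thesis
  proof (rule that)
    show "4 * C > 0" using C(1) by simp
    fix N and a :: "nat \<Rightarrow> 'k" and x
    assume N: "finite N" "\<And>n. n \<in> N \<Longrightarrow> norm (a n) \<le> 1"
    have "norm (\<Sum>n\<in>N'. B n x) \<le> C * norm x" if "N' \<subseteq> N" for N'
      using C(2)[of "\<lambda>x. \<Sum>n\<in>N'. B n x"] finite_subset[OF that N(1)] by (auto simp: \<T>_def)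
    then have "norm (\<Sum>n\<in>N. scale (a n) (B n x)) \<le> 4 * (C * norm x)"
      by (intro multiplier_bound N) auto
    then show "norm (\<Sum>n\<in>N. scale (a n) (B n x)) \<le> 4 * C * norm x" by simp
  qed
qed

definition mult :: "(nat \<Rightarrow> 'k) \<Rightarrow> 'a \<Rightarrow> 'a" where "mult \<xi> x = (\<Sum>n. scale (\<xi> n) (B n x))"

lemma mult_summable:
  assumes "bounded (range \<xi>)" shows "summable (\<lambda>n. scale (\<xi> n) (B n x))"
proof -
  obtain K where "\<And>n. norm (\<xi> n) \<le> K" using assms by (auto simp: bounded_iff)
  then show ?thesis
    by (intro unconditionally_Cauchy_summable unconditionally_Cauchy_scale unconditionally_Cauchy_B)
qed

lemma mult_sums: "bounded (range \<xi>) \<Longrightarrow> (\<lambda>n. scale (\<xi> n) (B n x)) sums mult \<xi> x"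
  unfolding mult_def by (rule summable_sums[OF mult_summable])

lemma mult_bound:
  obtains C where "C > 0" "\<And>\<xi> x. (\<And>n. norm (\<xi> n) \<le> 1) \<Longrightarrow> norm (mult \<xi> x) \<le> C * norm x"
proof -
  obtain C where C: "C > 0" "\<And>N a x. finite N \<Longrightarrow> (\<And>n. n \<in> N \<Longrightarrow> norm (a n) \<le> 1) \<Longrightarrow>
      norm (\<Sum>n\<in>N. scale (a n) (B n x)) \<le> C * norm x"
    by (rule multiplier_uniform_bound) (rule that; blast)
  have "norm (mult \<xi> x) \<le> C * norm x" if "\<And>n. norm (\<xi> n) \<le> 1" for \<xi> x
  proof (rule Lim_bounded)
    have "bounded (range \<xi>)" using that by (auto intro: boundedI)
    then show "(\<lambda>m. norm (\<Sum>n<m. scale (\<xi> n) (B n x))) \<longlonglongrightarrow> norm (mult \<xi> x)"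
      using mult_sums unfolding sums_def by (intro tendsto_norm)
  qed (use C that in auto)
  then show ?thesis using that C(1) by blast
qed

lemma mult_add:
  assumes "bounded (range \<xi>)" "bounded (range \<zeta>)"
  shows "mult (\<lambda>n. \<xi> n + \<zeta> n) x = mult \<xi> x + mult \<zeta> x"
  unfolding mult_def using assms by (simp add: scale_left_distrib suminf_add mult_summable)

lemma mult_scale:
  assumes "bounded (range \<xi>)"
  shows "mult (\<lambda>n. c * \<xi> n) x = scale c (mult \<xi> x)"
proof -
  have "(\<lambda>m. scale c (\<Sum>n<m. scale (\<xi> n) (B n x))) \<longlonglongrightarrow> scale c (mult \<xi> x)"
    using mult_sums[OF assms] unfolding sums_def by (intro tendsto_scale tendsto_const)
  then have "(\<lambda>n. scale (c * \<xi> n) (B n x)) sums scale c (mult \<xi> x)"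
    unfolding sums_def by (simp add: scale_sum_right)
  then show ?thesis unfolding mult_def by (rule sums_unique[symmetric])
qed

lemma bounded_operator_mult:
  assumes "bounded (range \<xi>)" shows "bounded_operator scale scale (mult \<xi>)"
proof -
  obtain K where K: "K > 0" "\<And>n. norm (\<xi> n) \<le> K" using assms by (auto simp: bounded_pos)
  obtain C where C: "C > 0" "\<And>\<xi> x. (\<And>n. norm (\<xi> n) \<le> 1) \<Longrightarrow> norm (mult \<xi> x) \<le> C * norm x"
    by (rule mult_bound) (rule that; blast)
  show ?thesis
  proof (rule bounded_operatorI[OF banach_space_over_axioms banach_space_over_axioms])
    show "mult \<xi> (x + y) = mult \<xi> x + mult \<xi> y" for x y
      unfolding mult_def using mult_summable[OF assms]
      by (simp add: bounded_operator_add[OF bounded_operator_B] scale_right_distrib suminf_add)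
    show "mult \<xi> (scale c x) = scale c (mult \<xi> x)" for c x
      using mult_scale[OF assms, of c x]
      by (simp add: mult_def bounded_operator_scale[OF bounded_operator_B] mult.commute)
    show "norm (mult \<xi> x) \<le> (K * C) * norm x" for x
    proof -
      have b: "norm (\<xi> n / of_real K) \<le> 1" for n using K by (simp add: norm_divide)
      then have "bounded (range (\<lambda>n. \<xi> n / of_real K))" by (auto intro: boundedI)
      then have "mult (\<lambda>n. of_real K * (\<xi> n / of_real K)) x
          = scale (of_real K) (mult (\<lambda>n. \<xi> n / of_real K) x)" by (rule mult_scale)
      then have "norm (mult \<xi> x) = K * norm (mult (\<lambda>n. \<xi> n / of_real K) x)"
        using K(1) by (simp add: norm_scale)
      also have "\<dots> \<le> K * (C * norm x)" using K(1) by (intro mult_left_mono C(2) b) auto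
      finally show ?thesis by simp
    qed
  qed
qed

end

locale fd_expansion = banach_space_over scale
  for scale :: "'k::real_or_complex \<Rightarrow> 'a::banach \<Rightarrow> 'a" +
  fixes A :: "nat \<Rightarrow> 'a \<Rightarrow> 'a"
  assumes expansion: "unconditional_fd_expansion scale A"
begin

definition S :: "nat \<Rightarrow> 'a \<Rightarrow> 'a" where "S m x = (\<Sum>n<m. A n x)"

lemma finite_rank_A: "finite_rank (A n)"
  using expansion unfolding unconditional_fd_expansion_def finite_rank_def
  by (metis order_refl)

lemma finite_rank_S: "finite_rank (S m)"
  unfolding S_def[abs_def] by (rule finite_rank_sum) (auto simp: finite_rank_A)

lemma bounded_operator_S: "bounded_operator scale scale (S m)"
  using finite_rank_S by (simp add: finite_rank_def)

lemma S_tendsto: "(\<lambda>m. S m x) \<longlonglongrightarrow> x"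
  using expansion by (auto simp: unconditional_fd_expansion_def unconditionally_sums_def sums_def S_def)

lemma S_bound:
  obtains C where "C > 0" "\<And>m x. norm (S m x) \<le> C * norm x"
proof -
  have "\<exists>K. \<forall>T\<in>range S. norm (T x) \<le> K" for x
    using convergent_imp_bounded[OF S_tendsto[of x]] by (auto simp: bounded_iff)
  moreover have "bounded_linear T" if "T \<in> range S" for T
    using that bounded_operator_bounded_linear[OF banach_space_over_axioms banach_space_over_axioms]
      bounded_operator_S by auto
  ultimately show ?thesis using uniform_boundedness[of "range S"] that by (metis rangeI)
qed

text \<open>A finite union of blocks far out is a finite set of indices far out, because the blocks
  are disjoint. The sequence \<open>a\<close> separates consecutive blocks and drives them to
  infinity, while gaps between blocks and empty blocks remain allowed.\<close>

lemma block_sequence: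
  assumes "strict_mono a" "\<And>p. a p \<le> m p" "\<And>p. m p \<le> q p" "\<And>p. q p \<le> a (Suc p)"
  shows "multiplier_sequence scale (\<lambda>p x. S (q p) x - S (m p) x)"
proof unfold_locales
  show "bounded_operator scale scale (\<lambda>x. S (q p) x - S (m p) x)" for p
    by (intro bounded_operator_diff_fun bounded_operator_S)
  fix x
  have S_diff: "S (q p) x - S (m p) x = (\<Sum>n\<in>{m p..<q p}. A n x)" for p
    unfolding S_def using sum_diff_nat_ivl[of 0 "m p" "q p" "\<lambda>n. A n x"] assms(3)
    by (simp add: atLeast0LessThan)
  have disj: "{m p..<q p} \<inter> {m p'..<q p'} = {}" if "p < p'" for p p'
  proof -
    have "q p \<le> a (Suc p)" by (rule assms)
    also have "\<dots> \<le> a p'" using that by (simp add: strict_mono_less_eq[OF assms(1)])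
    also have "\<dots> \<le> m p'" by (rule assms)
    finally show ?thesis by auto
  qed
  have uC: "unconditionally_Cauchy (\<lambda>n. A n x)"
    using expansion by (intro unconditionally_CauchyI)
      (auto simp: unconditional_fd_expansion_def unconditionally_sums_def)
  show "unconditionally_Cauchy (\<lambda>p. S (q p) x - S (m p) x)"
    unfolding unconditionally_Cauchy_def S_diff
  proof (intro allI impI)
    fix e :: real assume "e > 0"
    then obtain L where L: "\<And>N. finite N \<Longrightarrow> N \<subseteq> {L..} \<Longrightarrow> norm (\<Sum>n\<in>N. A n x) < e"
      using uC unfolding unconditionally_Cauchy_def by blast
    have "norm (\<Sum>p\<in>N. \<Sum>n\<in>{m p..<q p}. A n x) < e" if N: "finite N" "N \<subseteq> {L..}" for N
    proof -
      have "(\<Sum>n\<in>(\<Union>p\<in>N. {m p..<q p}). A n x) = (\<Sum>p\<in>N. \<Sum>n\<in>{m p..<q p}. A n x)"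
        using N(1) disj by (intro sum.UNION_disjoint) (auto simp: neq_iff)
      moreover have "(\<Union>p\<in>N. {m p..<q p}) \<subseteq> {L..}"
      proof
        fix n assume "n \<in> (\<Union>p\<in>N. {m p..<q p})"
        then obtain p where p: "p \<in> N" "m p \<le> n" by auto
        then have "L \<le> p" using N(2) by auto
        also have "p \<le> a p" by (rule strict_mono_imp_increasing[OF assms(1)])
        also have "a p \<le> m p" by (rule assms)
        finally show "n \<in> {L..}" using p(2) by simp
      qed
      ultimately show ?thesis using L[of "\<Union>p\<in>N. {m p..<q p}"] N(1) by simp
    qed
    then show "\<exists>L. \<forall>N. finite N \<longrightarrow> N \<subseteq> {L..} \<longrightarrow>
        norm (\<Sum>p\<in>N. \<Sum>n\<in>{m p..<q p}. A n x) < e" by blast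
  qed
qed

end

subsection \<open>Multilinear maps\<close>

text \<open>A working substitute for \<open>continuous_multilinear\<close>: arguments are total
  functions of which only the values below \<open>k\<close> count, so that updates and case
  distinctions need no restriction, and continuity is stated as a norm bound.\<close>

definition multilin ::
    "('k::real_or_complex \<Rightarrow> 'a::real_normed_vector \<Rightarrow> 'a) \<Rightarrow> ('k \<Rightarrow> 'b::real_normed_vector \<Rightarrow> 'b) \<Rightarrow>
     nat \<Rightarrow> ((nat \<Rightarrow> 'a) \<Rightarrow> 'b) \<Rightarrow> bool" where
  "multilin s1 s2 k A \<longleftrightarrow>
     (\<forall>x. \<forall>i<k. Vector_Spaces.linear s1 s2 (\<lambda>t. A (x(i := t)))) \<and>
     (\<forall>x y. (\<forall>i<k. x i = y i) \<longrightarrow> A x = A y) \<and>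
     (\<exists>C\<ge>0. \<forall>x. norm (A x) \<le> C * (\<Prod>i<k. norm (x i)))"

lemma multilin_cong: "multilin s1 s2 k A \<Longrightarrow> (\<And>i. i < k \<Longrightarrow> x i = y i) \<Longrightarrow> A x = A y"
  by (simp add: multilin_def)

lemma multilin_bound:
  assumes "multilin s1 s2 k A"
  obtains C where "C \<ge> 0" "\<And>x. norm (A x) \<le> C * (\<Prod>i<k. norm (x i))"
  using assms by (auto simp: multilin_def)

lemma multilin_upd:
  assumes "multilin s1 s2 k A" "i < k"
  shows multilin_add: "A (x(i := a + b)) = A (x(i := a)) + A (x(i := b))"
    and multilin_scale: "A (x(i := s1 c a)) = s2 c (A (x(i := a)))"
    and multilin_zero: "A (x(i := 0)) = 0"
    and multilin_diff: "A (x(i := a - b)) = A (x(i := a)) - A (x(i := b))"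
    and multilin_sum: "A (x(i := sum f N)) = (\<Sum>n\<in>N. A (x(i := f n)))"
proof -
  have lin: "Vector_Spaces.linear s1 s2 (\<lambda>t. A (x(i := t)))" for x
    using assms by (simp add: multilin_def)
  show add: "A (x(i := a + b)) = A (x(i := a)) + A (x(i := b))" for a b
    using lin[of x] by (simp add: Vector_Spaces.linear_iff)
  show "A (x(i := s1 c a)) = s2 c (A (x(i := a)))"
    using lin[of x] by (simp add: Vector_Spaces.linear_iff)
  have ad: "Modules.additive (\<lambda>t. A (x(i := t)))" by standard (rule add)
  show "A (x(i := 0)) = 0" by (rule Modules.additive.zero[OF ad])
  show "A (x(i := a - b)) = A (x(i := a)) - A (x(i := b))" by (rule Modules.additive.diff[OF ad])
  show "A (x(i := sum f N)) = (\<Sum>n\<in>N. A (x(i := f n)))" by (rule Modules.additive.sum[OF ad])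
qed

lemma multilin_eq_0:
  assumes "multilin s1 s2 k A" "i < k" "x i = 0"
  shows "A x = 0"
  using multilin_zero[OF assms(1,2), of x] assms(3) by (metis fun_upd_triv)

text \<open>Pass from \<open>y\<close> to \<open>x\<close> one slot at a time; two consecutive
  hybrids differ only in slot \<open>i\<close>, and linearity there puts the difference into that
  slot.\<close>

lemma multilin_telescope:
  assumes "multilin s1 s2 k A"
  shows "A x - A y = (\<Sum>i<k. A ((\<lambda>l. if l < i then x l else y l)(i := x i - y i)))"
proof -
  let ?h = "\<lambda>m l. if l < m then x l else y l"
  have main: "A (?h m) - A y = (\<Sum>i<m. A ((?h i)(i := x i - y i)))" if "m \<le> k" for m
    using that
  proof (induction m)
    case (Suc m)
    have 1: "(?h m)(m := x m) = ?h (Suc m)" "(?h m)(m := y m) = ?h m" by (auto simp: less_Suc_eq)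
    have "A ((?h m)(m := x m - y m)) = A (?h (Suc m)) - A (?h m)"
      using multilin_diff[OF assms, of m "?h m" "x m" "y m"] Suc.prems by (simp add: 1)
    then have "A (?h (Suc m)) - A y = (A (?h m) - A y) + A ((?h m)(m := x m - y m))" by simp
    also have "A (?h m) - A y = (\<Sum>i<m. A ((?h i)(i := x i - y i)))"
      using Suc.prems by (intro Suc.IH) simp
    finally show ?case by (simp only: sum.lessThan_Suc)
  qed simp
  have "A (?h k) = A x" by (rule multilin_cong[OF assms]) simp
  then show ?thesis using main[OF order_refl] by (simp only:)
qed

lemma prod_upd:
  fixes g :: "'a \<Rightarrow> 'c::comm_monoid_mult" and x :: "nat \<Rightarrow> 'a"
  assumes "j < k"
  shows "(\<Prod>l<k. g ((x(j := a)) l)) = g a * (\<Prod>l\<in>{..<k} - {j}. g (x l))"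
  using assms by (subst prod.remove[of _ j]) (auto intro!: prod.cong)

lemma prod_norm_upd_le:
  fixes x :: "nat \<Rightarrow> 'a::real_normed_vector"
  assumes "i < k" "\<And>l. l < k \<Longrightarrow> norm (x l) \<le> R"
  shows "(\<Prod>l<k. norm ((x(i := t)) l)) \<le> R ^ (k - 1) * norm t"
proof -
  have "(\<Prod>l<k. norm ((x(i := t)) l)) = norm t * (\<Prod>l\<in>{..<k} - {i}. norm ((x(i := t)) l))"
    using assms(1) by (subst prod.remove[of _ i]) auto
  also have "\<dots> \<le> norm t * (\<Prod>l\<in>{..<k} - {i}. R)"
    using assms(2) by (intro mult_left_mono prod_mono) auto
  also have "(\<Prod>l\<in>{..<k} - {i}. R) = R ^ (k - 1)" using assms(1) by simp
  finally show ?thesis by (simp add: mult.commute)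
qed

lemma multilin_diff_bound:
  assumes "multilin s1 s2 k A" "C \<ge> 0" "\<And>x. norm (A x) \<le> C * (\<Prod>i<k. norm (x i))"
    and "\<And>i. i < k \<Longrightarrow> norm (x i) \<le> R" "\<And>i. i < k \<Longrightarrow> norm (y i) \<le> R"
  shows "norm (A x - A y) \<le> C * R ^ (k - 1) * (\<Sum>i<k. norm (x i - y i))"
proof -
  have "norm (A x - A y) \<le> (\<Sum>i<k. norm (A ((\<lambda>l. if l < i then x l else y l)(i := x i - y i))))"
    unfolding multilin_telescope[OF assms(1), of x y] by (rule norm_sum)
  also have "\<dots> \<le> (\<Sum>i<k. C * (R ^ (k - 1) * norm (x i - y i)))"
    by (intro sum_mono order_trans[OF assms(3)] mult_left_mono prod_norm_upd_le assms(2))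
       (use assms(4,5) in auto)
  finally show ?thesis by (simp add: sum_distrib_left mult.assoc)
qed

locale banach_pair = E: banach_space_over scaleE + F: banach_space_over scaleF
  for scaleE :: "'k::real_or_complex \<Rightarrow> 'e::banach \<Rightarrow> 'e"
    and scaleF :: "'k \<Rightarrow> 'f::banach \<Rightarrow> 'f"
begin

abbreviation "mlin \<equiv> multilin scaleE scaleF"

lemma mlinI:
  assumes "\<And>x i a b. i < k \<Longrightarrow> A (x(i := a + b)) = A (x(i := a)) + A (x(i := b))"
    and "\<And>x i c a. i < k \<Longrightarrow> A (x(i := scaleE c a)) = scaleF c (A (x(i := a)))"
    and "\<And>x y. (\<And>i. i < k \<Longrightarrow> x i = y i) \<Longrightarrow> A x = A y"
    and "C \<ge> 0" "\<And>x. norm (A x) \<le> C * (\<Prod>i<k. norm (x i))"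
  shows "mlin k A"
  unfolding multilin_def Vector_Spaces.linear_iff
  using assms E.vector_space_axioms F.vector_space_axioms by blast

lemma mlin_scale_all:
  assumes "mlin k A"
  shows "A (\<lambda>i. scaleE (c i) (x i)) = scaleF (\<Prod>i<k. c i) (A x)"
proof -
  have "A (\<lambda>i. if i < m then scaleE (c i) (x i) else x i) = scaleF (\<Prod>i<m. c i) (A x)"
    if "m \<le> k" for m
    using that
  proof (induction m)
    case (Suc m)
    let ?h = "\<lambda>m i. if i < m then scaleE (c i) (x i) else x i"
    have "?h (Suc m) = (?h m)(m := scaleE (c m) (x m))" "(?h m)(m := x m) = ?h m"
      by (auto simp: less_Suc_eq)
    then have "A (?h (Suc m)) = scaleF (c m) (A (?h m))"
      using multilin_scale[OF assms, of m "?h m" "c m" "x m"] Suc.prems by simp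
    then show ?case using Suc by (simp add: mult.commute)
  qed simp
  from this[of k] show ?thesis
    using multilin_cong[OF assms, of "\<lambda>i. if i < k then scaleE (c i) (x i) else x i"
        "\<lambda>i. scaleE (c i) (x i)"] by simp
qed

lemma mlin_compose_slot:
  assumes "mlin k A" "bounded_operator scaleE scaleE T" "i < k"
  shows "mlin k (\<lambda>x. A (x(i := T (x i))))"
proof -
  obtain C where C: "C \<ge> 0" "\<And>x. norm (A x) \<le> C * (\<Prod>i<k. norm (x i))"
    using multilin_bound[OF assms(1)] by blast
  obtain D where D: "D > 0" "\<And>x. norm (T x) \<le> D * norm x"
    using bounded_operator_bound[OF assms(2)] by blast
  have upd: "(x(j := a))(i := T ((x(j := a)) i)) = (if j = i then x(i := T a) else (x(i := T (x i)))(j := a))"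
    for x j a by auto
  show ?thesis
  proof (rule mlinI)
    show "norm (A (x(i := T (x i)))) \<le> (C * D) * (\<Prod>i<k. norm (x i))" for x
    proof -
      have "(\<Prod>l<k. norm ((x(i := T (x i))) l)) = norm (T (x i)) * (\<Prod>l\<in>{..<k} - {i}. norm (x l))"
        using assms(3) by (subst prod.remove[of _ i]) (auto intro!: prod.cong)
      also have "\<dots> \<le> (D * norm (x i)) * (\<Prod>l\<in>{..<k} - {i}. norm (x l))"
        by (intro mult_right_mono D prod_nonneg) auto
      also have "\<dots> = D * (\<Prod>l<k. norm (x l))"
        using assms(3) by (subst (2) prod.remove[of _ i]) auto
      finally have "C * (\<Prod>l<k. norm ((x(i := T (x i))) l)) \<le> C * (D * (\<Prod>l<k. norm (x l)))"
        using C(1) by (rule mult_left_mono)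
      then show ?thesis using C(2)[of "x(i := T (x i))"] by (simp add: mult.assoc)
    qed
    show "C * D \<ge> 0" using C D by simp
    show "A (x(i := T (x i))) = A (y(i := T (y i)))" if "\<And>i. i < k \<Longrightarrow> x i = y i" for x y
      by (rule multilin_cong[OF assms(1)]) (use that assms(3) in auto)
  qed (unfold upd, simp_all add: multilin_add[OF assms(1)] multilin_scale[OF assms(1)]
      bounded_operator_add[OF assms(2)] bounded_operator_scale[OF assms(2)])
qed

lemma mlin_compose:
  assumes "mlin k A" "\<And>i. i < k \<Longrightarrow> bounded_operator scaleE scaleE (T i)"
  shows "mlin k (\<lambda>x. A (\<lambda>i. T i (x i)))"
proof -
  have "mlin k (\<lambda>x. A (\<lambda>i. if i < m then T i (x i) else x i))" if "m \<le> k" for m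
    using that
  proof (induction m)
    case (Suc m)
    have "(\<lambda>i. if i < Suc m then T i (x i) else x i)
        = (\<lambda>i. if i < m then T i ((x(m := T m (x m))) i) else (x(m := T m (x m))) i)" for x
      by (auto simp: less_Suc_eq)
    then show ?case using mlin_compose_slot[OF Suc.IH assms(2)[of m]] Suc.prems by simp
  qed (use assms in simp)
  from this[of k] show ?thesis
    using multilin_cong[OF assms(1), of "\<lambda>i. if i < k then T i (x i) else x i" "\<lambda>i. T i (x i)" for x]
    by simp
qed

lemma mlin_add:
  assumes "mlin k A" "mlin k B" shows "mlin k (\<lambda>x. A x + B x)"
proof -
  obtain C where C: "C \<ge> 0" "\<And>x. norm (A x) \<le> C * (\<Prod>i<k. norm (x i))"
    using multilin_bound[OF assms(1)] by blast
  obtain D where D: "D \<ge> 0" "\<And>x. norm (B x) \<le> D * (\<Prod>i<k. norm (x i))"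
    using multilin_bound[OF assms(2)] by blast
  show ?thesis
  proof (rule mlinI)
    show "norm (A x + B x) \<le> (C + D) * (\<Prod>i<k. norm (x i))" for x
      using norm_triangle_mono[OF C(2) D(2)] by (simp add: distrib_right)
    show "A x + B x = A y + B y" if "\<And>i. i < k \<Longrightarrow> x i = y i" for x y
      using that multilin_cong[OF assms(1)] multilin_cong[OF assms(2)] by metis
  qed (simp_all add: multilin_add[OF assms(1)] multilin_scale[OF assms(1)]
      multilin_add[OF assms(2)] multilin_scale[OF assms(2)] F.scale_right_distrib C D)
qed

lemma mlin_scale:
  assumes "mlin k A" shows "mlin k (\<lambda>x. scaleF c (A x))"
proof -
  obtain C where C: "C \<ge> 0" "\<And>x. norm (A x) \<le> C * (\<Prod>i<k. norm (x i))"
    using multilin_bound[OF assms(1)] by blast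
  show ?thesis
  proof (rule mlinI)
    show "norm (scaleF c (A x)) \<le> (norm c * C) * (\<Prod>i<k. norm (x i))" for x
      using mult_left_mono[OF C(2)[of x], of "norm c"] by (simp add: F.norm_scale mult.assoc)
    show "scaleF c (A x) = scaleF c (A y)" if "\<And>i. i < k \<Longrightarrow> x i = y i" for x y
      using that multilin_cong[OF assms(1)] by metis
  qed (simp_all add: multilin_add[OF assms(1)] multilin_scale[OF assms(1)]
      F.scale_right_distrib C mult.commute)
qed

lemma mlin_zero: "mlin k (\<lambda>x. 0)"
  by (rule mlinI[of _ _ 0]) auto

lemma mlin_sum: "(\<And>n. n \<in> N \<Longrightarrow> mlin k (A n)) \<Longrightarrow> mlin k (\<lambda>x. \<Sum>n\<in>N. A n x)"
  by (induction N rule: infinite_finite_induct) (simp_all add: mlin_zero mlin_add)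

subsection \<open>Homogeneous polynomials\<close>

lemma continuous_multilinear_multilin:
  assumes "mlin k A" shows "continuous_multilinear scaleE scaleF k A"
proof -
  obtain C where C: "C \<ge> 0" "\<And>x. norm (A x) \<le> C * (\<Prod>i<k. norm (x i))"
    using multilin_bound[OF assms] by blast
  have "continuous_map (product_topology (\<lambda>_. euclidean) {..<k}) euclidean A"
    unfolding continuous_map_def
  proof (intro conjI allI impI)
    fix U :: "'f set" assume "openin euclidean U"
    then have U: "open U" by simp
    show "openin (product_topology (\<lambda>_. euclidean) {..<k})
        {x \<in> topspace (product_topology (\<lambda>_. euclidean) {..<k}). A x \<in> U}"
      unfolding openin_product_topology_alt
    proof (intro ballI)
      fix x assume "x \<in> {x \<in> topspace (product_topology (\<lambda>_. euclidean) {..<k}). A x \<in> U}"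
      then have x: "x \<in> {..<k} \<rightarrow>\<^sub>E UNIV" "A x \<in> U" by auto
      then obtain e where e: "e > 0" "ball (A x) e \<subseteq> U" using U open_contains_ball by blast
      define R where "R = (\<Sum>i<k. norm (x i)) + 1"
      define K where "K = C * R ^ (k - 1) * real k + 1"
      have R: "norm (x i) \<le> R - 1" if "i < k" for i
        using member_le_sum[of i "{..<k}" "\<lambda>i. norm (x i)"] that by (auto simp: R_def)
      have R0: "R \<ge> 0" by (simp add: R_def sum_nonneg add_nonneg_nonneg)
      have K: "K > 0" using C(1) R0 by (simp add: K_def add_nonneg_pos)
      define d where "d = min 1 (e / K)"
      have d: "d > 0" using e K by (simp add: d_def)
      have "PiE {..<k} (\<lambda>i. ball (x i) d) \<subseteq> {x \<in> topspace (product_topology (\<lambda>_. euclidean) {..<k}). A x \<in> U}"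
      proof
        fix y assume y: "y \<in> PiE {..<k} (\<lambda>i. ball (x i) d)"
        have yd: "norm (y i - x i) < d" if "i < k" for i
          using y that by (auto simp: PiE_def Pi_def dist_norm norm_minus_commute)
        have "norm (A y - A x) \<le> C * R ^ (k - 1) * (\<Sum>i<k. norm (y i - x i))"
        proof (rule multilin_diff_bound[OF assms C])
          fix i assume "i < k"
          then show "norm (y i) \<le> R" "norm (x i) \<le> R"
            using R[of i] yd[of i] norm_triangle_sub[of "y i" "x i"] by (auto simp: d_def)
        qed
        also have "\<dots> \<le> C * R ^ (k - 1) * (\<Sum>i<k. d)"
          using yd C(1) R0 by (intro mult_left_mono sum_mono) (auto intro: less_imp_le)
        also have "\<dots> = (K - 1) * d" by (simp add: K_def)
        also have "\<dots> < K * d" using d by simp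
        also have "\<dots> \<le> e" using K by (simp add: d_def min_def field_simps)
        finally have "A y \<in> U" using e(2) by (auto simp: dist_norm norm_minus_commute)
        then show "y \<in> {x \<in> topspace (product_topology (\<lambda>_. euclidean) {..<k}). A x \<in> U}"
          using y by (auto simp: PiE_def)
      qed
      moreover have "x \<in> PiE {..<k} (\<lambda>i. ball (x i) d)" using x(1) d by (auto simp: PiE_def)
      ultimately show "\<exists>V. finite {i \<in> {..<k}. V i \<noteq> topspace euclidean} \<and>
          (\<forall>i\<in>{..<k}. openin euclidean (V i)) \<and> x \<in> PiE {..<k} V \<and>
          PiE {..<k} V \<subseteq> {x \<in> topspace (product_topology (\<lambda>_. euclidean) {..<k}). A x \<in> U}"
        by (intro exI[of _ "\<lambda>i. ball (x i) d"]) auto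
    qed
  qed auto
  then show ?thesis
    using assms by (auto simp: continuous_multilinear_def multilin_def)
qed

text \<open>Continuity at the origin bounds the map by 1 on a small polydisc, and rescaling each
  slot to its radius yields the norm bound. Arguments with a zero slot cannot be rescaled but are
  mapped to zero.\<close>

lemma multilin_continuous_multilinear:
  assumes "continuous_multilinear scaleE scaleF k A"
  shows "mlin k (\<lambda>x. A (restrict x {..<k}))"
proof -
  let ?A = "\<lambda>x. A (restrict x {..<k})"
  have upd: "restrict (x(i := t)) {..<k} = (restrict x {..<k})(i := t)" if "i < k" for x :: "nat \<Rightarrow> 'e" and i t
    using that by (auto simp: restrict_def)
  have lin: "Vector_Spaces.linear scaleE scaleF (\<lambda>t. ?A (x(i := t)))" if "i < k" for x i
    using assms that by (simp add: upd continuous_multilinear_def)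
  have scale_all: "?A (\<lambda>i. scaleE (c i) (x i)) = scaleF (\<Prod>i<k. c i) (?A x)" for c x
  proof -
    let ?h = "\<lambda>m i. if i < m then scaleE (c i) (x i) else x i"
    have "?A (?h m) = scaleF (\<Prod>i<m. c i) (?A x)" if "m \<le> k" for m
      using that
    proof (induction m)
      case (Suc m)
      have "?h (Suc m) = (?h m)(m := scaleE (c m) (x m))" "(?h m)(m := x m) = ?h m"
        by (auto simp: less_Suc_eq)
      then have "?A (?h (Suc m)) = scaleF (c m) (?A (?h m))"
        using lin[of m "?h m"] Suc.prems by (simp only: Vector_Spaces.linear_iff)
      also have "?A (?h m) = scaleF (\<Prod>i<m. c i) (?A x)" using Suc.prems by (intro Suc.IH) simp
      finally show ?case by (simp only: F.scale_scale prod.lessThan_Suc mult.commute)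
    qed simp
    moreover have "restrict (?h k) {..<k} = restrict (\<lambda>i. scaleE (c i) (x i)) {..<k}"
      by (auto simp: restrict_def)
    ultimately show ?thesis by (metis order_refl)
  qed
  have zero: "?A x = 0" if "i < k" "x i = 0" for x i
  proof -
    have "?A x = ?A (\<lambda>l. scaleE (if l = i then 0 else 1) (x l))"
      using that(2) by (intro arg_cong[of _ _ ?A]) auto
    also have "\<dots> = 0" unfolding scale_all using that(1) by (subst prod_zero) auto
    finally show ?thesis .
  qed
  let ?T = "product_topology (\<lambda>_. euclidean) {..<k} :: (nat \<Rightarrow> 'e) topology"
  have "\<exists>C\<ge>0. \<forall>x. norm (?A x) \<le> C * (\<Prod>i<k. norm (x i))"
  proof (cases "k = 0")
    case True
    \<comment> \<open>Without slots, every restriction is the constant function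
      \<open>undefined\<close>, so a single value has to be bounded by the empty product 1.\<close>
    then show ?thesis by (intro exI[of _ "norm (A (\<lambda>_. undefined))"]) (auto simp: restrict_def)
  next
    case False
    have A0: "?A (\<lambda>_. 0) = 0" using zero[of 0] False by simp
    have "openin ?T {x \<in> topspace ?T. A x \<in> ball 0 1}"
      using assms unfolding continuous_multilinear_def continuous_map_def
      by (simp only: open_openin[symmetric] open_ball simp_thms)
    moreover have "restrict (\<lambda>_. 0) {..<k} \<in> {x \<in> topspace ?T. A x \<in> ball 0 1}"
      using A0 by auto
    ultimately obtain U where U: "\<And>i. i < k \<Longrightarrow> open (U i)" "restrict (\<lambda>_. 0) {..<k} \<in> PiE {..<k} U"
      "PiE {..<k} U \<subseteq> {x \<in> topspace ?T. A x \<in> ball 0 1}"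
      unfolding openin_product_topology_alt by (smt (verit) lessThan_iff open_openin)
    have "\<exists>d>0. ball 0 d \<subseteq> U i" if "i < k" for i
      using U(1)[OF that] U(2) that open_contains_ball by (metis PiE_mem lessThan_iff restrict_apply')
    then obtain d where d: "\<And>i. i < k \<Longrightarrow> d i > 0" "\<And>i. i < k \<Longrightarrow> ball 0 (d i) \<subseteq> U i" by metis
    \<comment> \<open>Half the minimum leaves room for closed balls inside the open ones.\<close>
    define e where "e = Min (d ` {..<k}) / 2"
    have Min: "Min (d ` {..<k}) > 0" using d(1) False by (subst Min_gr_iff) auto
    then have e: "e > 0" by (simp add: e_def)
    have e': "e < d i" if "i < k" for i
    proof -
      have "Min (d ` {..<k}) \<le> d i" using that by (intro Min_le) auto
      then show ?thesis using Min unfolding e_def by linarith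
    qed
    have small: "norm (?A x) < 1" if "\<And>i. i < k \<Longrightarrow> norm (x i) \<le> e" for x
    proof -
      have "x i \<in> U i" if "i < k" for i
        using \<open>\<And>i. i < k \<Longrightarrow> norm (x i) \<le> e\<close>[OF that] e'[OF that] d(2)[OF that] by (auto simp: subset_iff)
      then have "restrict x {..<k} \<in> PiE {..<k} U" by auto
      from subsetD[OF U(3) this] show ?thesis by simp
    qed
    have "norm (?A x) \<le> (1 / e) ^ k * (\<Prod>i<k. norm (x i))" for x
    proof (cases "\<exists>i<k. x i = 0")
      case True
      then show ?thesis using zero[of _ x] e by (auto intro!: mult_nonneg_nonneg prod_nonneg)
    next
      case False
      let ?c = "\<lambda>i. of_real (e / norm (x i)) :: 'k"
      have "norm (?A (\<lambda>i. scaleE (?c i) (x i))) < 1"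
        using False e by (intro small) (auto simp: E.norm_scale simp del: of_real_divide)
      then have "(\<Prod>i<k. e / norm (x i)) * norm (?A x) < 1"
        using e unfolding scale_all F.norm_scale prod_norm[symmetric] by (simp del: of_real_divide)
      then have "e ^ k / (\<Prod>i<k. norm (x i)) * norm (?A x) < 1" by (simp add: prod_dividef)
      moreover have "(\<Prod>i<k. norm (x i)) > 0" using False by (intro prod_pos) auto
      ultimately show ?thesis using e by (simp add: field_simps)
    qed
    then show ?thesis using e by (intro exI[of _ "(1 / e) ^ k"]) auto
  qed
  moreover have "?A x = ?A y" if "\<forall>i<k. x i = y i" for x y
    using that by (intro arg_cong[of _ _ A]) (auto simp: restrict_def)
  ultimately show ?thesis unfolding multilin_def using lin by blast
qed

text \<open>Allows every polynomial to be handled through a total map of type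
  \<open>multilin\<close>, evaluated at constant functions.\<close>

lemma hom_polys_iff:
  "P \<in> hom_polys scaleE scaleF k \<longleftrightarrow> (\<exists>A. mlin k A \<and> (\<forall>x. P x = A (\<lambda>_. x)))"
proof
  assume "P \<in> hom_polys scaleE scaleF k"
  then obtain A where A: "continuous_multilinear scaleE scaleF k A" "\<forall>x. P x = A (\<lambda>i\<in>{..<k}. x)"
    by (auto simp: hom_polys_def)
  then show "\<exists>A. mlin k A \<and> (\<forall>x. P x = A (\<lambda>_. x))"
    using multilin_continuous_multilinear[OF A(1)] by (intro exI conjI) auto
next
  assume "\<exists>A. mlin k A \<and> (\<forall>x. P x = A (\<lambda>_. x))"
  then obtain A where A: "mlin k A" "\<And>x. P x = A (\<lambda>_. x)" by blast
  have "A (\<lambda>_. x) = A (\<lambda>i\<in>{..<k}. x)" for x by (rule multilin_cong[OF A(1)]) simp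
  then show "P \<in> hom_polys scaleE scaleF k"
    unfolding hom_polys_def using continuous_multilinear_multilin[OF A(1)] A(2) by auto
qed

lemma mlin_diag: "mlin k A \<Longrightarrow> (\<lambda>x. A (\<lambda>_. x)) \<in> hom_polys scaleE scaleF k"
  by (auto simp: hom_polys_iff)

lemma hom_polys_bound:
  assumes "P \<in> hom_polys scaleE scaleF k"
  obtains C where "C \<ge> 0" "\<And>x. norm (P x) \<le> C * norm x ^ k"
proof -
  obtain A where A: "mlin k A" "\<And>x. P x = A (\<lambda>_. x)" using assms by (auto simp: hom_polys_iff)
  obtain C where C: "C \<ge> 0" "\<And>x. norm (A x) \<le> C * (\<Prod>i<k. norm (x i))"
    using multilin_bound[OF A(1)] by blast
  have "norm (P x) \<le> C * norm x ^ k" for x using C(2)[of "\<lambda>_. x"] by (simp add: A(2))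
  then show ?thesis using that C(1) by blast
qed

lemma hom_polys_homogeneous:
  assumes "P \<in> hom_polys scaleE scaleF k"
  shows "P (scaleE c x) = scaleF (c ^ k) (P x)"
proof -
  obtain A where A: "mlin k A" "\<And>x. P x = A (\<lambda>_. x)" using assms by (auto simp: hom_polys_iff)
  show ?thesis using mlin_scale_all[OF A(1), of "\<lambda>_. c" "\<lambda>_. x"] by (simp add: A(2))
qed

lemma hom_polys_add:
  assumes "P \<in> hom_polys scaleE scaleF k" "Q \<in> hom_polys scaleE scaleF k"
  shows "P + Q \<in> hom_polys scaleE scaleF k"
proof -
  obtain A B where "mlin k A" "\<And>x. P x = A (\<lambda>_. x)" "mlin k B" "\<And>x. Q x = B (\<lambda>_. x)"
    using assms by (auto simp: hom_polys_iff)
  then show ?thesis unfolding hom_polys_iff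
    by (intro exI[of _ "\<lambda>x. A x + B x"]) (auto simp: mlin_add)
qed

lemma hom_polys_scale:
  assumes "P \<in> hom_polys scaleE scaleF k"
  shows "(\<lambda>x. scaleF c (P x)) \<in> hom_polys scaleE scaleF k"
proof -
  obtain A where "mlin k A" "\<And>x. P x = A (\<lambda>_. x)" using assms by (auto simp: hom_polys_iff)
  then show ?thesis unfolding hom_polys_iff
    by (intro exI[of _ "\<lambda>x. scaleF c (A x)"]) (auto simp: mlin_scale)
qed

lemma hom_polys_zero: "0 \<in> hom_polys scaleE scaleF k"
  unfolding hom_polys_iff by (intro exI[of _ "\<lambda>x. 0"]) (simp add: mlin_zero)

lemma hom_polys_diff:
  assumes "P \<in> hom_polys scaleE scaleF k" "Q \<in> hom_polys scaleE scaleF k"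
  shows "P - Q \<in> hom_polys scaleE scaleF k"
proof -
  have eq: "P - Q = P + (\<lambda>x. scaleF (-1) (Q x))" by auto
  show ?thesis unfolding eq by (rule hom_polys_add[OF assms(1) hom_polys_scale[OF assms(2)]])
qed

definition pnorm :: "('e \<Rightarrow> 'f) \<Rightarrow> real" where
  "pnorm P = (SUP x\<in>{x. norm x \<le> 1}. norm (P x))"

lemma pnorm_le: "(\<And>x. norm x \<le> 1 \<Longrightarrow> norm (P x) \<le> C) \<Longrightarrow> pnorm P \<le> C"
  unfolding pnorm_def by (rule cSUP_least) (auto intro: exI[of _ 0])

lemma norm_le_pnorm:
  assumes "P \<in> hom_polys scaleE scaleF k" "norm x \<le> 1"
  shows "norm (P x) \<le> pnorm P"
proof -
  obtain C where C: "C \<ge> 0" "\<And>x. norm (P x) \<le> C * norm x ^ k" using hom_polys_bound[OF assms(1)] by blast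
  have "norm (P x) \<le> C" if "norm x \<le> 1" for x
    using C(2)[of x] mult_left_mono[OF power_le_one[OF norm_ge_zero that, of k] C(1)] by simp
  then show ?thesis unfolding pnorm_def using assms(2)
    by (intro cSUP_upper bdd_aboveI2[of _ _ C]) auto
qed

lemma pnorm_nonneg: "P \<in> hom_polys scaleE scaleF k \<Longrightarrow> pnorm P \<ge> 0"
  using norm_le_pnorm[of P k 0] order_trans[OF norm_ge_zero[of "P 0"]] by simp

lemma norm_le_pnorm_power:
  assumes "P \<in> hom_polys scaleE scaleF k" "k > 0"
  shows "norm (P x) \<le> pnorm P * norm x ^ k"
proof (cases "x = 0")
  case True
  have "P (scaleE 0 0) = scaleF (0 ^ k) (P 0)" by (rule hom_polys_homogeneous[OF assms(1)])
  then have "P 0 = 0" unfolding zero_power[OF assms(2)] by simp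
  then show ?thesis using True assms(2) by (simp add: zero_power)
next
  case False
  let ?c = "of_real (norm x) :: 'k"
  have c: "x = scaleE ?c (scaleE (inverse ?c) x)" using False by simp
  have "norm (scaleE (inverse ?c) x) \<le> 1"
    using False by (simp add: E.norm_scale norm_inverse)
  then have "norm (P (scaleE (inverse ?c) x)) \<le> pnorm P" by (rule norm_le_pnorm[OF assms(1)])
  then have "norm x ^ k * norm (P (scaleE (inverse ?c) x)) \<le> norm x ^ k * pnorm P"
    by (intro mult_left_mono) auto
  moreover have "norm (P x) = norm x ^ k * norm (P (scaleE (inverse ?c) x))"
    by (subst c, subst hom_polys_homogeneous[OF assms(1)]) (simp add: F.norm_scale norm_power)
  ultimately show ?thesis by (simp add: mult.commute)
qed

subsection \<open>Polynomials that are weakly continuous on bounded sets\<close>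

lemma wb_polys_iff:
  "P \<in> wb_polys scaleE scaleF k \<longleftrightarrow> P \<in> hom_polys scaleE scaleF k \<and>
     (\<forall>r x0. norm x0 \<le> r \<longrightarrow> (P \<longlongrightarrow> P x0) (weak_at scaleE r x0))"
  by (simp add: wb_polys_def E.weakly_continuous_on_bounded_iff)

lemma wb_polys_hom: "P \<in> wb_polys scaleE scaleF k \<Longrightarrow> P \<in> hom_polys scaleE scaleF k"
  by (simp add: wb_polys_iff)

lemma wb_polys_add:
  assumes "P \<in> wb_polys scaleE scaleF k" "Q \<in> wb_polys scaleE scaleF k"
  shows "P + Q \<in> wb_polys scaleE scaleF k"
  using assms unfolding wb_polys_iff 
  by (auto simp: plus_fun_def intro!: tendsto_add hom_polys_add[unfolded plus_fun_def])

lemma wb_polys_scale: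
  assumes "P \<in> wb_polys scaleE scaleF k"
  shows "(\<lambda>x. scaleF c (P x)) \<in> wb_polys scaleE scaleF k"
  using assms unfolding wb_polys_iff by (auto simp: hom_polys_scale intro!: F.tendsto_scale)

lemma wb_polys_zero: "0 \<in> wb_polys scaleE scaleF k"
  using hom_polys_zero unfolding wb_polys_iff zero_fun_def by simp

lemma wb_polys_diff:
  assumes "P \<in> wb_polys scaleE scaleF k" "Q \<in> wb_polys scaleE scaleF k"
  shows "P - Q \<in> wb_polys scaleE scaleF k"
  using assms unfolding wb_polys_iff 
  by (auto simp: fun_diff_def intro!: tendsto_diff hom_polys_diff[unfolded fun_diff_def])

text \<open>By homogeneity a small norm means uniform smallness on each ball, and weak continuity on
  a ball survives uniform limits.\<close>

lemma wb_polys_closed: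
  assumes "P \<in> hom_polys scaleE scaleF k" "k > 0"
    and "\<And>e. e > 0 \<Longrightarrow> \<exists>Q\<in>wb_polys scaleE scaleF k. pnorm (P - Q) \<le> e"
  shows "P \<in> wb_polys scaleE scaleF k"
  unfolding wb_polys_iff
proof (intro conjI allI impI assms(1) tendstoI)
  fix r :: real and x0 :: 'e and e :: real assume x0: "norm x0 \<le> r" and "e > 0"
  have r: "r \<ge> 0" using x0 norm_ge_zero order_trans by blast
  \<comment> \<open>Three error terms account for the 3; the summand 1 covers the radius
    \<open>r = 0\<close>.\<close>
  define d where "d = e / (3 * (r ^ k + 1))"
  have d: "d > 0" using \<open>e > 0\<close> r by (simp add: d_def add_nonneg_pos)
  obtain Q where Q: "Q \<in> wb_polys scaleE scaleF k" "pnorm (P - Q) \<le> d" using assms(3)[OF d] by blast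
  have "norm (P x - Q x) \<le> e / 3" if "norm x \<le> r" for x
  proof -
    have "norm ((P - Q) x) \<le> pnorm (P - Q) * norm x ^ k"
      using Q(1) by (intro norm_le_pnorm_power hom_polys_diff assms wb_polys_hom)
    also have "\<dots> \<le> d * (r ^ k + 1)"
    proof (rule mult_mono)
      show "norm x ^ k \<le> r ^ k + 1" using power_mono[OF that norm_ge_zero, of k] by simp
    qed (use Q(2) d in auto)
    also have "\<dots> = e / 3" using r by (simp add: d_def field_simps add_nonneg_eq_0_iff)
    finally show ?thesis by simp
  qed
  note close = this
  have "(Q \<longlongrightarrow> Q x0) (weak_at scaleE r x0)" using Q(1) x0 by (simp add: wb_polys_iff)
  then have "\<forall>\<^sub>F x in weak_at scaleE r x0. dist (Q x) (Q x0) < e / 3"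
    using \<open>e > 0\<close> by (intro tendstoD) auto
  then show "\<forall>\<^sub>F x in weak_at scaleE r x0. dist (P x) (P x0) < e"
    using weak_at_norm_le[of r scaleE x0]
  proof eventually_elim
    case (elim x)
    have "norm (P x - P x0) = norm ((P x - Q x) + (Q x - Q x0) + (Q x0 - P x0))" by simp
    also have "\<dots> \<le> norm (P x - Q x) + norm (Q x - Q x0) + norm (Q x0 - P x0)"
      by (intro norm_triangle_mono order_refl)
    also have "\<dots> < e"
      using close[OF elim(2)] close[OF x0] elim(1) by (simp add: dist_norm norm_minus_commute)
    finally show ?case by (simp add: dist_norm)
  qed
qed

text \<open>The inner map \<open>A'\<close> may differ from \<open>A\<close>; this makes the
  property survive composition with an operator in another slot.\<close>

definition slot_finite_rank :: "nat \<Rightarrow> nat \<Rightarrow> ((nat \<Rightarrow> 'e) \<Rightarrow> 'f) \<Rightarrow> bool" where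
  "slot_finite_rank k i A \<longleftrightarrow>
     (\<exists>A' T. mlin k A' \<and> E.finite_rank T \<and> A = (\<lambda>x. A' (x(i := T (x i)))))"

text \<open>In the telescoping sum, slot \<open>i\<close> sees the difference only through
  \<open>T x - T x0\<close>, which tends to zero in norm when \<open>x\<close> tends weakly to
  \<open>x0\<close>; the other slots stay bounded.\<close>

lemma slot_finite_rank_wb:
  assumes A: "mlin k A" and fr: "\<And>i. i < k \<Longrightarrow> slot_finite_rank k i A"
  shows "(\<lambda>x. A (\<lambda>_. x)) \<in> wb_polys scaleE scaleF k"
  unfolding wb_polys_iff
proof (intro conjI allI impI mlin_diag[OF A])
  fix r :: real and x0 :: 'e assume x0: "norm x0 \<le> r"
  let ?h = "\<lambda>x i l. if l < i then x else x0"
  have "((\<lambda>x. A ((?h x i)(i := x - x0))) \<longlongrightarrow> 0) (weak_at scaleE r x0)" if i: "i < k" for i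
  proof -
    obtain A' T where A': "mlin k A'" and T: "E.finite_rank T"
      and AA': "A = (\<lambda>x. A' (x(i := T (x i))))"
      using fr[OF i] unfolding slot_finite_rank_def by blast
    obtain C where C: "C \<ge> 0" "\<And>x. norm (A' x) \<le> C * (\<Prod>i<k. norm (x i))"
      using multilin_bound[OF A'] by blast
    have "((\<lambda>x. C * (r ^ (k - 1) * norm (T x - T x0))) \<longlongrightarrow> C * (r ^ (k - 1) * norm (T x0 - T x0)))
        (weak_at scaleE r x0)"
      by (intro tendsto_intros E.finite_rank_weak_tendsto[OF T])
    then have "((\<lambda>x. C * (r ^ (k - 1) * norm (T x - T x0))) \<longlongrightarrow> 0) (weak_at scaleE r x0)" by simp
    moreover have "\<forall>\<^sub>F x in weak_at scaleE r x0.
        norm (A ((?h x i)(i := x - x0))) \<le> C * (r ^ (k - 1) * norm (T x - T x0))"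
      using weak_at_norm_le
    proof eventually_elim
      case (elim x)
      have "T (x - x0) = T x - T x0"
        using T bounded_operator_diff by (auto simp: E.finite_rank_def)
      then have "A ((?h x i)(i := x - x0)) = A' ((?h x i)(i := T x - T x0))"
        by (simp add: AA')
      also have "norm \<dots> \<le> C * (\<Prod>l<k. norm (((?h x i)(i := T x - T x0)) l))" by (rule C)
      also have "\<dots> \<le> C * (r ^ (k - 1) * norm (T x - T x0))"
        using elim x0 by (intro mult_left_mono prod_norm_upd_le i C) auto
      finally show ?case .
    qed
    ultimately show ?thesis by (rule Lim_null_comparison[rotated])
  qed
  then have "((\<lambda>x. \<Sum>i<k. A ((?h x i)(i := x - x0))) \<longlongrightarrow> (\<Sum>i<k. 0)) (weak_at scaleE r x0)"
    by (intro tendsto_sum) auto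
  then have "((\<lambda>x. A (\<lambda>_. x) - A (\<lambda>_. x0)) \<longlongrightarrow> 0) (weak_at scaleE r x0)"
    by (simp add: multilin_telescope[OF A])
  then show "((\<lambda>x. A (\<lambda>_. x)) \<longlongrightarrow> A (\<lambda>_. x0)) (weak_at scaleE r x0)"
    by (simp add: Lim_null[symmetric])
qed

text \<open>A multilinear map with the least number of slots that do not factor through a finite rank
  operator has such a slot, and composing there with finite rank operators decreases the number.\<close>

lemma exists_slot:
  assumes "hom_polys scaleE scaleF k \<noteq> wb_polys scaleE scaleF k"
  obtains A i where "mlin k A" "i < k" "(\<lambda>x. A (\<lambda>_. x)) \<notin> wb_polys scaleE scaleF k"
    "\<And>T. E.finite_rank T \<Longrightarrow> (\<lambda>x. A ((\<lambda>_. x)(i := T x))) \<in> wb_polys scaleE scaleF k"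
proof -
  let ?Q = "\<lambda>A. mlin k A \<and> (\<lambda>x. A (\<lambda>_. x)) \<notin> wb_polys scaleE scaleF k"
  let ?m = "\<lambda>A. card {i. i < k \<and> \<not> slot_finite_rank k i A}"
  obtain P where P: "P \<in> hom_polys scaleE scaleF k" "P \<notin> wb_polys scaleE scaleF k"
    using assms wb_polys_hom by blast
  then obtain A0 where A0: "mlin k A0" "\<forall>x. P x = A0 (\<lambda>_. x)" by (auto simp: hom_polys_iff)
  then have "P = (\<lambda>x. A0 (\<lambda>_. x))" by auto
  then have "?Q A0" using P A0 by simp
  then obtain A where A: "?Q A" "\<And>B. ?Q B \<Longrightarrow> ?m A \<le> ?m B"
    using ex_has_least_nat[of ?Q A0 ?m] by blast
  obtain i where i: "i < k" "\<not> slot_finite_rank k i A" using A(1) slot_finite_rank_wb by blast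
  have "(\<lambda>x. A ((\<lambda>_. x)(i := T x))) \<in> wb_polys scaleE scaleF k" if T: "E.finite_rank T" for T
  proof (rule ccontr)
    assume not: "(\<lambda>x. A ((\<lambda>_. x)(i := T x))) \<notin> wb_polys scaleE scaleF k"
    have opT: "bounded_operator scaleE scaleE T" using T by (simp add: E.finite_rank_def)
    let ?B = "\<lambda>x. A (x(i := T (x i)))"
    have B: "mlin k ?B" using A(1) opT i(1) by (intro mlin_compose_slot) auto
    have "slot_finite_rank k j ?B" if j: "slot_finite_rank k j A \<or> j = i" for j
    proof (cases "j = i")
      case True
      then show ?thesis unfolding slot_finite_rank_def using A(1) T by blast
    next
      case False
      then obtain A' U where A': "mlin k A'" and U: "E.finite_rank U"
        and AA': "A = (\<lambda>x. A' (x(j := U (x j))))"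
        using j unfolding slot_finite_rank_def by blast
      have "?B = (\<lambda>x. (\<lambda>x. A' (x(i := T (x i)))) (x(j := U (x j))))"
        unfolding AA' using False by (auto simp: fun_upd_twist)
      moreover have "mlin k (\<lambda>x. A' (x(i := T (x i))))" using A' opT i(1) by (rule mlin_compose_slot)
      ultimately show ?thesis unfolding slot_finite_rank_def using U by blast
    qed
    then have "{j. j < k \<and> \<not> slot_finite_rank k j ?B} \<subset> {j. j < k \<and> \<not> slot_finite_rank k j A}"
      using i by blast
    then have "?m ?B < ?m A" by (intro psubset_card_mono) auto
    moreover have "?Q ?B" using B not by (simp add: fun_upd_def)
    ultimately show False using A(2)[of ?B] by simp
  qed
  then show ?thesis using that A(1) i(1) by blast
qed

subsection \<open>Polarization\<close>

text \<open>Multinomial expansion over choice functions. The set \<open>D\<close> marks the slots to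
  be polarized, the others are frozen at \<open>z\<close>; this relative form is what the induction
  on free slots later needs.\<close>

lemma mlin_expand:
  assumes A: "mlin k A" and "finite D" "D \<subseteq> {..<k}" "finite J"
  shows "A (\<lambda>i. if i \<in> D then \<Sum>j\<in>J. f i j else z i)
    = (\<Sum>g\<in>D \<rightarrow>\<^sub>E J. A (\<lambda>i. if i \<in> D then f i (g i) else z i))"
  using assms(2,3)
proof (induction D arbitrary: z rule: finite_induct)
  case (insert d D)
  let ?h = "\<lambda>z g i. if i \<in> D then f i (g i) else z i"
  have "A (\<lambda>i. if i \<in> insert d D then \<Sum>j\<in>J. f i j else z i)
      = A (\<lambda>i. if i \<in> D then \<Sum>j\<in>J. f i j else (z(d := \<Sum>j\<in>J. f d j)) i)"
    using insert.hyps by (intro arg_cong[of _ _ A]) auto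
  also have "\<dots> = (\<Sum>g\<in>D \<rightarrow>\<^sub>E J. A (?h (z(d := \<Sum>j\<in>J. f d j)) g))"
    using insert by auto
  also have "\<dots> = (\<Sum>g\<in>D \<rightarrow>\<^sub>E J. \<Sum>j\<in>J. A ((?h z g)(d := f d j)))"
  proof (intro sum.cong refl)
    fix g
    have "?h (z(d := \<Sum>j\<in>J. f d j)) g = (?h z g)(d := \<Sum>j\<in>J. f d j)" using insert.hyps by auto
    then show "A (?h (z(d := \<Sum>j\<in>J. f d j)) g) = (\<Sum>j\<in>J. A ((?h z g)(d := f d j)))"
      using insert.prems by (simp add: multilin_sum[OF A])
  qed
  also have "\<dots> = (\<Sum>(j, g)\<in>J \<times> (D \<rightarrow>\<^sub>E J). A ((?h z g)(d := f d j)))"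
    by (subst sum.swap) (simp add: sum.cartesian_product)
  also have "\<dots> = (\<Sum>(j, g)\<in>J \<times> (D \<rightarrow>\<^sub>E J). A (\<lambda>i. if i \<in> insert d D then f i ((g(d := j)) i) else z i))"
    using insert.hyps by (intro sum.cong refl) (auto intro!: arg_cong[of _ _ A])
  also have "\<dots> = (\<Sum>g\<in>insert d D \<rightarrow>\<^sub>E J. A (\<lambda>i. if i \<in> insert d D then f i (g i) else z i))"
    unfolding PiE_insert_eq using inj_combinator[OF insert.hyps(2), of "\<lambda>_. J"]
    by (subst sum.reindex) (auto simp only: o_def case_prod_conv intro!: sum.cong)
  finally show ?case .
qed simp

text \<open>If some \<open>a\<close> lies in \<open>D\<close> but not in \<open>B\<close>, toggling
  \<open>a\<close> is a sign-reversing involution of the index set.\<close>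

lemma alternating_sum_supersets:
  assumes "finite D" "B \<subseteq> D"
  shows "(\<Sum>D'\<in>{D'. B \<subseteq> D' \<and> D' \<subseteq> D}. (-1) ^ card (D - D')) = (if B = D then 1 else (0::real))"
proof (cases "B = D")
  case True
  then have "{D'. B \<subseteq> D' \<and> D' \<subseteq> D} = {D}" by auto
  then show ?thesis using True by simp
next
  case False
  then obtain a where a: "a \<in> D" "a \<notin> B" using assms by blast
  let ?\<D> = "{D'. B \<subseteq> D' \<and> D' \<subseteq> D}"
  let ?t = "\<lambda>D'. if a \<in> D' then D' - {a} else insert a D'"
  have "(-1) ^ card (D - ?t D') = - ((-1 :: real) ^ card (D - D'))" if "D' \<in> ?\<D>" for D'
  proof (cases "a \<in> D'")
    case True
    then have "D - ?t D' = insert a (D - D')" using a by auto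
    then show ?thesis using True assms(1) by simp
  next
    case False
    then have "D - D' = insert a (D - ?t D')" using a by auto
    then have "card (D - D') = Suc (card (D - ?t D'))"
      using False assms(1) by (simp only: card_insert_disjoint finite_Diff if_False Diff_iff insert_iff not_True_eq_False simp_thms)
    then show ?thesis by simp
  qed
  then have "(\<Sum>D'\<in>?\<D>. (-1 :: real) ^ card (D - ?t D')) = - (\<Sum>D'\<in>?\<D>. (-1) ^ card (D - D'))"
    by (simp add: sum_negf[symmetric])
  moreover have "(\<Sum>D'\<in>?\<D>. (-1 :: real) ^ card (D - ?t D')) = (\<Sum>D'\<in>?\<D>. (-1) ^ card (D - D'))"
    by (rule sum.reindex_bij_witness[of _ ?t ?t]) (use a in auto)
  ultimately show ?thesis using False by simp
qed

text \<open>Permutations in extensional form, so that they are a finite part of the choice functions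
  occurring in \<open>mlin_expand\<close>.\<close>

definition bijections :: "nat set \<Rightarrow> (nat \<Rightarrow> nat) set" where
  "bijections D = {g \<in> D \<rightarrow>\<^sub>E D. g ` D = D}"

lemma finite_bijections: "finite D \<Longrightarrow> finite (bijections D)"
  unfolding bijections_def by (auto intro: finite_subset[OF _ finite_PiE[of D "\<lambda>_. D"]])

lemma bijections_bij: "finite D \<Longrightarrow> g \<in> bijections D \<Longrightarrow> bij_betw g D D"
  by (auto simp: bijections_def bij_betw_def eq_card_imp_inj_on)

lemma bijections_card: "finite D \<Longrightarrow> card (bijections D) > 0"
proof -
  assume "finite D"
  moreover have "restrict id D \<in> bijections D" by (auto simp: bijections_def)
  ultimately show ?thesis using finite_bijections card_gt_0_iff by blast
qed

text \<open>After expansion and exchange of the sums, a choice function \<open>g\<close> receives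
  the alternating sum over the sets between its image and \<open>D\<close>. This vanishes unless
  \<open>g\<close> is onto, so exactly the permutations survive.\<close>

lemma mlin_polarization:
  assumes A: "mlin k A" and D: "D \<subseteq> {..<k}"
  shows "(\<Sum>D'\<in>Pow D. (-1) ^ card (D - D') *\<^sub>R A (\<lambda>i. if i \<in> D then \<Sum>j\<in>D'. x j else z i))
    = (\<Sum>g\<in>bijections D. A (\<lambda>i. if i \<in> D then x (g i) else z i))"
proof -
  have finD: "finite D" using D finite_subset by blast
  let ?a = "\<lambda>g. A (\<lambda>i. if i \<in> D then x (g i) else z i)"
  have "(\<Sum>D'\<in>Pow D. (-1) ^ card (D - D') *\<^sub>R A (\<lambda>i. if i \<in> D then \<Sum>j\<in>D'. x j else z i))
      = (\<Sum>D'\<in>Pow D. \<Sum>g\<in>D \<rightarrow>\<^sub>E D'. (-1) ^ card (D - D') *\<^sub>R ?a g)"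
    using mlin_expand[OF A finD D, of _ "\<lambda>_ j. x j" z] finite_subset[OF _ finD]
    by (intro sum.cong refl) (simp add: scaleR_sum_right)
  also have "\<dots> = (\<Sum>D'\<in>Pow D. \<Sum>g\<in>{g \<in> D \<rightarrow>\<^sub>E D. g ` D \<subseteq> D'}. (-1) ^ card (D - D') *\<^sub>R ?a g)"
    by (intro sum.cong refl) (auto simp: PiE_def Pi_def)
  also have "\<dots> = (\<Sum>g\<in>D \<rightarrow>\<^sub>E D. \<Sum>D'\<in>{D' \<in> Pow D. g ` D \<subseteq> D'}. (-1) ^ card (D - D') *\<^sub>R ?a g)"
    using finD by (intro sum.swap_restrict finite_PiE) auto
  also have "\<dots> = (\<Sum>g\<in>D \<rightarrow>\<^sub>E D. (if g ` D = D then 1 else 0) *\<^sub>R ?a g)"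
  proof (intro sum.cong refl)
    fix g assume "g \<in> D \<rightarrow>\<^sub>E D"
    then have "g ` D \<subseteq> D" by auto
    moreover have "{D' \<in> Pow D. g ` D \<subseteq> D'} = {D'. g ` D \<subseteq> D' \<and> D' \<subseteq> D}" by auto
    ultimately show "(\<Sum>D'\<in>{D' \<in> Pow D. g ` D \<subseteq> D'}. (-1) ^ card (D - D') *\<^sub>R ?a g)
        = (if g ` D = D then 1 else 0) *\<^sub>R ?a g"
      unfolding scaleR_sum_left[symmetric] using alternating_sum_supersets[OF finD] by simp
  qed
  also have "\<dots> = (\<Sum>g\<in>bijections D. ?a g)"
    unfolding bijections_def using finD
    by (intro sum.mono_neutral_cong_right finite_PiE) auto
  finally show ?thesis .
qed

text \<open>The usual factor \<open>1 / k!\<close> is left out, so no division occurs; the diagonal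
  is multiplied by the number of permutations, which is at least 1.\<close>

definition symmetrization :: "nat \<Rightarrow> ((nat \<Rightarrow> 'e) \<Rightarrow> 'f) \<Rightarrow> (nat \<Rightarrow> 'e) \<Rightarrow> 'f" where
  "symmetrization k A x = (\<Sum>g\<in>bijections {..<k}. A (\<lambda>i. x (g i)))"

lemma mlin_symmetrization:
  assumes "mlin k A" shows "mlin k (symmetrization k A)"
  unfolding symmetrization_def[abs_def]
proof (rule mlin_sum)
  fix g assume "g \<in> bijections {..<k}"
  then have g: "bij_betw g {..<k} {..<k}" by (rule bijections_bij[rotated]) simp
  obtain C where C: "C \<ge> 0" "\<And>x. norm (A x) \<le> C * (\<Prod>i<k. norm (x i))"
    using multilin_bound[OF assms] by blast
  have upd: "A (\<lambda>l. (x(i := a)) (g l)) = A ((\<lambda>l. x (g l))(inv_into {..<k} g i := a))"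
    if "i < k" for x i a
  proof (rule multilin_cong[OF assms])
    fix l assume "l < k"
    then show "(x(i := a)) (g l) = ((\<lambda>l. x (g l))(inv_into {..<k} g i := a)) l"
      using g that by (auto simp: bij_betw_def f_inv_into_f)
  qed
  have inv: "inv_into {..<k} g i < k" if "i < k" for i
    using g that inv_into_into[of i g "{..<k}"] by (auto simp: bij_betw_def)
  show "mlin k (\<lambda>x. A (\<lambda>i. x (g i)))"
  proof (rule mlinI)
    show "norm (A (\<lambda>i. x (g i))) \<le> C * (\<Prod>i<k. norm (x i))" for x
      using C(2)[of "\<lambda>i. x (g i)"] prod.reindex_bij_betw[OF g, of "\<lambda>i. norm (x i)"] by simp
    show "A (\<lambda>i. x (g i)) = A (\<lambda>i. y (g i))" if "\<And>i. i < k \<Longrightarrow> x i = y i" for x y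
      using that g by (intro multilin_cong[OF assms]) (auto simp: bij_betw_def)
  qed (simp_all only: upd inv C multilin_add[OF assms] multilin_scale[OF assms])
qed

lemma symmetrization_invariant:
  assumes A: "mlin k A" and h: "bij_betw h {..<k} {..<k}"
  shows "symmetrization k A (\<lambda>i. x (h i)) = symmetrization k A x"
  unfolding symmetrization_def
proof (rule sum.reindex_bij_witness[of _ "\<lambda>g. restrict (inv_into {..<k} h \<circ> g) {..<k}"
      "\<lambda>g. restrict (h \<circ> g) {..<k}"])
  let ?i = "inv_into {..<k} h"
  have i: "bij_betw ?i {..<k} {..<k}" by (rule bij_betw_inv_into[OF h])
  have hi: "h (?i l) = l" "?i (h l) = l" if "l < k" for l
    using h that by (auto simp: bij_betw_def f_inv_into_f)
  have mem: "g l < k" if "g \<in> bijections {..<k}" "l < k" for g l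
    using that by (auto simp: bijections_def PiE_def Pi_def)
  have comp: "restrict (f \<circ> g) {..<k} \<in> bijections {..<k}"
    if "bij_betw f {..<k} {..<k}" "g \<in> bijections {..<k}" for f g
  proof -
    have "f ` g ` {..<k} = {..<k}" using that by (auto simp: bijections_def bij_betw_def)
    then have "(\<lambda>l. f (g l)) ` {..<k} = {..<k}" by (simp add: image_image)
    then show ?thesis by (auto simp: bijections_def)
  qed
  fix g assume g: "g \<in> bijections {..<k}"
  have ext: "g \<in> extensional {..<k}" using g by (auto simp: bijections_def PiE_def)
  show "restrict (?i \<circ> restrict (h \<circ> g) {..<k}) {..<k} = g"
    "restrict (h \<circ> restrict (?i \<circ> g) {..<k}) {..<k} = g"
    using mem[OF g] hi by (auto intro!: extensionalityI[OF _ ext])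
  show "restrict (h \<circ> g) {..<k} \<in> bijections {..<k}" "restrict (?i \<circ> g) {..<k} \<in> bijections {..<k}"
    by (intro comp h i g)+
  show "A (\<lambda>l. x ((restrict (h \<circ> g) {..<k}) l)) = A (\<lambda>l. x (h (g l)))"
    by (rule multilin_cong[OF A]) auto
qed

lemma symmetrization_diag:
  "symmetrization k A (\<lambda>_. x) = real (card (bijections {..<k})) *\<^sub>R A (\<lambda>_. x)"
  by (simp add: symmetrization_def sum_constant_scaleR)

lemma symmetrization_polarization:
  assumes "mlin k A"
  shows "symmetrization k A x = (\<Sum>D\<in>Pow {..<k}. (-1) ^ card ({..<k} - D) *\<^sub>R A (\<lambda>_. \<Sum>j\<in>D. x j))"
proof -
  have "A (\<lambda>i. if i \<in> {..<k} then y i else 0) = A y" for y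
    by (rule multilin_cong[OF assms]) simp
  then show ?thesis
    using mlin_polarization[OF assms order_refl, of x "\<lambda>_. 0"] by (simp add: symmetrization_def)
qed

end

section \<open>Families of polynomials indexed by bounded sequences, and Phillips' argument\<close>

context banach_pair
begin

lemma mlin_slot_operator:
  assumes "mlin k A" "i < k"
  shows "bounded_operator scaleE scaleF (\<lambda>t. A (z(i := t)))"
proof -
  obtain C where C: "C \<ge> 0" "\<And>x. norm (A x) \<le> C * (\<Prod>i<k. norm (x i))"
    using multilin_bound[OF assms(1)] by blast
  have "norm (A (z(i := t))) \<le> (C * (\<Prod>l\<in>{..<k} - {i}. norm (z l))) * norm t" for t
  proof -
    have "(\<Prod>l<k. norm ((z(i := t)) l)) = norm t * (\<Prod>l\<in>{..<k} - {i}. norm (z l))"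
      using assms(2) by (subst prod.remove[of _ i]) (auto intro!: prod.cong)
    then show ?thesis using C(2)[of "z(i := t)"] by (simp add: mult_ac)
  qed
  then show ?thesis
    by (rule bounded_operatorI[OF E.banach_space_over_axioms F.banach_space_over_axioms
        multilin_add[OF assms] multilin_scale[OF assms]])
qed

lemma wb_polys_sum:
  assumes "\<And>n. n \<in> N \<Longrightarrow> P n \<in> wb_polys scaleE scaleF k"
  shows "(\<lambda>x. \<Sum>n\<in>N. P n x) \<in> wb_polys scaleE scaleF k"
  using assms
proof (induction N rule: infinite_finite_induct)
  case (insert n N)
  then show ?case using wb_polys_add[of "P n" k "\<lambda>x. \<Sum>n\<in>N. P n x"] by (simp add: plus_fun_def)
qed (use wb_polys_zero in \<open>simp_all add: zero_fun_def\<close>)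

text \<open>The common shape of both constructions \<open>\<Phi>\<close>: a bounded linear map from
  \<open>ell_infinity\<close> to the polynomials that sends finitely supported sequences to weakly
  continuous ones. Phillips' argument uses nothing else about \<open>\<Phi>\<close>.\<close>

definition poly_family :: "nat \<Rightarrow> ((nat \<Rightarrow> 'k) \<Rightarrow> 'e \<Rightarrow> 'f) \<Rightarrow> bool" where
  "poly_family k \<Phi> \<longleftrightarrow>
     (\<forall>\<xi>. bounded (range \<xi>) \<longrightarrow> \<Phi> \<xi> \<in> hom_polys scaleE scaleF k) \<and>
     (\<forall>\<xi> \<zeta>. bounded (range \<xi>) \<longrightarrow> bounded (range \<zeta>) \<longrightarrow> \<Phi> (\<lambda>n. \<xi> n + \<zeta> n) = \<Phi> \<xi> + \<Phi> \<zeta>) \<and>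
     (\<forall>c \<xi>. bounded (range \<xi>) \<longrightarrow> \<Phi> (\<lambda>n. c * \<xi> n) = (\<lambda>x. scaleF c (\<Phi> \<xi> x))) \<and>
     (\<exists>C\<ge>0. \<forall>\<xi>. (\<forall>n. norm (\<xi> n) \<le> 1) \<longrightarrow> pnorm (\<Phi> \<xi>) \<le> C) \<and>
     (\<forall>\<xi>. finite {n. \<xi> n \<noteq> 0} \<longrightarrow> \<Phi> \<xi> \<in> wb_polys scaleE scaleF k)"

lemma poly_familyD:
  assumes "poly_family k \<Phi>"
  shows poly_family_hom: "bounded (range \<xi>) \<Longrightarrow> \<Phi> \<xi> \<in> hom_polys scaleE scaleF k"
    and poly_family_add: "bounded (range \<xi>) \<Longrightarrow> bounded (range \<zeta>) \<Longrightarrow>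
      \<Phi> (\<lambda>n. \<xi> n + \<zeta> n) = \<Phi> \<xi> + \<Phi> \<zeta>"
    and poly_family_scale: "bounded (range \<xi>) \<Longrightarrow> \<Phi> (\<lambda>n. c * \<xi> n) = (\<lambda>x. scaleF c (\<Phi> \<xi> x))"
    and poly_family_finite: "finite {n. \<xi> n \<noteq> 0} \<Longrightarrow> \<Phi> \<xi> \<in> wb_polys scaleE scaleF k"
  using assms unfolding poly_family_def by blast+

lemma poly_family_bound:
  assumes "poly_family k \<Phi>"
  obtains C where "C \<ge> 0" "\<And>\<xi>. (\<forall>n. norm (\<xi> n) \<le> 1) \<Longrightarrow> pnorm (\<Phi> \<xi>) \<le> C"
  using assms unfolding poly_family_def by blast

lemma poly_space_simps:
  "pts (poly_space scaleE scaleF k) = hom_polys scaleE scaleF k"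
  "scl (poly_space scaleE scaleF k) = (\<lambda>c P x. scaleF c (P x))"
  "nrm (poly_space scaleE scaleF k) = pnorm"
  by (simp_all add: poly_space_def pnorm_def[abs_def])

lemma bounded_indicator: "bounded (range (indicator M :: nat \<Rightarrow> 'k))"
  by (rule boundedI[of _ 1]) (auto simp: indicator_def)

text \<open>Phillips' argument: for a projection \<open>\<pi>\<close> onto the weakly continuous polynomials, the functionals
  \<open>\<xi> \<mapsto> \<psi>\<^sub>m ((\<pi> (\<Phi> \<xi>) - \<Phi> \<xi>) (z\<^sub>m))\<close> vanish on finitely supported sequences, hence all of them
  vanish at the indicator of some infinite \<open>M\<close>, taken from an uncountable almost disjoint family.\<close>

lemma not_complemented:
  assumes k: "k > 0" and \<Phi>: "poly_family k \<Phi>"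
    and \<psi>: "\<And>m :: nat. bounded_operator scaleF (*) (\<psi> m)"
    and contra: "\<And>M Q. infinite M \<Longrightarrow> Q \<in> wb_polys scaleE scaleF k \<Longrightarrow>
      (\<And>m. \<psi> m (Q (z m)) = \<psi> m (\<Phi> (indicator M) (z m))) \<Longrightarrow> False"
  shows "\<not> complemented_in (wb_polys scaleE scaleF k) (poly_space scaleE scaleF k)"
proof
  let ?H = "hom_polys scaleE scaleF k" and ?W = "wb_polys scaleE scaleF k"
  assume "complemented_in ?W (poly_space scaleE scaleF k)"
  then obtain \<pi> K where lin: "linear_between (poly_space scaleE scaleF k) (poly_space scaleE scaleF k) \<pi>"
    and K: "\<And>P. P \<in> ?H \<Longrightarrow> pnorm (\<pi> P) \<le> K * pnorm P"
    and idem: "\<And>P. P \<in> ?H \<Longrightarrow> \<pi> (\<pi> P) = \<pi> P" and img: "\<pi> ` ?H = ?W"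
    unfolding complemented_in_def by (auto simp: poly_space_simps)
  have \<pi>_add: "\<pi> (P + Q) = \<pi> P + \<pi> Q" if "P \<in> ?H" "Q \<in> ?H" for P Q
    using lin that by (simp add: linear_between_def poly_space_simps)
  have \<pi>_scale: "\<pi> (\<lambda>x. scaleF c (P x)) = (\<lambda>x. scaleF c (\<pi> P x))" if "P \<in> ?H" for P c
    using lin that by (simp add: linear_between_def poly_space_simps)
  have \<pi>_W: "\<pi> P \<in> ?W" if "P \<in> ?H" for P using img that by blast
  have \<pi>_id: "\<pi> P = P" if P: "P \<in> ?W" for P
  proof -
    obtain Q where "Q \<in> ?H" "P = \<pi> Q" using P img by blast
    then show ?thesis using idem by simp
  qed
  obtain C where C: "C \<ge> 0" "\<And>\<xi>. (\<forall>n. norm (\<xi> n) \<le> 1) \<Longrightarrow> pnorm (\<Phi> \<xi>) \<le> C"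
    using poly_family_bound[OF \<Phi>] by metis
  define f where "f m \<xi> = \<psi> m (\<Phi> \<xi> (z m) - \<pi> (\<Phi> \<xi>) (z m))" for m \<xi>
  obtain M where M: "infinite M" "\<And>m. f m (indicator M) = 0"
  proof (rule functionals_vanish_on_indicator[of f])
    fix m and \<xi> \<zeta> :: "nat \<Rightarrow> 'k" assume b: "bounded (range \<xi>)" "bounded (range \<zeta>)"
    have "\<Phi> (\<lambda>n. \<xi> n + \<zeta> n) (z m) - \<pi> (\<Phi> (\<lambda>n. \<xi> n + \<zeta> n)) (z m)
        = (\<Phi> \<xi> (z m) - \<pi> (\<Phi> \<xi>) (z m)) + (\<Phi> \<zeta> (z m) - \<pi> (\<Phi> \<zeta>) (z m))"
      using b by (simp add: poly_family_add[OF \<Phi>] \<pi>_add poly_family_hom[OF \<Phi>])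
    then show "f m (\<lambda>n. \<xi> n + \<zeta> n) = f m \<xi> + f m \<zeta>"
      by (simp only: f_def bounded_operator_add[OF \<psi>])
  next
    fix m c and \<xi> :: "nat \<Rightarrow> 'k" assume b: "bounded (range \<xi>)"
    have "\<Phi> (\<lambda>n. c * \<xi> n) (z m) - \<pi> (\<Phi> (\<lambda>n. c * \<xi> n)) (z m)
        = scaleF c (\<Phi> \<xi> (z m) - \<pi> (\<Phi> \<xi>) (z m))"
      using b by (simp add: poly_family_scale[OF \<Phi>] \<pi>_scale poly_family_hom[OF \<Phi>] F.scale_right_diff_distrib)
    then show "f m (\<lambda>n. c * \<xi> n) = c * f m \<xi>"
      by (simp only: f_def bounded_operator_scale[OF \<psi>])
  next
    fix m
    obtain D where D: "D > 0" "\<And>y. norm (\<psi> m y) \<le> D * norm y" using bounded_operator_bound[OF \<psi>] by blast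
    show "\<exists>C. \<forall>\<xi>. (\<forall>n. norm (\<xi> n) \<le> 1) \<longrightarrow> norm (f m \<xi>) \<le> C"
    proof (intro exI allI impI)
      fix \<xi> :: "nat \<Rightarrow> 'k" assume \<xi>: "\<forall>n. norm (\<xi> n) \<le> 1"
      then have h: "\<Phi> \<xi> \<in> ?H" by (intro poly_family_hom[OF \<Phi>] boundedI[of _ 1]) auto
      have p: "pnorm (\<Phi> \<xi>) \<le> C" by (rule C(2)[OF \<xi>])
      have "K * pnorm (\<Phi> \<xi>) \<le> \<bar>K\<bar> * C"
        using p pnorm_nonneg[OF h] by (intro mult_mono) auto
      then have p': "pnorm (\<pi> (\<Phi> \<xi>)) \<le> \<bar>K\<bar> * C" using K[OF h] by simp
      have "norm (\<Phi> \<xi> (z m)) \<le> C * norm (z m) ^ k"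
        using norm_le_pnorm_power[OF h k, of "z m"] mult_right_mono[OF p, of "norm (z m) ^ k"] by simp
      moreover have "norm (\<pi> (\<Phi> \<xi>) (z m)) \<le> \<bar>K\<bar> * C * norm (z m) ^ k"
        using norm_le_pnorm_power[OF wb_polys_hom[OF \<pi>_W[OF h]] k, of "z m"]
          mult_right_mono[OF p', of "norm (z m) ^ k"] by simp
      ultimately have "norm (\<Phi> \<xi> (z m) - \<pi> (\<Phi> \<xi>) (z m))
          \<le> C * norm (z m) ^ k + \<bar>K\<bar> * C * norm (z m) ^ k"
        using norm_triangle_ineq4[of "\<Phi> \<xi> (z m)" "\<pi> (\<Phi> \<xi>) (z m)"] by linarith
      then have "D * norm (\<Phi> \<xi> (z m) - \<pi> (\<Phi> \<xi>) (z m))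
          \<le> D * (C * norm (z m) ^ k + \<bar>K\<bar> * C * norm (z m) ^ k)"
        using D(1) by (intro mult_left_mono) auto
      then show "norm (f m \<xi>) \<le> D * (C * norm (z m) ^ k + \<bar>K\<bar> * C * norm (z m) ^ k)"
        unfolding f_def using D(2) order_trans by blast
    qed
  next
    fix m and \<xi> :: "nat \<Rightarrow> 'k" assume "finite {n. \<xi> n \<noteq> 0}"
    then have "\<pi> (\<Phi> \<xi>) = \<Phi> \<xi>" by (intro \<pi>_id poly_family_finite[OF \<Phi>])
    then show "f m \<xi> = 0" by (simp add: f_def bounded_operator_zero[OF \<psi>])
  qed (rule that)
  have "\<psi> m (\<pi> (\<Phi> (indicator M)) (z m)) = \<psi> m (\<Phi> (indicator M) (z m))" for m
    using M(2)[of m] by (simp add: f_def bounded_operator_diff[OF \<psi>])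
  then show False
    by (intro contra[OF M(1) \<pi>_W[OF poly_family_hom[OF \<Phi> bounded_indicator]]]) auto
qed

lemma weak_limit_wb:
  assumes "P \<in> wb_polys scaleE scaleF k" "\<And>p. norm (x p) \<le> r" "norm x0 \<le> r"
    and "\<And>\<phi>. bounded_operator scaleE (*) \<phi> \<Longrightarrow> (\<lambda>p. \<phi> (x p)) \<longlonglongrightarrow> \<phi> x0"
  shows "(\<lambda>p. P (x p)) \<longlonglongrightarrow> P x0"
proof -
  have "filterlim x (weak_at scaleE r x0) sequentially"
    unfolding filterlim_iff
  proof (intro allI impI)
    fix Q assume "eventually Q (weak_at scaleE r x0)"
    then obtain \<Phi> \<eta> where \<Phi>: "finite \<Phi>" "\<And>\<phi>. \<phi> \<in> \<Phi> \<Longrightarrow> bounded_operator scaleE (*) \<phi>" "\<eta> > 0"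
      "\<And>x. norm x \<le> r \<Longrightarrow> \<forall>\<phi>\<in>\<Phi>. norm (\<phi> x - \<phi> x0) < \<eta> \<Longrightarrow> Q x"
      unfolding eventually_weak_at by blast
    have "\<forall>\<^sub>F p in sequentially. \<forall>\<phi>\<in>\<Phi>. norm (\<phi> (x p) - \<phi> x0) < \<eta>"
      using \<Phi>(1)
    proof (rule eventually_ball_finite, intro ballI)
      fix \<phi> assume "\<phi> \<in> \<Phi>"
      then show "\<forall>\<^sub>F p in sequentially. norm (\<phi> (x p) - \<phi> x0) < \<eta>"
        using tendstoD[OF assms(4)[OF \<Phi>(2)] \<Phi>(3)] by (simp add: dist_norm)
    qed
    then show "\<forall>\<^sub>F p in sequentially. Q (x p)"
      by eventually_elim (use \<Phi>(4) assms(2) in auto)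
  qed
  moreover have "(P \<longlongrightarrow> P x0) (weak_at scaleE r x0)" using assms(1,3) by (simp add: wb_polys_iff)
  ultimately show ?thesis by (rule filterlim_compose[rotated])
qed

end

locale fd_pair = banach_pair scaleE scaleF + X: fd_expansion scaleE \<A>
  for scaleE :: "'k::real_or_complex \<Rightarrow> 'e::banach \<Rightarrow> 'e"
    and scaleF :: "'k \<Rightarrow> 'f::banach \<Rightarrow> 'f" and \<A> :: "nat \<Rightarrow> 'e \<Rightarrow> 'e"
begin

subsection \<open>Blocks of a polynomial that is not weakly continuous\<close>

text \<open>The jump of the polynomial at \<open>x0\<close> happens frequently in the weak filter,
  whereas the finitely many truncations with \<open>n \<le> N\<close> are eventually close to their
  values at \<open>x0\<close>. A frequent event meets an eventual one, and this gives
  \<open>x N\<close>.\<close>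

lemma hump_points:
  assumes A: "mlin k A" and i: "i < k"
    and notW: "(\<lambda>x. A (\<lambda>_. x)) \<notin> wb_polys scaleE scaleF k"
    and W: "\<And>T. E.finite_rank T \<Longrightarrow> (\<lambda>x. A ((\<lambda>_. x)(i := T x))) \<in> wb_polys scaleE scaleF k"
  obtains x x0 r e where "e > 0" "\<And>N. norm (x N) \<le> r" "norm x0 \<le> r"
    "\<And>N. e \<le> norm (A (\<lambda>_. x N) - A (\<lambda>_. x0))"
    "\<And>N n. n \<le> N \<Longrightarrow> norm (A ((\<lambda>_. x N)(i := X.S n (x N))) - A ((\<lambda>_. x0)(i := X.S n x0))) < 1 / real (Suc N)"
    "\<And>N n. n \<le> N \<Longrightarrow> norm (X.S n (x N) - X.S n x0) < 1 / real (Suc N)"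
proof -
  let ?P = "\<lambda>x. A (\<lambda>_. x)" and ?Q = "\<lambda>n x. A ((\<lambda>_. x)(i := X.S n x))"
  obtain r x0 where x0: "norm x0 \<le> r" and nt: "\<not> (?P \<longlongrightarrow> ?P x0) (weak_at scaleE r x0)"
    using notW mlin_diag[OF A] unfolding wb_polys_iff by blast
  then obtain e where e: "e > 0" "\<exists>\<^sub>F x in weak_at scaleE r x0. e \<le> norm (?P x - ?P x0)"
    unfolding tendsto_iff frequently_def by (auto simp: dist_norm not_le)
  have "\<exists>x. norm x \<le> r \<and> e \<le> norm (?P x - ?P x0) \<and>
      (\<forall>n\<le>N. norm (?Q n x - ?Q n x0) < 1 / real (Suc N) \<and> norm (X.S n x - X.S n x0) < 1 / real (Suc N))" for N
  proof -
    have "\<forall>\<^sub>F x in weak_at scaleE r x0. \<forall>n\<in>{..N}.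
        norm (?Q n x - ?Q n x0) < 1 / real (Suc N) \<and> norm (X.S n x - X.S n x0) < 1 / real (Suc N)"
    proof (intro eventually_ball_finite ballI eventually_conj)
      fix n
      have "(?Q n \<longlongrightarrow> ?Q n x0) (weak_at scaleE r x0)"
        using W[OF X.finite_rank_S[of n]] x0 by (simp add: wb_polys_iff)
      then show "\<forall>\<^sub>F x in weak_at scaleE r x0. norm (?Q n x - ?Q n x0) < 1 / real (Suc N)"
        unfolding tendsto_iff dist_norm by (auto dest: spec[of _ "1 / real (Suc N)"])
      show "\<forall>\<^sub>F x in weak_at scaleE r x0. norm (X.S n x - X.S n x0) < 1 / real (Suc N)"
        using E.finite_rank_weak_tendsto[OF X.finite_rank_S[of n], of x0 r]
        unfolding tendsto_iff dist_norm by (auto dest: spec[of _ "1 / real (Suc N)"])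
    qed auto
    with weak_at_norm_le[of r scaleE x0]
    have "\<forall>\<^sub>F x in weak_at scaleE r x0. norm x \<le> r \<and> (\<forall>n\<in>{..N}.
        norm (?Q n x - ?Q n x0) < 1 / real (Suc N) \<and> norm (X.S n x - X.S n x0) < 1 / real (Suc N))"
      by (rule eventually_conj)
    from frequently_ex[OF frequently_eventually_conj[OF e(2) this]]
    show ?thesis by auto
  qed
  then obtain x where x: "\<And>N. norm (x N) \<le> r" "\<And>N. e \<le> norm (?P (x N) - ?P x0)"
    "\<And>N n. n \<le> N \<Longrightarrow> norm (?Q n (x N) - ?Q n x0) < 1 / real (Suc N)"
    "\<And>N n. n \<le> N \<Longrightarrow> norm (X.S n (x N) - X.S n x0) < 1 / real (Suc N)" by metis
  show ?thesis by (rule that[OF e(1) x(1) x0 x(2-4)])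
qed

text \<open>Truncations in the chosen slot cut the polynomial into blocks \<open>R p\<close>.
  Between \<open>x (t p)\<close> and \<open>x0\<close>, block \<open>p\<close> carries at least half
  of the jump, each earlier block changes little because it is weakly continuous, and the later
  blocks form a small tail by unconditional convergence. The gliding hump makes this uniform over
  all bounded coefficients.\<close>

lemma hump_family:
  assumes "hom_polys scaleE scaleF k \<noteq> wb_polys scaleE scaleF k"
  obtains \<Phi> x x0 r e where "poly_family k \<Phi>" "e > 0" "\<And>p. norm (x p) \<le> r" "norm x0 \<le> r"
    "\<And>m. (\<lambda>p. X.S m (x p)) \<longlonglongrightarrow> X.S m x0"
    "\<And>p. e \<le> norm (\<Phi> (indicator {p}) (x p) - \<Phi> (indicator {p}) x0)"
    "\<And>p \<xi>. \<xi> p = 0 \<Longrightarrow> (\<forall>n. norm (\<xi> n) \<le> 1) \<Longrightarrow> norm (\<Phi> \<xi> (x p) - \<Phi> \<xi> x0) \<le> e / 4"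
proof -
  obtain A i where A: "mlin k A" and i: "i < k" and notW: "(\<lambda>x. A (\<lambda>_. x)) \<notin> wb_polys scaleE scaleF k"
    and W: "\<And>T. E.finite_rank T \<Longrightarrow> (\<lambda>x. A ((\<lambda>_. x)(i := T x))) \<in> wb_polys scaleE scaleF k"
    using exists_slot[OF assms] by blast
  obtain x x0 r e where e: "e > 0" and xr: "\<And>N. norm (x N) \<le> r" "norm x0 \<le> r"
    and eP: "\<And>N. e \<le> norm (A (\<lambda>_. x N) - A (\<lambda>_. x0))"
    and QN: "\<And>N n. n \<le> N \<Longrightarrow> norm (A ((\<lambda>_. x N)(i := X.S n (x N))) - A ((\<lambda>_. x0)(i := X.S n x0))) < 1 / real (Suc N)"
    and SN: "\<And>N n. n \<le> N \<Longrightarrow> norm (X.S n (x N) - X.S n x0) < 1 / real (Suc N)"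
    by (rule hump_points[OF A i notW W]) (assumption, rule that)
  let ?P = "\<lambda>x. A (\<lambda>_. x)" and ?Q = "\<lambda>n x. A ((\<lambda>_. x)(i := X.S n x))"
  let ?s = "\<lambda>y t. A ((\<lambda>_. y)(i := t))"
  have slot: "bounded_operator scaleE scaleF (?s y)" for y by (rule mlin_slot_operator[OF A i])
  have slot_self: "?s y y = ?P y" for y by (intro arg_cong[of _ _ A]) auto
  have Qlim: "(\<lambda>n. ?Q n y) \<longlonglongrightarrow> ?P y" for y
    using bounded_operator_tendsto[OF slot[of y] X.S_tendsto[of y]] by (simp only: slot_self)
  \<comment> \<open>A truncation late enough to recover the polynomial almost completely at both
    points of the jump; it ends the block that starts at \<open>N\<close>.\<close>
  have "\<exists>q>N. norm (?Q q (x N) - ?P (x N)) < e / 8 \<and> norm (?Q q x0 - ?P x0) < e / 8" for N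
  proof -
    have "\<forall>\<^sub>F q in sequentially. norm (?Q q (x N) - ?P (x N)) < e / 8"
      "\<forall>\<^sub>F q in sequentially. norm (?Q q x0 - ?P x0) < e / 8"
      using tendstoD[OF Qlim, of "e / 8"] e by (simp_all add: dist_norm)
    then have "\<forall>\<^sub>F q in sequentially. q > N \<and> norm (?Q q (x N) - ?P (x N)) < e / 8 \<and> norm (?Q q x0 - ?P x0) < e / 8"
      by (intro eventually_conj eventually_gt_at_top)
    then show ?thesis unfolding eventually_sequentially by blast
  qed
  then obtain q where q: "\<And>N. N < q N" "\<And>N. norm (?Q (q N) (x N) - ?P (x N)) < e / 8"
    "\<And>N. norm (?Q (q N) x0 - ?P x0) < e / 8" by metis
  obtain N0 where N0: "1 / real (Suc N0) < e / 8"
    using reals_Archimedean[of "e / 8"] e by (auto simp: inverse_eq_divide)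
  define t where "t p = (q ^^ p) N0" for p
  have tS: "t (Suc p) = q (t p)" for p by (simp add: t_def)
  have mono_t: "strict_mono t" by (rule strict_mono_Suc_iff[THEN iffD2]) (simp add: tS q)
  have tN0: "N0 \<le> t p" for p
    using strict_mono_less_eq[OF mono_t, of 0 p] by (simp add: t_def)
  have tp: "p \<le> t p" for p by (rule strict_mono_imp_increasing[OF mono_t])
  interpret T: multiplier_sequence scaleE "\<lambda>p x. X.S (t (Suc p)) x - X.S (t p) x"
    by (rule X.block_sequence[OF mono_t]) (use strict_mono_less_eq[OF mono_t] in auto)
  define R where "R p y = ?s y (X.S (t (Suc p)) y - X.S (t p) y)" for p y
  have RQ: "R p y = ?Q (t (Suc p)) y - ?Q (t p) y" for p y
    unfolding R_def by (rule bounded_operator_diff[OF slot])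
  define d where "d p l = R p (x (t l)) - R p x0" for p l
  \<comment> \<open>The jump \<open>e\<close> loses three errors below \<open>e / 8\<close>:
    truncation at the end of the block at two points, and the change of the truncation at its start.
    Starting at \<open>N0\<close> makes the last one small.\<close>
  have diag: "e / 2 \<le> norm (d p p)" for p
  proof -
    let ?N = "t p"
    have "norm (?Q ?N (x ?N) - ?Q ?N x0) < e / 8"
    proof -
      have "1 / real (Suc ?N) \<le> 1 / real (Suc N0)" using tN0[of p] by (intro divide_left_mono) auto
      then show ?thesis using QN[of ?N ?N] N0 by linarith
    qed
    moreover have "?P (x ?N) - ?P x0 = d p p - (?Q (q ?N) (x ?N) - ?P (x ?N))
        + (?Q (q ?N) x0 - ?P x0) + (?Q ?N (x ?N) - ?Q ?N x0)"
      by (simp add: d_def RQ tS)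
    then have "norm (?P (x ?N) - ?P x0) \<le> norm (d p p) + norm (?Q (q ?N) (x ?N) - ?P (x ?N))
        + norm (?Q (q ?N) x0 - ?P x0) + norm (?Q ?N (x ?N) - ?Q ?N x0)"
      by (metis (no_types) norm_triangle_mono norm_triangle_ineq4 order_refl)
    ultimately show ?thesis using eP[of ?N] q(2)[of ?N] q(3)[of ?N] e by linarith
  qed
  define u where "u c p l = scaleF (c p) (d p l)" for c p l
  \<comment> \<open>All coefficient sequences in the unit ball enter the gliding hump at once, since
    the subsequence must not depend on \<open>\<xi>\<close>.\<close>
  define \<C> where "\<C> = {c :: nat \<Rightarrow> 'k. \<forall>n. norm (c n) \<le> 1}"
  have col: "\<exists>L. \<forall>l\<ge>L. \<forall>c\<in>\<C>. norm (u c p l) < e'" if e'0: "e' > 0" for p e'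
  proof -
    obtain L0 where L0: "1 / real (Suc L0) < e' / 2"
      using reals_Archimedean[OF half_gt_zero[OF e'0]] unfolding inverse_eq_divide by blast
    have "norm (u c p l) < e'" if l: "l \<ge> max L0 (Suc p)" and c: "c \<in> \<C>" for l c
    proof -
      have "t (Suc p) \<le> t l" "t p \<le> t l" using l strict_mono_less_eq[OF mono_t] by auto
      then have "norm (?Q (t (Suc p)) (x (t l)) - ?Q (t (Suc p)) x0) < 1 / real (Suc (t l))"
        "norm (?Q (t p) (x (t l)) - ?Q (t p) x0) < 1 / real (Suc (t l))" using QN by auto
      moreover have "1 / real (Suc (t l)) \<le> 1 / real (Suc L0)"
        using l tp[of l] by (intro divide_left_mono) auto
      moreover have "d p l = (?Q (t (Suc p)) (x (t l)) - ?Q (t (Suc p)) x0) - (?Q (t p) (x (t l)) - ?Q (t p) x0)"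
        by (simp add: d_def RQ)
      ultimately have "norm (d p l) < e'"
        using L0 norm_triangle_ineq4[of "?Q (t (Suc p)) (x (t l)) - ?Q (t (Suc p)) x0"
            "?Q (t p) (x (t l)) - ?Q (t p) x0"] by simp
      moreover have "norm (u c p l) \<le> 1 * norm (d p l)"
        unfolding u_def F.norm_scale using c by (intro mult_right_mono) (auto simp: \<C>_def)
      ultimately show ?thesis by simp
    qed
    then show ?thesis by blast
  qed
  have sumR: "(\<Sum>p\<in>N. scaleF (c p) (R p y))
      = ?s y (\<Sum>p\<in>N. scaleE (c p) (X.S (t (Suc p)) y - X.S (t p) y))" for N c y
    by (simp only: R_def bounded_operator_sum[OF slot] bounded_operator_scale[OF slot])
  have tailR: "\<exists>L. \<forall>N. finite N \<longrightarrow> N \<subseteq> {L..} \<longrightarrow> (\<forall>c\<in>\<C>. norm (\<Sum>p\<in>N. scaleF (c p) (R p y)) < e')"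
    if e'0: "e' > 0" for y e'
  proof -
    obtain K where K: "K > 0" "\<And>t. norm (?s y t) \<le> K * norm t"
      using bounded_operator_bound[OF slot[of y]] by blast
    have pos: "e' / K > 0" using e'0 K(1) by simp
    obtain L where L: "\<And>N c. finite N \<Longrightarrow> N \<subseteq> {L..} \<Longrightarrow> (\<And>n. n \<in> N \<Longrightarrow> norm (c n) \<le> 1) \<Longrightarrow>
        norm (\<Sum>p\<in>N. scaleE (c p) (X.S (t (Suc p)) y - X.S (t p) y)) < e' / K"
      by (rule E.unconditionally_Cauchy_multiplier[OF T.unconditionally_Cauchy_B[of y] pos])
         (rule that; blast)
    have "norm (\<Sum>p\<in>N. scaleF (c p) (R p y)) < e'" if N: "finite N" "N \<subseteq> {L..}" "c \<in> \<C>" for N c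
    proof -
      have "norm (\<Sum>p\<in>N. scaleE (c p) (X.S (t (Suc p)) y - X.S (t p) y)) < e' / K"
        by (rule L) (use N in \<open>auto simp: \<C>_def\<close>)
      then have "K * norm (\<Sum>p\<in>N. scaleE (c p) (X.S (t (Suc p)) y - X.S (t p) y)) < e'"
        using K(1) by (simp add: field_simps)
      then show ?thesis unfolding sumR using K(2) order_le_less_trans by blast
    qed
    then show ?thesis by blast
  qed
  have tail: "\<exists>L. \<forall>N. finite N \<longrightarrow> N \<subseteq> {L..} \<longrightarrow> (\<forall>c\<in>\<C>. norm (\<Sum>p\<in>N. u c p l) < e')"
    if "e' > 0" for l e'
  proof -
    have e2: "e' / 2 > 0" using that by simp
    obtain L1 where L1: "\<forall>N. finite N \<longrightarrow> N \<subseteq> {L1..} \<longrightarrow> (\<forall>c\<in>\<C>.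
        norm (\<Sum>p\<in>N. scaleF (c p) (R p (x (t l)))) < e' / 2)" using tailR[OF e2] ..
    obtain L2 where L2: "\<forall>N. finite N \<longrightarrow> N \<subseteq> {L2..} \<longrightarrow> (\<forall>c\<in>\<C>.
        norm (\<Sum>p\<in>N. scaleF (c p) (R p x0)) < e' / 2)" using tailR[OF e2] ..
    have "norm (\<Sum>p\<in>N. u c p l) < e'" if N: "finite N" "N \<subseteq> {max L1 L2..}" "c \<in> \<C>" for N c
    proof -
      have "(\<Sum>p\<in>N. u c p l) = (\<Sum>p\<in>N. scaleF (c p) (R p (x (t l)))) - (\<Sum>p\<in>N. scaleF (c p) (R p x0))"
        by (simp add: u_def d_def F.scale_right_diff_distrib sum_subtractf)
      moreover have "N \<subseteq> {L1..}" "N \<subseteq> {L2..}" using N(2) by auto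
      ultimately show ?thesis
        using L1[rule_format, OF N(1) _ N(3)] L2[rule_format, OF N(1) _ N(3)]
          norm_triangle_ineq4[of "\<Sum>p\<in>N. scaleF (c p) (R p (x (t l)))" "\<Sum>p\<in>N. scaleF (c p) (R p x0)"]
        by simp
    qed
    then show ?thesis by blast
  qed
  have e8: "e / 8 > 0" using e by simp
  obtain s :: "nat \<Rightarrow> nat" where s: "strict_mono s" and s': "\<And>p N c. finite N \<Longrightarrow> p \<notin> N \<Longrightarrow> c \<in> \<C> \<Longrightarrow>
      norm (\<Sum>i\<in>N. u c (s i) (s p)) \<le> e / 8"
    by (rule gliding_hump[OF col tail e8]) (assumption, assumption, rule that)
  let ?B = "\<lambda>p x. X.S (t (Suc (s p))) x - X.S (t (s p)) x"
  interpret M: multiplier_sequence scaleE ?B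
  proof (rule X.block_sequence[of "\<lambda>p. t (s p)"])
    show "strict_mono (\<lambda>p. t (s p))" using mono_t s by (simp add: strict_mono_def)
    show "t (s p) \<le> t (Suc (s p))" "t (Suc (s p)) \<le> t (s (Suc p))" for p
      using strict_mono_less_eq[OF mono_t] strict_monoD[OF s, of p "Suc p"] by auto
  qed auto
  define \<Phi> where "\<Phi> \<xi> y = ?s y (M.mult \<xi> y)" for \<xi> y
  have comp: "mlin k (\<lambda>y. A (y(i := M.mult \<xi> (y i))))" if "bounded (range \<xi>)" for \<xi>
    by (rule mlin_compose_slot[OF A M.bounded_operator_mult[OF that] i])
  have \<Phi>_hom: "\<Phi> \<xi> \<in> hom_polys scaleE scaleF k" if "bounded (range \<xi>)" for \<xi>
    unfolding \<Phi>_def[abs_def] using mlin_diag[OF comp[OF that]] by simp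
  have \<Phi>_add: "\<Phi> (\<lambda>n. \<xi> n + \<zeta> n) = \<Phi> \<xi> + \<Phi> \<zeta>" if "bounded (range \<xi>)" "bounded (range \<zeta>)" for \<xi> \<zeta>
    by (auto simp: fun_eq_iff \<Phi>_def M.mult_add[OF that] bounded_operator_add[OF slot])
  have \<Phi>_scale: "\<Phi> (\<lambda>n. c * \<xi> n) = (\<lambda>x. scaleF c (\<Phi> \<xi> x))" if "bounded (range \<xi>)" for c \<xi>
    by (auto simp: fun_eq_iff \<Phi>_def M.mult_scale[OF that] bounded_operator_scale[OF slot])
  have \<Phi>_lim: "(\<lambda>n. \<Sum>p<n. scaleF (\<xi> p) (R (s p) y)) \<longlonglongrightarrow> \<Phi> \<xi> y" if "bounded (range \<xi>)" for \<xi> y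
  proof -
    have "(\<lambda>n. \<Sum>p<n. scaleE (\<xi> p) (?B p y)) \<longlonglongrightarrow> M.mult \<xi> y"
      using M.mult_sums[OF that] by (simp add: sums_def)
    then have "(\<lambda>n. ?s y (\<Sum>p<n. scaleE (\<xi> p) (?B p y))) \<longlonglongrightarrow> \<Phi> \<xi> y"
      unfolding \<Phi>_def by (rule bounded_operator_tendsto[OF slot])
    then show ?thesis
      by (simp only: R_def bounded_operator_sum[OF slot] bounded_operator_scale[OF slot])
  qed
  have single: "\<Phi> (indicator {p}) y = R (s p) y" for p y
  proof -
    have "(\<lambda>n. scaleE (indicator {p} n) (?B n y)) = (\<lambda>n. if n = p then ?B n y else 0)"
      by (auto simp: indicator_def)
    then have "M.mult (indicator {p}) y = ?B p y"
      unfolding M.mult_def using sums_single[of p "\<lambda>n. ?B n y"] by (simp add: sums_unique[symmetric])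
    then show ?thesis by (simp add: \<Phi>_def R_def)
  qed
  have R_W: "R p \<in> wb_polys scaleE scaleF k" for p
  proof -
    have "R p = (\<lambda>y. A ((\<lambda>_. y)(i := X.S (t (Suc p)) y))) - (\<lambda>y. A ((\<lambda>_. y)(i := X.S (t p) y)))"
      by (auto simp: RQ)
    then show ?thesis
      by (simp only:) (intro wb_polys_diff W X.finite_rank_S)
  qed
  have f1: "poly_family k \<Phi>"
    unfolding poly_family_def
  proof (intro conjI allI impI)
    obtain C where C: "C \<ge> 0" "\<And>x. norm (A x) \<le> C * (\<Prod>i<k. norm (x i))"
      using multilin_bound[OF A] by blast
    obtain D where D: "D > 0" "\<And>\<xi> x. (\<And>n. norm (\<xi> n) \<le> 1) \<Longrightarrow> norm (M.mult \<xi> x) \<le> D * norm x"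
      by (rule M.mult_bound) (rule that; blast)
    have "pnorm (\<Phi> \<xi>) \<le> C * (1 * D)" if \<xi>: "\<forall>n. norm (\<xi> n) \<le> 1" for \<xi>
    proof (rule pnorm_le)
      fix y :: 'e assume y: "norm y \<le> 1"
      have "norm (\<Phi> \<xi> y) \<le> C * (\<Prod>l<k. norm (((\<lambda>_. y)(i := M.mult \<xi> y)) l))"
        unfolding \<Phi>_def by (rule C)
      also have "(\<Prod>l<k. norm (((\<lambda>_. y)(i := M.mult \<xi> y)) l)) \<le> 1 ^ (k - 1) * norm (M.mult \<xi> y)"
        using y by (intro prod_norm_upd_le i) auto
      also have "norm (M.mult \<xi> y) \<le> D * norm y" using \<xi> by (intro D(2)) auto
      also have "D * norm y \<le> D" using y D(1) by (simp add: mult_left_le)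
      finally show "norm (\<Phi> \<xi> y) \<le> C * (1 * D)" using C(1) by (simp add: mult_left_mono)
    qed
    then show "\<exists>C\<ge>0. \<forall>\<xi>. (\<forall>n. norm (\<xi> n) \<le> 1) \<longrightarrow> pnorm (\<Phi> \<xi>) \<le> C"
      using C(1) D(1) by (intro exI[of _ "C * (1 * D)"]) auto
  next
    fix \<xi> :: "nat \<Rightarrow> 'k" assume fin: "finite {n. \<xi> n \<noteq> 0}"
    have "bounded (range \<xi>)"
    proof -
      have "range \<xi> \<subseteq> insert 0 (\<xi> ` {n. \<xi> n \<noteq> 0})" by auto
      then have "finite (range \<xi>)" by (rule finite_subset) (simp add: fin)
      then show ?thesis by (rule finite_imp_bounded)
    qed
    obtain n0 where "{n. \<xi> n \<noteq> 0} \<subseteq> {..<n0}" using finite_nat_bounded[OF fin] by blast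
    then have n0: "\<xi> n = 0" if "n \<ge> n0" for n using that by (force simp: subset_iff)
    have "(\<Sum>p<n. scaleF (\<xi> p) (R (s p) y)) = (\<Sum>p<n0. scaleF (\<xi> p) (R (s p) y))" if "n \<ge> n0" for n y
      using that n0 by (intro sum.mono_neutral_right) auto
    then have lim0: "(\<lambda>n. \<Sum>p<n. scaleF (\<xi> p) (R (s p) y)) \<longlonglongrightarrow> (\<Sum>p<n0. scaleF (\<xi> p) (R (s p) y))" for y
      by (intro tendsto_eventually eventually_sequentiallyI[of n0])
    have "\<Phi> \<xi> y = (\<Sum>p<n0. scaleF (\<xi> p) (R (s p) y))" for y
      by (rule LIMSEQ_unique[OF \<Phi>_lim[OF \<open>bounded (range \<xi>)\<close>] lim0])
    then have "\<Phi> \<xi> = (\<lambda>y. \<Sum>p<n0. scaleF (\<xi> p) (R (s p) y))" by auto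
    then show "\<Phi> \<xi> \<in> wb_polys scaleE scaleF k"
      by (simp only:) (intro wb_polys_sum wb_polys_scale R_W)
  qed (auto simp: \<Phi>_hom \<Phi>_add \<Phi>_scale)
  \<comment> \<open>The result is stated with \<open>e / 2\<close> in place of \<open>e\<close>, so
    the off-diagonal bound \<open>e / 8\<close> is a quarter of it.\<close>
  have f2: "e / 2 > 0" using e by simp
  have f3: "norm (x (t (s p))) \<le> r" for p by (rule xr)
  have f4: "(\<lambda>p. X.S m (x (t (s p)))) \<longlonglongrightarrow> X.S m x0" for m
  proof (rule LIMSEQ_I)
    fix e' :: real assume "e' > 0"
    then obtain L0 where L0: "1 / real (Suc L0) < e'"
      using reals_Archimedean[of e'] by (auto simp: inverse_eq_divide)
    have "norm (X.S m (x (t (s p))) - X.S m x0) < e'" if p: "p \<ge> max L0 m" for p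
    proof -
      have tsp: "p \<le> t (s p)" using tp[of "s p"] strict_mono_imp_increasing[OF s, of p] by simp
      then have "1 / real (Suc (t (s p))) \<le> 1 / real (Suc L0)" using p by (intro divide_left_mono) auto
      then show ?thesis using SN[of m "t (s p)"] tsp p L0 by simp
    qed
    then show "\<exists>no. \<forall>n\<ge>no. norm (X.S m (x (t (s n))) - X.S m x0) < e'" by blast
  qed
  have f5: "e / 2 \<le> norm (\<Phi> (indicator {p}) (x (t (s p))) - \<Phi> (indicator {p}) x0)" for p
    using diag[of "s p"] by (simp add: single d_def)
  have f6: "norm (\<Phi> \<xi> (x (t (s p))) - \<Phi> \<xi> x0) \<le> e / 2 / 4"
    if \<xi>: "\<xi> p = 0" "\<forall>n. norm (\<xi> n) \<le> 1" for p \<xi>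
  proof (rule Lim_bounded)
    have b: "bounded (range \<xi>)" using \<xi>(2) by (auto intro!: boundedI[of _ 1])
    show "(\<lambda>n. norm ((\<Sum>l<n. scaleF (\<xi> l) (R (s l) (x (t (s p))))) - (\<Sum>l<n. scaleF (\<xi> l) (R (s l) x0))))
        \<longlonglongrightarrow> norm (\<Phi> \<xi> (x (t (s p))) - \<Phi> \<xi> x0)"
      by (intro tendsto_intros \<Phi>_lim b)
    \<comment> \<open>The gliding hump refers to the blocks before thinning, so \<open>\<xi>\<close>
      is transported along \<open>s\<close> and extended by zero.\<close>
    define c where "c n = (if n \<in> range s then \<xi> (inv s n) else 0)" for n
    have c: "c \<in> \<C>" "c (s l) = \<xi> l" for l
      using \<xi>(2) strict_mono_imp_inj_on[OF s] by (auto simp: c_def \<C>_def inv_f_f)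
    show "\<forall>n\<ge>0. norm ((\<Sum>l<n. scaleF (\<xi> l) (R (s l) (x (t (s p))))) - (\<Sum>l<n. scaleF (\<xi> l) (R (s l) x0))) \<le> e / 2 / 4"
    proof (intro allI impI)
      fix n
      have "(\<Sum>l<n. scaleF (\<xi> l) (R (s l) (x (t (s p))))) - (\<Sum>l<n. scaleF (\<xi> l) (R (s l) x0))
          = (\<Sum>l<n. u c (s l) (s p))"
        by (simp add: u_def d_def c(2) F.scale_right_diff_distrib sum_subtractf)
      also have "\<dots> = (\<Sum>l\<in>{..<n} - {p}. u c (s l) (s p))"
        using \<xi>(1) by (intro sum.mono_neutral_right) (auto simp: u_def c(2))
      also have "norm \<dots> \<le> e / 8" by (rule s') (auto simp: c(1))
      finally show "norm ((\<Sum>l<n. scaleF (\<xi> l) (R (s l) (x (t (s p))))) - (\<Sum>l<n. scaleF (\<xi> l) (R (s l) x0))) \<le> e / 2 / 4"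
        by simp
    qed
  qed
  show ?thesis by (rule that[OF f1 f2 f3 xr(2) f4 f5 f6])
qed

subsection \<open>Shrinking expansions\<close>

text \<open>Equivalently, each functional is the limit of its compositions with the
  \<open>S m\<close> in the norm of the dual space.\<close>

definition shrinking :: bool where
  "shrinking \<longleftrightarrow> (\<forall>\<phi>. bounded_operator scaleE (*) \<phi> \<longrightarrow>
     (\<forall>e>0. \<exists>M. \<forall>m\<ge>M. \<forall>x. norm (\<phi> (x - X.S m x)) \<le> e * norm x))"

text \<open>On a bounded set a functional is uniformly close to its composition with one
  \<open>S M\<close>, and there convergence is known by assumption.\<close>

lemma shrinking_weak_limit:
  assumes shrinking "bounded_operator scaleE (*) \<phi>" "\<And>p. norm (x p) \<le> r"
    and lim: "\<And>m. (\<lambda>p. X.S m (x p)) \<longlonglongrightarrow> X.S m x0"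
  shows "(\<lambda>p. \<phi> (x p)) \<longlonglongrightarrow> \<phi> x0"
proof (rule LIMSEQ_I)
  fix e :: real assume e: "e > 0"
  define D where "D = r + norm x0 + 1"
  have D: "D > 0" using order_trans[OF norm_ge_zero assms(3)[of 0]] by (simp add: D_def add_nonneg_pos)
  have xD: "norm (x p - x0) \<le> D" for p
    using norm_triangle_ineq4[of "x p" x0] assms(3)[of p] by (simp add: D_def)
  obtain M where M: "\<And>x. norm (\<phi> (x - X.S M x)) \<le> (e / (2 * D)) * norm x"
    using assms(1,2) e D unfolding shrinking_def
    by (metis order_refl divide_pos_pos mult_pos_pos zero_less_numeral)
  have "(\<lambda>p. \<phi> (X.S M (x p))) \<longlonglongrightarrow> \<phi> (X.S M x0)" by (rule bounded_operator_tendsto[OF assms(2) lim])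
  then obtain no where no: "\<And>p. p \<ge> no \<Longrightarrow> norm (\<phi> (X.S M (x p)) - \<phi> (X.S M x0)) < e / 2"
    using LIMSEQ_D[of _ _ "e / 2"] e by (metis half_gt_zero)
  have "norm (\<phi> (x p) - \<phi> x0) < e" if "p \<ge> no" for p
  proof -
    have "\<phi> (x p) - \<phi> x0 = \<phi> ((x p - x0) - X.S M (x p - x0)) + (\<phi> (X.S M (x p)) - \<phi> (X.S M x0))"
      by (simp add: bounded_operator_diff[OF assms(2)] bounded_operator_diff[OF X.bounded_operator_S])
    also have "norm \<dots> \<le> norm (\<phi> ((x p - x0) - X.S M (x p - x0))) + norm (\<phi> (X.S M (x p)) - \<phi> (X.S M x0))"
      by (rule norm_triangle_ineq)
    also have "norm (\<phi> ((x p - x0) - X.S M (x p - x0))) \<le> (e / (2 * D)) * norm (x p - x0)" by (rule M)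
    also have "\<dots> \<le> (e / (2 * D)) * D" using xD e D by (intro mult_left_mono) auto
    also have "(e / (2 * D)) * D = e / 2" using D by simp
    finally show ?thesis using no[OF that] by simp
  qed
  then show "\<exists>no. \<forall>p\<ge>no. norm (\<phi> (x p) - \<phi> x0) < e" by blast
qed

text \<open>Let \<open>\<psi> p\<close> norm the jump of block \<open>p\<close>. A polynomial
  \<open>Q\<close> that agrees with \<open>\<Phi> (indicator M)\<close> under these tests jumps, for
  \<open>p\<close> in \<open>M\<close>, by at least \<open>e - 2 * (e / 4)\<close> as seen by
  \<open>\<psi> p\<close>; but weak convergence of \<open>x p\<close> to \<open>x0\<close> makes the
  jump of \<open>Q\<close> small.\<close>

lemma shrinking_not_complemented:
  assumes shrinking "k > 0" "hom_polys scaleE scaleF k \<noteq> wb_polys scaleE scaleF k"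
  shows "\<not> complemented_in (wb_polys scaleE scaleF k) (poly_space scaleE scaleF k)"
proof -
  obtain \<Phi> x x0 r e where \<Phi>: "poly_family k \<Phi>" and e: "e > 0"
    and xr: "\<And>p. norm (x p) \<le> r" "norm x0 \<le> r"
    and S: "\<And>m. (\<lambda>p. X.S m (x p)) \<longlonglongrightarrow> X.S m x0"
    and diag: "\<And>p. e \<le> norm (\<Phi> (indicator {p}) (x p) - \<Phi> (indicator {p}) x0)"
    and off: "\<And>p \<xi>. \<xi> p = 0 \<Longrightarrow> (\<forall>n. norm (\<xi> n) \<le> 1) \<Longrightarrow> norm (\<Phi> \<xi> (x p) - \<Phi> \<xi> x0) \<le> e / 4"
    by (rule hump_family[OF assms(3)]) (rule that)
  let ?v = "\<lambda>p. \<Phi> (indicator {p}) (x p) - \<Phi> (indicator {p}) x0"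
  have "\<exists>\<psi>. bounded_operator scaleF (*) \<psi> \<and> (\<forall>y. norm (\<psi> y) \<le> 2 * norm y) \<and> norm (?v p) \<le> norm (\<psi> (?v p))" for p
    using F.norming_functional[of "?v p"] by metis
  then obtain \<psi> where \<psi>: "\<And>p. bounded_operator scaleF (*) (\<psi> p)" "\<And>p y. norm (\<psi> p y) \<le> 2 * norm y"
    "\<And>p. norm (?v p) \<le> norm (\<psi> p (?v p))" by metis
  \<comment> \<open>Each \<open>\<psi> p\<close> is used at two points: even indices evaluate at
    \<open>x p\<close>, odd ones at \<open>x0\<close>.\<close>
  let ?\<psi> = "\<lambda>m. \<psi> (m div 2)" and ?z = "\<lambda>m. if even m then x (m div 2) else x0"
  show ?thesis
  proof (rule not_complemented[OF assms(2) \<Phi>, of ?\<psi> ?z])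
    fix M Q assume M: "infinite M" and Q: "Q \<in> wb_polys scaleE scaleF k"
      and eq: "\<And>m. ?\<psi> m (Q (?z m)) = ?\<psi> m (\<Phi> (indicator M) (?z m))"
    have "(\<lambda>p. Q (x p)) \<longlonglongrightarrow> Q x0"
      by (rule weak_limit_wb[OF Q xr]) (rule shrinking_weak_limit[OF assms(1) _ xr(1) S])
    then obtain no where no: "\<And>p. p \<ge> no \<Longrightarrow> norm (Q (x p) - Q x0) < e / 8"
      using LIMSEQ_D[of _ _ "e / 8"] e by (metis divide_pos_pos zero_less_numeral)
    obtain p where p: "p \<in> M" "p \<ge> no" using M by (meson infinite_nat_iff_unbounded_le)
    have "\<psi> p (Q (x p) - Q x0) = \<psi> p (\<Phi> (indicator M) (x p) - \<Phi> (indicator M) x0)"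
      using eq[of "2 * p"] eq[of "Suc (2 * p)"] by (simp add: bounded_operator_diff[OF \<psi>(1)])
    also have "\<Phi> (indicator M) = \<Phi> (indicator {p}) + \<Phi> (indicator (M - {p}))"
    proof -
      have "(indicator M :: nat \<Rightarrow> 'k) = (\<lambda>n. indicator {p} n + indicator (M - {p}) n)"
        using p(1) by (auto simp: indicator_def)
      then show ?thesis using poly_family_add[OF \<Phi> bounded_indicator bounded_indicator] by simp
    qed
    also have "(\<Phi> (indicator {p}) + \<Phi> (indicator (M - {p}))) (x p) - (\<Phi> (indicator {p}) + \<Phi> (indicator (M - {p}))) x0
        = ?v p + (\<Phi> (indicator (M - {p})) (x p) - \<Phi> (indicator (M - {p})) x0)" by simp
    finally have \<psi>_eq: "\<psi> p (Q (x p) - Q x0)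
        = \<psi> p (?v p) + \<psi> p (\<Phi> (indicator (M - {p})) (x p) - \<Phi> (indicator (M - {p})) x0)"
      by (simp only: bounded_operator_add[OF \<psi>(1)])
    have "norm (\<psi> p (\<Phi> (indicator (M - {p})) (x p) - \<Phi> (indicator (M - {p})) x0)) \<le> 2 * (e / 4)"
      by (rule order_trans[OF \<psi>(2)], intro mult_left_mono off) (auto simp: indicator_def)
    moreover have "norm (\<psi> p (Q (x p) - Q x0)) < 2 * (e / 8)"
      by (rule order_le_less_trans[OF \<psi>(2)]) (use no[OF p(2)] in simp)
    moreover have "e \<le> norm (\<psi> p (?v p))" using diag \<psi>(3) order_trans by blast
    ultimately show False
      using norm_triangle_ineq4[of "\<psi> p (Q (x p) - Q x0)"
          "\<psi> p (\<Phi> (indicator (M - {p})) (x p) - \<Phi> (indicator (M - {p})) x0)"] e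
      unfolding \<psi>_eq by simp
  qed (rule \<psi>)
qed

end

subsection \<open>Expansions that are not shrinking\<close>

context fd_pair
begin

text \<open>The functional \<open>\<phi>\<close> that violates shrinking is large on arbitrarily
  late remainders, hence on disjoint finite blocks. Composing it with these blocks gives the
  \<open>R p\<close>; unconditionality makes the sums of their absolute values bounded.\<close>

lemma not_shrinking_blocks:
  assumes "\<not> shrinking"
  obtains R x e K where "e > 0" "K \<ge> 0" "\<And>p :: nat. bounded_operator scaleE (*) (R p)"
    "\<And>p. norm (x p) \<le> 1" "\<And>p. e < norm (R p (x p))"
    "\<And>N y. finite N \<Longrightarrow> (\<Sum>p\<in>N. norm (R p y)) \<le> K * norm y"
proof -
  obtain \<phi> e where \<phi>: "bounded_operator scaleE (*) \<phi>" and e: "e > 0"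
    and big: "\<And>M. \<exists>m\<ge>M. \<exists>x. e * norm x < norm (\<phi> (x - X.S m x))"
    using assms unfolding shrinking_def by (auto simp: not_le)
  have "\<exists>m q x. M \<le> m \<and> m < q \<and> norm x \<le> 1 \<and> e < norm (\<phi> (X.S q x - X.S m x))" for M
  proof -
    obtain m x where m: "m \<ge> M" and x: "e * norm x < norm (\<phi> (x - X.S m x))" using big by blast
    have "x \<noteq> 0"
      using x bounded_operator_zero[OF X.bounded_operator_S] bounded_operator_zero[OF \<phi>] by auto
    define y where "y = scaleE (inverse (of_real (norm x))) x"
    have "y - X.S m y = scaleE (inverse (of_real (norm x))) (x - X.S m x)"
      by (simp add: y_def bounded_operator_scale[OF X.bounded_operator_S] E.scale_right_diff_distrib)
    then have eq: "norm (\<phi> (y - X.S m y)) = norm (\<phi> (x - X.S m x)) / norm x"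
      by (simp add: bounded_operator_scale[OF \<phi>] norm_mult norm_inverse divide_inverse mult.commute)
    have y: "e < norm (\<phi> (y - X.S m y))"
      unfolding eq using x \<open>x \<noteq> 0\<close> by (simp add: pos_less_divide_eq)
    \<comment> \<open>The infinite remainder is cut to a finite block without losing the strict
      lower bound.\<close>
    have "(\<lambda>q. norm (\<phi> (X.S q y - X.S m y))) \<longlonglongrightarrow> norm (\<phi> (y - X.S m y))"
      by (intro tendsto_norm bounded_operator_tendsto[OF \<phi>] tendsto_diff X.S_tendsto tendsto_const)
    from order_tendstoD(1)[OF this y]
    have "\<forall>\<^sub>F q in sequentially. m < q \<and> e < norm (\<phi> (X.S q y - X.S m y))"
      by (intro eventually_conj eventually_gt_at_top)
    then obtain q where "m < q" "e < norm (\<phi> (X.S q y - X.S m y))"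
      unfolding eventually_sequentially by blast
    moreover have "norm y \<le> 1" using \<open>x \<noteq> 0\<close> by (simp add: y_def E.norm_scale norm_inverse)
    ultimately show ?thesis using m by blast
  qed
  then obtain m q x where mq: "\<And>M. M \<le> m M" "\<And>M. m M < q M" and x: "\<And>M. norm (x M) \<le> 1"
    "\<And>M. e < norm (\<phi> (X.S (q M) (x M) - X.S (m M) (x M)))" by metis
  define t where "t p = (q ^^ p) 0" for p
  have tS: "t (Suc p) = q (t p)" for p by (simp add: t_def)
  have mono: "strict_mono t"
    by (rule strict_mono_Suc_iff[THEN iffD2]) (simp add: tS order_le_less_trans[OF mq])
  interpret B: multiplier_sequence scaleE "\<lambda>p y. X.S (q (t p)) y - X.S (m (t p)) y"
    by (rule X.block_sequence[OF mono]) (simp_all add: mq less_imp_le tS)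
  let ?B = "\<lambda>p y. X.S (q (t p)) y - X.S (m (t p)) y"
  obtain C where C: "C > 0" "\<And>N a x. finite N \<Longrightarrow> (\<And>n. n \<in> N \<Longrightarrow> norm (a n) \<le> 1) \<Longrightarrow>
      norm (\<Sum>n\<in>N. scaleE (a n) (?B n x)) \<le> C * norm x"
    by (rule B.multiplier_uniform_bound) (rule that; blast)
  obtain D where D: "D > 0" "\<And>y. norm (\<phi> y) \<le> D * norm y" using bounded_operator_bound[OF \<phi>] by blast
  have bound: "(\<Sum>p\<in>N. norm (\<phi> (?B p y))) \<le> (D * C) * norm y" if N: "finite N" for N y
  proof -
    \<comment> \<open>Coefficients that align the phases, so the sum of absolute values becomes one
      value of \<open>\<phi>\<close> at a multiplier of \<open>y\<close>.\<close>
    define c where "c p = (if \<phi> (?B p y) = 0 then 0 else of_real (norm (\<phi> (?B p y))) / \<phi> (?B p y))" for p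
    have c: "norm (c p) \<le> 1" "c p * \<phi> (?B p y) = of_real (norm (\<phi> (?B p y)))" for p
      by (auto simp: c_def norm_divide)
    have "\<phi> (\<Sum>p\<in>N. scaleE (c p) (?B p y)) = of_real (\<Sum>p\<in>N. norm (\<phi> (?B p y)))"
      by (simp only: bounded_operator_sum[OF \<phi>] bounded_operator_scale[OF \<phi>] c(2) of_real_sum)
    then have "(\<Sum>p\<in>N. norm (\<phi> (?B p y))) = norm (\<phi> (\<Sum>p\<in>N. scaleE (c p) (?B p y)))"
      by (simp add: sum_nonneg del: of_real_sum)
    also have "\<dots> \<le> D * norm (\<Sum>p\<in>N. scaleE (c p) (?B p y))" by (rule D)
    also have "\<dots> \<le> D * (C * norm y)" using D(1) by (intro mult_left_mono C(2) N c) auto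
    finally show ?thesis by (simp add: mult.assoc)
  qed
  show ?thesis
  proof (rule that[of e "D * C" "\<lambda>p y. \<phi> (?B p y)" "\<lambda>p. x (t p)"])
    show "bounded_operator scaleE (*) (\<lambda>y. \<phi> (?B p y))" for p
      by (rule bounded_operator_compose[OF B.bounded_operator_B \<phi>])
  qed (use e C D x bound in auto)
qed

text \<open>Such a system behaves like the unit vectors of \<open>\<ell>\<^sub>1\<close> and their coordinate functionals.\<close>

definition almost_biorthogonal :: "(nat \<Rightarrow> 'e \<Rightarrow> 'k) \<Rightarrow> (nat \<Rightarrow> 'e) \<Rightarrow> real \<Rightarrow> real \<Rightarrow> bool" where
  "almost_biorthogonal \<pi> y r K \<longleftrightarrow> K \<ge> 0 \<and>
     (\<forall>i. bounded_operator scaleE (*) (\<pi> i) \<and> norm (y i) \<le> r \<and> \<pi> i (y i) = 1) \<and>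
     (\<forall>N x. finite N \<longrightarrow> (\<Sum>i\<in>N. norm (\<pi> i x)) \<le> K * norm x) \<and>
     (\<forall>N l. finite N \<longrightarrow> l \<notin> N \<longrightarrow> (\<Sum>i\<in>N. norm (\<pi> i (y l))) \<le> 1 / 50)"

text \<open>Differences \<open>x n - x n'\<close> along an almost constant set of indices are nearly
  annihilated by the first \<open>N\<close> functionals, while \<open>R n\<close> stays large on
  them. A gliding hump controls the remaining off-diagonal entries, and division by the diagonal
  value \<open>a p\<close> normalizes.\<close>

lemma not_shrinking_biorthogonal:
  assumes "\<not> shrinking"
  obtains \<pi> y r K where "almost_biorthogonal \<pi> y r K"
proof -
  obtain R x e K where e: "e > 0" and K: "K \<ge> 0" and R: "\<And>p :: nat. bounded_operator scaleE (*) (R p)"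
    and x: "\<And>p. norm (x p) \<le> 1" "\<And>p. e < norm (R p (x p))"
    and RK: "\<And>N y. finite N \<Longrightarrow> (\<Sum>p\<in>N. norm (R p y)) \<le> K * norm y"
    by (rule not_shrinking_blocks[OF assms]) (rule that)
  have summ: "summable (\<lambda>p. norm (R p y))" for y
    by (rule bounded_imp_summable[of _ "K * norm y"]) (auto simp: RK)
  have "\<exists>n y. N \<le> n \<and> norm y \<le> 2 \<and> (\<forall>i\<le>N. norm (R i y) < 1 / real (Suc N)) \<and> e / 2 \<le> norm (R n y)" for N
  proof -
    obtain J where J: "J \<subseteq> {N..}" "infinite J"
      "\<And>\<phi> i j. \<phi> \<in> R ` {..N} \<Longrightarrow> i \<in> J \<Longrightarrow> j \<in> J \<Longrightarrow> norm (\<phi> (x i) - \<phi> (x j)) < 1 / real (Suc N)"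
      by (rule E.almost_constant_functionals[of x 1 "{N..}" "R ` {..N}" "1 / real (Suc N)"])
         (use x(1) R infinite_Ici in auto)
    obtain n' where n': "n' \<in> J" using J(2) infinite_imp_nonempty by blast
    have "(\<lambda>p. norm (R p (x n'))) \<longlonglongrightarrow> 0" by (rule summable_LIMSEQ_zero[OF summ])
    from order_tendstoD(2)[OF this half_gt_zero[OF e]]
    obtain L where L: "\<And>p. p \<ge> L \<Longrightarrow> norm (R p (x n')) < e / 2" unfolding eventually_sequentially by blast
    \<comment> \<open>With \<open>n'\<close> fixed, the summable values \<open>R p (x n')\<close>
      are below \<open>e / 2\<close> for late \<open>p\<close>, so subtracting \<open>x n'\<close>
      costs at most half of \<open>R n (x n)\<close>.\<close>
    obtain n where n: "n \<in> J" "n \<ge> L" using J(2) by (meson infinite_nat_iff_unbounded_le)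
    have "norm (x n - x n') \<le> 2" using norm_triangle_ineq4[of "x n" "x n'"] x(1)[of n] x(1)[of n'] by simp
    moreover have "norm (R i (x n - x n')) < 1 / real (Suc N)" if "i \<le> N" for i
      using J(3)[of "R i" n n'] that n n' by (simp add: bounded_operator_diff[OF R])
    moreover have "e / 2 \<le> norm (R n (x n - x n'))"
      using x(2)[of n] L[OF n(2)] norm_triangle_ineq2[of "R n (x n)" "R n (x n')"]
      by (simp add: bounded_operator_diff[OF R])
    moreover have "N \<le> n" using J(1) n(1) by auto
    ultimately show ?thesis by blast
  qed
  then obtain \<nu> Y where \<nu>: "\<And>N. N \<le> \<nu> N" and Y: "\<And>N. norm (Y N) \<le> 2"
    "\<And>N i. i \<le> N \<Longrightarrow> norm (R i (Y N)) < 1 / real (Suc N)" "\<And>N. e / 2 \<le> norm (R (\<nu> N) (Y N))" by metis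
  define s where "s l = ((\<lambda>N. Suc (\<nu> N)) ^^ l) 0" for l
  have sS: "s (Suc l) = Suc (\<nu> (s l))" for l by (simp add: s_def)
  have mono: "strict_mono s"
    by (rule strict_mono_Suc_iff[THEN iffD2]) (simp add: sS \<nu> less_Suc_eq_le)
  have ls: "l \<le> s l" for l by (rule strict_mono_imp_increasing[OF mono])
  define n where "n l = \<nu> (s l)" for l
  have mono_n: "strict_mono n"
    by (rule strict_mono_Suc_iff[THEN iffD2]) (metis n_def sS \<nu> Suc_le_eq)
  \<comment> \<open>Taking norms as entries makes the gliding hump bound sums of absolute values. A
    single dummy parameter suffices here.\<close>
  define u where "u c i l = norm (R (n i) (Y (s l)))" for c :: unit and i l
  have RK': "(\<Sum>i\<in>N. norm (R (h i) y)) \<le> K * norm y" if "finite N" "strict_mono h" for N y and h :: "nat \<Rightarrow> nat"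
  proof -
    have "inj_on h N" using strict_mono_imp_inj_on[OF that(2), of UNIV] by (rule inj_on_subset) simp
    then have "(\<Sum>i\<in>N. norm (R (h i) y)) = (\<Sum>p\<in>h ` N. norm (R p y))" by (simp add: sum.reindex)
    then show ?thesis using RK[of "h ` N" y] that(1) by simp
  qed
  note bound = RK'[OF _ mono_n]
  have mono_nr: "strict_mono (\<lambda>i. n (r i))" if "strict_mono r" for r :: "nat \<Rightarrow> nat"
    using mono_n that by (simp add: strict_mono_def)
  have col: "\<exists>L. \<forall>l\<ge>L. \<forall>c\<in>UNIV. norm (u c i l) < e'" if e'0: "e' > 0" for i e'
  proof -
    obtain L0 where L0: "1 / real (Suc L0) < e'"
      using reals_Archimedean[OF e'0] unfolding inverse_eq_divide by blast
    have "norm (u c i l) < e'" if l: "l \<ge> max L0 (Suc i)" for l c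
    proof -
      have "n i \<le> s (Suc i)" by (simp add: n_def sS)
      also have "\<dots> \<le> s l" using l strict_mono_less_eq[OF mono] by auto
      finally have "norm (R (n i) (Y (s l))) < 1 / real (Suc (s l))" by (rule Y(2))
      also have "\<dots> \<le> 1 / real (Suc L0)" using l ls[of l] by (intro divide_left_mono) auto
      finally show ?thesis using L0 by (simp add: u_def)
    qed
    then show ?thesis by blast
  qed
  have tail: "\<exists>L. \<forall>N. finite N \<longrightarrow> N \<subseteq> {L..} \<longrightarrow> (\<forall>c\<in>UNIV. norm (\<Sum>i\<in>N. u c i l) < e')"
    if "e' > 0" for l e'
  proof -
    have "summable (\<lambda>i. norm (norm (R (n i) (Y (s l)))))"
      by (rule bounded_imp_summable[of _ "K * norm (Y (s l))"]) (auto simp: bound)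
    from unconditionally_Cauchy_norm_summable[OF this] \<open>e' > 0\<close>
    obtain L where "\<forall>N. finite N \<longrightarrow> N \<subseteq> {L..} \<longrightarrow> norm (\<Sum>i\<in>N. norm (R (n i) (Y (s l)))) < e'"
      unfolding unconditionally_Cauchy_def by (elim allE[of _ e'] impE exE)
    then show ?thesis by (intro exI[of _ L]) (simp add: u_def)
  qed
  \<comment> \<open>The diagonal is at least \<open>e / 2\<close>, so normalization turns
    \<open>e / 100\<close> into the required \<open>1 / 50\<close>.\<close>
  have e100: "e / 100 > 0" using e by simp
  obtain r :: "nat \<Rightarrow> nat" where r: "strict_mono r" and r': "\<And>p N c. finite N \<Longrightarrow> p \<notin> N \<Longrightarrow> c \<in> UNIV \<Longrightarrow>
      norm (\<Sum>i\<in>N. u c (r i) (r p)) \<le> e / 100"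
    by (rule gliding_hump[OF col tail e100]) (assumption, assumption, rule that)
  define a where "a p = R (n (r p)) (Y (s (r p)))" for p
  have a: "e / 2 \<le> norm (a p)" for p using Y(3) by (simp add: a_def n_def)
  have a0: "a p \<noteq> 0" for p using a[of p] e by auto
  have inv_a: "inverse (norm (a p)) \<le> 2 / e" for p
    using le_imp_inverse_le[OF a[of p]] e by simp
  have "almost_biorthogonal (\<lambda>p. R (n (r p))) (\<lambda>p. scaleE (inverse (a p)) (Y (s (r p)))) (2 / e * 2) K"
    unfolding almost_biorthogonal_def
  proof (intro conjI allI impI)
    show "norm (scaleE (inverse (a p)) (Y (s (r p)))) \<le> 2 / e * 2" for p
      unfolding E.norm_scale norm_inverse using inv_a Y(1) e by (intro mult_mono) auto
    show "R (n (r p)) (scaleE (inverse (a p)) (Y (s (r p)))) = 1" for p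
      using a0[of p] by (simp add: bounded_operator_scale[OF R] a_def)
    show "(\<Sum>i\<in>N. norm (R (n (r i)) x)) \<le> K * norm x" if "finite N" for N x
      by (rule RK'[OF that mono_nr[OF r]])
    show "(\<Sum>i\<in>N. norm (R (n (r i)) (scaleE (inverse (a l)) (Y (s (r l)))))) \<le> 1 / 50"
      if N: "finite N" "l \<notin> N" for N l
    proof -
      have "(\<Sum>i\<in>N. norm (R (n (r i)) (scaleE (inverse (a l)) (Y (s (r l))))))
          = inverse (norm (a l)) * (\<Sum>i\<in>N. norm (R (n (r i)) (Y (s (r l)))))"
        by (simp add: bounded_operator_scale[OF R] norm_mult norm_inverse sum_distrib_left)
      also have "\<dots> \<le> 2 / e * (e / 100)"
        using inv_a e r'[OF N, of "()"] by (intro mult_mono) (auto simp: u_def sum_nonneg)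
      finally show ?thesis using e by simp
    qed
  qed (use K R in auto)
  then show ?thesis by (rule that)
qed

definition power_family :: "nat \<Rightarrow> (nat \<Rightarrow> 'e \<Rightarrow> 'k) \<Rightarrow> 'f \<Rightarrow> (nat \<Rightarrow> 'k) \<Rightarrow> 'e \<Rightarrow> 'f" where
  "power_family k \<pi> f \<xi> x = scaleF (\<Sum>i. \<xi> i * \<pi> i x ^ k) f"

text \<open>The vector \<open>y\<^sub>i - (y\<^sub>j + y\<^sub>l) / 2\<close> can be chosen weakly small. The unequal weights make the value of
  \<open>\<Sum> \<pi>\<^sub>m\<^sup>k\<close> there large for every exponent \<open>k \<ge> 2\<close>.\<close>

definition triple :: "(nat \<Rightarrow> 'e \<Rightarrow> 'k) \<Rightarrow> (nat \<Rightarrow> 'e) \<Rightarrow> nat \<Rightarrow> nat \<Rightarrow> nat \<Rightarrow> 'e" where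
  "triple \<pi> y i j l = (let v = y i - scaleE (1 / 2) (y j + y l) in scaleE (inverse (\<pi> i v)) v)"

context
  fixes \<pi> :: "nat \<Rightarrow> 'e \<Rightarrow> 'k" and y :: "nat \<Rightarrow> 'e" and r K :: real
  assumes system: "almost_biorthogonal \<pi> y r K"
begin

lemma K: "K \<ge> 0"
  and \<pi>: "bounded_operator scaleE (*) (\<pi> i)"
  and yr: "norm (y i) \<le> r"
  and diag: "\<pi> i (y i) = 1"
  and bound: "finite N \<Longrightarrow> (\<Sum>i\<in>N. norm (\<pi> i x)) \<le> K * norm x"
  and off: "finite N \<Longrightarrow> l \<notin> N \<Longrightarrow> (\<Sum>i\<in>N. norm (\<pi> i (y l))) \<le> 1 / 50"
  using system unfolding almost_biorthogonal_def by blast+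

text \<open>Estimating all slots but the last by the sup bound and the last by the
  \<open>\<ell>_1\<close> bound makes the series absolutely convergent; here one slot is enough,
  whence \<open>k > 0\<close>. Finitely supported coefficients leave a finite sum of powers of
  functionals, which is weakly continuous.\<close>

lemma poly_family_power:
  assumes k: "k > 0"
  shows "poly_family k (power_family k \<pi> f)"
    and "bounded (range \<xi>) \<Longrightarrow> summable (\<lambda>i. \<xi> i * \<pi> i x ^ k)"
proof -
  obtain k' where k': "k = Suc k'" using k by (cases k) auto
  have \<pi>K: "norm (\<pi> i x) \<le> K * norm x" for i x using bound[of "{i}" x] by simp
  define a where "a \<xi> x i = \<xi> i * (\<Prod>l<k. \<pi> i (x l))" for \<xi> :: "nat \<Rightarrow> 'k" and x :: "nat \<Rightarrow> 'e" and i
  define G where "G \<xi> x = (\<Sum>i. a \<xi> x i)" for \<xi> x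
  have ai: "norm (a \<xi> x i) \<le> B * (K ^ k' * (\<Prod>l<k'. norm (x l))) * norm (\<pi> i (x k'))"
    if B: "\<And>n. norm (\<xi> n) \<le> B" for \<xi> x i B
  proof -
    have B0: "B \<ge> 0" using B[of 0] norm_ge_zero order_trans by blast
    have "(\<Prod>l<k'. norm (\<pi> i (x l))) \<le> (\<Prod>l<k'. K * norm (x l))" by (intro prod_mono) (simp add: \<pi>K)
    then have p: "(\<Prod>l<k'. norm (\<pi> i (x l))) \<le> K ^ k' * (\<Prod>l<k'. norm (x l))"
      by (simp add: prod.distrib)
    have "norm (a \<xi> x i) = norm (\<xi> i) * (\<Prod>l<k'. norm (\<pi> i (x l))) * norm (\<pi> i (x k'))"
      by (simp add: a_def k' norm_mult prod_norm[symmetric] mult.assoc)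
    also have "\<dots> \<le> B * (K ^ k' * (\<Prod>l<k'. norm (x l))) * norm (\<pi> i (x k'))"
      using p B B0 K by (intro mult_mono order_refl) (auto intro!: mult_nonneg_nonneg prod_nonneg)
    finally show ?thesis .
  qed
  have GB: "summable (a \<xi> x) \<and> norm (G \<xi> x) \<le> B * K ^ k * (\<Prod>l<k. norm (x l))"
    if B: "\<And>n. norm (\<xi> n) \<le> B" for \<xi> x B
  proof -
    let ?c = "B * (K ^ k' * (\<Prod>l<k'. norm (x l)))"
    have B0: "B \<ge> 0" using B[of 0] norm_ge_zero order_trans by blast
    then have c: "?c \<ge> 0" using K by (auto intro!: mult_nonneg_nonneg prod_nonneg)
    have part: "(\<Sum>i\<in>N. norm (a \<xi> x i)) \<le> ?c * (K * norm (x k'))" if "finite N" for N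
    proof -
      have "(\<Sum>i\<in>N. norm (a \<xi> x i)) \<le> (\<Sum>i\<in>N. ?c * norm (\<pi> i (x k')))"
        by (intro sum_mono ai B)
      also have "\<dots> = ?c * (\<Sum>i\<in>N. norm (\<pi> i (x k')))" by (simp add: sum_distrib_left)
      also have "\<dots> \<le> ?c * (K * norm (x k'))" by (intro mult_left_mono bound that c)
      finally show ?thesis .
    qed
    have s: "summable (\<lambda>i. norm (a \<xi> x i))"
      by (rule bounded_imp_summable[of _ "?c * (K * norm (x k'))"]) (auto simp: part)
    have "norm (G \<xi> x) \<le> (\<Sum>i. norm (a \<xi> x i))" unfolding G_def by (rule summable_norm[OF s])
    also have "\<dots> \<le> ?c * (K * norm (x k'))" by (rule suminf_le_const[OF s]) (simp add: part)
    also have "\<dots> = B * K ^ k * (\<Prod>l<k. norm (x l))" by (simp add: k' mult_ac)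
    finally show ?thesis using summable_norm_cancel[OF s] by blast
  qed
  have summ: "summable (a \<xi> x)" if "bounded (range \<xi>)" for \<xi> x
    using that GB by (auto simp: bounded_iff)
  have a_diag: "a \<xi> (\<lambda>_. x) = (\<lambda>i. \<xi> i * \<pi> i x ^ k)" for \<xi> x by (auto simp: a_def)
  show "summable (\<lambda>i. \<xi> i * \<pi> i x ^ k)" if "bounded (range \<xi>)" for \<xi> x
    using summ[OF that, of "\<lambda>_. x"] by (simp add: a_diag)
  have PG: "power_family k \<pi> f \<xi> = (\<lambda>x. scaleF (G \<xi> (\<lambda>_. x)) f)" for \<xi>
    by (auto simp: power_family_def G_def a_diag)
  have mlinG: "mlin k (\<lambda>x. scaleF (G \<xi> x) f)" if b: "bounded (range \<xi>)" for \<xi>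
  proof -
    obtain B where B: "\<And>n. norm (\<xi> n) \<le> B" using b by (auto simp: bounded_iff)
    have B0: "B \<ge> 0" using B[of 0] norm_ge_zero order_trans by blast
    have upd: "a \<xi> (x(j := b)) i = \<pi> i b * (\<xi> i * (\<Prod>l\<in>{..<k} - {j}. \<pi> i (x l)))"
      if "j < k" for x j b i
      unfolding a_def prod_upd[OF that] by (simp add: mult_ac)
    show ?thesis
    proof (rule mlinI)
      fix x :: "nat \<Rightarrow> 'e" and j c d assume j: "j < k"
      have "a \<xi> (x(j := c + d)) i = a \<xi> (x(j := c)) i + a \<xi> (x(j := d)) i" for i
        unfolding upd[OF j] bounded_operator_add[OF \<pi>] by (simp add: distrib_right)
      then have "G \<xi> (x(j := c + d)) = G \<xi> (x(j := c)) + G \<xi> (x(j := d))"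
        unfolding G_def using suminf_add[OF summ[OF b] summ[OF b]] by presburger
      then show "scaleF (G \<xi> (x(j := c + d))) f = scaleF (G \<xi> (x(j := c))) f + scaleF (G \<xi> (x(j := d))) f"
        by (simp only: F.scale_left_distrib)
    next
      fix x :: "nat \<Rightarrow> 'e" and j c d assume j: "j < k"
      have "a \<xi> (x(j := scaleE c d)) i = c * a \<xi> (x(j := d)) i" for i
        unfolding upd[OF j] bounded_operator_scale[OF \<pi>] by (simp add: mult.assoc)
      then have "G \<xi> (x(j := scaleE c d)) = c * G \<xi> (x(j := d))"
        unfolding G_def using suminf_mult[OF summ[OF b]] by presburger
      then show "scaleF (G \<xi> (x(j := scaleE c d))) f = scaleF c (scaleF (G \<xi> (x(j := d))) f)"
        by (simp only: F.scale_scale)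
    next
      fix x y :: "nat \<Rightarrow> 'e" assume "\<And>i. i < k \<Longrightarrow> x i = y i"
      then have "a \<xi> x = a \<xi> y" by (auto simp: a_def intro!: prod.cong)
      then show "scaleF (G \<xi> x) f = scaleF (G \<xi> y) f" by (simp add: G_def)
    next
      fix x :: "nat \<Rightarrow> 'e"
      have "norm (G \<xi> x) * norm f \<le> (B * K ^ k * (\<Prod>l<k. norm (x l))) * norm f"
        using GB[of \<xi> B, OF B] by (intro mult_right_mono) auto
      then show "norm (scaleF (G \<xi> x) f) \<le> (B * K ^ k * norm f) * (\<Prod>l<k. norm (x l))"
        by (simp add: F.norm_scale mult_ac)
    qed (use B0 K in simp)
  qed
  show "poly_family k (power_family k \<pi> f)"
    unfolding poly_family_def
  proof (intro conjI allI impI)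
    fix \<xi> :: "nat \<Rightarrow> 'k" assume b: "bounded (range \<xi>)"
    show "power_family k \<pi> f \<xi> \<in> hom_polys scaleE scaleF k"
      unfolding PG by (rule mlin_diag[OF mlinG[OF b]])
    fix \<zeta> :: "nat \<Rightarrow> 'k" assume b': "bounded (range \<zeta>)"
    have "G (\<lambda>n. \<xi> n + \<zeta> n) x = G \<xi> x + G \<zeta> x" for x
    proof -
      have "a (\<lambda>n. \<xi> n + \<zeta> n) x = (\<lambda>i. a \<xi> x i + a \<zeta> x i)" by (auto simp: a_def distrib_right)
      then show ?thesis unfolding G_def suminf_add[OF summ[OF b] summ[OF b']] by simp
    qed
    then show "power_family k \<pi> f (\<lambda>n. \<xi> n + \<zeta> n) = power_family k \<pi> f \<xi> + power_family k \<pi> f \<zeta>"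
      by (auto simp: PG F.scale_left_distrib)
  next
    fix c and \<xi> :: "nat \<Rightarrow> 'k" assume b: "bounded (range \<xi>)"
    have "G (\<lambda>n. c * \<xi> n) x = c * G \<xi> x" for x
    proof -
      have "a (\<lambda>n. c * \<xi> n) x = (\<lambda>i. c * a \<xi> x i)" by (auto simp: a_def mult.assoc)
      then show ?thesis unfolding G_def suminf_mult[OF summ[OF b], symmetric] by simp
    qed
    then show "power_family k \<pi> f (\<lambda>n. c * \<xi> n) = (\<lambda>x. scaleF c (power_family k \<pi> f \<xi> x))"
      by (auto simp: PG)
  next
    have "pnorm (power_family k \<pi> f \<xi>) \<le> K ^ k * norm f" if \<xi>: "\<forall>n. norm (\<xi> n) \<le> 1" for \<xi>
    proof (rule pnorm_le)
      fix x :: 'e assume x: "norm x \<le> 1"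
      have "norm (G \<xi> (\<lambda>_. x)) \<le> 1 * K ^ k * (\<Prod>l<k. norm x)" using GB[of \<xi> 1] \<xi> by blast
      also have "\<dots> \<le> 1 * K ^ k * 1"
        using x K by (intro mult_left_mono) (auto simp: power_le_one)
      finally show "norm (power_family k \<pi> f \<xi> x) \<le> K ^ k * norm f"
        by (simp add: PG F.norm_scale mult_right_mono)
    qed
    then show "\<exists>C\<ge>0. \<forall>\<xi>. (\<forall>n. norm (\<xi> n) \<le> 1) \<longrightarrow> pnorm (power_family k \<pi> f \<xi>) \<le> C"
      using K by (intro exI[of _ "K ^ k * norm f"]) auto
  next
    fix \<xi> :: "nat \<Rightarrow> 'k" assume fin: "finite {n. \<xi> n \<noteq> 0}"
    have "range \<xi> \<subseteq> insert 0 (\<xi> ` {n. \<xi> n \<noteq> 0})" by auto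
    then have "finite (range \<xi>)" by (rule finite_subset) (simp add: fin)
    then have b: "bounded (range \<xi>)" by (rule finite_imp_bounded)
    have eq: "power_family k \<pi> f \<xi> = (\<lambda>x. scaleF (\<Sum>i\<in>{n. \<xi> n \<noteq> 0}. \<xi> i * \<pi> i x ^ k) f)"
      unfolding power_family_def[abs_def] using fin by (subst suminf_finite) auto
    have "(power_family k \<pi> f \<xi> \<longlongrightarrow> power_family k \<pi> f \<xi> x0) (weak_at scaleE r x0)" for x0 r
      unfolding eq
      by (intro F.tendsto_scale tendsto_sum tendsto_mult tendsto_power tendsto_const tendsto_weak_at \<pi>)
    then show "power_family k \<pi> f \<xi> \<in> wb_polys scaleE scaleF k"
      unfolding wb_polys_iff using mlin_diag[OF mlinG[OF b]] by (simp add: PG)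
  qed
qed

lemma off_diagonal: "i \<noteq> l \<Longrightarrow> norm (\<pi> i (y l)) \<le> 1 / 50"
  using off[of "{i}" l] by simp

lemma functional_combination:
  assumes "bounded_operator scaleE (*) \<phi>"
  shows "\<phi> (y i - scaleE (1 / 2) (y j + y l)) = \<phi> (y i) - (\<phi> (y j) + \<phi> (y l)) / 2"
  by (simp add: bounded_operator_diff[OF assms] bounded_operator_scale[OF assms] bounded_operator_add[OF assms])

lemma norm_combination_le:
  "norm (\<phi> (y i) - (\<phi> (y j) + \<phi> (y l)) / (2 :: 'k)) \<le> norm (\<phi> (y i)) + norm (\<phi> (y j)) / 2 + norm (\<phi> (y l)) / 2"
proof -
  have "norm ((\<phi> (y j) + \<phi> (y l)) / 2) \<le> norm (\<phi> (y j)) / 2 + norm (\<phi> (y l)) / 2"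
    using norm_triangle_ineq[of "\<phi> (y j)" "\<phi> (y l)"] by (simp add: norm_divide)
  then show ?thesis using norm_triangle_ineq4[of "\<phi> (y i)" "(\<phi> (y j) + \<phi> (y l)) / 2"] by linarith
qed

text \<open>The value is \<open>1\<close> minus the mean of two off-diagonal entries, each at most
  \<open>1 / 50\<close>, so its modulus is at least \<open>49 / 50\<close>.\<close>

lemma triple_normalizer:
  assumes "i \<noteq> j" "i \<noteq> l"
  shows "norm (inverse (\<pi> i (y i - scaleE (1 / 2) (y j + y l)))) \<le> 50 / 49"
    and "\<pi> i (y i - scaleE (1 / 2) (y j + y l)) \<noteq> 0"
proof -
  let ?a = "\<pi> i (y i - scaleE (1 / 2) (y j + y l))"
  have "norm (\<pi> i (y j) + \<pi> i (y l)) / 2 \<le> 1 / 50"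
    using norm_triangle_ineq[of "\<pi> i (y j)" "\<pi> i (y l)"] off_diagonal[OF assms(1)] off_diagonal[OF assms(2)]
    by linarith
  then have "norm ((\<pi> i (y j) + \<pi> i (y l)) / 2) \<le> 1 / 50" by (simp add: norm_divide)
  then have a: "49 / 50 \<le> norm ?a"
    using norm_triangle_ineq2[of 1 "(\<pi> i (y j) + \<pi> i (y l)) / 2"]
    unfolding functional_combination[OF \<pi>] diag norm_one by linarith
  then show "?a \<noteq> 0" by auto
  show "norm (inverse ?a) \<le> 50 / 49" unfolding norm_inverse using le_imp_inverse_le[OF a] by simp
qed

lemma norm_triple_le:
  assumes "i \<noteq> j" "i \<noteq> l" shows "norm (triple \<pi> y i j l) \<le> 3 * r"
proof -
  let ?v = "y i - scaleE (1 / 2) (y j + y l)"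
  have r0: "r \<ge> 0" using yr[of 0] norm_ge_zero order_trans by blast
  have "norm (scaleE (1 / 2) (y j + y l)) = norm (y j + y l) / 2"
    by (simp add: E.norm_scale norm_divide)
  then have "norm ?v \<le> 2 * r"
    using norm_triangle_ineq4[of "y i" "scaleE (1 / 2) (y j + y l)"] norm_triangle_ineq[of "y j" "y l"]
      yr[of i] yr[of j] yr[of l] by linarith
  then have "norm (inverse (\<pi> i ?v)) * norm ?v \<le> 50 / 49 * (2 * r)"
    by (intro mult_mono triple_normalizer[OF assms]) auto
  also have "\<dots> \<le> 3 * r" using r0 by simp
  finally show ?thesis by (simp add: triple_def Let_def E.norm_scale)
qed

lemma norm_functional_triple:
  assumes "bounded_operator scaleE (*) \<phi>" "i \<noteq> j" "i \<noteq> l"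
  shows "norm (\<phi> (triple \<pi> y i j l)) \<le> 50 / 49 * norm (\<phi> (y i) - (\<phi> (y j) + \<phi> (y l)) / 2)"
  unfolding triple_def Let_def bounded_operator_scale[OF assms(1)] functional_combination[OF assms(1), symmetric]
    norm_mult by (intro mult_right_mono triple_normalizer assms) auto

text \<open>Coordinate \<open>i\<close> contributes exactly 1. The other coordinates are at most
  \<open>53 / 98\<close> each and at most \<open>52 / 49\<close> in total; as
  \<open>k \<ge> 2\<close>, their powers add up to at most the product of these numbers, which is
  below \<open>2 / 3\<close>.\<close>

lemma power_family_triple:
  assumes k: "k > 1" and d: "i \<noteq> j" "i \<noteq> l" "j \<noteq> l" and M: "i \<in> M"
  shows "norm (power_family k \<pi> f (indicator M) (triple \<pi> y i j l)) \<ge> norm f / 3"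
proof -
  let ?v = "triple \<pi> y i j l"
  have one: "\<pi> i ?v = 1"
    using triple_normalizer(2)[OF d(1,2)] by (simp add: triple_def Let_def bounded_operator_scale[OF \<pi>])
  have single: "norm (\<pi> m ?v) \<le> 53 / 98" if "m \<noteq> i" for m
  proof -
    \<comment> \<open>At most one of \<open>j\<close> and \<open>l\<close> equals \<open>m\<close>,
      so the mean is at most half of \<open>1 + 1 / 50\<close>; equal indices would spoil
      this.\<close>
    have "norm (\<pi> m (y j)) / 2 + norm (\<pi> m (y l)) / 2 \<le> 51 / 100"
      using off_diagonal[of m j] off_diagonal[of m l] d(3)
      by (cases "m = j"; cases "m = l") (auto simp: diag)
    then have "norm (\<pi> m (y i) - (\<pi> m (y j) + \<pi> m (y l)) / 2) \<le> 53 / 100"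
      using norm_combination_le[of "\<pi> m" i j l] off_diagonal[OF that] by linarith
    then show ?thesis using norm_functional_triple[OF \<pi> d(1,2), of m] by linarith
  qed
  have total: "(\<Sum>m\<in>N. norm (\<pi> m ?v)) \<le> 52 / 49" if N: "finite N" "i \<notin> N" for N
  proof -
    \<comment> \<open>The diagonal entry 1, if present, plus the off-diagonal sum
      \<open>1 / 50\<close>.\<close>
    have row: "(\<Sum>m\<in>N. norm (\<pi> m (y p))) \<le> 51 / 50" for p
    proof (cases "p \<in> N")
      case True
      then show ?thesis using off[of "N - {p}" p] N(1) by (simp add: sum.remove[of N p] diag)
    qed (use off[OF N(1), of p] in simp)
    have "(\<Sum>m\<in>N. norm (\<pi> m ?v)) \<le> (\<Sum>m\<in>N. 50 / 49 * (norm (\<pi> m (y i)) + norm (\<pi> m (y j)) / 2 + norm (\<pi> m (y l)) / 2))"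
      by (intro sum_mono order_trans[OF norm_functional_triple[OF \<pi> d(1,2)]] mult_left_mono norm_combination_le) auto
    also have "\<dots> = 50 / 49 * ((\<Sum>m\<in>N. norm (\<pi> m (y i))) + (\<Sum>m\<in>N. norm (\<pi> m (y j))) / 2 + (\<Sum>m\<in>N. norm (\<pi> m (y l))) / 2)"
      unfolding sum_distrib_left[symmetric] sum.distrib sum_divide_distrib[symmetric] ..
    also have "\<dots> \<le> 50 / 49 * (1 / 50 + (51 / 50) / 2 + (51 / 50) / 2)"
      using off[OF N] row[of j] row[of l] by (intro mult_left_mono add_mono) auto
    finally show ?thesis by simp
  qed
  have summ: "summable (\<lambda>m. indicator M m * \<pi> m ?v ^ k)"
    using k by (intro poly_family_power(2) bounded_indicator) auto
  have "1 / 3 \<le> norm (\<Sum>m. indicator M m * \<pi> m ?v ^ k)"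
  proof (rule Lim_bounded2)
    show "(\<lambda>n. norm (\<Sum>m<n. indicator M m * \<pi> m ?v ^ k)) \<longlonglongrightarrow> norm (\<Sum>m. indicator M m * \<pi> m ?v ^ k)"
      by (intro tendsto_norm summable_LIMSEQ summ)
    show "\<forall>n\<ge>Suc i. 1 / 3 \<le> norm (\<Sum>m<n. indicator M m * \<pi> m ?v ^ k)"
    proof (intro allI impI)
      fix n assume n: "n \<ge> Suc i"
      let ?N = "{..<n} - {i}"
      have "(\<Sum>m<n. indicator M m * \<pi> m ?v ^ k) = 1 + (\<Sum>m\<in>?N. indicator M m * \<pi> m ?v ^ k)"
        using n M by (subst sum.remove[of _ i]) (auto simp: one)
      moreover have "norm (\<Sum>m\<in>?N. indicator M m * \<pi> m ?v ^ k) \<le> 2 / 3"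
      proof -
        have "norm (indicator M m * \<pi> m ?v ^ k) \<le> 53 / 98 * norm (\<pi> m ?v)" if "m \<in> ?N" for m
        proof -
          have le: "norm (\<pi> m ?v) \<le> 53 / 98" using that by (intro single) auto
          have "norm (indicator M m * \<pi> m ?v ^ k) \<le> norm (\<pi> m ?v) ^ k"
            by (auto simp: norm_mult norm_power indicator_def)
          also have "\<dots> \<le> norm (\<pi> m ?v) ^ 2" using k le by (intro power_decreasing) auto
          also have "\<dots> \<le> 53 / 98 * norm (\<pi> m ?v)"
            unfolding power2_eq_square using le by (intro mult_right_mono) auto
          finally show ?thesis .
        qed
        then have "norm (\<Sum>m\<in>?N. indicator M m * \<pi> m ?v ^ k) \<le> (\<Sum>m\<in>?N. 53 / 98 * norm (\<pi> m ?v))"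
          by (rule sum_norm_le)
        also have "\<dots> = 53 / 98 * (\<Sum>m\<in>?N. norm (\<pi> m ?v))" by (simp add: sum_distrib_left)
        also have "\<dots> \<le> 53 / 98 * (52 / 49)" by (intro mult_left_mono total) auto
        finally show ?thesis by simp
      qed
      ultimately show "1 / 3 \<le> norm (\<Sum>m<n. indicator M m * \<pi> m ?v ^ k)"
        using norm_diff_ineq[of 1 "\<Sum>m\<in>?N. indicator M m * \<pi> m ?v ^ k"] by simp
    qed
  qed
  then have "1 / 3 * norm f \<le> norm (\<Sum>m. indicator M m * \<pi> m ?v ^ k) * norm f" by (rule mult_right_mono) simp
  then show ?thesis by (simp add: power_family_def F.norm_scale)
qed

text \<open>A weak neighbourhood of 0 involves finitely many functionals; they almost agree on
  infinitely many \<open>y i\<close> with \<open>i\<close> in \<open>M\<close>, and on such a triple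
  the combination is an average of small differences.\<close>

lemma wb_triple_small:
  assumes "Q \<in> wb_polys scaleE scaleF k" "k > 0" "infinite M" "d > 0"
  obtains i j l where "i \<in> M" "i \<noteq> j" "i \<noteq> l" "j \<noteq> l" "norm (Q (triple \<pi> y i j l)) < d"
proof -
  have r0: "0 \<le> 3 * r" using yr[of 0] norm_ge_zero[of "y 0"] by linarith
  have "Q 0 = 0"
    using norm_le_pnorm_power[OF wb_polys_hom[OF assms(1)] assms(2), of 0] assms(2) by (simp add: zero_power)
  moreover have "(Q \<longlongrightarrow> Q 0) (weak_at scaleE (3 * r) 0)" using assms(1) r0 by (simp add: wb_polys_iff)
  ultimately have "\<forall>\<^sub>F v in weak_at scaleE (3 * r) 0. norm (Q v) < d"
    using tendstoD[OF _ assms(4)] by fastforce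
  then obtain \<Phi> \<eta> where \<Phi>: "finite \<Phi>" "\<And>\<phi>. \<phi> \<in> \<Phi> \<Longrightarrow> bounded_operator scaleE (*) \<phi>" "\<eta> > 0"
    "\<And>v. norm v \<le> 3 * r \<Longrightarrow> \<forall>\<phi>\<in>\<Phi>. norm (\<phi> v - \<phi> 0) < \<eta> \<Longrightarrow> norm (Q v) < d"
    unfolding eventually_weak_at by blast
  obtain J where J: "J \<subseteq> M" "infinite J"
    "\<And>\<phi> i j. \<phi> \<in> \<Phi> \<Longrightarrow> i \<in> J \<Longrightarrow> j \<in> J \<Longrightarrow> norm (\<phi> (y i) - \<phi> (y j)) < \<eta> / 2"
    by (rule E.almost_constant_functionals[of y r M \<Phi> "\<eta> / 2"]) (use yr assms(3) \<Phi> in auto)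
  obtain F where "F \<subseteq> J" "finite F" "card F = 3" using infinite_arbitrarily_large[OF J(2)] by blast
  then obtain i j l where ijl: "i \<in> J" "j \<in> J" "l \<in> J" and d: "i \<noteq> j" "i \<noteq> l" "j \<noteq> l"
    by (auto simp: card_3_iff)
  have "norm (\<phi> (triple \<pi> y i j l) - \<phi> 0) < \<eta>" if "\<phi> \<in> \<Phi>" for \<phi>
  proof -
    have op: "bounded_operator scaleE (*) \<phi>" by (rule \<Phi>(2)[OF that])
    have "\<phi> (y i) - (\<phi> (y j) + \<phi> (y l)) / 2 = (\<phi> (y i) - \<phi> (y j)) / 2 + (\<phi> (y i) - \<phi> (y l)) / 2"
      by (simp add: field_simps)
    also have "norm \<dots> \<le> norm (\<phi> (y i) - \<phi> (y j)) / 2 + norm (\<phi> (y i) - \<phi> (y l)) / 2"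
      by (rule norm_triangle_mono) (auto simp: norm_divide)
    also have "\<dots> < \<eta> / 2" using J(3)[OF that ijl(1,2)] J(3)[OF that ijl(1,3)] by linarith
    finally show ?thesis
      using norm_functional_triple[OF op d(1,2)] \<Phi>(3) by (simp add: bounded_operator_zero[OF op])
  qed
  then have "norm (Q (triple \<pi> y i j l)) < d" by (intro \<Phi>(4) norm_triple_le d) auto
  then show ?thesis using that ijl J(1) d by blast
qed

end

lemma not_shrinking_not_complemented:
  assumes "\<not> shrinking" "k > 1" "hom_polys scaleE scaleF k \<noteq> wb_polys scaleE scaleF k"
  shows "\<not> complemented_in (wb_polys scaleE scaleF k) (poly_space scaleE scaleF k)"
proof -
  obtain f :: 'f where f: "f \<noteq> 0"
  proof (rule ccontr)
    assume "\<not> thesis"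
    then have "P = 0" for P :: "'e \<Rightarrow> 'f" using that by (auto simp: fun_eq_iff)
    then have "P \<in> wb_polys scaleE scaleF k" for P using wb_polys_zero by metis
    then show False using assms(3) wb_polys_hom by blast
  qed
  obtain \<pi> y r K where sys: "almost_biorthogonal \<pi> y r K"
    by (rule not_shrinking_biorthogonal[OF assms(1)]) (rule that)
  obtain \<psi> where \<psi>: "bounded_operator scaleF (*) \<psi>" "\<And>x. norm (\<psi> x) \<le> 2 * norm x" "norm f \<le> norm (\<psi> f)"
    by (rule F.norming_functional[of f]) (rule that)
  \<comment> \<open>The functional \<open>\<psi>\<close> may double norms, so
    \<open>norm f / 6\<close> is the size that contradicts the lower bound
    \<open>norm f / 3\<close>.\<close>
  have k0: "k > 0" and d: "norm f / 6 > 0" using assms(2) f by simp_all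
  have fam: "poly_family k (power_family k \<pi> f)" by (rule poly_family_power(1)[OF sys k0])
  \<comment> \<open>Phillips' argument allows countably many test points; decoding \<open>m\<close>
    lists all triples, so those suited to \<open>M\<close> are among them.\<close>
  let ?z = "\<lambda>m. triple \<pi> y (fst (prod_decode m)) (fst (prod_decode (snd (prod_decode m))))
      (snd (prod_decode (snd (prod_decode m))))"
  show ?thesis
  proof (rule not_complemented[OF k0 fam \<psi>(1), of ?z])
    fix M Q assume M: "infinite M" and Q: "Q \<in> wb_polys scaleE scaleF k"
      and eq: "\<And>m. \<psi> (Q (?z m)) = \<psi> (power_family k \<pi> f (indicator M) (?z m))"
    obtain i j l where ijl: "i \<in> M" "i \<noteq> j" "i \<noteq> l" "j \<noteq> l" "norm (Q (triple \<pi> y i j l)) < norm f / 6"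
      by (rule wb_triple_small[OF sys Q k0 M d]) (rule that)
    let ?v = "triple \<pi> y i j l" and ?q = "\<Sum>m. indicator M m * \<pi> m (triple \<pi> y i j l) ^ k"
    have "\<psi> (Q ?v) = ?q * \<psi> f"
      using eq[of "prod_encode (i, prod_encode (j, l))"]
      by (simp add: power_family_def bounded_operator_scale[OF \<psi>(1)])
    then have "norm (\<psi> (Q ?v)) = norm ?q * norm (\<psi> f)" by (simp add: norm_mult)
    moreover have "norm f / 3 \<le> norm ?q * norm f"
      using power_family_triple[OF sys assms(2) ijl(2,3,4,1), of f] by (simp add: power_family_def F.norm_scale)
    moreover have "norm ?q * norm f \<le> norm ?q * norm (\<psi> f)" using \<psi>(3) by (intro mult_left_mono) auto
    ultimately show False using \<psi>(2)[of "Q ?v"] ijl(5) by linarith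
  qed
qed

text \<open>The polynomial \<open>\<Sum> \<pi>_i^k f\<close> with all coefficients 1 is not weakly
  continuous at 0. Hence equality of the two spaces forces a shrinking expansion as soon as the
  range is nonzero.\<close>

lemma not_shrinking_not_wb:
  assumes "\<not> shrinking" "k > 1" "(f :: 'f) \<noteq> 0"
  shows "hom_polys scaleE scaleF k \<noteq> wb_polys scaleE scaleF k"
proof
  assume eq: "hom_polys scaleE scaleF k = wb_polys scaleE scaleF k"
  obtain \<pi> y r K where sys: "almost_biorthogonal \<pi> y r K"
    by (rule not_shrinking_biorthogonal[OF assms(1)]) (rule that)
  have k0: "k > 0" and d: "norm f / 6 > 0" using assms(2,3) by simp_all
  have Q: "power_family k \<pi> f (indicator UNIV) \<in> wb_polys scaleE scaleF k"
    using poly_family_hom[OF poly_family_power(1)[OF sys k0] bounded_indicator] eq by blast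
  obtain i j l where ijl: "i \<in> UNIV" "i \<noteq> j" "i \<noteq> l" "j \<noteq> l"
    "norm (power_family k \<pi> f (indicator UNIV) (triple \<pi> y i j l)) < norm f / 6"
    by (rule wb_triple_small[OF sys Q k0 infinite_UNIV_nat d]) (rule that)
  then show False using power_family_triple[OF sys assms(2) ijl(2,3,4,1), of f] d by linarith
qed

end

subsection \<open>Weakly unconditionally Cauchy series\<close>

text \<open>A norm form of weakly unconditionally Cauchy series; the unit vectors of
  \<open>c_0\<close> and their images under bounded operators have it.\<close>

definition bounded_sums :: "(nat \<Rightarrow> 'a::real_normed_vector) \<Rightarrow> bool" where
  "bounded_sums v \<longleftrightarrow> (\<exists>K. \<forall>N. finite N \<longrightarrow> norm (sum v N) \<le> K)"

lemma bounded_sums_subseq: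
  assumes "bounded_sums v" "inj r" shows "bounded_sums (\<lambda>n. v (r n))"
proof -
  obtain K where K: "\<And>N. finite N \<Longrightarrow> norm (sum v N) \<le> K" using assms(1) by (auto simp: bounded_sums_def)
  have "norm (\<Sum>n\<in>N. v (r n)) \<le> K" if "finite N" for N
  proof -
    have "(\<Sum>n\<in>N. v (r n)) = sum v (r ` N)"
      using inj_on_subset[OF assms(2) subset_UNIV] by (simp add: sum.reindex)
    then show ?thesis using K[of "r ` N"] that by simp
  qed
  then show ?thesis by (auto simp: bounded_sums_def)
qed

text \<open>By the Bessaga-Pelczynski theorem, this says that the space contains no copy of \<open>c\<^sub>0\<close>.\<close>

definition no_c0_sequence :: "'a::real_normed_vector itself \<Rightarrow> bool" where
  "no_c0_sequence _ \<longleftrightarrow> (\<forall>v :: nat \<Rightarrow> 'a. bounded_sums v \<longrightarrow> v \<longlonglongrightarrow> 0)"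

text \<open>Otherwise disjoint blocks with sums of norm at least \<open>e\<close> exist; they form a
  sequence that again has bounded sums but does not tend to zero.\<close>

lemma bounded_sums_unconditionally_Cauchy:
  fixes v :: "nat \<Rightarrow> 'a::real_normed_vector"
  assumes "no_c0_sequence TYPE('a)" "bounded_sums v"
  shows "unconditionally_Cauchy v"
proof (rule ccontr)
  assume "\<not> unconditionally_Cauchy v"
  then obtain e where e: "e > 0" and "\<And>L. \<exists>N. finite N \<and> N \<subseteq> {L..} \<and> e \<le> norm (sum v N)"
    by (auto simp: unconditionally_Cauchy_def not_less)
  then obtain g where g: "\<And>L. finite (g L)" "\<And>L. g L \<subseteq> {L..}" "\<And>L. e \<le> norm (sum v (g L))"
    by metis
  define h where "h L = Suc (Max (insert L (g L)))" for L
  have gh: "g L \<subseteq> {L..<h L}" for L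
    using g(1,2)[of L] by (auto simp: h_def less_Suc_eq_le)
  have hL: "L < h L" for L using g(1)[of L] by (simp add: h_def less_Suc_eq_le)
  define a where "a n = (h ^^ n) 0" for n
  have aS: "a (Suc n) = h (a n)" for n by (simp add: a_def)
  have mono: "strict_mono a" by (rule strict_mono_Suc_iff[THEN iffD2]) (simp add: aS hL)
  have disj: "g (a n) \<inter> g (a m) = {}" if "n < m" for n m
  proof -
    have "a (Suc n) \<le> a m" using that by (simp add: strict_mono_less_eq[OF mono])
    then show ?thesis using gh[of "a n"] g(2)[of "a m"] by (force simp: aS)
  qed
  obtain K where K: "\<And>N. finite N \<Longrightarrow> norm (sum v N) \<le> K" using assms(2) by (auto simp: bounded_sums_def)
  have "norm (\<Sum>n\<in>N. sum v (g (a n))) \<le> K" if N: "finite N" for N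
  proof -
    have "sum v (\<Union>n\<in>N. g (a n)) = (\<Sum>n\<in>N. sum v (g (a n)))"
      using N g(1) disj by (intro sum.UNION_disjoint) (auto simp: neq_iff)
    then show ?thesis using K[of "\<Union>n\<in>N. g (a n)"] N g(1) by simp
  qed
  then have "(\<lambda>n. sum v (g (a n))) \<longlonglongrightarrow> 0"
    using assms(1) unfolding no_c0_sequence_def bounded_sums_def by blast
  from LIMSEQ_D[OF this e] obtain n where "norm (sum v (g (a n))) < e" by auto
  then show False using g(3)[of "a n"] by simp
qed

text \<open>An injective finite rank operator would map a basis to an independent subset of a finite
  span.\<close>

lemma (in banach_space_over) finite_rank_kernel:
  assumes "finite_rank T" "\<nexists>B. finite B \<and> span B = UNIV"
  obtains x where "norm x = 1" "T x = 0"
proof -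
  have op: "bounded_operator scale scale T" using assms(1) by (simp add: finite_rank_def)
  interpret L: Vector_Spaces.linear scale scale T using op by (simp add: bounded_operator_def)
  obtain B where B: "finite B" "range T \<subseteq> span B" using assms(1) by (auto simp: finite_rank_def)
  have "\<not> inj T"
  proof
    assume inj: "inj T"
    obtain I where I: "independent I" "UNIV \<subseteq> span I" 
      by (rule maximal_independent_subset[of UNIV]) (rule that)
    have "independent (T ` I)" by (rule L.independent_inj_image[OF I(1) inj])
    then have "finite (T ` I)" using independent_span_bound[OF B(1)] B(2) by blast
    then have "finite I" using inj by (meson finite_imageD inj_on_subset subset_UNIV)
    then show False using assms(2) I(2) by blast
  qed
  then obtain x where x: "T x = 0" "x \<noteq> 0" using L.inj_iff_eq_0 by blast
  show ?thesis
  proof (rule that[of "scale (inverse (of_real (norm x))) x"])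
    show "norm (scale (inverse (of_real (norm x))) x) = 1" using x(2) by (simp add: norm_scale norm_inverse)
    show "T (scale (inverse (of_real (norm x))) x) = 0" by (simp add: bounded_operator_scale[OF op] x(1))
  qed
qed

context banach_pair
begin

lemma multiplier_sums_bound:
  fixes v :: "nat \<Rightarrow> 'f"
  assumes "\<And>N. finite N \<Longrightarrow> norm (sum v N) \<le> K" "finite N" "\<And>n. n \<in> N \<Longrightarrow> norm (c n) \<le> d" "d \<ge> 0"
  shows "norm (\<Sum>n\<in>N. scaleF (c n) (v n)) \<le> d * (4 * K)"
proof (cases "d = 0")
  case True
  then show ?thesis using assms(3) by simp
next
  case False
  have "norm (\<Sum>n\<in>N. scaleF (c n / of_real d) (v n)) \<le> 4 * K"
    using assms False by (intro F.multiplier_bound) (auto simp: norm_divide intro: finite_subset)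
  then have "d * norm (\<Sum>n\<in>N. scaleF (c n / of_real d) (v n)) \<le> d * (4 * K)"
    using assms(4) by (rule mult_left_mono)
  moreover have "(\<Sum>n\<in>N. scaleF (c n) (v n)) = scaleF (of_real d) (\<Sum>n\<in>N. scaleF (c n / of_real d) (v n))"
    using False by (simp add: F.scale_sum_right)
  ultimately show ?thesis using assms(4) by (simp add: F.norm_scale)
qed

lemma mlin_ball_bound:
  assumes A: "mlin k A" and C: "\<And>x. (\<And>i. norm (x i) \<le> 1) \<Longrightarrow> norm (A x) \<le> C"
  shows "norm (A x) \<le> C * (\<Prod>i<k. norm (x i))"
proof (cases "\<exists>i<k. x i = 0")
  case True
  then have "A x = 0" using multilin_eq_0[OF A] by blast
  moreover have "C \<ge> 0" using C[of "\<lambda>_. 0"] norm_ge_zero order_trans by (metis norm_zero zero_le_one)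
  ultimately show ?thesis by (simp add: prod_nonneg)
next
  case False
  define y where "y i = scaleE (inverse (of_real (norm (x i)))) (x i)" for i
  have "norm (y i) \<le> 1" for i by (cases "x i = 0") (auto simp: y_def E.norm_scale norm_inverse)
  then have "norm (A y) \<le> C" by (rule C)
  moreover have "A x = A (\<lambda>i. scaleE (of_real (norm (x i))) (y i))"
    using False by (intro multilin_cong[OF A]) (auto simp: y_def)
  then have "norm (A x) = (\<Prod>i<k. norm (x i)) * norm (A y)"
    unfolding mlin_scale_all[OF A] by (simp add: F.norm_scale prod_norm[symmetric])
  ultimately show ?thesis by (simp add: mult_right_mono prod_nonneg mult.commute)
qed

text \<open>Pointwise limits keep linearity in each slot, and the bound of the partial sums on unit
  balls passes to the limit.\<close>

lemma mlin_suminf: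
  assumes A: "\<And>p. mlin k (A p)" and s: "\<And>x. summable (\<lambda>p. A p x)"
    and C: "\<And>x n. (\<And>i. norm (x i) \<le> 1) \<Longrightarrow> norm (\<Sum>p<n. A p x) \<le> C"
  shows "mlin k (\<lambda>x. \<Sum>p. A p x)"
proof (rule mlinI)
  fix x :: "nat \<Rightarrow> 'e" and i a b assume i: "i < k"
  show "(\<Sum>p. A p (x(i := a + b))) = (\<Sum>p. A p (x(i := a))) + (\<Sum>p. A p (x(i := b)))"
    unfolding multilin_add[OF A i] by (rule suminf_add[OF s s, symmetric])
next
  fix x :: "nat \<Rightarrow> 'e" and i c a assume i: "i < k"
  have "(\<lambda>n. scaleF c (\<Sum>p<n. A p (x(i := a)))) \<longlonglongrightarrow> scaleF c (\<Sum>p. A p (x(i := a)))"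
    by (intro F.tendsto_scale tendsto_const summable_LIMSEQ s)
  then have "(\<lambda>p. A p (x(i := scaleE c a))) sums scaleF c (\<Sum>p. A p (x(i := a)))"
    unfolding sums_def multilin_scale[OF A i] by (simp add: F.scale_sum_right)
  then show "(\<Sum>p. A p (x(i := scaleE c a))) = scaleF c (\<Sum>p. A p (x(i := a)))"
    by (rule sums_unique[symmetric])
next
  fix x y :: "nat \<Rightarrow> 'e" assume "\<And>i. i < k \<Longrightarrow> x i = y i"
  then have "A p x = A p y" for p by (rule multilin_cong[OF A])
  then show "(\<Sum>p. A p x) = (\<Sum>p. A p y)" by simp
next
  show "C \<ge> 0" using C[of "\<lambda>_. 0" 0] by simp
  fix x :: "nat \<Rightarrow> 'e"
  show "norm (\<Sum>p. A p x) \<le> C * (\<Prod>i<k. norm (x i))"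
  proof (rule Lim_bounded)
    show "(\<lambda>n. norm (\<Sum>p<n. A p x)) \<longlonglongrightarrow> norm (\<Sum>p. A p x)"
      by (intro tendsto_norm summable_LIMSEQ s)
    show "\<forall>n\<ge>0. norm (\<Sum>p<n. A p x) \<le> C * (\<Prod>i<k. norm (x i))"
    proof (intro allI impI)
      fix n
      show "norm (\<Sum>p<n. A p x) \<le> C * (\<Prod>i<k. norm (x i))"
        by (rule mlin_ball_bound[OF mlin_sum[OF A] C])
    qed
  qed
qed

text \<open>Replacing \<open>w\<close> by \<open>w - \<phi>(w) x\<^sub>0\<close>, which lies in the
  kernel of \<open>\<phi>\<close>, the values of \<open>A\<close> become the values of one \<open>k\<close>-homogeneous polynomial near \<open>x\<^sub>0\<close>.\<close>

lemma weakly_null_slots: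
  assumes eq: "hom_polys scaleE scaleF k = wb_polys scaleE scaleF k" and A: "mlin k A"
    and D: "D \<subseteq> {..<k}" "D \<noteq> {}"
    and wr: "\<And>l. norm (w l) \<le> r"
    and null: "\<And>\<phi>. bounded_operator scaleE (*) \<phi> \<Longrightarrow> (\<lambda>l. \<phi> (w l)) \<longlonglongrightarrow> 0"
  shows "(\<lambda>l. A (\<lambda>i. if i \<in> D then w l else z i)) \<longlonglongrightarrow> 0"
proof (cases "\<exists>x :: 'e. x \<noteq> 0")
  case False
  obtain d where d: "d \<in> D" "d < k" using D by auto
  have "A (\<lambda>i. if i \<in> D then w l else z i) = 0" for l
    by (rule multilin_eq_0[OF A d(2)]) (use False in auto)
  then show ?thesis by simp
next
  case True
  then obtain x1 :: 'e where x1: "x1 \<noteq> 0" by blast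
  obtain \<phi> where \<phi>: "bounded_operator scaleE (*) \<phi>" "norm x1 \<le> norm (\<phi> x1)"
    by (rule E.norming_functional[of x1]) (rule that)
  have "\<phi> x1 \<noteq> 0" using x1 \<phi>(2) by auto
  define x0 where "x0 = scaleE (inverse (\<phi> x1)) x1"
  have \<phi>0: "\<phi> x0 = 1" using \<open>\<phi> x1 \<noteq> 0\<close> by (simp add: x0_def bounded_operator_scale[OF \<phi>(1)])
  obtain B where B: "B > 0" "\<And>x. norm (\<phi> x) \<le> B * norm x" using bounded_operator_bound[OF \<phi>(1)] by blast
  have rank1: "bounded_operator scaleE scaleE (\<lambda>x. scaleE (\<phi> x) y)" for y
  proof (rule bounded_operatorI[OF E.banach_space_over_axioms E.banach_space_over_axioms])
    show "norm (scaleE (\<phi> x) y) \<le> (B * norm y) * norm x" for x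
      using mult_right_mono[OF B(2)[of x], of "norm y"] by (simp add: E.norm_scale mult_ac)
  qed (simp_all add: bounded_operator_add[OF \<phi>(1)] bounded_operator_scale[OF \<phi>(1)] E.scale_left_distrib)
  \<comment> \<open>Both kinds of slots become operators in one variable. At \<open>x0 + w'\<close>
    with \<open>\<phi> x0 = 1\<close> and \<open>\<phi> w' = 0\<close> they return \<open>w'\<close>
    in the slots of \<open>D\<close> and \<open>z i\<close> elsewhere; at \<open>x0\<close> the
    slots of \<open>D\<close> vanish.\<close>
  define T where "T i x = (if i \<in> D then x - scaleE (\<phi> x) x0 else scaleE (\<phi> x) (z i))" for i x
  have opT: "bounded_operator scaleE scaleE (T i)" for i
    unfolding T_def[abs_def]
    by (cases "i \<in> D") (simp_all add: rank1 E.bounded_operator_diff_fun E.bounded_operator_id)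
  define P where "P x = A (\<lambda>i. T i x)" for x
  have "P \<in> hom_polys scaleE scaleF k"
    unfolding P_def[abs_def] using mlin_diag[OF mlin_compose[OF A opT]] by simp
  then have P: "P \<in> wb_polys scaleE scaleF k" using eq by simp
  define w' where "w' l = w l - scaleE (\<phi> (w l)) x0" for l
  have r0: "r \<ge> 0" using wr[of 0] norm_ge_zero order_trans by blast
  have w'r: "norm (w' l) \<le> r + B * r * norm x0" for l
  proof -
    have "norm (\<phi> (w l)) \<le> B * r" using B wr[of l] by (meson less_imp_le mult_left_mono order_trans)
    then have "norm (scaleE (\<phi> (w l)) x0) \<le> B * r * norm x0"
      unfolding E.norm_scale by (intro mult_right_mono) auto
    then show ?thesis unfolding w'_def using norm_triangle_ineq4 wr[of l] by (meson add_mono order_trans)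
  qed
  have \<phi>w': "\<phi> (w' l) = 0" for l
    by (simp add: w'_def bounded_operator_diff[OF \<phi>(1)] bounded_operator_scale[OF \<phi>(1)] \<phi>0)
  have "(\<lambda>l. P (x0 + w' l)) \<longlonglongrightarrow> P x0"
  proof (rule weak_limit_wb[OF P, of _ "norm x0 + (r + B * r * norm x0)"])
    show "norm (x0 + w' l) \<le> norm x0 + (r + B * r * norm x0)" for l
      using norm_triangle_ineq[of x0 "w' l"] w'r[of l] by linarith
    show "norm x0 \<le> norm x0 + (r + B * r * norm x0)" using r0 B(1) by simp
    fix \<psi> assume \<psi>: "bounded_operator scaleE (*) \<psi>"
    have "(\<lambda>l. \<psi> x0 + (\<psi> (w l) - \<phi> (w l) * \<psi> x0)) \<longlonglongrightarrow> \<psi> x0 + (0 - 0 * \<psi> x0)"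
      by (intro tendsto_intros null \<psi> \<phi>(1))
    then show "(\<lambda>l. \<psi> (x0 + w' l)) \<longlonglongrightarrow> \<psi> x0"
      by (simp add: w'_def bounded_operator_add[OF \<psi>] bounded_operator_diff[OF \<psi>] bounded_operator_scale[OF \<psi>])
  qed
  moreover have "P x0 = 0"
  proof -
    obtain d where d: "d \<in> D" "d < k" using D by auto
    show ?thesis unfolding P_def by (rule multilin_eq_0[OF A d(2)]) (simp add: T_def d(1) \<phi>0)
  qed
  moreover have "P (x0 + w' l) = A (\<lambda>i. if i \<in> D then w' l else z i)" for l
    unfolding P_def by (intro multilin_cong[OF A]) (simp add: T_def bounded_operator_add[OF \<phi>(1)] \<phi>0 \<phi>w')
  ultimately have lim': "(\<lambda>l. A (\<lambda>i. if i \<in> D then w' l else z i)) \<longlonglongrightarrow> 0" by simp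
  obtain C where C: "C \<ge> 0" "\<And>x. norm (A x) \<le> C * (\<Prod>i<k. norm (x i))" using multilin_bound[OF A] by blast
  \<comment> \<open>A common bound for \<open>w\<close>, \<open>w'\<close> and \<open>z\<close>; it
    serves to replace \<open>w'\<close> by \<open>w\<close>, whose difference
    \<open>\<phi> (w l)\<close> times \<open>x0\<close> tends to zero in norm.\<close>
  define R where "R = r + B * r * norm x0 + (\<Sum>i<k. norm (z i))"
  have Rz: "norm (z i) \<le> R" if "i < k" for i
    using member_le_sum[of i "{..<k}" "\<lambda>i. norm (z i)"] that r0 B(1) by (auto simp: R_def add_increasing)
  have Rw: "norm (w l) \<le> R" "norm (w' l) \<le> R" for l
  proof -
    have "(\<Sum>i<k. norm (z i)) \<ge> 0" "B * r * norm x0 \<ge> 0" using r0 B(1) by (auto simp: sum_nonneg)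
    then show "norm (w l) \<le> R" "norm (w' l) \<le> R" using wr[of l] w'r[of l] unfolding R_def by linarith+
  qed
  have "norm (A (\<lambda>i. if i \<in> D then w l else z i) - A (\<lambda>i. if i \<in> D then w' l else z i))
      \<le> C * R ^ (k - 1) * (\<Sum>i<k. norm (\<phi> (w l)) * norm x0)" for l
  proof (rule order_trans[OF multilin_diff_bound[OF A C, where R = R]])
    have "R \<ge> 0" using order_trans[OF norm_ge_zero Rw(1)[of 0]] .
    then show "C * R ^ (k - 1) * (\<Sum>i<k. norm ((if i \<in> D then w l else z i) - (if i \<in> D then w' l else z i)))
        \<le> C * R ^ (k - 1) * (\<Sum>i<k. norm (\<phi> (w l)) * norm x0)"
      using C(1) by (intro mult_left_mono sum_mono) (auto simp: w'_def E.norm_scale)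
  qed (use Rz Rw in auto)
  moreover have "(\<lambda>l. C * R ^ (k - 1) * (\<Sum>i<k. norm (\<phi> (w l)) * norm x0)) \<longlonglongrightarrow>
      C * R ^ (k - 1) * (\<Sum>i<k. norm (0 :: 'k) * norm x0)"
    by (intro tendsto_intros null \<phi>(1))
  then have "(\<lambda>l. C * R ^ (k - 1) * (\<Sum>i<k. norm (\<phi> (w l)) * norm x0)) \<longlonglongrightarrow> 0" by simp
  ultimately have "(\<lambda>l. A (\<lambda>i. if i \<in> D then w l else z i) - A (\<lambda>i. if i \<in> D then w' l else z i)) \<longlonglongrightarrow> 0"
    by (intro Lim_null_comparison[of "\<lambda>l. A (\<lambda>i. if i \<in> D then w l else z i) - A (\<lambda>i. if i \<in> D then w' l else z i)"
          "\<lambda>l. C * R ^ (k - 1) * (\<Sum>i<k. norm (\<phi> (w l)) * norm x0)"]) simp_all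
  from tendsto_add[OF this lim'] show ?thesis by simp
qed

text \<open>Raises a linear operator to any degree by multiplying with values of a fixed functional,
  so that information on polynomials of degree \<open>k\<close> applies to operators.\<close>

lemma mlin_functional_operator:
  assumes \<phi>: "bounded_operator scaleE (*) \<phi>" and U: "bounded_operator scaleE scaleF U"
  shows "mlin (Suc k) (\<lambda>x. scaleF (\<Prod>l<k. \<phi> (x l)) (U (x k)))"
proof -
  obtain B where B: "B > 0" "\<And>x. norm (\<phi> x) \<le> B * norm x" using bounded_operator_bound[OF \<phi>] by blast
  obtain C where C: "C > 0" "\<And>x. norm (U x) \<le> C * norm x" using bounded_operator_bound[OF U] by blast
  have upd: "scaleF (\<Prod>l<k. \<phi> ((x(i := a)) l)) (U ((x(i := a)) k))
      = (if i = k then scaleF (\<Prod>l<k. \<phi> (x l)) (U a)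
         else scaleF (\<phi> a) (scaleF (\<Prod>l\<in>{..<k} - {i}. \<phi> (x l)) (U (x k))))" if "i < Suc k" for x i a
  proof (cases "i = k")
    case True
    moreover have "(\<Prod>l<k. \<phi> ((x(k := a)) l)) = (\<Prod>l<k. \<phi> (x l))" by (intro prod.cong) auto
    ultimately show ?thesis by simp
  next
    case False
    then have "i < k" using that by simp
    then show ?thesis unfolding prod_upd[OF \<open>i < k\<close>, of \<phi>] using False by simp
  qed
  show ?thesis
  proof (rule mlinI)
    fix x :: "nat \<Rightarrow> 'e" and i a b assume i: "i < Suc k"
    show "scaleF (\<Prod>l<k. \<phi> ((x(i := a + b)) l)) (U ((x(i := a + b)) k))
        = scaleF (\<Prod>l<k. \<phi> ((x(i := a)) l)) (U ((x(i := a)) k))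
        + scaleF (\<Prod>l<k. \<phi> ((x(i := b)) l)) (U ((x(i := b)) k))"
      unfolding upd[OF i] bounded_operator_add[OF \<phi>] bounded_operator_add[OF U]
      by (simp add: F.scale_left_distrib F.scale_right_distrib distrib_right)
  next
    fix x :: "nat \<Rightarrow> 'e" and i c a assume i: "i < Suc k"
    show "scaleF (\<Prod>l<k. \<phi> ((x(i := scaleE c a)) l)) (U ((x(i := scaleE c a)) k))
        = scaleF c (scaleF (\<Prod>l<k. \<phi> ((x(i := a)) l)) (U ((x(i := a)) k)))"
      unfolding upd[OF i] bounded_operator_scale[OF \<phi>] bounded_operator_scale[OF U]
      by (simp add: mult.commute mult.assoc)
  next
    fix x y :: "nat \<Rightarrow> 'e" assume xy: "\<And>i. i < Suc k \<Longrightarrow> x i = y i"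
    then have "(\<Prod>l<k. \<phi> (x l)) = (\<Prod>l<k. \<phi> (y l))" by (intro prod.cong) auto
    then show "scaleF (\<Prod>l<k. \<phi> (x l)) (U (x k)) = scaleF (\<Prod>l<k. \<phi> (y l)) (U (y k))"
      using xy[of k] by simp
  next
    fix x :: "nat \<Rightarrow> 'e"
    have "(\<Prod>l<k. norm (\<phi> (x l))) \<le> (\<Prod>l<k. B * norm (x l))" by (intro prod_mono) (simp add: B)
    then have "norm (\<Prod>l<k. \<phi> (x l)) * norm (U (x k)) \<le> (\<Prod>l<k. B * norm (x l)) * (C * norm (x k))"
      using B(1) by (intro mult_mono C(2)) (auto simp: prod_norm intro!: prod_nonneg)
    then show "norm (scaleF (\<Prod>l<k. \<phi> (x l)) (U (x k))) \<le> (B ^ k * C) * (\<Prod>i<Suc k. norm (x i))"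
      by (simp add: F.norm_scale prod.distrib mult_ac)
  qed (use B C in simp)
qed

end

section \<open>Equality of the two spaces excludes \<open>c_0\<close> from the range space\<close>

context fd_pair
begin

lemma weakly_null_remainders:
  assumes shrinking "bounded_operator scaleE (*) \<phi>" "\<And>l. norm (x l) \<le> r"
  shows "(\<lambda>l. \<phi> (x l - X.S l (x l))) \<longlonglongrightarrow> 0"
proof (rule LIMSEQ_I)
  fix e :: real assume e: "e > 0"
  have r0: "r \<ge> 0" using assms(3)[of 0] norm_ge_zero order_trans by blast
  obtain M where M: "\<And>m x. m \<ge> M \<Longrightarrow> norm (\<phi> (x - X.S m x)) \<le> (e / (r + 1) / 2) * norm x"
    using assms(1,2) e r0 unfolding shrinking_def
    by (metis add_nonneg_pos divide_pos_pos zero_less_one zero_less_numeral)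
  have "norm (\<phi> (x l - X.S l (x l)) - 0) < e" if "l \<ge> M" for l
  proof -
    have "norm (\<phi> (x l - X.S l (x l))) \<le> (e / (r + 1) / 2) * norm (x l)" by (rule M[OF that])
    also have "\<dots> \<le> (e / (r + 1) / 2) * (r + 1)"
      using assms(3)[of l] e r0 by (intro mult_left_mono) auto
    also have "\<dots> = e / 2"
    proof -
      have "r + 1 \<noteq> 0" using r0 by simp
      then show ?thesis by (simp add: field_simps)
    qed
    finally show ?thesis using e by simp
  qed
  then show "\<exists>no. \<forall>n\<ge>no. norm (\<phi> (x n - X.S n (x n)) - 0) < e" by blast
qed

text \<open>A bad sequence \<open>u\<close> in the range yields the operator
  \<open>U z = \<Sum> \<phi>_p(z) u_p\<close>, essentially a map through \<open>c_0\<close>. It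
  stays bounded away from zero on a weakly null sequence, and raising \<open>U\<close> to degree
  \<open>k\<close> contradicts \<open>weakly_null_slots\<close>.\<close>

lemma wb_no_c0_sequence:
  assumes eq: "hom_polys scaleE scaleF k = wb_polys scaleE scaleF k" and k: "k > 0" and shrinking
    and inf: "\<nexists>B. finite B \<and> E.span B = UNIV"
  shows "no_c0_sequence TYPE('f)"
  unfolding no_c0_sequence_def
proof (intro allI impI, rule ccontr)
  fix v :: "nat \<Rightarrow> 'f" assume v: "bounded_sums v" and "\<not> v \<longlonglongrightarrow> 0"
  then obtain d where d: "d > 0" and "\<And>n0. \<exists>n\<ge>n0. d \<le> norm (v n)"
    unfolding lim_sequentially dist_norm by (auto simp: not_less)
  then have "infinite {n. d \<le> norm (v n)}" by (auto simp: infinite_nat_iff_unbounded_le)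
  then obtain a :: "nat \<Rightarrow> nat" where a: "strict_mono a" "\<And>n. d \<le> norm (v (a n))"
    using infinite_enumerate[of "{n. d \<le> norm (v n)}"] by auto
  define u where "u n = v (a n)" for n
  have "bounded_sums u"
    unfolding u_def by (rule bounded_sums_subseq[OF v strict_mono_imp_inj_on[OF a(1)]])
  then obtain K where K: "\<And>N. finite N \<Longrightarrow> norm (sum u N) \<le> K" by (auto simp: bounded_sums_def)
  have K0: "K \<ge> 0" using K[of "{}"] by simp
  have du: "d \<le> norm (u n)" for n using a(2) by (simp add: u_def)
  \<comment> \<open>Infinite dimension enters here; since the expansion is shrinking, these unit
    vectors are weakly null.\<close>
  have "\<exists>x. norm x = 1 \<and> X.S m x = 0" for m
    by (rule E.finite_rank_kernel[OF X.finite_rank_S[of m] inf]) blast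
  then obtain x where x: "\<And>m. norm (x m) = 1" "\<And>m. X.S m (x m) = 0" by metis
  have null: "(\<lambda>l. \<phi> (x l)) \<longlonglongrightarrow> 0" if "bounded_operator scaleE (*) \<phi>" for \<phi>
    using weakly_null_remainders[OF assms(3) that, of x 1] x by simp
  have S_null: "(\<lambda>l. X.S p (x l)) \<longlonglongrightarrow> 0" for p
  proof -
    obtain B \<phi> where B: "finite B" "\<And>b. b \<in> B \<Longrightarrow> bounded_operator scaleE (*) (\<phi> b)"
      "\<And>x. X.S p x = (\<Sum>b\<in>B. scaleE (\<phi> b x) b)"
      by (rule E.finite_rank_coordinates[OF X.finite_rank_S[of p]]) (rule that)
    have "(\<lambda>l. \<Sum>b\<in>B. scaleE (\<phi> b (x l)) b) \<longlonglongrightarrow> (\<Sum>b\<in>B. scaleE 0 b)"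
      by (intro tendsto_sum E.tendsto_scale null B(2) tendsto_const)
    then show ?thesis by (simp add: B(3))
  qed
  have "\<exists>l\<ge>p. norm (X.S p (x l)) \<le> 1 / 2" for p
  proof -
    have "\<forall>\<^sub>F l in sequentially. p \<le> l \<and> norm (X.S p (x l)) < 1 / 2"
      using tendstoD[OF S_null, of "1 / 2" p] eventually_ge_at_top[of p]
      by (intro eventually_conj) (simp_all add: dist_norm)
    then show ?thesis unfolding eventually_sequentially by (metis less_imp_le order_refl)
  qed
  then obtain l where l: "\<And>p. p \<le> l p" "\<And>p. norm (X.S p (x (l p))) \<le> 1 / 2" by metis
  define y where "y p = x (l p)" for p
  have y1: "norm (y p) \<le> 1" for p by (simp add: y_def x(1))
  have l_lim: "filterlim l at_top sequentially"
    by (rule filterlim_at_top_mono[OF filterlim_ident]) (simp add: l(1))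
  have y_null: "(\<lambda>p. \<phi> (y p)) \<longlonglongrightarrow> 0" if "bounded_operator scaleE (*) \<phi>" for \<phi>
    unfolding y_def by (rule filterlim_compose[OF null[OF that] l_lim])
  \<comment> \<open>Norming the remainder of \<open>y p\<close> and composing with the remainder
    operator gives functionals that tend to zero pointwise but are at least \<open>1 / 2\<close> at
    \<open>y p\<close>.\<close>
  have "\<exists>\<psi>. bounded_operator scaleE (*) \<psi> \<and> (\<forall>z. norm (\<psi> z) \<le> 2 * norm z) \<and>
      norm (y p - X.S p (y p)) \<le> norm (\<psi> (y p - X.S p (y p)))" for p
    by (rule E.norming_functional[of "y p - X.S p (y p)"]) blast
  then obtain \<psi> where \<psi>: "\<And>p. bounded_operator scaleE (*) (\<psi> p)" "\<And>p z. norm (\<psi> p z) \<le> 2 * norm z"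
    "\<And>p. norm (y p - X.S p (y p)) \<le> norm (\<psi> p (y p - X.S p (y p)))" by metis
  define \<phi> where "\<phi> p z = \<psi> p (z - X.S p z)" for p z
  have \<phi>: "bounded_operator scaleE (*) (\<phi> p)" for p
    unfolding \<phi>_def
    by (intro bounded_operator_compose[OF E.bounded_operator_diff_fun \<psi>(1)] E.bounded_operator_id X.bounded_operator_S)
  have \<phi>_big: "1 / 2 \<le> norm (\<phi> p (y p))" for p
    using \<psi>(3)[of p] norm_triangle_ineq2[of "y p" "X.S p (y p)"] l(2)[of p] x(1)[of "l p"]
    by (simp add: \<phi>_def y_def)
  have \<phi>_lim: "(\<lambda>p. \<phi> p z) \<longlonglongrightarrow> 0" for z
  proof (rule Lim_null_comparison)
    show "\<forall>\<^sub>F p in sequentially. norm (\<phi> p z) \<le> 2 * norm (z - X.S p z)" by (simp add: \<phi>_def \<psi>(2))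
    have "(\<lambda>p. 2 * norm (z - X.S p z)) \<longlonglongrightarrow> 2 * norm (z - z)" by (intro tendsto_intros X.S_tendsto)
    then show "(\<lambda>p. 2 * norm (z - X.S p z)) \<longlonglongrightarrow> 0" by simp
  qed
  obtain C where C: "C > 0" "\<And>m x. norm (X.S m x) \<le> C * norm x" by (rule X.S_bound) (rule that)
  have \<phi>_bound: "norm (\<phi> p z) \<le> (2 * (1 + C)) * norm z" for p z
  proof -
    have "norm (\<phi> p z) \<le> 2 * norm (z - X.S p z)" by (simp add: \<phi>_def \<psi>(2))
    also have "\<dots> \<le> 2 * (norm z + C * norm z)"
      using norm_triangle_ineq4[of z "X.S p z"] C(2)[of p z] by simp
    finally show ?thesis by (simp add: algebra_simps)
  qed
  have uC: "unconditionally_Cauchy (\<lambda>p. scaleF (\<phi> p z) (u p))" for z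
    unfolding unconditionally_Cauchy_def
  proof (intro allI impI)
    fix e :: real assume e: "e > 0"
    define e' where "e' = e / (4 * K + 1) / 2"
    have e': "e' > 0" using e K0 by (simp add: e'_def add_nonneg_pos)
    obtain L where L: "\<And>p. p \<ge> L \<Longrightarrow> norm (\<phi> p z) < e'" using LIMSEQ_D[OF \<phi>_lim e'] by auto
    have "norm (\<Sum>p\<in>N. scaleF (\<phi> p z) (u p)) < e" if N: "finite N" "N \<subseteq> {L..}" for N
    proof -
      have "norm (\<Sum>p\<in>N. scaleF (\<phi> p z) (u p)) \<le> e' * (4 * K)"
        by (rule multiplier_sums_bound[OF K N(1)]) (use L N(2) e' in \<open>auto intro: less_imp_le\<close>)
      also have "\<dots> \<le> e' * (4 * K + 1)" using e' by simp
      also have "\<dots> = e / 2"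
      proof -
        have "4 * K + 1 \<noteq> 0" using K0 by simp
        then show ?thesis by (simp add: e'_def field_simps)
      qed
      finally show ?thesis using e by simp
    qed
    then show "\<exists>L. \<forall>N. finite N \<longrightarrow> N \<subseteq> {L..} \<longrightarrow> norm (\<Sum>p\<in>N. scaleF (\<phi> p z) (u p)) < e" by blast
  qed
  define g where "g c i p = scaleF (\<phi> i (y p)) (u i)" for c :: unit and i p
  have col: "\<exists>L. \<forall>p\<ge>L. \<forall>c\<in>UNIV. norm (g c i p) < e" if "e > 0" for i e
  proof -
    have "(\<lambda>p. scaleF (\<phi> i (y p)) (u i)) \<longlonglongrightarrow> scaleF 0 (u i)"
      by (intro F.tendsto_scale y_null \<phi> tendsto_const)
    from LIMSEQ_D[OF this that] show ?thesis by (simp add: g_def)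
  qed
  have tail: "\<exists>L. \<forall>N. finite N \<longrightarrow> N \<subseteq> {L..} \<longrightarrow> (\<forall>c\<in>UNIV. norm (\<Sum>i\<in>N. g c i p) < e)" if e0: "e > 0" for p e
  proof -
    obtain L where "\<forall>N. finite N \<longrightarrow> N \<subseteq> {L..} \<longrightarrow> norm (\<Sum>i\<in>N. scaleF (\<phi> i (y p)) (u i)) < e"
      using uC[of "y p"] e0 unfolding unconditionally_Cauchy_def by (elim allE[of _ e] impE exE)
    then show ?thesis by (intro exI[of _ L]) (simp add: g_def)
  qed
  have d8: "d / 8 > 0" using d by simp
  obtain s :: "nat \<Rightarrow> nat" where s: "strict_mono s" and s': "\<And>p N c. finite N \<Longrightarrow> p \<notin> N \<Longrightarrow> c \<in> UNIV \<Longrightarrow>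
      norm (\<Sum>i\<in>N. g c (s i) (s p)) \<le> d / 8"
    by (rule gliding_hump[OF col tail d8]) (assumption, assumption, rule that)
  define U where "U z = (\<Sum>p. scaleF (\<phi> (s p) z) (u (s p)))" for z
  have summ: "summable (\<lambda>p. scaleF (\<phi> (s p) z) (u (s p)))" for z
  proof (rule unconditionally_Cauchy_summable)
    show "unconditionally_Cauchy (\<lambda>p. scaleF (\<phi> (s p) z) (u (s p)))"
      unfolding unconditionally_Cauchy_def
    proof (intro allI impI)
      fix e :: real assume "e > 0"
      then obtain L where L: "\<forall>N. finite N \<longrightarrow> N \<subseteq> {L..} \<longrightarrow> norm (\<Sum>i\<in>N. scaleF (\<phi> i z) (u i)) < e"
        using uC[of z] unfolding unconditionally_Cauchy_def by (elim allE[of _ e] impE exE)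
      have "norm (\<Sum>p\<in>N. scaleF (\<phi> (s p) z) (u (s p))) < e" if N: "finite N" "N \<subseteq> {L..}" for N
      proof -
        have "inj_on s N" using strict_mono_imp_inj_on[OF s, of UNIV] by (rule inj_on_subset) simp
        then have "(\<Sum>p\<in>N. scaleF (\<phi> (s p) z) (u (s p))) = (\<Sum>i\<in>s ` N. scaleF (\<phi> i z) (u i))"
          by (simp add: sum.reindex)
        moreover have "s ` N \<subseteq> {L..}"
          using N(2) le_trans[OF _ strict_mono_imp_increasing[OF s]] by auto
        ultimately show ?thesis using L N(1) by simp
      qed
      then show "\<exists>L. \<forall>N. finite N \<longrightarrow> N \<subseteq> {L..} \<longrightarrow> norm (\<Sum>p\<in>N. scaleF (\<phi> (s p) z) (u (s p))) < e" by blast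
    qed
  qed
  have U: "bounded_operator scaleE scaleF U"
  proof (rule bounded_operatorI[OF E.banach_space_over_axioms F.banach_space_over_axioms])
    show "U (a + b) = U a + U b" for a b
      unfolding U_def bounded_operator_add[OF \<phi>] F.scale_left_distrib by (rule suminf_add[OF summ summ, symmetric])
    show "U (scaleE c b) = scaleF c (U b)" for c b
    proof -
      have "(\<lambda>n. scaleF c (\<Sum>p<n. scaleF (\<phi> (s p) b) (u (s p)))) \<longlonglongrightarrow> scaleF c (U b)"
        unfolding U_def by (intro F.tendsto_scale tendsto_const summable_LIMSEQ summ)
      then have "(\<lambda>p. scaleF (\<phi> (s p) (scaleE c b)) (u (s p))) sums scaleF c (U b)"
        unfolding sums_def bounded_operator_scale[OF \<phi>] by (simp add: F.scale_sum_right)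
      then show ?thesis unfolding U_def[of "scaleE c b"] by (rule sums_unique[symmetric])
    qed
    show "norm (U z) \<le> (2 * (1 + C) * (4 * K)) * norm z" for z
    proof (rule Lim_bounded)
      show "(\<lambda>n. norm (\<Sum>p<n. scaleF (\<phi> (s p) z) (u (s p)))) \<longlonglongrightarrow> norm (U z)"
        unfolding U_def by (intro tendsto_norm summable_LIMSEQ summ)
      have Ks: "norm (\<Sum>p\<in>N. u (s p)) \<le> K" if "finite N" for N
      proof -
        have "inj_on s N" using strict_mono_imp_inj_on[OF s, of UNIV] by (rule inj_on_subset) simp
        then have "(\<Sum>p\<in>N. u (s p)) = sum u (s ` N)" by (simp add: sum.reindex)
        then show ?thesis using K[of "s ` N"] that by simp
      qed
      have "norm (\<Sum>p<n. scaleF (\<phi> (s p) z) (u (s p))) \<le> (2 * (1 + C) * norm z) * (4 * K)" for n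
        by (rule multiplier_sums_bound[OF Ks]) (use \<phi>_bound C(1) in auto)
      then show "\<forall>n\<ge>0. norm (\<Sum>p<n. scaleF (\<phi> (s p) z) (u (s p))) \<le> (2 * (1 + C) * (4 * K)) * norm z"
        by (simp add: mult_ac)
    qed
  qed
  \<comment> \<open>The diagonal term has norm at least \<open>d / 2\<close>, the off-diagonal sum
    at most \<open>d / 8\<close>.\<close>
  have U_big: "d / 4 \<le> norm (U (y (s p)))" for p
  proof (rule Lim_bounded2)
    show "(\<lambda>n. norm (\<Sum>i<n. scaleF (\<phi> (s i) (y (s p))) (u (s i)))) \<longlonglongrightarrow> norm (U (y (s p)))"
      unfolding U_def by (intro tendsto_norm summable_LIMSEQ summ)
    show "\<forall>n\<ge>Suc p. d / 4 \<le> norm (\<Sum>i<n. scaleF (\<phi> (s i) (y (s p))) (u (s i)))"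
    proof (intro allI impI)
      fix n assume "n \<ge> Suc p"
      then have "(\<Sum>i<n. scaleF (\<phi> (s i) (y (s p))) (u (s i)))
          = scaleF (\<phi> (s p) (y (s p))) (u (s p)) + (\<Sum>i\<in>{..<n} - {p}. g () (s i) (s p))"
        by (subst sum.remove[of _ p]) (auto simp: g_def)
      moreover have "norm (\<Sum>i\<in>{..<n} - {p}. g () (s i) (s p)) \<le> d / 8" by (rule s') auto
      moreover have "1 / 2 * d \<le> norm (scaleF (\<phi> (s p) (y (s p))) (u (s p)))"
        unfolding F.norm_scale using \<phi>_big du d by (intro mult_mono) auto
      ultimately show "d / 4 \<le> norm (\<Sum>i<n. scaleF (\<phi> (s i) (y (s p))) (u (s i)))"
        using norm_diff_ineq[of "scaleF (\<phi> (s p) (y (s p))) (u (s p))" "\<Sum>i\<in>{..<n} - {p}. g () (s i) (s p)"] d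
        by simp
    qed
  qed
  obtain k' where k': "k = Suc k'" using k by (cases k) auto
  obtain \<phi>0 where \<phi>0: "bounded_operator scaleE (*) \<phi>0" "norm (x 0) \<le> norm (\<phi>0 (x 0))"
    by (rule E.norming_functional[of "x 0"]) (rule that)
  have "\<phi>0 (x 0) \<noteq> 0" using \<phi>0(2) x(1)[of 0] by auto
  define z where "z = scaleE (inverse (\<phi>0 (x 0))) (x 0)"
  have z: "\<phi>0 z = 1" using \<open>\<phi>0 (x 0) \<noteq> 0\<close> by (simp add: z_def bounded_operator_scale[OF \<phi>0(1)])
  \<comment> \<open>Only the operator slot \<open>k'\<close> moves; the functional slots are frozen
    at \<open>z\<close>, where \<open>\<phi>0\<close> is 1, so the value is
    \<open>U (y (s p))\<close>.\<close>
  have "(\<lambda>p. (\<lambda>x. scaleF (\<Prod>l<k'. \<phi>0 (x l)) (U (x k'))) (\<lambda>i. if i \<in> {k'} then y (s p) else z)) \<longlonglongrightarrow> 0"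
  proof (rule weakly_null_slots[OF eq[unfolded k']])
    show "mlin (Suc k') (\<lambda>x. scaleF (\<Prod>l<k'. \<phi>0 (x l)) (U (x k')))"
      by (rule mlin_functional_operator[OF \<phi>0(1) U])
    show "(\<lambda>p. \<phi> (y (s p))) \<longlonglongrightarrow> 0" if "bounded_operator scaleE (*) \<phi>" for \<phi>
      using LIMSEQ_subseq_LIMSEQ[OF y_null[OF that] s] by (simp add: o_def)
  qed (use y1 in auto)
  then have "(\<lambda>p. U (y (s p))) \<longlonglongrightarrow> 0" by (simp add: z)
  from LIMSEQ_D[OF this, of "d / 4"] obtain p where "norm (U (y (s p))) < d / 4" using d by auto
  then show False using U_big[of p] by simp
qed

end

subsection \<open>Absence of \<open>c\<^sub>0\<close> in the space of polynomials\<close>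

context fd_pair
begin

text \<open>Uniformity concerns only the slots in \<open>D\<close>, while \<open>z\<close> stays
  fixed. Thus \<open>D = {}\<close> is pointwise convergence to zero and \<open>D = {..<k}\<close>
  convergence in norm: the two ends of the induction.\<close>

definition uniformly_null :: "(nat \<Rightarrow> (nat \<Rightarrow> 'e) \<Rightarrow> 'f) \<Rightarrow> nat set \<Rightarrow> bool" where
  "uniformly_null A D \<longleftrightarrow> (\<forall>z R e. e > 0 \<longrightarrow> (\<exists>n0. \<forall>n\<ge>n0. \<forall>x. (\<forall>i. norm (x i) \<le> R) \<longrightarrow>
     norm (A n (\<lambda>i. if i \<in> D then x i else z i)) < e))"

text \<open>The slots outside \<open>D\<close> are frozen at \<open>z\<close>. A finite rank operator in one slot reduces to a smaller \<open>D\<close>, so the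
  arguments \<open>x\<close> may be replaced by the weakly null remainders \<open>x - S\<^sub>m x\<close>; then a subseries defines a
  multilinear map that contradicts \<open>weakly_null_slots\<close>.\<close>

context
  fixes k :: nat and A :: "nat \<Rightarrow> (nat \<Rightarrow> 'e) \<Rightarrow> 'f" and C0 :: real
  assumes eq: "hom_polys scaleE scaleF k = wb_polys scaleE scaleF k"
    and shr: shrinking and c0: "no_c0_sequence TYPE('f)"
    and A: "\<And>n. mlin k (A n)"
    and sym: "\<And>n h x. bij_betw h {..<k} {..<k} \<Longrightarrow> A n (\<lambda>i. x (h i)) = A n x"
    and bdd: "\<And>N x. finite N \<Longrightarrow> (\<And>i. norm (x i) \<le> 1) \<Longrightarrow> norm (\<Sum>n\<in>N. A n x) \<le> C0"
begin

lemma bounded_sums_A: "bounded_sums (\<lambda>n. A n x)"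
proof -
  have "norm (\<Sum>n\<in>N. A n x) \<le> C0 * (\<Prod>i<k. norm (x i))" if "finite N" for N
    by (rule mlin_ball_bound[OF mlin_sum[OF A] bdd[OF that]])
  then show ?thesis by (auto simp: bounded_sums_def)
qed

text \<open>The absence of \<open>c_0\<close> in the range makes the pointwise bounded sums
  converge, so every subseries is again a multilinear map.\<close>

lemma subseries_mlin:
  fixes r :: "nat \<Rightarrow> nat"
  assumes "inj r"
  shows "mlin k (\<lambda>x. \<Sum>p. A (r p) x)" and "summable (\<lambda>p. A (r p) x)"
proof -
  show s: "summable (\<lambda>p. A (r p) x)" for x
    by (rule unconditionally_Cauchy_summable, rule bounded_sums_unconditionally_Cauchy[OF c0],
        rule bounded_sums_subseq[OF bounded_sums_A assms])
  show "mlin k (\<lambda>x. \<Sum>p. A (r p) x)"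
  proof (rule mlin_suminf[OF A s])
    fix x :: "nat \<Rightarrow> 'e" and n assume x: "\<And>i. norm (x i) \<le> 1"
    have "inj_on r {..<n}" using assms by (rule inj_on_subset) simp
    then have "(\<Sum>p<n. A (r p) x) = (\<Sum>i\<in>r ` {..<n}. A i x)" by (simp add: sum.reindex)
    then show "norm (\<Sum>p<n. A (r p) x) \<le> C0" using bdd[OF _ x, of "r ` {..<n}"] by simp
  qed
qed

text \<open>Telescoping puts \<open>T x\<close> into one slot of \<open>D\<close>. Expanded in
  coordinates, that slot is frozen at one of finitely many vectors \<open>b\<close>, up to bounded
  scalars, and the induction hypothesis for the remaining slots applies.\<close>

lemma finite_rank_slots_null:
  assumes D: "D \<subseteq> {..<k}" and IH: "\<And>i. i \<in> D \<Longrightarrow> uniformly_null A (D - {i})"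
    and T: "E.finite_rank T" and e: "e > 0"
  obtains n0 where "\<And>n x. n \<ge> n0 \<Longrightarrow> norm x \<le> R \<Longrightarrow>
    norm (A n (\<lambda>i. if i \<in> D then x else z i) - A n (\<lambda>i. if i \<in> D then x - T x else z i)) \<le> e"
proof -
  obtain B \<phi> where B: "finite B" "\<And>b. b \<in> B \<Longrightarrow> bounded_operator scaleE (*) (\<phi> b)"
    "\<And>x. T x = (\<Sum>b\<in>B. scaleE (\<phi> b x) b)"
    by (rule E.finite_rank_coordinates[OF T]) (rule that)
  have opT: "bounded_operator scaleE scaleE T" using T by (simp add: E.finite_rank_def)
  obtain C where C: "C > 0" "\<And>x. norm (T x) \<le> C * norm x" using bounded_operator_bound[OF opT] by blast
  have "\<forall>b\<in>B. \<exists>c>0. \<forall>x. norm (\<phi> b x) \<le> c * norm x" using bounded_operator_bound[OF B(2)] by metis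
  then obtain c where c: "\<And>b. b \<in> B \<Longrightarrow> c b > 0" "\<And>b x. b \<in> B \<Longrightarrow> norm (\<phi> b x) \<le> c b * norm x" by metis
  define R0 where "R0 = max R 0"
  define K where "K = real k * (\<Sum>b\<in>B. c b * R0)"
  have K0: "K \<ge> 0" using c(1) by (auto simp: K_def R0_def less_imp_le intro!: mult_nonneg_nonneg sum_nonneg)
  define e' where "e' = e / (K + 1)"
  have e': "e' > 0" using e K0 by (simp add: e'_def add_nonneg_pos)
  define R1 where "R1 = R0 + C * R0"
  have finD: "finite D" using D finite_subset by blast
  have "\<forall>\<^sub>F n in sequentially. \<forall>(i, b)\<in>D \<times> B. \<forall>x. (\<forall>l. norm (x l) \<le> R1) \<longrightarrow>
      norm (A n (\<lambda>l. if l \<in> D - {i} then x l else (z(i := b)) l)) < e'"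
  proof (rule eventually_ball_finite, use finD B(1) in simp, safe)
    fix i b assume "i \<in> D"
    then obtain n0 where "\<forall>n\<ge>n0. \<forall>x. (\<forall>l. norm (x l) \<le> R1) \<longrightarrow>
        norm (A n (\<lambda>l. if l \<in> D - {i} then x l else (z(i := b)) l)) < e'"
      using IH e' unfolding uniformly_null_def by blast
    then show "\<forall>\<^sub>F n in sequentially. \<forall>x. (\<forall>l. norm (x l) \<le> R1) \<longrightarrow>
        norm (A n (\<lambda>l. if l \<in> D - {i} then x l else (z(i := b)) l)) < e'"
      unfolding eventually_sequentially by blast
  qed
  then obtain n0 where n0: "\<And>n i b x. n \<ge> n0 \<Longrightarrow> i \<in> D \<Longrightarrow> b \<in> B \<Longrightarrow> (\<And>l. norm (x l) \<le> R1) \<Longrightarrow>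
      norm (A n (\<lambda>l. if l \<in> D - {i} then x l else (z(i := b)) l)) < e'"
    unfolding eventually_sequentially by blast
  show ?thesis
  proof (rule that)
    fix n and x :: 'e assume n: "n \<ge> n0" and x: "norm x \<le> R"
    let ?X = "\<lambda>i. if i \<in> D then x else z i" and ?Y = "\<lambda>i. if i \<in> D then x - T x else z i"
    let ?h = "\<lambda>i l. if l < i then ?X l else ?Y l"
    have xR: "norm x \<le> R0" using x by (simp add: R0_def)
    then have xR1: "norm x \<le> R1" "norm (x - T x) \<le> R1"
    proof -
      have "norm (T x) \<le> C * R0" using C xR by (meson less_imp_le mult_left_mono order_trans)
      moreover have "C * R0 \<ge> 0" using C(1) by (simp add: R0_def)
      ultimately show "norm x \<le> R1" "norm (x - T x) \<le> R1"
        using xR norm_triangle_ineq4[of x "T x"] unfolding R1_def by linarith+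
    qed
    have slot: "norm (A n ((?h i)(i := ?X i - ?Y i))) \<le> (\<Sum>b\<in>B. c b * R0) * e'" if i: "i < k" for i
    proof (cases "i \<in> D")
      case False
      then have "A n ((?h i)(i := ?X i - ?Y i)) = 0" using multilin_zero[OF A i] by simp
      then show ?thesis using c(1) e' by (auto simp: R0_def less_imp_le intro!: mult_nonneg_nonneg sum_nonneg)
    next
      case True
      have "A n ((?h i)(i := ?X i - ?Y i)) = (\<Sum>b\<in>B. scaleF (\<phi> b x) (A n ((?h i)(i := b))))"
        using True by (simp only: if_True diff_diff_eq2 add_diff_cancel_left' B(3)
            multilin_sum[OF A i] multilin_scale[OF A i])
      also have "norm \<dots> \<le> (\<Sum>b\<in>B. (c b * R0) * e')"
      proof (rule sum_norm_le)
        fix b assume b: "b \<in> B"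
        have "(?h i)(i := b) = (\<lambda>l. if l \<in> D - {i} then (if l < i then x else x - T x) else (z(i := b)) l)"
          using True by auto
        then have "norm (A n ((?h i)(i := b))) \<le> e'"
          using n0[OF n True b, of "\<lambda>l. if l < i then x else x - T x"] xR1 by (auto intro: less_imp_le)
        moreover have "norm (\<phi> b x) \<le> c b * R0"
          using c[OF b] xR by (meson less_imp_le mult_left_mono order_trans)
        moreover have "c b * R0 \<ge> 0" using c(1)[OF b] by (simp add: R0_def)
        ultimately show "norm (scaleF (\<phi> b x) (A n ((?h i)(i := b)))) \<le> (c b * R0) * e'"
          unfolding F.norm_scale by (intro mult_mono) auto
      qed
      finally show ?thesis by (simp add: sum_distrib_right)
    qed
    have "norm (A n ?X - A n ?Y) \<le> (\<Sum>i<k. (\<Sum>b\<in>B. c b * R0) * e')"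
      unfolding multilin_telescope[OF A[of n], of ?X ?Y] by (rule sum_norm_le) (use slot in simp)
    also have "\<dots> = K * e'" by (simp add: K_def)
    also have "\<dots> \<le> (K + 1) * e'" using e' by simp
    also have "\<dots> = e" using K0 by (simp add: e'_def add_nonneg_eq_0_iff)
    finally show "norm (A n ?X - A n ?Y) \<le> e" .
  qed
qed

text \<open>The slots of \<open>D\<close> share one argument because
  \<open>weakly_null_slots\<close> reduces to a polynomial only in that case; polarization restores
  distinct arguments afterwards.\<close>

lemma diagonal_null:
  assumes D: "D \<subseteq> {..<k}" "D \<noteq> {}" and IH: "\<And>i. i \<in> D \<Longrightarrow> uniformly_null A (D - {i})" and e: "e > 0"
  shows "\<exists>n0. \<forall>n\<ge>n0. \<forall>x. norm x \<le> R \<longrightarrow> norm (A n (\<lambda>i. if i \<in> D then x else z i)) < e"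
proof (rule ccontr)
  let ?q = "\<lambda>n x. A n (\<lambda>i. if i \<in> D then x else z i)"
  assume "\<not> ?thesis"
  then have bad: "\<exists>n\<ge>n0. \<exists>x. norm x \<le> R \<and> e \<le> norm (?q n x)" for n0 by (simp add: not_less)
  \<comment> \<open>Removing the finite rank part costs at most \<open>e / 2\<close>, provided the
    bad index \<open>n\<close> is chosen after the operator.\<close>
  have step: "\<exists>n\<ge>m. \<exists>x. norm x \<le> R \<and> e / 2 \<le> norm (?q n (x - X.S l x))" for m l
  proof -
    obtain n1 where n1: "\<And>n x. n \<ge> n1 \<Longrightarrow> norm x \<le> R \<Longrightarrow> norm (?q n x - ?q n (x - X.S l x)) \<le> e / 2"
      by (rule finite_rank_slots_null[OF D(1) IH X.finite_rank_S half_gt_zero[OF e]]) (assumption, rule that)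
    obtain n x where nx: "n \<ge> max m n1" "norm x \<le> R" "e \<le> norm (?q n x)" using bad by blast
    have "e / 2 \<le> norm (?q n (x - X.S l x))"
      using n1[of n x] nx norm_triangle_ineq2[of "?q n x" "?q n (x - X.S l x)"] by simp
    then show ?thesis using nx by (intro exI[of _ n]) auto
  qed
  \<comment> \<open>The choice is dependent because the indices must increase strictly: the
    subseries is taken over distinct terms.\<close>
  have "\<exists>f. \<forall>l. (norm (snd (f l)) \<le> R \<and> e / 2 \<le> norm (?q (fst (f l)) (snd (f l) - X.S l (snd (f l))))) \<and>
      fst (f l) < fst (f (Suc l))"
  proof (rule dependent_nat_choice)
    obtain n x where "norm x \<le> R" "e / 2 \<le> norm (?q n (x - X.S 0 x))" using step[of 0 0] by blast
    then show "\<exists>x. norm (snd x) \<le> R \<and> e / 2 \<le> norm (?q (fst x) (snd x - X.S 0 (snd x)))"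
      by (intro exI[of _ "(n, x)"]) (simp cong: if_cong)
    fix y :: "nat \<times> 'e" and l
    obtain n x where "n \<ge> Suc (fst y)" "norm x \<le> R" "e / 2 \<le> norm (?q n (x - X.S (Suc l) x))"
      using step[of "Suc (fst y)" "Suc l"] by blast
    then show "\<exists>x. (norm (snd x) \<le> R \<and> e / 2 \<le> norm (?q (fst x) (snd x - X.S (Suc l) (snd x)))) \<and> fst y < fst x"
      by (intro exI[of _ "(n, x)"]) (simp cong: if_cong)
  qed
  then obtain f where f: "\<And>l. norm (snd (f l)) \<le> R"
    "\<And>l. e / 2 \<le> norm (?q (fst (f l)) (snd (f l) - X.S l (snd (f l))))" "\<And>l. fst (f l) < fst (f (Suc l))" by blast
  define \<nu> where "\<nu> l = fst (f l)" for l
  define w where "w l = snd (f l) - X.S l (snd (f l))" for l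
  have mono: "strict_mono \<nu>" by (rule strict_mono_Suc_iff[THEN iffD2]) (simp add: \<nu>_def f(3))
  have big: "e / 2 \<le> norm (?q (\<nu> l) (w l))" for l using f(2)[of l] unfolding \<nu>_def w_def .
  obtain C where C: "C > 0" "\<And>m x. norm (X.S m x) \<le> C * norm x" by (rule X.S_bound) (rule that)
  have wr: "norm (w l) \<le> R + C * R" for l
  proof -
    have "norm (X.S l (snd (f l))) \<le> C * R" using C f(1)[of l] by (meson less_imp_le mult_left_mono order_trans)
    then show ?thesis unfolding w_def using norm_triangle_ineq4[of "snd (f l)" "X.S l (snd (f l))"] f(1)[of l] by linarith
  qed
  have null: "(\<lambda>l. \<phi> (w l)) \<longlonglongrightarrow> 0" if "bounded_operator scaleE (*) \<phi>" for \<phi>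
    unfolding w_def by (rule weakly_null_remainders[OF shr that f(1)])
  have slots: "(\<lambda>l. B (\<lambda>i. if i \<in> D then w l else z i)) \<longlonglongrightarrow> 0" if "mlin k B" for B
    by (rule weakly_null_slots[OF eq that D wr]) (rule null)
  have uC: "unconditionally_Cauchy (\<lambda>i. ?q (\<nu> i) x)" for x
    by (rule bounded_sums_unconditionally_Cauchy[OF c0],
        rule bounded_sums_subseq[OF bounded_sums_A strict_mono_imp_inj_on[OF mono]])
  define g where "g c i p = ?q (\<nu> i) (w p)" for c :: unit and i p
  have col: "\<exists>L. \<forall>p\<ge>L. \<forall>c\<in>UNIV. norm (g c i p) < e'" if "e' > 0" for i e'
    using LIMSEQ_D[OF slots[OF A[of "\<nu> i"]] that] by (simp add: g_def)
  have tail: "\<exists>L. \<forall>N. finite N \<longrightarrow> N \<subseteq> {L..} \<longrightarrow> (\<forall>c\<in>UNIV. norm (\<Sum>i\<in>N. g c i p) < e')" if e0: "e' > 0" for p e'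
  proof -
    obtain L where "\<forall>N. finite N \<longrightarrow> N \<subseteq> {L..} \<longrightarrow> norm (\<Sum>i\<in>N. ?q (\<nu> i) (w p)) < e'"
      using uC[of "w p"] e0 unfolding unconditionally_Cauchy_def by (elim allE[of _ e'] impE exE)
    then show ?thesis by (intro exI[of _ L]) (simp add: g_def)
  qed
  have e8: "e / 8 > 0" using e by simp
  obtain s :: "nat \<Rightarrow> nat" where s: "strict_mono s" and s': "\<And>p N c. finite N \<Longrightarrow> p \<notin> N \<Longrightarrow> c \<in> UNIV \<Longrightarrow>
      norm (\<Sum>i\<in>N. g c (s i) (s p)) \<le> e / 8"
    by (rule gliding_hump[OF col tail e8]) (assumption, assumption, rule that)
  have inj: "inj (\<lambda>p. \<nu> (s p))"
    using mono s by (intro strict_mono_imp_inj_on) (simp add: strict_mono_def)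
  let ?B = "\<lambda>x. \<Sum>p. A (\<nu> (s p)) x" and ?w = "\<lambda>p i. if i \<in> D then w (s p) else z i"
  have "(\<lambda>p. ?B (?w p)) \<longlonglongrightarrow> 0"
    using LIMSEQ_subseq_LIMSEQ[OF slots[OF subseries_mlin(1)[OF inj]] s]
    by (simp add: o_def)
  then obtain p where p: "norm (?B (?w p)) < e / 4" using LIMSEQ_D[of _ 0 "e / 4"] e by fastforce
  have "e / 4 \<le> norm (?B (?w p))"
  proof (rule Lim_bounded2)
    show "(\<lambda>n. norm (\<Sum>i<n. A (\<nu> (s i)) (?w p))) \<longlonglongrightarrow> norm (?B (?w p))"
      by (intro tendsto_norm summable_LIMSEQ subseries_mlin(2)[OF inj])
    show "\<forall>n\<ge>Suc p. e / 4 \<le> norm (\<Sum>i<n. A (\<nu> (s i)) (?w p))"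
    proof (intro allI impI)
      fix n assume "n \<ge> Suc p"
      then have "(\<Sum>i<n. A (\<nu> (s i)) (?w p)) = ?q (\<nu> (s p)) (w (s p)) + (\<Sum>i\<in>{..<n} - {p}. g () (s i) (s p))"
        by (subst sum.remove[of _ p]) (auto simp: g_def)
      moreover have "norm (\<Sum>i\<in>{..<n} - {p}. g () (s i) (s p)) \<le> e / 8" by (rule s') auto
      ultimately show "e / 4 \<le> norm (\<Sum>i<n. A (\<nu> (s i)) (?w p))"
        using norm_diff_ineq[of "?q (\<nu> (s p)) (w (s p))" "\<Sum>i\<in>{..<n} - {p}. g () (s i) (s p)"] big[of "s p"] e
        by simp
    qed
  qed
  then show False using p by simp
qed

text \<open>In the induction step, polarization over \<open>D\<close> expresses the sum over all
  permutations of the slots in \<open>D\<close> through diagonal values. By symmetry that sum is a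
  positive integer multiple of the wanted value, so no smallness is lost.\<close>

lemma uniformly_null_slots:
  assumes "D \<subseteq> {..<k}" shows "uniformly_null A D"
proof -
  have "finite D" using assms finite_subset by blast
  then show ?thesis
    using assms
  proof (induction D rule: finite_psubset_induct)
    case (psubset D)
    show ?case
    proof (cases "D = {}")
      case True
      have lim: "(\<lambda>n. A n z) \<longlonglongrightarrow> 0" for z using c0 bounded_sums_A by (auto simp: no_c0_sequence_def)
      show ?thesis
        unfolding uniformly_null_def
      proof (intro allI impI)
        fix z :: "nat \<Rightarrow> 'e" and R e :: real assume "e > 0"
        from LIMSEQ_D[OF lim[of z] this] True
        show "\<exists>n0. \<forall>n\<ge>n0. \<forall>x. (\<forall>i. norm (x i) \<le> R) \<longrightarrow> norm (A n (\<lambda>i. if i \<in> D then x i else z i)) < e"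
          by auto
      qed
    next
      case False
      have IH: "uniformly_null A (D - {i})" if "i \<in> D" for i
        using psubset that by (intro psubset.IH) auto
      show ?thesis
        unfolding uniformly_null_def
      proof (intro allI impI)
        fix z :: "nat \<Rightarrow> 'e" and R e :: real assume e: "e > 0"
        \<comment> \<open>Polarization evaluates at sums of up to \<open>card D\<close> vectors,
          over the \<open>2 ^ card D\<close> subsets of \<open>D\<close>; this fixes
          \<open>R'\<close> and \<open>e'\<close>.\<close>
        define R' where "R' = real (card D) * R"
        define e' where "e' = e / 2 ^ card D"
        have e': "e' > 0" using e by (simp add: e'_def)
        obtain n0 where n0: "\<And>n x. n \<ge> n0 \<Longrightarrow> norm x \<le> R' \<Longrightarrow> norm (A n (\<lambda>i. if i \<in> D then x else z i)) < e'"
          using diagonal_null[OF psubset.prems False IH e', of R' z] by blast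
        have "norm (A n (\<lambda>i. if i \<in> D then x i else z i)) < e"
          if n: "n \<ge> n0" and x: "\<forall>i. norm (x i) \<le> R" for n x
        proof -
          let ?a = "A n (\<lambda>i. if i \<in> D then x i else z i)"
          have "A n (\<lambda>i. if i \<in> D then x (g i) else z i) = ?a" if g: "g \<in> bijections D" for g
          proof -
            have b: "bij_betw g D D" by (rule bijections_bij[OF psubset.hyps g])
            define h where "h i = (if i \<in> D then g i else i)" for i
            have "bij_betw h (D \<union> ({..<k} - D)) (D \<union> ({..<k} - D))"
            proof (rule bij_betw_combine)
              show "bij_betw h D D" by (rule iffD1[OF bij_betw_cong b]) (simp add: h_def)
              show "bij_betw h ({..<k} - D) ({..<k} - D)"
                by (rule iffD1[OF bij_betw_cong bij_betw_id]) (auto simp: h_def)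
            qed auto
            then have "bij_betw h {..<k} {..<k}" using psubset.prems by (simp add: Un_absorb1)
            from sym[OF this, of n "\<lambda>i. if i \<in> D then x i else z i"]
            have "A n (\<lambda>i. if h i \<in> D then x (h i) else z (h i)) = ?a" .
            moreover have "(\<lambda>i. if h i \<in> D then x (h i) else z (h i)) = (\<lambda>i. if i \<in> D then x (g i) else z i)"
              using bij_betwE[OF b] by (auto simp: h_def fun_eq_iff)
            ultimately show ?thesis by simp
          qed
          then have "(\<Sum>g\<in>bijections D. A n (\<lambda>i. if i \<in> D then x (g i) else z i)) = real (card (bijections D)) *\<^sub>R ?a"
            by (simp add: sum_constant_scaleR)
          then have "real (card (bijections D)) * norm ?a
              = norm (\<Sum>D'\<in>Pow D. (-1) ^ card (D - D') *\<^sub>R A n (\<lambda>i. if i \<in> D then \<Sum>j\<in>D'. x j else z i))"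
            using mlin_polarization[OF A psubset.prems, of n x z] by simp
          also have "\<dots> \<le> (\<Sum>D'\<in>Pow D. norm ((-1) ^ card (D - D') *\<^sub>R A n (\<lambda>i. if i \<in> D then \<Sum>j\<in>D'. x j else z i)))"
            by (rule norm_sum)
          also have "\<dots> < (\<Sum>D'\<in>Pow D. e')"
          proof (rule sum_strict_mono)
            fix D' assume D': "D' \<in> Pow D"
            have "norm (\<Sum>j\<in>D'. x j) \<le> (\<Sum>j\<in>D'. R)" using x by (intro sum_norm_le) auto
            also have "\<dots> \<le> (\<Sum>j\<in>D. R)"
              using D' psubset.hyps order_trans[OF norm_ge_zero x[rule_format]] by (intro sum_mono2) auto
            finally have "norm (\<Sum>j\<in>D'. x j) \<le> R'" by (simp add: R'_def)
            then show "norm ((-1) ^ card (D - D') *\<^sub>R A n (\<lambda>i. if i \<in> D then \<Sum>j\<in>D'. x j else z i)) < e'"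
              using n0[OF n] by (simp add: power_abs)
          qed (use psubset.hyps in auto)
          also have "\<dots> = e" using psubset.hyps by (simp add: card_Pow e'_def)
          finally have *: "real (card (bijections D)) * norm ?a < e" .
          have "1 \<le> real (card (bijections D))" using bijections_card[OF psubset.hyps] by simp
          then have "1 * norm ?a \<le> real (card (bijections D)) * norm ?a" by (intro mult_right_mono) auto
          then show ?thesis using * by simp
        qed
        then show "\<exists>n0. \<forall>n\<ge>n0. \<forall>x. (\<forall>i. norm (x i) \<le> R) \<longrightarrow>
            norm (A n (\<lambda>i. if i \<in> D then x i else z i)) < e" by blast
      qed
    qed
  qed
qed

end

text \<open>Passing to symmetrized multilinear maps makes uniform nullity in all slots available,
  and on the diagonal this says that the norms of the \<open>P n\<close> tend to zero. A zero range
  is impossible because of the lower bound \<open>d\<close>, so the expansion is shrinking.\<close>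

lemma no_c0_sequence_polys:
  assumes eq: "hom_polys scaleE scaleF k = wb_polys scaleE scaleF k" and k: "k > 1"
    and inf: "\<nexists>B. finite B \<and> E.span B = UNIV"
    and P: "\<And>n :: nat. P n \<in> hom_polys scaleE scaleF k"
    and bdd: "\<And>N x. finite N \<Longrightarrow> norm x \<le> 1 \<Longrightarrow> norm (\<Sum>n\<in>N. P n x) \<le> C"
    and d: "d > 0" "\<And>n. d \<le> pnorm (P n)"
  shows False
proof -
  have "\<exists>f :: 'f. f \<noteq> 0"
  proof (rule ccontr)
    assume "\<nexists>f :: 'f. f \<noteq> 0"
    then have "norm (P 0 x) \<le> 0" for x by auto
    then have "pnorm (P 0) \<le> 0" by (rule pnorm_le)
    then show False using d(1) d(2)[of 0] by linarith
  qed
  then have shr: shrinking using not_shrinking_not_wb[OF _ k] eq by blast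
  have k0: "k > 0" using k by simp
  have c0: "no_c0_sequence TYPE('f)" by (rule wb_no_c0_sequence[OF eq k0 shr inf])
  have "\<forall>n. \<exists>B. mlin k B \<and> (\<forall>x. P n x = B (\<lambda>_. x))" using P by (simp add: hom_polys_iff)
  then obtain B where B: "\<And>n. mlin k (B n)" "\<And>n x. P n x = B n (\<lambda>_. x)" by metis
  let ?A = "\<lambda>n. symmetrization k (B n)"
  have C0: "C \<ge> 0" using bdd[of "{}" 0] by simp
  \<comment> \<open>Polarization evaluates polynomials at sums of at most \<open>k\<close> vectors
    of norm at most 1, whence \<open>k ^ k\<close> for each subset of slots.\<close>
  have bddA: "norm (\<Sum>n\<in>N. ?A n x) \<le> (\<Sum>D\<in>Pow {..<k}. C * real k ^ k)"
    if N: "finite N" and x: "\<And>i. norm (x i) \<le> 1" for N x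
  proof -
    let ?Q = "\<lambda>y. \<Sum>n\<in>N. P n y"
    have "?Q \<in> hom_polys scaleE scaleF k"
      using mlin_diag[OF mlin_sum[of N k B, OF B(1)]] by (simp add: B(2))
    moreover have "pnorm ?Q \<le> C" by (rule pnorm_le) (rule bdd[OF N])
    ultimately have Q: "norm (?Q y) \<le> C * norm y ^ k" for y
      using norm_le_pnorm_power[of ?Q k y] k0 mult_right_mono[of "pnorm ?Q" C "norm y ^ k"] by simp
    have "(\<Sum>n\<in>N. ?A n x) = (\<Sum>D\<in>Pow {..<k}. (-1) ^ card ({..<k} - D) *\<^sub>R ?Q (\<Sum>j\<in>D. x j))"
      unfolding symmetrization_polarization[OF B(1)] B(2) by (subst sum.swap) (simp add: scaleR_sum_right)
    also have "norm \<dots> \<le> (\<Sum>D\<in>Pow {..<k}. C * real k ^ k)"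
    proof (rule sum_norm_le)
      fix D assume D: "D \<in> Pow {..<k}"
      have "norm (\<Sum>j\<in>D. x j) \<le> (\<Sum>j\<in>D. 1)" using x by (intro sum_norm_le) auto
      also have "\<dots> \<le> (\<Sum>j<k. 1)" using D by (intro sum_mono2) auto
      finally have "norm (\<Sum>j\<in>D. x j) ^ k \<le> real k ^ k" by (intro power_mono) auto
      then have "C * norm (\<Sum>j\<in>D. x j) ^ k \<le> C * real k ^ k" using C0 by (intro mult_left_mono)
      then show "norm ((-1) ^ card ({..<k} - D) *\<^sub>R ?Q (\<Sum>j\<in>D. x j)) \<le> C * real k ^ k"
        using Q[of "\<Sum>j\<in>D. x j"] by (simp add: power_abs)
    qed
    finally show ?thesis .
  qed
  have "uniformly_null ?A {..<k}"
    by (rule uniformly_null_slots[OF eq shr c0 mlin_symmetrization[OF B(1)] symmetrization_invariant[OF B(1)] bddA order_refl])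
  then have "\<exists>n0. \<forall>n\<ge>n0. \<forall>x. (\<forall>i. norm (x i) \<le> 1) \<longrightarrow> norm (?A n (\<lambda>i. if i \<in> {..<k} then x i else 0)) < d / 2"
    using half_gt_zero[OF d(1)] unfolding uniformly_null_def
    by (elim allE[of _ "\<lambda>_. 0"] allE[of _ 1] allE[of _ "d / 2"] impE)
  then obtain n where n: "\<forall>x. (\<forall>i. norm (x i) \<le> 1) \<longrightarrow> norm (?A n (\<lambda>i. if i \<in> {..<k} then x i else 0)) < d / 2"
    by blast
  have "norm (P n x) \<le> d / 2" if x: "norm x \<le> 1" for x
  proof -
    have "?A n (\<lambda>i. if i \<in> {..<k} then x else 0) = ?A n (\<lambda>_. x)"
      by (rule multilin_cong[OF mlin_symmetrization[OF B(1)]]) simp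
    then have "real (card (bijections {..<k})) * norm (P n x) < d / 2"
      using n[rule_format, of "\<lambda>_. x"] x by (simp add: symmetrization_diag B(2))
    moreover have "1 \<le> real (card (bijections {..<k}))" using bijections_card[of "{..<k}"] by simp
    then have "1 * norm (P n x) \<le> real (card (bijections {..<k})) * norm (P n x)" by (intro mult_right_mono) auto
    ultimately show ?thesis by simp
  qed
  then have "pnorm (P n) \<le> d / 2" by (rule pnorm_le)
  then show False using d(1) d(2)[of n] by simp
qed

end

subsection \<open>Normed spaces given by a carrier\<close>

text \<open>The module laws are required on the whole type, as \<open>module.subspace\<close> in
  \<open>closed_subspace\<close> presupposes them, whereas the norm laws are meaningful only on the
  carrier.\<close>

locale normed_carrier =
  fixes X :: "('k::real_or_complex, 'v::ab_group_add) normed_sp"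
  assumes module_scl: "module (scl X)"
    and zero_pts: "0 \<in> pts X"
    and add_pts: "x \<in> pts X \<Longrightarrow> y \<in> pts X \<Longrightarrow> x + y \<in> pts X"
    and scl_pts: "x \<in> pts X \<Longrightarrow> scl X c x \<in> pts X"
    and nrm_ge_0: "x \<in> pts X \<Longrightarrow> 0 \<le> nrm X x"
    and nrm_eq_0: "x \<in> pts X \<Longrightarrow> nrm X x = 0 \<Longrightarrow> x = 0"
    and nrm_triangle: "x \<in> pts X \<Longrightarrow> y \<in> pts X \<Longrightarrow> nrm X (x + y) \<le> nrm X x + nrm X y"
    and nrm_scl: "x \<in> pts X \<Longrightarrow> nrm X (scl X c x) = norm c * nrm X x"
begin

lemma scl_simps: "scl X 1 x = x" "scl X c (scl X d x) = scl X (c * d) x" "scl X 0 x = 0" "scl X c 0 = 0"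
    "scl X (-1) x = - x"
  using module_scl by (simp_all add: module.scale_one module.scale_scale module.scale_zero_left
      module.scale_zero_right module.scale_minus_left)

lemma minus_pts: "x \<in> pts X \<Longrightarrow> - x \<in> pts X"
  using scl_pts[of x "-1"] by (simp add: scl_simps)

lemma diff_pts: "x \<in> pts X \<Longrightarrow> y \<in> pts X \<Longrightarrow> x - y \<in> pts X"
  using add_pts[of x "- y"] minus_pts[of y] by simp

lemma nrm_minus: "x \<in> pts X \<Longrightarrow> nrm X (- x) = nrm X x"
  using nrm_scl[of x "-1"] by (simp add: scl_simps)

lemma nrm_zero: "nrm X 0 = 0"
  using nrm_scl[OF zero_pts, of 0] by (simp add: scl_simps)

lemma nrm_diff_commute: "x \<in> pts X \<Longrightarrow> y \<in> pts X \<Longrightarrow> nrm X (x - y) = nrm X (y - x)"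
  using nrm_minus[OF diff_pts, of x y] by simp

lemma nrm_triangle_via:
  assumes "x \<in> pts X" "y \<in> pts X" "z \<in> pts X" shows "nrm X (x - z) \<le> nrm X (x - y) + nrm X (y - z)"
  using nrm_triangle[OF diff_pts diff_pts, of x y y z] assms by simp

sublocale M: Metric_space "pts X" "\<lambda>x y. if x \<in> pts X \<and> y \<in> pts X then nrm X (x - y) else 0"
proof
  fix x y z
  show "0 \<le> (if x \<in> pts X \<and> y \<in> pts X then nrm X (x - y) else 0)" using nrm_ge_0 diff_pts by simp
  show "(if x \<in> pts X \<and> y \<in> pts X then nrm X (x - y) else 0) = (if y \<in> pts X \<and> x \<in> pts X then nrm X (y - x) else 0)"
    using nrm_diff_commute by simp
  show "(if x \<in> pts X \<and> y \<in> pts X then nrm X (x - y) else 0) = 0 \<longleftrightarrow> x = y" if "x \<in> pts X" "y \<in> pts X"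
    using that nrm_eq_0[OF diff_pts, of x y] by (auto simp: nrm_zero)
  show "(if x \<in> pts X \<and> z \<in> pts X then nrm X (x - z) else 0)
      \<le> (if x \<in> pts X \<and> y \<in> pts X then nrm X (x - y) else 0) + (if y \<in> pts X \<and> z \<in> pts X then nrm X (y - z) else 0)"
    if "x \<in> pts X" "y \<in> pts X" "z \<in> pts X" using that nrm_triangle_via by simp
qed

lemma topspace_norm_topology: "topspace (norm_topology X) = pts X"
  unfolding norm_topology_def by (rule M.topspace_mtopology)

lemma openin_norm_topology:
  "openin (norm_topology X) U \<longleftrightarrow> U \<subseteq> pts X \<and> (\<forall>x\<in>U. \<exists>r>0. \<forall>y\<in>pts X. nrm X (x - y) < r \<longrightarrow> y \<in> U)"
proof -
  have "M.mball x r \<subseteq> U \<longleftrightarrow> (\<forall>y\<in>pts X. nrm X (x - y) < r \<longrightarrow> y \<in> U)" if "x \<in> pts X" for x r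
    using that by (auto simp: M.mball_def subset_iff)
  then have "(\<exists>r>0. M.mball x r \<subseteq> U) \<longleftrightarrow> (\<exists>r>0. \<forall>y\<in>pts X. nrm X (x - y) < r \<longrightarrow> y \<in> U)" if "x \<in> pts X" for x
    using that by simp
  then have "(\<forall>x\<in>U. \<exists>r>0. M.mball x r \<subseteq> U) \<longleftrightarrow> (\<forall>x\<in>U. \<exists>r>0. \<forall>y\<in>pts X. nrm X (x - y) < r \<longrightarrow> y \<in> U)" if "U \<subseteq> pts X"
    by (intro ball_cong refl) (use that in blast)
  then show ?thesis unfolding norm_topology_def M.openin_mtopology Ball_def by blast
qed

lemma openin_ball: "x \<in> pts X \<Longrightarrow> openin (norm_topology X) {y \<in> pts X. nrm X (x - y) < r}"
proof -
  assume "x \<in> pts X"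
  then have "{y \<in> pts X. nrm X (x - y) < r} = M.mball x r" by (auto simp: M.mball_def)
  then show ?thesis by (simp add: norm_topology_def M.openin_mball)
qed

lemma closedin_norm_topologyI:
  assumes "Z \<subseteq> pts X"
    and "\<And>(\<sigma> :: nat \<Rightarrow> 'v) l. (\<And>n. \<sigma> n \<in> Z) \<Longrightarrow> l \<in> pts X \<Longrightarrow> (\<And>e. e > 0 \<Longrightarrow> \<exists>N. \<forall>n\<ge>N. nrm X (\<sigma> n - l) < e) \<Longrightarrow> l \<in> Z"
  shows "closedin (norm_topology X) Z"
  unfolding norm_topology_def M.metric_closedin_iff_sequentially_closed
proof (intro conjI assms(1) allI impI, elim conjE)
  fix \<sigma> :: "nat \<Rightarrow> 'v" and l assume \<sigma>: "range \<sigma> \<subseteq> Z" and lim: "limitin M.mtopology \<sigma> l sequentially"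
  have l: "l \<in> pts X" using lim M.limit_metric_sequentially by blast
  show "l \<in> Z"
  proof (rule assms(2)[of \<sigma>])
    show "\<sigma> n \<in> Z" for n using \<sigma> by auto
    fix e :: real assume "e > 0"
    then obtain N where "\<forall>n\<ge>N. \<sigma> n \<in> pts X \<and> (if \<sigma> n \<in> pts X \<and> l \<in> pts X then nrm X (\<sigma> n - l) else 0) < e"
      using lim unfolding M.limit_metric_sequentially by blast
    then show "\<exists>N. \<forall>n\<ge>N. nrm X (\<sigma> n - l) < e" using l by (intro exI[of _ N]) auto
  qed (rule l)
qed

definition nrm_complete :: bool where
  "nrm_complete \<longleftrightarrow> (\<forall>\<sigma>. (\<forall>n :: nat. \<sigma> n \<in> pts X) \<longrightarrow>
     (\<forall>e>0. \<exists>N. \<forall>m\<ge>N. \<forall>n\<ge>N. nrm X (\<sigma> m - \<sigma> n) < e) \<longrightarrow>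
     (\<exists>l\<in>pts X. \<forall>e>0. \<exists>N. \<forall>n\<ge>N. nrm X (\<sigma> n - l) < e))"

end

locale normed_carrier_pair = X: normed_carrier X + Y: normed_carrier Y
  for X :: "('k::real_or_complex, 'v::ab_group_add) normed_sp" and Y :: "('k, 'w::ab_group_add) normed_sp"
begin

context
  fixes T assumes T: "linear_between X Y T"
begin

lemma T_pts: "x \<in> pts X \<Longrightarrow> T x \<in> pts Y"
  and T_add: "x \<in> pts X \<Longrightarrow> y \<in> pts X \<Longrightarrow> T (x + y) = T x + T y"
  and T_scl: "x \<in> pts X \<Longrightarrow> T (scl X c x) = scl Y c (T x)"
  using T by (auto simp: linear_between_def)

lemma T_zero: "T 0 = 0"
  using T_scl[OF X.zero_pts, of 0] by (simp add: X.scl_simps Y.scl_simps)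

lemma T_diff: "x \<in> pts X \<Longrightarrow> y \<in> pts X \<Longrightarrow> T (x - y) = T x - T y"
  using T_add[OF X.diff_pts, of x y y] by (simp add: algebra_simps)

lemma T_sum: "finite N \<Longrightarrow> (\<And>n. n \<in> N \<Longrightarrow> x n \<in> pts X) \<Longrightarrow> sum x N \<in> pts X \<and> T (sum x N) = (\<Sum>n\<in>N. T (x n))"
  by (induction N rule: finite_induct) (auto simp: T_zero T_add X.zero_pts X.add_pts)

lemma T_normalize:
  assumes "x \<in> pts X" "x \<noteq> 0"
  obtains y where "y \<in> pts X" "nrm X y = 1" "nrm X x > 0" "nrm Y (T x) = nrm X x * nrm Y (T y)"
proof -
  have n: "nrm X x > 0" using X.nrm_ge_0[OF assms(1)] X.nrm_eq_0[OF assms(1)] assms(2) by force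
  define y where "y = scl X (of_real (inverse (nrm X x))) x"
  have y: "y \<in> pts X" "nrm X y = 1"
    using assms(1) n by (auto simp: y_def X.scl_pts X.nrm_scl simp del: of_real_inverse)
  have "x = scl X (of_real (nrm X x)) y"
    using n by (simp add: y_def X.scl_simps of_real_mult[symmetric] del: of_real_inverse of_real_mult)
  then have "T x = scl Y (of_real (nrm X x)) (T y)" using T_scl[OF y(1)] by metis
  then show ?thesis using that[OF y n] n T_pts[OF y(1)] by (simp add: Y.nrm_scl)
qed

text \<open>Bounds on the unit sphere extend by homogeneity to two-sided Lipschitz bounds. The lower
  one gives injectivity and openness onto the image, and with completeness of \<open>X\<close> also
  closedness of the image.\<close>

lemma contains_copyI:
  assumes complete: X.nrm_complete and c: "c > 0"
    and bounds: "\<And>x. x \<in> pts X \<Longrightarrow> nrm X x = 1 \<Longrightarrow> c \<le> nrm Y (T x) \<and> nrm Y (T x) \<le> C"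
  shows "contains_copy_of Y X"
proof -
  \<comment> \<open>Keeps the upper constant positive, so it can be divided by even if the sphere is
    empty.\<close>
  define D where "D = max C 1"
  have D: "D > 0" by (simp add: D_def)
  have cD: "c * nrm X x \<le> nrm Y (T x) \<and> nrm Y (T x) \<le> D * nrm X x" if x: "x \<in> pts X" for x
  proof (cases "x = 0")
    case True
    then show ?thesis by (simp add: T_zero X.nrm_zero Y.nrm_zero)
  next
    case False
    then obtain y where y: "y \<in> pts X" "nrm X y = 1" "nrm X x > 0" "nrm Y (T x) = nrm X x * nrm Y (T y)"
      using T_normalize[OF x] by blast
    have "c \<le> nrm Y (T y)" "nrm Y (T y) \<le> D" using bounds[OF y(1,2)] unfolding D_def by linarith+
    then have "nrm X x * c \<le> nrm X x * nrm Y (T y)" "nrm X x * nrm Y (T y) \<le> nrm X x * D"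
      using y(3) by (simp_all del: mult_le_cancel_left_pos add: mult_left_mono)
    then show ?thesis unfolding y(4) by (simp add: mult.commute)
  qed
  have dist: "c * nrm X (x - y) \<le> nrm Y (T x - T y)" "nrm Y (T x - T y) \<le> D * nrm X (x - y)"
    if "x \<in> pts X" "y \<in> pts X" for x y
    using cD[OF X.diff_pts[OF that]] T_diff[OF that] by auto
  let ?Z = "T ` pts X"
  have Z: "?Z \<subseteq> pts Y" using T_pts by auto
  have inj: "inj_on T (pts X)"
  proof (rule inj_onI)
    fix x y assume xy: "x \<in> pts X" "y \<in> pts X" "T x = T y"
    have "c * nrm X (x - y) \<le> 0" using dist(1)[OF xy(1,2)] xy(3) by (simp add: Y.nrm_zero)
    then have "nrm X (x - y) \<le> 0" using c by (simp add: mult_le_0_iff)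
    then have "nrm X (x - y) = 0" using X.nrm_ge_0[OF X.diff_pts[OF xy(1,2)]] by simp
    then show "x = y" using X.nrm_eq_0[OF X.diff_pts[OF xy(1,2)]] by simp
  qed
  have closed: "closedin (norm_topology Y) ?Z"
  proof (rule Y.closedin_norm_topologyI[OF Z])
    fix \<sigma> :: "nat \<Rightarrow> 'w" and l assume \<sigma>: "\<And>n. \<sigma> n \<in> ?Z" and l: "l \<in> pts Y"
      and lim: "\<And>e. e > 0 \<Longrightarrow> \<exists>N. \<forall>n\<ge>N. nrm Y (\<sigma> n - l) < e"
    define \<xi> where "\<xi> n = inv_into (pts X) T (\<sigma> n)" for n
    have \<xi>: "\<xi> n \<in> pts X" "\<sigma> n = T (\<xi> n)" for n
      using \<sigma>[of n] by (simp_all add: \<xi>_def inv_into_into f_inv_into_f)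
    have \<sigma>Y: "\<sigma> n \<in> pts Y" for n using \<xi> T_pts by simp
    have "\<forall>e>0. \<exists>N. \<forall>m\<ge>N. \<forall>n\<ge>N. nrm X (\<xi> m - \<xi> n) < e"
    proof (intro allI impI)
      fix e :: real assume "e > 0"
      then obtain N where N: "\<And>n. n \<ge> N \<Longrightarrow> nrm Y (\<sigma> n - l) < c * e / 2"
        using lim[of "c * e / 2"] c by auto
      have "nrm X (\<xi> m - \<xi> n) < e" if "m \<ge> N" "n \<ge> N" for m n
      proof -
        have "c * nrm X (\<xi> m - \<xi> n) \<le> nrm Y (\<sigma> m - \<sigma> n)" using dist(1) \<xi> by simp
        also have "\<dots> \<le> nrm Y (\<sigma> m - l) + nrm Y (\<sigma> n - l)"
          using Y.nrm_triangle_via[OF \<sigma>Y l \<sigma>Y] Y.nrm_diff_commute[OF l \<sigma>Y] by simp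
        also have "\<dots> < c * e" using N[OF that(1)] N[OF that(2)] by simp
        finally show ?thesis using c by simp
      qed
      then show "\<exists>N. \<forall>m\<ge>N. \<forall>n\<ge>N. nrm X (\<xi> m - \<xi> n) < e" by blast
    qed
    then obtain x where x: "x \<in> pts X" "\<forall>e>0. \<exists>N. \<forall>n\<ge>N. nrm X (\<xi> n - x) < e"
      using complete \<xi>(1) unfolding X.nrm_complete_def by blast
    have "nrm Y (l - T x) \<le> e" if "e > 0" for e
    proof -
      obtain N1 where N1: "\<And>n. n \<ge> N1 \<Longrightarrow> nrm Y (\<sigma> n - l) < e / 2" using lim[of "e / 2"] \<open>e > 0\<close> by auto
      have "e / 2 / D > 0" using \<open>e > 0\<close> D by simp
      then obtain N2 where N2: "\<And>n. n \<ge> N2 \<Longrightarrow> nrm X (\<xi> n - x) < e / 2 / D" using x(2) by blast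
      let ?n = "max N1 N2"
      have "nrm Y (\<sigma> ?n - T x) \<le> D * nrm X (\<xi> ?n - x)" using dist(2)[OF \<xi>(1) x(1)] \<xi>(2) by simp
      also have "\<dots> \<le> D * (e / 2 / D)" using N2[of ?n] D by (intro mult_left_mono) auto
      finally have "nrm Y (\<sigma> ?n - T x) \<le> e / 2" using D by simp
      moreover have "nrm Y (l - T x) \<le> nrm Y (\<sigma> ?n - l) + nrm Y (\<sigma> ?n - T x)"
        using Y.nrm_triangle_via[OF l \<sigma>Y T_pts[OF x(1)], of ?n] Y.nrm_diff_commute[OF l \<sigma>Y, of ?n] by simp
      ultimately show ?thesis using N1[of ?n] by simp
    qed
    then have "nrm Y (l - T x) \<le> 0" by (rule field_le_epsilon[of _ 0, simplified])
    then have "l - T x = 0" using Y.nrm_eq_0 Y.nrm_ge_0 Y.diff_pts[OF l T_pts[OF x(1)]] by force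
    then show "l \<in> ?Z" using x(1) by simp
  qed
  have "module.subspace (scl Y) ?Z"
    unfolding module.subspace_def[OF Y.module_scl]
  proof (intro conjI ballI allI)
    show "0 \<in> ?Z" using T_zero X.zero_pts by force
    show "u + v \<in> ?Z" if uv: "u \<in> ?Z" "v \<in> ?Z" for u v
    proof -
      obtain a b where "a \<in> pts X" "b \<in> pts X" "u = T a" "v = T b" using uv by blast
      then show ?thesis using T_add X.add_pts by (metis imageI)
    qed
    show "scl Y c u \<in> ?Z" if u: "u \<in> ?Z" for c u
    proof -
      obtain a where "a \<in> pts X" "u = T a" using u by blast
      then show ?thesis using T_scl X.scl_pts by (metis imageI)
    qed
  qed
  with closed Z have sub: "closed_subspace ?Z Y" by (simp add: closed_subspace_def)
  have "homeomorphic_map (norm_topology X) (subtopology (norm_topology Y) ?Z) T"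
  proof (rule bijective_open_imp_homeomorphic_map)
    show "continuous_map (norm_topology X) (subtopology (norm_topology Y) ?Z) T"
      unfolding continuous_map_in_subtopology
    proof
      show "continuous_map (norm_topology X) (norm_topology Y) T"
        unfolding continuous_map_def X.topspace_norm_topology Y.topspace_norm_topology
      proof (intro conjI allI impI)
        fix U assume U: "openin (norm_topology Y) U"
        show "openin (norm_topology X) {x \<in> pts X. T x \<in> U}"
          unfolding X.openin_norm_topology
        proof (intro conjI ballI)
          fix x assume x: "x \<in> {x \<in> pts X. T x \<in> U}"
          then obtain r where r: "r > 0" "\<And>y. y \<in> pts Y \<Longrightarrow> nrm Y (T x - y) < r \<Longrightarrow> y \<in> U"
            using U unfolding Y.openin_norm_topology by blast
          have "T y \<in> U" if y: "y \<in> pts X" "nrm X (x - y) < r / D" for y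
          proof (rule r(2)[OF T_pts[OF y(1)]])
            have "nrm Y (T x - T y) \<le> D * nrm X (x - y)" using dist(2) x y(1) by simp
            also have "\<dots> < D * (r / D)" using y(2) D by (intro mult_strict_left_mono)
            finally show "nrm Y (T x - T y) < r" using D by simp
          qed
          then show "\<exists>r>0. \<forall>y\<in>pts X. nrm X (x - y) < r \<longrightarrow> y \<in> {x \<in> pts X. T x \<in> U}"
            using r(1) D by (intro exI[of _ "r / D"]) auto
        qed auto
      qed (use T_pts in auto)
    qed (simp add: X.topspace_norm_topology)
    show "open_map (norm_topology X) (subtopology (norm_topology Y) ?Z) T"
      unfolding open_map_def
    proof (intro allI impI)
      fix U assume U: "openin (norm_topology X) U"
      have UX: "U \<subseteq> pts X" using U by (simp add: X.openin_norm_topology)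
      show "openin (subtopology (norm_topology Y) ?Z) (T ` U)"
      proof (subst openin_subopen, intro ballI)
        fix v assume "v \<in> T ` U"
        then obtain x where x: "x \<in> U" "v = T x" by blast
        obtain r where r: "r > 0" "\<And>y. y \<in> pts X \<Longrightarrow> nrm X (x - y) < r \<Longrightarrow> y \<in> U"
          using U x(1) unfolding X.openin_norm_topology by blast
        have xX: "x \<in> pts X" using x(1) UX by blast
        let ?B = "{y \<in> pts Y. nrm Y (T x - y) < c * r}"
        have "openin (subtopology (norm_topology Y) ?Z) (?B \<inter> ?Z)"
          using Y.openin_ball[OF T_pts[OF xX]] by (auto simp: openin_subtopology)
        moreover have "v \<in> ?B \<inter> ?Z" using x xX T_pts[OF xX] c r(1) by (auto simp: Y.nrm_zero)
        moreover have "?B \<inter> ?Z \<subseteq> T ` U"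
        proof
          fix w assume "w \<in> ?B \<inter> ?Z"
          then obtain y where y: "y \<in> pts X" "w = T y" "nrm Y (T x - T y) < c * r" by blast
          have "c * nrm X (x - y) < c * r" using dist(1)[OF xX y(1)] y(3) by simp
          then have "y \<in> U" using c y(1) by (intro r(2)) auto
          then show "w \<in> T ` U" using y(2) by blast
        qed
        ultimately show "\<exists>V. openin (subtopology (norm_topology Y) ?Z) V \<and> v \<in> V \<and> V \<subseteq> T ` U" by blast
      qed
    qed
    show "T ` topspace (norm_topology X) = topspace (subtopology (norm_topology Y) ?Z)"
      using Z by (auto simp: X.topspace_norm_topology Y.topspace_norm_topology)
    show "inj_on T (topspace (norm_topology X))" using inj by (simp add: X.topspace_norm_topology)
  qed
  then show ?thesis unfolding contains_copy_of_def using sub T by blast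
qed

end

text \<open>Continuity at 0 bounds the map above on the unit ball; openness onto its image at 0
  bounds it below on the unit sphere.\<close>

lemma contains_copyD:
  assumes "contains_copy_of Y X"
  obtains T c C where "linear_between X Y T" "c > 0"
    "\<And>x. x \<in> pts X \<Longrightarrow> nrm X x \<le> 1 \<Longrightarrow> nrm Y (T x) \<le> C"
    "\<And>x. x \<in> pts X \<Longrightarrow> nrm X x = 1 \<Longrightarrow> c \<le> nrm Y (T x)"
proof -
  obtain Z T where T: "linear_between X Y T"
    and hom: "homeomorphic_map (norm_topology X) (subtopology (norm_topology Y) Z) T"
    using assms by (auto simp: contains_copy_of_def)
  note pts = T_pts[OF T] and zero = T_zero[OF T]
  have cont: "continuous_map (norm_topology X) (norm_topology Y) T"
    using homeomorphic_imp_continuous_map[OF hom] by (simp add: continuous_map_in_subtopology)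
  have "openin (norm_topology X) {x \<in> topspace (norm_topology X). T x \<in> {y \<in> pts Y. nrm Y (0 - y) < 1}}"
    by (rule openin_continuous_map_preimage[OF cont Y.openin_ball[OF Y.zero_pts]])
  moreover have "0 \<in> {x \<in> topspace (norm_topology X). T x \<in> {y \<in> pts Y. nrm Y (0 - y) < 1}}"
    using X.zero_pts Y.zero_pts by (simp add: X.topspace_norm_topology zero Y.nrm_zero)
  ultimately obtain r where r: "r > 0" "\<And>x. x \<in> pts X \<Longrightarrow> nrm X (0 - x) < r \<Longrightarrow> nrm Y (0 - T x) < 1"
    unfolding X.openin_norm_topology by blast
  have upper: "nrm Y (T x) \<le> 2 / r" if x: "x \<in> pts X" "nrm X x \<le> 1" for x
  proof -
    define s where "s = (of_real (r / 2) :: 'k)"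
    have s: "norm s = r / 2" using r(1) unfolding s_def norm_of_real by simp
    have sx: "scl X s x \<in> pts X" by (rule X.scl_pts[OF x(1)])
    have n: "nrm X (scl X s x) = r / 2 * nrm X x" "nrm Y (T (scl X s x)) = r / 2 * nrm Y (T x)"
      using X.nrm_scl[OF x(1)] Y.nrm_scl[OF pts[OF x(1)]] T_scl[OF T x(1)] s by simp_all
    have "r / 2 * nrm X x \<le> r / 2 * 1" using x(2) r(1) by (intro mult_left_mono) auto
    then have "nrm X (scl X s x) < r" using r(1) unfolding n(1) by linarith
    then have "nrm X (0 - scl X s x) < r" using X.nrm_minus[OF sx] by simp
    then have "nrm Y (T (scl X s x)) < 1" using r(2)[OF sx] Y.nrm_minus[OF pts[OF sx]] by simp
    then show ?thesis using n(2) r(1) by (simp add: field_simps)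
  qed
  have inj: "inj_on T (pts X)"
    using homeomorphic_imp_injective_map[OF hom] by (simp add: X.topspace_norm_topology)
  have "openin (subtopology (norm_topology Y) Z) (T ` {x \<in> pts X. nrm X (0 - x) < 1})"
    using homeomorphic_imp_open_map[OF hom] X.openin_ball[OF X.zero_pts] unfolding open_map_def by blast
  then obtain V where V: "openin (norm_topology Y) V" "T ` {x \<in> pts X. nrm X (0 - x) < 1} = V \<inter> Z"
    by (auto simp: openin_subtopology)
  have "T ` pts X = topspace (norm_topology Y) \<inter> Z"
    using homeomorphic_imp_surjective_map[OF hom] by (simp add: X.topspace_norm_topology)
  then have TZ: "T x \<in> Z" if "x \<in> pts X" for x using that by blast
  have "0 \<in> T ` {x \<in> pts X. nrm X (0 - x) < 1}"
    using X.zero_pts zero by (intro image_eqI[of _ _ 0]) (auto simp: X.nrm_zero)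
  then have "0 \<in> V" using V(2) by blast
  then obtain c where c: "c > 0" "\<And>y. y \<in> pts Y \<Longrightarrow> nrm Y (0 - y) < c \<Longrightarrow> y \<in> V"
    using V(1) unfolding Y.openin_norm_topology by blast
  \<comment> \<open>A smaller value would be the image of some point of norm below 1, against
    injectivity.\<close>
  have lower: "c \<le> nrm Y (T x)" if x: "x \<in> pts X" "nrm X x = 1" for x
  proof (rule ccontr)
    assume "\<not> c \<le> nrm Y (T x)"
    then have "T x \<in> V" using c(2)[OF pts[OF x(1)]] Y.nrm_minus[OF pts[OF x(1)]] by simp
    then have "T x \<in> T ` {x \<in> pts X. nrm X (0 - x) < 1}" using V(2) TZ[OF x(1)] by blast
    then obtain x' where "x' \<in> pts X" "nrm X (0 - x') < 1" "T x = T x'" by blast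
    then show False using inj x X.nrm_minus[OF x(1)] by (auto simp: inj_on_def)
  qed
  show ?thesis by (rule that[OF T c(1) upper lower])
qed

end

subsection \<open>The sequence spaces\<close>

lemma norm_le_SUP:
  fixes x :: "nat \<Rightarrow> 'k::real_normed_vector"
  assumes "bounded (range x)" shows "norm (x n) \<le> (SUP n. norm (x n))"
proof -
  obtain B where "\<And>n. norm (x n) \<le> B" using assms by (auto simp: bounded_iff)
  then show ?thesis by (intro cSUP_upper bdd_aboveI2[of _ _ B]) auto
qed

lemma SUP_norm_le: "(\<And>n. norm (x n) \<le> B) \<Longrightarrow> (SUP n :: nat. norm (x n)) \<le> B"
  by (rule cSUP_least) auto

lemma normed_carrier_sequences:
  fixes S :: "(nat \<Rightarrow> 'k::real_or_complex) set"
  assumes bdd: "\<And>x. x \<in> S \<Longrightarrow> bounded (range x)" and zero: "0 \<in> S"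
    and add: "\<And>x y. x \<in> S \<Longrightarrow> y \<in> S \<Longrightarrow> x + y \<in> S" and scale: "\<And>c x. x \<in> S \<Longrightarrow> (\<lambda>n. c * x n) \<in> S"
  shows "normed_carrier \<lparr>pts = S, scl = (\<lambda>c x n. c * x n), nrm = (\<lambda>x. SUP n. norm (x n))\<rparr>"
proof (rule normed_carrier.intro)
  show "module (scl \<lparr>pts = S, scl = (\<lambda>c x n. c * x n), nrm = (\<lambda>x. SUP n. norm (x n))\<rparr>)"
    by unfold_locales (auto simp: fun_eq_iff algebra_simps)
next
  fix x assume "x \<in> pts \<lparr>pts = S, scl = (\<lambda>c x n. c * x n), nrm = (\<lambda>x. SUP n. norm (x n))\<rparr>"
  then have x: "x \<in> S" by simp
  note le = norm_le_SUP[OF bdd[OF x]]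
  have ge0: "0 \<le> (SUP n. norm (x n))" using order_trans[OF norm_ge_zero le[of 0]] .
  then show "0 \<le> nrm \<lparr>pts = S, scl = (\<lambda>c x n. c * x n), nrm = (\<lambda>x. SUP n. norm (x n))\<rparr> x" by simp
  show "x = 0" if "nrm \<lparr>pts = S, scl = (\<lambda>c x n. c * x n), nrm = (\<lambda>x. SUP n. norm (x n))\<rparr> x = 0"
    using that le by (simp add: fun_eq_iff)
  show "nrm \<lparr>pts = S, scl = (\<lambda>c x n. c * x n), nrm = (\<lambda>x. SUP n. norm (x n))\<rparr> (x + y)
      \<le> nrm \<lparr>pts = S, scl = (\<lambda>c x n. c * x n), nrm = (\<lambda>x. SUP n. norm (x n))\<rparr> x
        + nrm \<lparr>pts = S, scl = (\<lambda>c x n. c * x n), nrm = (\<lambda>x. SUP n. norm (x n))\<rparr> y"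
    if "y \<in> pts \<lparr>pts = S, scl = (\<lambda>c x n. c * x n), nrm = (\<lambda>x. SUP n. norm (x n))\<rparr>" for y
    using norm_triangle_mono[OF le norm_le_SUP[OF bdd]] that by (auto intro!: SUP_norm_le)
  fix c
  have "(SUP n. norm (c * x n)) = norm c * (SUP n. norm (x n))"
  proof (rule antisym)
    show "(SUP n. norm (c * x n)) \<le> norm c * (SUP n. norm (x n))"
      by (rule SUP_norm_le) (simp add: norm_mult mult_left_mono le)
    show "norm c * (SUP n. norm (x n)) \<le> (SUP n. norm (c * x n))"
    proof (cases "c = 0")
      case False
      have "(SUP n. norm (x n)) \<le> (SUP n. norm (c * x n)) / norm c"
        using norm_le_SUP[OF bdd[OF scale[OF x, of c]]] False
        by (intro SUP_norm_le) (simp add: pos_le_divide_eq norm_mult mult.commute)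
      then show ?thesis using False by (simp add: pos_le_divide_eq mult.commute)
    qed simp
  qed
  then show "nrm \<lparr>pts = S, scl = (\<lambda>c x n. c * x n), nrm = (\<lambda>x. SUP n. norm (x n))\<rparr>
      (scl \<lparr>pts = S, scl = (\<lambda>c x n. c * x n), nrm = (\<lambda>x. SUP n. norm (x n))\<rparr> c x)
      = norm c * nrm \<lparr>pts = S, scl = (\<lambda>c x n. c * x n), nrm = (\<lambda>x. SUP n. norm (x n))\<rparr> x" by simp
qed (simp_all add: zero add scale)

lemma tendsto_zero_bounded:
  fixes x :: "nat \<Rightarrow> 'a::real_normed_vector" shows "x \<longlonglongrightarrow> 0 \<Longrightarrow> bounded (range x)"
  by (rule convergent_imp_bounded)

interpretation ell_infinity: normed_carrier "ell_infinity :: ('k::real_or_complex, nat \<Rightarrow> 'k) normed_sp"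
  unfolding ell_infinity_def
proof (rule normed_carrier_sequences)
  show "0 \<in> {x :: nat \<Rightarrow> 'k. bounded (range x)}" by (auto intro: boundedI)
  show "x + y \<in> {x. bounded (range x)}" if "x \<in> {x. bounded (range x)}" "y \<in> {x. bounded (range x)}"
    for x y :: "nat \<Rightarrow> 'k"
    using that bounded_plus_comp[of x UNIV y] by (simp add: plus_fun_def)
  show "(\<lambda>n. c * x n) \<in> {x. bounded (range x)}" if "x \<in> {x. bounded (range x)}" for c and x :: "nat \<Rightarrow> 'k"
  proof -
    obtain B where "\<And>n. norm (x n) \<le> B" using \<open>x \<in> _\<close> by (auto simp: bounded_iff)
    then have "norm (c * x n) \<le> norm c * B" for n by (simp add: norm_mult mult_left_mono)
    then show ?thesis by (auto intro: boundedI)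
  qed
qed simp

interpretation c_zero: normed_carrier "c_zero :: ('k::real_or_complex, nat \<Rightarrow> 'k) normed_sp"
  unfolding c_zero_def
proof (rule normed_carrier_sequences)
  show "0 \<in> {x :: nat \<Rightarrow> 'k. x \<longlonglongrightarrow> 0}" by (simp add: zero_fun_def)
  show "x + y \<in> {x. x \<longlonglongrightarrow> 0}" if "x \<in> {x. x \<longlonglongrightarrow> 0}" "y \<in> {x. x \<longlonglongrightarrow> 0}" for x y :: "nat \<Rightarrow> 'k"
    using that tendsto_add[of x 0 sequentially y 0] by (simp add: plus_fun_def)
  show "(\<lambda>n. c * x n) \<in> {x. x \<longlonglongrightarrow> 0}" if "x \<in> {x. x \<longlonglongrightarrow> 0}" for c and x :: "nat \<Rightarrow> 'k"
    using that by (simp add: tendsto_mult_right_zero)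
qed (simp add: tendsto_zero_bounded)

text \<open>The coordinatewise limit is uniform; completeness of both sequence spaces only has to
  add that the limit belongs to the space.\<close>

lemma sequences_limit:
  fixes \<sigma> :: "nat \<Rightarrow> nat \<Rightarrow> 'k::real_or_complex"
  assumes bdd: "\<And>n. bounded (range (\<sigma> n))"
    and cau: "\<forall>e>0. \<exists>N. \<forall>m\<ge>N. \<forall>n\<ge>N. (SUP i. norm ((\<sigma> m - \<sigma> n) i)) < e"
  obtains l where "\<And>e. e > 0 \<Longrightarrow> \<exists>N. \<forall>n\<ge>N. \<forall>i. norm (\<sigma> n i - l i) \<le> e"
proof -
  have bd: "bounded (range (\<sigma> m - \<sigma> n))" for m n
    using bounded_minus_comp[OF bdd bdd] by (simp add: fun_diff_def)
  have unif: "\<exists>N. \<forall>m\<ge>N. \<forall>n\<ge>N. \<forall>i. norm (\<sigma> m i - \<sigma> n i) < e" if e: "e > 0" for e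
  proof -
    obtain N where N: "\<forall>m\<ge>N. \<forall>n\<ge>N. (SUP i. norm ((\<sigma> m - \<sigma> n) i)) < e" using cau e by blast
    have "norm (\<sigma> m i - \<sigma> n i) < e" if "m \<ge> N" "n \<ge> N" for m n i
    proof -
      have "norm ((\<sigma> m - \<sigma> n) i) \<le> (SUP i. norm ((\<sigma> m - \<sigma> n) i))" by (rule norm_le_SUP[OF bd])
      then show ?thesis using N that by fastforce
    qed
    then show ?thesis by blast
  qed
  have "Cauchy (\<lambda>n. \<sigma> n i)" for i
  proof (rule metric_CauchyI)
    fix e :: real assume "e > 0"
    from unif[OF this] show "\<exists>M. \<forall>m\<ge>M. \<forall>n\<ge>M. dist (\<sigma> m i) (\<sigma> n i) < e" by (auto simp: dist_norm)
  qed
  then have "\<forall>i. \<exists>l. (\<lambda>n. \<sigma> n i) \<longlonglongrightarrow> l" using Cauchy_convergent convergent_def by blast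
  then obtain l where l: "\<And>i. (\<lambda>n. \<sigma> n i) \<longlonglongrightarrow> l i" by metis
  show ?thesis
  proof (rule that)
    fix e :: real assume "e > 0"
    then obtain N where N: "\<And>m n i. m \<ge> N \<Longrightarrow> n \<ge> N \<Longrightarrow> norm (\<sigma> m i - \<sigma> n i) < e" using unif by blast
    have "norm (\<sigma> n i - l i) \<le> e" if n: "n \<ge> N" for n i
    proof (rule Lim_bounded)
      show "(\<lambda>m. norm (\<sigma> n i - \<sigma> m i)) \<longlonglongrightarrow> norm (\<sigma> n i - l i)" by (intro tendsto_intros l)
      show "\<forall>m\<ge>N. norm (\<sigma> n i - \<sigma> m i) \<le> e" using N[OF n] less_imp_le by blast
    qed
    then show "\<exists>N. \<forall>n\<ge>N. \<forall>i. norm (\<sigma> n i - l i) \<le> e" by blast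
  qed
qed

lemma uniform_limit_SUP:
  fixes \<sigma> :: "nat \<Rightarrow> nat \<Rightarrow> 'k::real_normed_vector"
  assumes "\<And>e. e > 0 \<Longrightarrow> \<exists>N. \<forall>n\<ge>N. \<forall>i. norm (\<sigma> n i - l i) \<le> e" "e > 0"
  shows "\<exists>N. \<forall>n\<ge>N. (SUP i. norm ((\<sigma> n - l) i)) < e"
proof -
  obtain N where N: "\<And>n i. n \<ge> N \<Longrightarrow> norm (\<sigma> n i - l i) \<le> e / 2" using assms(1)[of "e / 2"] assms(2) by auto
  have "(SUP i. norm ((\<sigma> n - l) i)) < e" if "n \<ge> N" for n
    using SUP_norm_le[of "\<sigma> n - l" "e / 2"] N[OF that] assms(2) by simp
  then show ?thesis by blast
qed

lemma ell_infinity_complete: "normed_carrier.nrm_complete (ell_infinity :: ('k::real_or_complex, nat \<Rightarrow> 'k) normed_sp)"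
  unfolding ell_infinity.nrm_complete_def
proof (intro allI impI)
  fix \<sigma> :: "nat \<Rightarrow> nat \<Rightarrow> 'k"
  assume \<sigma>: "\<forall>n. \<sigma> n \<in> pts ell_infinity" and cau: "\<forall>e>0. \<exists>N. \<forall>m\<ge>N. \<forall>n\<ge>N. nrm ell_infinity (\<sigma> m - \<sigma> n) < e"
  have bdd: "bounded (range (\<sigma> n))" for n using \<sigma> by (simp add: ell_infinity_def)
  obtain l where l: "\<And>e. e > 0 \<Longrightarrow> \<exists>N. \<forall>n\<ge>N. \<forall>i. norm (\<sigma> n i - l i) \<le> e"
    by (rule sequences_limit[OF bdd]) (use cau in \<open>simp add: ell_infinity_def\<close>, rule that)
  obtain N where N: "\<And>i. norm (\<sigma> N i - l i) \<le> 1" using l[of 1] by auto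
  obtain B where B: "\<And>i. norm (\<sigma> N i) \<le> B" using bdd[of N] by (auto simp: bounded_iff)
  have "norm (l i) \<le> B + 1" for i
    using norm_triangle_ineq4[of "\<sigma> N i" "\<sigma> N i - l i"] N[of i] B[of i] by simp
  then have "l \<in> pts ell_infinity" by (auto simp: ell_infinity_def intro: boundedI)
  then show "\<exists>l\<in>pts ell_infinity. \<forall>e>0. \<exists>N. \<forall>n\<ge>N. nrm ell_infinity (\<sigma> n - l) < e"
    using uniform_limit_SUP[OF l] by (intro bexI[of _ l]) (auto simp: ell_infinity_def)
qed

lemma c_zero_complete: "normed_carrier.nrm_complete (c_zero :: ('k::real_or_complex, nat \<Rightarrow> 'k) normed_sp)"
  unfolding c_zero.nrm_complete_def
proof (intro allI impI)
  fix \<sigma> :: "nat \<Rightarrow> nat \<Rightarrow> 'k"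
  assume \<sigma>: "\<forall>n. \<sigma> n \<in> pts c_zero" and cau: "\<forall>e>0. \<exists>N. \<forall>m\<ge>N. \<forall>n\<ge>N. nrm c_zero (\<sigma> m - \<sigma> n) < e"
  have null: "\<sigma> n \<longlonglongrightarrow> 0" for n using \<sigma> by (simp add: c_zero_def)
  obtain l where l: "\<And>e. e > 0 \<Longrightarrow> \<exists>N. \<forall>n\<ge>N. \<forall>i. norm (\<sigma> n i - l i) \<le> e"
    by (rule sequences_limit[OF tendsto_zero_bounded[OF null]]) (use cau in \<open>simp add: c_zero_def\<close>, rule that)
  have "l \<longlonglongrightarrow> 0"
  proof (rule LIMSEQ_I)
    fix e :: real assume e: "e > 0"
    then obtain N where N: "\<And>i. norm (\<sigma> N i - l i) \<le> e / 2" using l[of "e / 2"] by auto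
    obtain no where no: "\<And>i. i \<ge> no \<Longrightarrow> norm (\<sigma> N i) < e / 2" using LIMSEQ_D[OF null[of N], of "e / 2"] e by auto
    have "norm (l i - 0) < e" if "i \<ge> no" for i
      using norm_triangle_ineq4[of "\<sigma> N i" "\<sigma> N i - l i"] N[of i] no[OF that] by simp
    then show "\<exists>no. \<forall>i\<ge>no. norm (l i - 0) < e" by blast
  qed
  then have "l \<in> pts c_zero" by (simp add: c_zero_def)
  then show "\<exists>l\<in>pts c_zero. \<forall>e>0. \<exists>N. \<forall>n\<ge>N. nrm c_zero (\<sigma> n - l) < e"
    using uniform_limit_SUP[OF l] by (intro bexI[of _ l]) (auto simp: c_zero_def)
qed

subsection \<open>Copies of sequence spaces in spaces of polynomials\<close>

context banach_pair
begin

lemma pnorm_triangle: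
  assumes "P \<in> hom_polys scaleE scaleF k" "Q \<in> hom_polys scaleE scaleF k"
  shows "pnorm (P + Q) \<le> pnorm P + pnorm Q"
  by (rule pnorm_le) (simp add: norm_triangle_mono[OF norm_le_pnorm[OF assms(1)] norm_le_pnorm[OF assms(2)]])

lemma pnorm_scale:
  assumes P: "P \<in> hom_polys scaleE scaleF k"
  shows "pnorm (\<lambda>x. scaleF c (P x)) = norm c * pnorm P"
proof (rule antisym)
  show "pnorm (\<lambda>x. scaleF c (P x)) \<le> norm c * pnorm P"
    by (rule pnorm_le) (simp add: F.norm_scale mult_left_mono norm_le_pnorm[OF P])
  show "norm c * pnorm P \<le> pnorm (\<lambda>x. scaleF c (P x))"
  proof (cases "c = 0")
    case True
    then show ?thesis using pnorm_nonneg[OF hom_polys_scale[OF P, of c]] by simp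
  next
    case False
    have "pnorm P \<le> pnorm (\<lambda>x. scaleF c (P x)) / norm c"
      using norm_le_pnorm[OF hom_polys_scale[OF P, of c]] False
      by (intro pnorm_le) (simp add: F.norm_scale pos_le_divide_eq mult.commute)
    then show ?thesis using False by (simp add: pos_le_divide_eq mult.commute)
  qed
qed

lemma pnorm_eq_0:
  assumes "P \<in> hom_polys scaleE scaleF k" "k > 0" "pnorm P = 0" shows "P = 0"
proof
  show "P x = 0 x" for x using norm_le_pnorm_power[OF assms(1,2), of x] assms(3) by simp
qed

lemma module_pointwise: "module (\<lambda>c P x. scaleF c (P x :: 'f))"
  by unfold_locales (auto simp: fun_eq_iff F.scale_right_distrib F.scale_left_distrib)

lemma normed_carrier_poly_space: "k > 0 \<Longrightarrow> normed_carrier (poly_space scaleE scaleF k)"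
  by (rule normed_carrier.intro, unfold poly_space_simps)
     (rule module_pointwise hom_polys_zero hom_polys_add hom_polys_scale pnorm_nonneg pnorm_eq_0
        pnorm_triangle pnorm_scale; assumption)+

lemma wb_poly_space_simps:
  "pts (wb_poly_space scaleE scaleF k) = wb_polys scaleE scaleF k"
  "scl (wb_poly_space scaleE scaleF k) = (\<lambda>c P x. scaleF c (P x))"
  "nrm (wb_poly_space scaleE scaleF k) = pnorm"
  using poly_space_simps by (simp_all add: wb_poly_space_def)

lemma normed_carrier_wb_poly_space: "k > 0 \<Longrightarrow> normed_carrier (wb_poly_space scaleE scaleF k)"
  by (rule normed_carrier.intro, unfold wb_poly_space_simps)
     (rule module_pointwise wb_polys_zero wb_polys_add wb_polys_scale
        pnorm_nonneg[OF wb_polys_hom] pnorm_eq_0[OF wb_polys_hom] pnorm_triangle[OF wb_polys_hom wb_polys_hom]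
        pnorm_scale[OF wb_polys_hom]; assumption)+

text \<open>Finitely supported sequences are dense in \<open>c_zero\<close>, the family is bounded,
  and weakly continuous polynomials are closed in norm.\<close>

lemma poly_family_c_zero:
  assumes \<Phi>: "poly_family k \<Phi>" and k: "k > 0" and \<xi>: "\<xi> \<longlonglongrightarrow> 0"
  shows "\<Phi> \<xi> \<in> wb_polys scaleE scaleF k"
proof (rule wb_polys_closed[OF _ k])
  have bdd: "bounded (range \<xi>)" by (rule tendsto_zero_bounded[OF \<xi>])
  show "\<Phi> \<xi> \<in> hom_polys scaleE scaleF k" by (rule poly_family_hom[OF \<Phi> bdd])
  obtain C where C: "C \<ge> 0" "\<And>\<zeta>. (\<forall>n. norm (\<zeta> n) \<le> 1) \<Longrightarrow> pnorm (\<Phi> \<zeta>) \<le> C"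
    by (rule poly_family_bound[OF \<Phi>]) (rule that)
  fix e :: real assume e: "e > 0"
  define d where "d = e / (C + 1)"
  have d: "d > 0" using e C(1) by (simp add: d_def)
  obtain m where m: "\<And>n. n \<ge> m \<Longrightarrow> norm (\<xi> n) < d" using LIMSEQ_D[OF \<xi> d] by auto
  \<comment> \<open>The decomposition \<open>\<xi> = \<zeta> + d \<eta>\<close>: a finitely
    supported part and a tail rescaled into the unit ball, to which the bound of the family
    applies.\<close>
  define \<zeta> where "\<zeta> n = (if n < m then \<xi> n else 0)" for n
  define \<eta> where "\<eta> n = of_real (inverse d) * (if n < m then 0 else \<xi> n)" for n
  have \<eta>: "norm (\<eta> n) \<le> 1" for n
  proof (cases "n < m")
    case False
    then have "inverse d * norm (\<xi> n) \<le> inverse d * d" using m[of n] d by (intro mult_left_mono) auto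
    then show ?thesis using d False by (simp add: \<eta>_def norm_mult norm_inverse)
  qed (simp add: \<eta>_def)
  have bdd': "bounded (range \<zeta>)" "bounded (range \<eta>)"
  proof -
    obtain B where "B > 0" "\<And>n. norm (\<xi> n) \<le> B" using bdd by (auto simp: bounded_pos)
    then show "bounded (range \<zeta>)" by (intro boundedI[of _ B]) (auto simp: \<zeta>_def)
    show "bounded (range \<eta>)" using \<eta> by (auto intro: boundedI)
  qed
  have scaled: "bounded (range (\<lambda>n. of_real d * \<eta> n))"
    using \<eta> d by (intro boundedI[of _ d]) (auto simp: norm_mult mult_left_le)
  have "\<xi> = (\<lambda>n. \<zeta> n + of_real d * \<eta> n)"
    using d by (auto simp: fun_eq_iff \<zeta>_def \<eta>_def of_real_mult[symmetric] mult.assoc[symmetric] simp del: of_real_mult of_real_inverse)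
  then have "\<Phi> \<xi> = \<Phi> \<zeta> + (\<lambda>x. scaleF (of_real d) (\<Phi> \<eta> x))"
    using poly_family_add[OF \<Phi> bdd'(1) scaled] poly_family_scale[OF \<Phi> bdd'(2), of "of_real d"] by simp
  then have "pnorm (\<Phi> \<xi> - \<Phi> \<zeta>) = d * pnorm (\<Phi> \<eta>)"
    using pnorm_scale[OF poly_family_hom[OF \<Phi> bdd'(2)], of "of_real d"] d by simp
  also have "\<dots> \<le> d * C" using C(2)[of \<eta>] \<eta> d by (intro mult_left_mono) auto
  also have "\<dots> \<le> e" using e C(1) by (simp add: d_def field_simps)
  finally have "pnorm (\<Phi> \<xi> - \<Phi> \<zeta>) \<le> e" .
  moreover have "finite {n. \<zeta> n \<noteq> 0}"
    by (rule finite_subset[of _ "{..<m}"]) (auto simp: \<zeta>_def)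
  ultimately show "\<exists>Q\<in>wb_polys scaleE scaleF k. pnorm (\<Phi> \<xi> - Q) \<le> e"
    using poly_family_finite[OF \<Phi>] by blast
qed

end

context fd_pair
begin

text \<open>At a coordinate \<open>p\<close> where \<open>\<xi>\<close> is nearly maximal, the jump
  between \<open>x p\<close> and \<open>x0\<close> is dominated by block \<open>p\<close>, and a
  jump inside the ball of radius \<open>r\<close> is controlled by the norm of the
  polynomial.\<close>

lemma hump_family_isomorphic:
  assumes "hom_polys scaleE scaleF k \<noteq> wb_polys scaleE scaleF k" and k: "k > 0"
  obtains \<Phi> c C where "poly_family k \<Phi>" "c > 0"
    "\<And>\<xi>. bounded (range \<xi>) \<Longrightarrow> (SUP n. norm (\<xi> n)) = 1 \<Longrightarrow> c \<le> pnorm (\<Phi> \<xi>) \<and> pnorm (\<Phi> \<xi>) \<le> C"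
proof -
  obtain \<Phi> x x0 r e where \<Phi>: "poly_family k \<Phi>" and e: "e > 0"
    and xr: "\<And>p. norm (x p) \<le> r" "norm x0 \<le> r"
    and diag: "\<And>p. e \<le> norm (\<Phi> (indicator {p}) (x p) - \<Phi> (indicator {p}) x0)"
    and off: "\<And>p \<xi>. \<xi> p = 0 \<Longrightarrow> (\<forall>n. norm (\<xi> n) \<le> 1) \<Longrightarrow> norm (\<Phi> \<xi> (x p) - \<Phi> \<xi> x0) \<le> e / 4"
    by (rule hump_family[OF assms(1)]) (rule that)
  obtain C where C: "\<And>\<xi>. (\<forall>n. norm (\<xi> n) \<le> 1) \<Longrightarrow> pnorm (\<Phi> \<xi>) \<le> C"
    by (rule poly_family_bound[OF \<Phi>]) (rule that)
  have r: "r \<ge> 0" using order_trans[OF norm_ge_zero xr(2)] .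
  \<comment> \<open>Two evaluations in the ball of radius \<open>r\<close> turn a jump of
    \<open>e / 2\<close> into this bound; the summand 1 avoids division by zero.\<close>
  define c where "c = e / (4 * (r ^ k + 1))"
  have rk: "r ^ k \<ge> 0" using r by simp
  have c: "c > 0" using e rk by (simp add: c_def add_nonneg_pos)
  have "c \<le> pnorm (\<Phi> \<xi>) \<and> pnorm (\<Phi> \<xi>) \<le> C" if bdd: "bounded (range \<xi>)" and sup: "(SUP n. norm (\<xi> n)) = 1" for \<xi>
  proof
    have le1: "norm (\<xi> n) \<le> 1" for n using norm_le_SUP[OF bdd, of n] sup by simp
    then show "pnorm (\<Phi> \<xi>) \<le> C" by (intro C) simp
    \<comment> \<open>With 3/4, the diagonal part \<open>3/4 * e\<close> still exceeds the
      off-diagonal part \<open>e / 4\<close> by \<open>e / 2\<close>.\<close>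
    have "\<exists>p. norm (\<xi> p) > 3/4"
    proof (rule ccontr)
      assume "\<not> ?thesis"
      then have "norm (\<xi> n) \<le> 3/4" for n by (simp add: not_less)
      from SUP_norm_le[of \<xi>, OF this] sup show False by simp
    qed
    then obtain p where p: "norm (\<xi> p) > 3/4" by blast
    define \<zeta> where "\<zeta> = \<xi>(p := 0)"
    have \<zeta>: "\<zeta> p = 0" "\<forall>n. norm (\<zeta> n) \<le> 1" using le1 by (auto simp: \<zeta>_def)
    have bdd\<zeta>: "bounded (range \<zeta>)" using \<zeta>(2) by (auto intro: boundedI)
    have bdd\<xi>p: "bounded (range (\<lambda>n. \<xi> p * indicator {p} n))"
      using le1 by (intro boundedI[of _ 1]) (auto simp: indicator_def)
    have "\<xi> = (\<lambda>n. \<xi> p * indicator {p} n + \<zeta> n)" by (auto simp: \<zeta>_def indicator_def)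
    then have eq: "\<Phi> \<xi> = (\<lambda>x. scaleF (\<xi> p) (\<Phi> (indicator {p}) x)) + \<Phi> \<zeta>"
      using poly_family_add[OF \<Phi> bdd\<xi>p bdd\<zeta>] poly_family_scale[OF \<Phi> bounded_indicator, of "\<xi> p" "{p}"] by simp
    define v where "v = \<Phi> (indicator {p}) (x p) - \<Phi> (indicator {p}) x0"
    define w where "w = \<Phi> \<zeta> (x p) - \<Phi> \<zeta> x0"
    have vw: "\<Phi> \<xi> (x p) - \<Phi> \<xi> x0 = scaleF (\<xi> p) v + w"
      unfolding eq by (simp add: v_def w_def F.scale_right_diff_distrib)
    have "3/4 * e \<le> norm (\<xi> p) * norm v"
      using p diag[of p] e unfolding v_def by (intro mult_mono) auto
    then have "e / 2 \<le> norm (scaleF (\<xi> p) v) - norm w"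
      using off[OF \<zeta>] unfolding w_def F.norm_scale by linarith
    also have "\<dots> \<le> norm (\<Phi> \<xi> (x p) - \<Phi> \<xi> x0)"
      unfolding vw by (rule norm_diff_ineq)
    also have "\<dots> \<le> norm (\<Phi> \<xi> (x p)) + norm (\<Phi> \<xi> x0)" by (rule norm_triangle_ineq4)
    also have "\<dots> \<le> pnorm (\<Phi> \<xi>) * r ^ k + pnorm (\<Phi> \<xi>) * r ^ k"
    proof -
      have hom: "\<Phi> \<xi> \<in> hom_polys scaleE scaleF k" by (rule poly_family_hom[OF \<Phi> bdd])
      have "norm (\<Phi> \<xi> y) \<le> pnorm (\<Phi> \<xi>) * r ^ k" if "norm y \<le> r" for y
        using order_trans[OF norm_le_pnorm_power[OF hom k] mult_left_mono[OF power_mono[OF that norm_ge_zero] pnorm_nonneg[OF hom]]] .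
      from add_mono[OF this[OF xr(1)] this[OF xr(2)]] show ?thesis .
    qed
    also have "\<dots> \<le> 2 * (pnorm (\<Phi> \<xi>) * (r ^ k + 1))"
      using pnorm_nonneg[OF poly_family_hom[OF \<Phi> bdd]] by (simp add: algebra_simps)
    finally show "c \<le> pnorm (\<Phi> \<xi>)"
      using rk by (simp add: c_def pos_divide_le_eq add_nonneg_pos mult.commute mult.left_commute)
  qed
  from that[OF \<Phi> c this] show ?thesis .
qed

text \<open>One family serves both claims: it embeds \<open>ell_infinity\<close>, and its
  restriction to \<open>c_zero\<close> has weakly continuous values.\<close>

lemma contains_copies:
  assumes "hom_polys scaleE scaleF k \<noteq> wb_polys scaleE scaleF k" and k: "k > 0"
  shows "contains_copy_of (wb_poly_space scaleE scaleF k) c_zero"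
    and "contains_copy_of (poly_space scaleE scaleF k) ell_infinity"
proof -
  obtain \<Phi> c C where \<Phi>: "poly_family k \<Phi>" and c: "c > 0"
    and b: "\<And>\<xi>. bounded (range \<xi>) \<Longrightarrow> (SUP n. norm (\<xi> n)) = 1 \<Longrightarrow> c \<le> pnorm (\<Phi> \<xi>) \<and> pnorm (\<Phi> \<xi>) \<le> C"
    by (rule hump_family_isomorphic[OF assms]) (rule that)
  show "contains_copy_of (wb_poly_space scaleE scaleF k) c_zero"
  proof -
    interpret Y: normed_carrier "wb_poly_space scaleE scaleF k" by (rule normed_carrier_wb_poly_space[OF k])
    interpret XY: normed_carrier_pair c_zero "wb_poly_space scaleE scaleF k" ..
    have "linear_between c_zero (wb_poly_space scaleE scaleF k) \<Phi>"
      using poly_family_c_zero[OF \<Phi> k] poly_family_add[OF \<Phi>] poly_family_scale[OF \<Phi>]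
      by (auto simp: linear_between_def wb_poly_space_simps c_zero_def tendsto_zero_bounded plus_fun_def)
    then show ?thesis
      by (rule XY.contains_copyI[OF _ c_zero_complete c, of _ C])
        (use b tendsto_zero_bounded in \<open>auto simp: wb_poly_space_simps c_zero_def\<close>)
  qed
  show "contains_copy_of (poly_space scaleE scaleF k) ell_infinity"
  proof -
    interpret Y: normed_carrier "poly_space scaleE scaleF k" by (rule normed_carrier_poly_space[OF k])
    interpret XY: normed_carrier_pair ell_infinity "poly_space scaleE scaleF k" ..
    have "linear_between ell_infinity (poly_space scaleE scaleF k) \<Phi>"
      using poly_family_hom[OF \<Phi>] poly_family_add[OF \<Phi>] poly_family_scale[OF \<Phi>]
      by (auto simp: linear_between_def poly_space_simps ell_infinity_def plus_fun_def)
    then show ?thesis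
      by (rule XY.contains_copyI[OF _ ell_infinity_complete c, of _ C])
        (use b in \<open>auto simp: poly_space_simps ell_infinity_def\<close>)
  qed
qed

text \<open>The images of the unit vectors are bounded away from zero, while their finite sums are
  images of indicators and hence bounded. The general \<open>X\<close> covers \<open>c_zero\<close>
  and \<open>ell_infinity\<close> alike.\<close>

lemma no_copy:
  fixes X :: "('k, nat \<Rightarrow> 'k) normed_sp"
  assumes eq: "hom_polys scaleE scaleF k = wb_polys scaleE scaleF k" and k: "k > 1"
    and inf: "\<nexists>B. finite B \<and> E.span B = UNIV"
    and X: "normed_carrier X" "nrm X = (\<lambda>\<xi>. SUP n. norm (\<xi> n))" "\<And>N. finite N \<Longrightarrow> indicator N \<in> pts X"
  shows "\<not> contains_copy_of (poly_space scaleE scaleF k) X"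
proof
  assume copy: "contains_copy_of (poly_space scaleE scaleF k) X"
  interpret X: normed_carrier X by (rule X(1))
  interpret Y: normed_carrier "poly_space scaleE scaleF k" by (rule normed_carrier_poly_space) (use k in simp)
  interpret XY: normed_carrier_pair X "poly_space scaleE scaleF k" ..
  obtain T c C where T: "linear_between X (poly_space scaleE scaleF k) T" and c: "c > 0"
    and up: "\<And>x. x \<in> pts X \<Longrightarrow> nrm X x \<le> 1 \<Longrightarrow> nrm (poly_space scaleE scaleF k) (T x) \<le> C"
    and low: "\<And>x. x \<in> pts X \<Longrightarrow> nrm X x = 1 \<Longrightarrow> c \<le> nrm (poly_space scaleE scaleF k) (T x)"
    by (rule XY.contains_copyD[OF copy]) (rule that)
  have sum: "(\<Sum>n\<in>N. indicator {n}) = (indicator N :: nat \<Rightarrow> 'k)" if "finite N" for N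
    using that by (induction N rule: finite_induct) (auto simp: fun_eq_iff indicator_def)
  have one: "nrm X (indicator {n}) = 1" for n
  proof (rule antisym)
    show "nrm X (indicator {n}) \<le> 1" unfolding X(2) by (rule SUP_norm_le) (simp add: indicator_def)
    show "1 \<le> nrm X (indicator {n})" unfolding X(2) using norm_le_SUP[OF bounded_indicator, of "{n}" n] by simp
  qed
  show False
  proof (rule no_c0_sequence_polys[OF eq k inf])
    show "T (indicator {n}) \<in> hom_polys scaleE scaleF k" for n
      using XY.T_pts[OF T X(3)[of "{n}"]] by (simp add: poly_space_simps)
    show "norm (\<Sum>n\<in>N. T (indicator {n}) x) \<le> C" if N: "finite N" and x: "norm x \<le> 1" for N x
    proof -
      have "T (indicator N) = (\<Sum>n\<in>N. T (indicator {n}))"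
        using XY.T_sum[OF T N, of "\<lambda>n. indicator {n}"] X(3) sum[OF N] by simp
      moreover have "(\<Sum>n\<in>N. T (indicator {n})) x = (\<Sum>n\<in>N. T (indicator {n}) x)"
        using N by (induction N rule: finite_induct) auto
      ultimately have "(\<Sum>n\<in>N. T (indicator {n}) x) = T (indicator N) x" by simp
      moreover have "T (indicator N) \<in> hom_polys scaleE scaleF k"
        using XY.T_pts[OF T X(3)[OF N]] by (simp add: poly_space_simps)
      moreover have "pnorm (T (indicator N)) \<le> C"
        using up[OF X(3)[OF N]] unfolding X(2) poly_space_simps
        by (simp add: SUP_norm_le indicator_def)
      ultimately show ?thesis using norm_le_pnorm x order_trans by metis
    qed
    show "c \<le> pnorm (T (indicator {n}))" for n
      using low[OF X(3)[of "{n}"] one] by (simp add: poly_space_simps)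
  qed (rule c)
qed

lemma complemented_self:
  assumes eq: "hom_polys scaleE scaleF k = wb_polys scaleE scaleF k" and k: "k > 0"
  shows "complemented_in (wb_polys scaleE scaleF k) (poly_space scaleE scaleF k)"
proof -
  interpret Y: normed_carrier "poly_space scaleE scaleF k" by (rule normed_carrier_poly_space[OF k])
  have "closed_subspace (hom_polys scaleE scaleF k) (poly_space scaleE scaleF k)"
    unfolding closed_subspace_def
  proof (intro conjI)
    show "closedin (norm_topology (poly_space scaleE scaleF k)) (hom_polys scaleE scaleF k)"
      using closedin_topspace[of "norm_topology (poly_space scaleE scaleF k)"]
      by (simp add: Y.topspace_norm_topology poly_space_simps)
    show "module.subspace (scl (poly_space scaleE scaleF k)) (hom_polys scaleE scaleF k)"
      unfolding poly_space_simps module.subspace_def[OF module_pointwise]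
      by (auto simp: hom_polys_zero hom_polys_add hom_polys_scale)
  qed (simp add: poly_space_simps)
  then show ?thesis
    unfolding complemented_in_def eq[symmetric]
    by (intro conjI exI[of _ id]) (auto simp: linear_between_def poly_space_simps intro: exI[of _ 1])
qed

end

theorem theorem7:
  fixes scaleE :: "'k::real_or_complex \<Rightarrow> 'e::banach \<Rightarrow> 'e"
    and scaleF :: "'k \<Rightarrow> 'f::banach \<Rightarrow> 'f"
    and k :: nat
  assumes "banach_space_over scaleE"
    and "banach_space_over scaleF"
    and "\<nexists>B. finite B \<and> module.span scaleE B = UNIV"
    and "\<exists>A. unconditional_fd_expansion scaleE A"
    and "k > 1"
  shows "(hom_polys scaleE scaleF k = wb_polys scaleE scaleF k
            \<longleftrightarrow> \<not> contains_copy_of (wb_poly_space scaleE scaleF k) c_zero) \<and>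
         (\<not> contains_copy_of (wb_poly_space scaleE scaleF k) c_zero
            \<longleftrightarrow> \<not> contains_copy_of (poly_space scaleE scaleF k) ell_infinity) \<and>
         (\<not> contains_copy_of (poly_space scaleE scaleF k) ell_infinity
            \<longleftrightarrow> complemented_in (wb_polys scaleE scaleF k) (poly_space scaleE scaleF k))"
proof -
  obtain A where A: "unconditional_fd_expansion scaleE A" using assms(4) by blast
  interpret banach_pair scaleE scaleF by (intro banach_pair.intro assms)
  interpret fd_pair scaleE scaleF A
    by (intro fd_pair.intro fd_expansion.intro fd_expansion_axioms.intro banach_pair_axioms assms(1) A)
  have k: "k > 0" using assms(5) by simp
  \<comment> \<open>All four assertions hold when the two spaces of polynomials agree, and all four
    fail otherwise, which settles every equivalence at once.\<close>
  show ?thesis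
  proof (cases "hom_polys scaleE scaleF k = wb_polys scaleE scaleF k")
    case True
    have null: "(indicator N :: nat \<Rightarrow> 'k) \<longlonglongrightarrow> 0" if N: "finite N" for N
    proof (rule tendsto_eventually)
      obtain m where "N \<subseteq> {..<m}" using finite_nat_bounded[OF N] by blast
      then show "eventually (\<lambda>n. (indicator N n :: 'k) = 0) sequentially"
        unfolding eventually_sequentially by (intro exI[of _ m]) (auto simp: indicator_def)
    qed
    have "wb_poly_space scaleE scaleF k = poly_space scaleE scaleF k"
      by (simp add: wb_poly_space_def poly_space_def True)
    moreover have "\<not> contains_copy_of (poly_space scaleE scaleF k) c_zero"
      by (rule no_copy[OF True assms(5,3) c_zero.normed_carrier_axioms]) (simp_all add: c_zero_def null)
    moreover have "\<not> contains_copy_of (poly_space scaleE scaleF k) ell_infinity"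
      by (rule no_copy[OF True assms(5,3) ell_infinity.normed_carrier_axioms])
        (simp_all add: ell_infinity_def bounded_indicator)
    ultimately show ?thesis using complemented_self[OF True k] True by simp
  next
    case False
    then have "\<not> complemented_in (wb_polys scaleE scaleF k) (poly_space scaleE scaleF k)"
      using shrinking_not_complemented[OF _ k] not_shrinking_not_complemented[OF _ assms(5)] by blast
    then show ?thesis using contains_copies[OF False k] False by simp
  qed
qed

end
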